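(* Assume $g\ge 0$ in $\Omega\times(0,T)$, $b\ge 0$ on $\Gamma_1\times(0,T)$ and $u_b\ge 0$ in $\Omega$. For $h>0$ and $f\in\mathcal F_-$ let $u_{hf}$ be the unique solution of the Robin state problem with parameter $h$ and flux $f$ (defined in the context), and let $J_h:\mathcal F_-\to\mathbb R^+$, $J_h(f)=\frac12\|u_{hf}\|_{\mathcal H}^2+\frac M2\|f\|_{\mathcal F}^2$, where $M>0$ is a constant. Then: (a) for every $h>0$, the cost functional $J_h$ is strictly convex on $\mathcal F_-$; (b) for every $h>0$, there exists a unique optimal control $f_{op_h}\in\mathcal F_-$ such that $J_h(f_{op_h})=\min_{f\in\mathcal F_-}J_h(f)$.
   Context: Setting. $\Omega$ is a bounded regular domain in $\mathbb R^n$ with boundary $\partial\Omega=\Gamma_1\cup\Gamma_2\cup\Gamma_3$, $\mathrm{meas}(\Gamma_1)>0$, $\mathrm{meas}(\Gamma_3)>0$, and $T>0$. Spaces: $V=H^1(\Omega)$, $H=L^2(\Omega)$ with scalar product $(\cdot,\cdot)$, $\mathcal H=L^2(0,T;H)$, $\mathcal V=L^2(0,T;V)$, $\mathcal F=L^2((0,T)\times\Gamma_3)$, $\mathcal F_-=\{f\in\mathcal F: f\le 0\}$. Given data: $g\in\mathcal H$; $b\in L^2(0,T;H^{1/2}(\Gamma_1))$; $q\in L^2((0,T)\times\Gamma_2)$ with $q>0$; $K_b=\{v\in V: v|_{\Gamma_1}=b\}$; $u_b\in K_b$, with compatibility condition $u_b=b$ on $\Gamma_1\times(0,T)$. Set $a(u,v)=\int_\Omega\nabla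 u\cdot\nabla v\,dx$, $a_h(u,v)=a(u,v)+h\int_{\Gamma_1}uv\,ds$ and $\Phi(v)=\int_{\Gamma_2}q|v|\,ds$ (with $q=q(t,\cdot)$ at time $t$). A dot denotes the time derivative and $\langle\cdot,\cdot\rangle$ the duality pairing extending $(\cdot,\cdot)$. Robin state problem: for $h>0$ and $f\in\mathcal F$, $u_{hf}$ is the function $u\in C([0,T];H)\cap\mathcal V$ with $\dot u\in\mathcal H$, $u(0)=u_b$ and, for a.e. $t\in(0,T)$, $$\langle\dot u,v-u\rangle+a_h(u,v-u)+\Phi(v)-\Phi(u)\ge (g,v-u)-\int_{\Gamma_3}f(v-u)\,ds+h\int_{\Gamma_1}b(v-u)\,ds\quad\forall v\in V.$$ Existence and uniqueness of $u_{hf}$ for each $h>0$ and $f$ is taken as known. *)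

theory Defs
  imports "HOL-Analysis.Analysis"
begin

section \<open>Hausdorff measure\<close>

text \<open>
  Surface measure is the \<open>(n - 1)\<close>-dimensional Hausdorff measure, normalised as usual by
  \<open>vol (unit ball of R^s) * (diam C / 2) ^ s\<close>. The empty set contributes \<open>0\<close> also for \<open>s = 0\<close>
  (where \<open>0 ^ 0 = 1\<close> makes the contribution of a point \<open>1\<close>).
\<close>

definition hausdorff_gauge :: "nat \<Rightarrow> 'a::euclidean_space set \<Rightarrow> ennreal" where
  "hausdorff_gauge s C =
     (if C = {} then 0 else ennreal (unit_ball_vol (real s) * (diameter C / 2) ^ s))"

definition fine_covers :: "real \<Rightarrow> 'a::euclidean_space set \<Rightarrow> (nat \<Rightarrow> 'a set) set" where
  "fine_covers \<delta> A = {C. A \<subseteq> (\<Union>i. C i) \<and> (\<forall>i. bounded (C i) \<and> diameter (C i) \<le> \<delta>)}"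

definition hausdorff_content :: "nat \<Rightarrow> real \<Rightarrow> 'a::euclidean_space set \<Rightarrow> ennreal" where
  "hausdorff_content s \<delta> A = (INF C\<in>fine_covers \<delta> A. \<Sum>i. hausdorff_gauge s (C i))"

definition hausdorff_outer :: "nat \<Rightarrow> 'a::euclidean_space set \<Rightarrow> ennreal" where
  "hausdorff_outer s A = (SUP \<delta>\<in>{0<..}. hausdorff_content s \<delta> A)"

definition hausdorff_measure :: "nat \<Rightarrow> 'a::euclidean_space measure" where
  "hausdorff_measure s = measure_of UNIV (sets borel) (hausdorff_outer s)"

lemma hausdorff_gauge_empty [simp]: "hausdorff_gauge s {} = 0"
  by (simp add: hausdorff_gauge_def)

lemma hausdorff_content_mono: "A \<subseteq> B \<Longrightarrow> hausdorff_content s \<delta> A \<le> hausdorff_content s \<delta> B"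
  unfolding hausdorff_content_def by (rule INF_superset_mono) (auto simp: fine_covers_def)

lemma hausdorff_content_antimono:
  "\<delta> \<le> \<epsilon> \<Longrightarrow> hausdorff_content s \<epsilon> A \<le> hausdorff_content s \<delta> A"
  unfolding hausdorff_content_def
  by (rule INF_superset_mono) (auto simp: fine_covers_def intro: order_trans)

lemma hausdorff_content_empty [simp]: "\<delta> > 0 \<Longrightarrow> hausdorff_content s \<delta> {} = 0"
  unfolding hausdorff_content_def
  by (intro antisym INF_lower2[of "\<lambda>_. {}"]) (auto simp: fine_covers_def)

lemma hausdorff_content_subadd:
  "hausdorff_content s \<delta> (\<Union>i. A i) \<le> (\<Sum>i. hausdorff_content s \<delta> (A i))"
proof (rule ennreal_le_epsilon)
  fix e :: real
  assume "0 < e" "(\<Sum>n. hausdorff_content s \<delta> (A n)) < top"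
  then have *: "hausdorff_content s \<delta> (A n) < hausdorff_content s \<delta> (A n) + e * (1/2)^Suc n" for n
    by (auto simp add: less_top dest!: ennreal_suminf_lessD)
  then have "\<exists>C\<in>fine_covers \<delta> (A n).
      (\<Sum>i. hausdorff_gauge s (C i)) < hausdorff_content s \<delta> (A n) + e * (1/2)^Suc n" for n
    unfolding hausdorff_content_def INF_less_iff .
  then obtain B where B: "\<And>n. B n \<in> fine_covers \<delta> (A n)"
    and Bl: "\<And>n. (\<Sum>i. hausdorff_gauge s (B n i)) < hausdorff_content s \<delta> (A n) + e * (1/2)^Suc n"
    by metis
  define C where "C = case_prod B o prod_decode"
  have "(\<Union>i. A i) \<subseteq> (\<Union>i. C i)"
  proof
    fix x assume "x \<in> (\<Union>i. A i)"
    then obtain n where "x \<in> A n" by auto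
    with B[of n] obtain i where "x \<in> B n i" by (auto simp: fine_covers_def)
    then have "x \<in> C (prod_encode (n, i))" by (simp add: C_def)
    then show "x \<in> (\<Union>i. C i)" by blast
  qed
  with B have "C \<in> fine_covers \<delta> (\<Union>i. A i)"
    by (auto simp: fine_covers_def C_def split: prod.splits)
  then have "hausdorff_content s \<delta> (\<Union>i. A i) \<le> (\<Sum>i. hausdorff_gauge s (C i))"
    unfolding hausdorff_content_def by (rule INF_lower)
  also have "\<dots> = (\<Sum>n. \<Sum>i. hausdorff_gauge s (B n i))"
    unfolding C_def comp_def
    using suminf_ennreal_2dimen[of "\<lambda>n. (\<Sum>i. hausdorff_gauge s (B n i))"
        "\<lambda>p. hausdorff_gauge s (case_prod B p)"]
    by (simp add: split_def)
  also have "\<dots> \<le> (\<Sum>n. hausdorff_content s \<delta> (A n) + e * (1/2) ^ Suc n)"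
    by (intro suminf_le allI less_imp_le[OF Bl]) auto
  also have "\<dots> = (\<Sum>n. hausdorff_content s \<delta> (A n)) + (\<Sum>n. ennreal e * ennreal ((1/2) ^ Suc n))"
    using \<open>0 < e\<close> by (subst suminf_add[symmetric])
                     (auto simp del: ennreal_suminf_cmult simp add: ennreal_mult[symmetric])
  also have "\<dots> = (\<Sum>n. hausdorff_content s \<delta> (A n)) + e"
    unfolding ennreal_suminf_cmult
    by (subst suminf_ennreal_eq[OF zero_le_power power_half_series]) auto
  finally show "hausdorff_content s \<delta> (\<Union>i. A i) \<le> (\<Sum>n. hausdorff_content s \<delta> (A n)) + e" .
qed

lemma hausdorff_content_le_outer:
  "\<delta> > 0 \<Longrightarrow> hausdorff_content s \<delta> A \<le> hausdorff_outer s A"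
  unfolding hausdorff_outer_def by (rule SUP_upper) simp

lemma hausdorff_outer_UN: "hausdorff_outer s (\<Union>i::nat. A i) \<le> (\<Sum>i. hausdorff_outer s (A i))"
  unfolding hausdorff_outer_def[of s "\<Union>i. A i"]
proof (rule SUP_least)
  fix \<delta> :: real assume "\<delta> \<in> {0<..}"
  then have "(\<Sum>i. hausdorff_content s \<delta> (A i)) \<le> (\<Sum>i. hausdorff_outer s (A i))"
    by (intro suminf_le allI hausdorff_content_le_outer) auto
  with hausdorff_content_subadd
  show "hausdorff_content s \<delta> (\<Union>i. A i) \<le> (\<Sum>i. hausdorff_outer s (A i))"
    by (rule order_trans)
qed

lemma hausdorff_outer_mono: "A \<subseteq> B \<Longrightarrow> hausdorff_outer s A \<le> hausdorff_outer s B"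
  unfolding hausdorff_outer_def by (rule SUP_mono) (use hausdorff_content_mono in blast)

lemma hausdorff_outer_empty [simp]: "hausdorff_outer s {} = 0"
  unfolding hausdorff_outer_def by (auto intro!: antisym SUP_least)

lemma outer_measure_space_hausdorff: "outer_measure_space UNIV (hausdorff_outer s)"
  by (auto simp: outer_measure_space_def positive_def increasing_def countably_subadditive_def
      intro: hausdorff_outer_mono hausdorff_outer_UN)

lemma hausdorff_outer_Un: "hausdorff_outer s (A \<union> B) \<le> hausdorff_outer s A + hausdorff_outer s B"
proof -
  have "hausdorff_outer s (\<Union>i. binaryset A B i) \<le> (\<Sum>i. hausdorff_outer s (binaryset A B i))"
    by (rule hausdorff_outer_UN)
  also have "(\<Sum>i. hausdorff_outer s (binaryset A B i)) = hausdorff_outer s A + hausdorff_outer s B"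
    by (rule suminf_binaryset_eq) simp
  finally show ?thesis by (simp add: UN_binaryset_eq)
qed

lemma hausdorff_outer_metric:
  assumes e: "e > 0" and far: "\<And>x y. x \<in> A \<Longrightarrow> y \<in> B \<Longrightarrow> e \<le> dist x y"
  shows "hausdorff_outer s A + hausdorff_outer s B \<le> hausdorff_outer s (A \<union> B)"
proof -
  have *: "hausdorff_content s \<delta> A + hausdorff_content s \<delta> B \<le> hausdorff_content s \<delta> (A \<union> B)"
    if \<delta>: "\<delta> > 0" "\<delta> < e" for \<delta>
    unfolding hausdorff_content_def[of s \<delta> "A \<union> B"]
  proof (rule INF_greatest)
    fix C assume C: "C \<in> fine_covers \<delta> (A \<union> B)"
    define E where "E i = (if C i \<inter> A \<noteq> {} then C i else {})" for i
    define F where "F i = (if C i \<inter> B \<noteq> {} then C i else {})" for i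
    have "E \<in> fine_covers \<delta> A" "F \<in> fine_covers \<delta> B"
      using C \<delta> by (force simp: fine_covers_def E_def F_def)+
    then have "hausdorff_content s \<delta> A + hausdorff_content s \<delta> B
        \<le> (\<Sum>i. hausdorff_gauge s (E i)) + (\<Sum>i. hausdorff_gauge s (F i))"
      unfolding hausdorff_content_def by (intro add_mono INF_lower)
    also have "\<dots> = (\<Sum>i. hausdorff_gauge s (E i) + hausdorff_gauge s (F i))"
      by (rule suminf_add) auto
    also have "\<dots> \<le> (\<Sum>i. hausdorff_gauge s (C i))"
    proof (intro suminf_le allI)
      fix i
      have "C i \<inter> A = {} \<or> C i \<inter> B = {}"
      proof (rule ccontr)
        assume "\<not> ?thesis"
        then obtain x y where "x \<in> C i" "x \<in> A" "y \<in> C i" "y \<in> B" by auto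
        moreover have "bounded (C i)" "diameter (C i) \<le> \<delta>"
          using C by (auto simp: fine_covers_def)
        ultimately show False
          using diameter_bounded_bound[of "C i" x y] far[of x y] \<delta> by auto
      qed
      then show "hausdorff_gauge s (E i) + hausdorff_gauge s (F i) \<le> hausdorff_gauge s (C i)"
        by (auto simp: E_def F_def)
    qed auto
    finally show "hausdorff_content s \<delta> A + hausdorff_content s \<delta> B
        \<le> (\<Sum>i. hausdorff_gauge s (C i))" .
  qed
  have "hausdorff_outer s A + hausdorff_outer s B
      = (SUP \<delta>\<in>{0<..}. hausdorff_content s \<delta> A + hausdorff_content s \<delta> B)"
    unfolding hausdorff_outer_def
  proof (rule SUP_add_directed_ennreal[symmetric])
    fix x y :: real assume "x \<in> {0<..}" "y \<in> {0<..}"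
    then show "\<exists>k\<in>{0<..}. hausdorff_content s x A + hausdorff_content s y B
        \<le> hausdorff_content s k A + hausdorff_content s k B"
      by (intro bexI[of _ "min x y"] add_mono hausdorff_content_antimono) auto
  qed
  also have "\<dots> \<le> hausdorff_outer s (A \<union> B)"
  proof (rule SUP_least)
    fix \<delta> :: real assume "\<delta> \<in> {0<..}"
    then have p: "0 < min \<delta> (e/2)" "min \<delta> (e/2) < e" using e by auto
    have "hausdorff_content s \<delta> A + hausdorff_content s \<delta> B
        \<le> hausdorff_content s (min \<delta> (e/2)) A + hausdorff_content s (min \<delta> (e/2)) B"
      by (intro add_mono hausdorff_content_antimono) auto
    also have "\<dots> \<le> hausdorff_content s (min \<delta> (e/2)) (A \<union> B)" using *[OF p] .
    also have "\<dots> \<le> hausdorff_outer s (A \<union> B)" using p by (intro hausdorff_content_le_outer)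
    finally show "hausdorff_content s \<delta> A + hausdorff_content s \<delta> B
        \<le> hausdorff_outer s (A \<union> B)" .
  qed
  finally show ?thesis .
qed

lemma hausdorff_outer_closed:
  fixes A C :: "'a::euclidean_space set"
  assumes C: "closed C"
  shows "hausdorff_outer s (A \<inter> C) + hausdorff_outer s (A - C) = hausdorff_outer s A"
proof (rule antisym)
  have "A \<inter> C \<union> (A - C) = A" by blast
  then show "hausdorff_outer s A \<le> hausdorff_outer s (A \<inter> C) + hausdorff_outer s (A - C)"
    using hausdorff_outer_Un[of s "A \<inter> C" "A - C"] by simp
next
  show "hausdorff_outer s (A \<inter> C) + hausdorff_outer s (A - C) \<le> hausdorff_outer s A"
  proof (cases "hausdorff_outer s A = top \<or> C = {}")
    case False
    then have fin: "hausdorff_outer s A < top" and ne: "C \<noteq> {}" by (auto simp: less_top)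
    let ?H = "hausdorff_outer s"
    define B where "B k = {x\<in>A. 1 / (real k + 1) \<le> infdist x C}" for k
    define D where "D k = {x\<in>A. 1 / (real k + 2) \<le> infdist x C \<and> infdist x C < 1 / (real k + 1)}" for k
    have BC: "?H (A \<inter> C) + ?H (B k) \<le> ?H A" for k
    proof -
      have "?H (A \<inter> C) + ?H (B k) \<le> ?H ((A \<inter> C) \<union> B k)"
      proof (rule hausdorff_outer_metric)
        fix x y assume "x \<in> A \<inter> C" "y \<in> B k"
        then show "1 / (real k + 1) \<le> dist x y"
          using infdist_le[of x C y] by (auto simp: B_def dist_commute)
      qed simp
      also have "\<dots> \<le> ?H A" by (rule hausdorff_outer_mono) (auto simp: B_def)
      finally show ?thesis .
    qed
    have part: "(\<Sum>j<n. ?H (D (2*j+p))) \<le> ?H (\<Union>j<n. D (2*j+p))" for n p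
    proof (induction n)
      case (Suc n)
      have "(\<Sum>j<Suc n. ?H (D (2*j+p))) \<le> ?H (\<Union>j<n. D (2*j+p)) + ?H (D (2*n+p))"
        using Suc by (simp add: add_right_mono)
      also have "\<dots> \<le> ?H ((\<Union>j<n. D (2*j+p)) \<union> D (2*n+p))"
      proof (cases "n = 0")
        case False
        show ?thesis
        proof (rule hausdorff_outer_metric)
          show "0 < 1 / real (2*n+p) - 1 / (real (2*n+p) + 1)"
            using False by (simp add: divide_strict_left_mono)
          fix x y assume "x \<in> (\<Union>j<n. D (2*j+p))" and y: "y \<in> D (2*n+p)"
          then obtain j where j: "j < n" "x \<in> D (2*j+p)" by auto
          have "1 / real (2*n+p) \<le> 1 / (real (2*j+p) + 2)"
            using j by (intro divide_left_mono) auto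
          also have "\<dots> \<le> infdist x C" using j by (auto simp: D_def)
          also have "\<dots> \<le> infdist y C + dist x y" by (rule infdist_triangle)
          also have "infdist y C < 1 / (real (2*n+p) + 1)" using y by (auto simp: D_def)
          finally show "1 / real (2*n+p) - 1 / (real (2*n+p) + 1) \<le> dist x y" by simp
        qed
      qed simp
      also have "\<dots> = ?H (\<Union>j<Suc n. D (2*j+p))" by (simp add: lessThan_Suc Un_commute)
      finally show ?case .
    qed simp
    have part': "(\<Sum>j<n. ?H (D (2*j+p))) \<le> ?H A" for n p
      using part[of p n] hausdorff_outer_mono[of "\<Union>j<n. D (2*j+p)" A s]
      by (force simp: D_def)
    define d where "d j = enn2real (?H (D j))" for j
    have "?H (D j) \<le> ?H A" for j by (rule hausdorff_outer_mono) (auto simp: D_def)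
    then have Hd: "?H (D j) = ennreal (d j)" for j
      using fin unfolding d_def by (metis ennreal_enn2real le_less_trans)
    have d0: "0 \<le> d j" for j by (simp add: d_def)
    have bound: "(\<Sum>j<n. d (2*j+p)) \<le> enn2real (?H A)" for n p
    proof -
      have "ennreal (\<Sum>j<n. d (2*j+p)) \<le> ennreal (enn2real (?H A))"
        using part'[of p n] fin d0 by (simp add: Hd)
      then show ?thesis by (simp add: ennreal_le_iff)
    qed
    have "(\<Sum>j<n. d j) \<le> 2 * enn2real (?H A)" for n
    proof -
      have "(\<Sum>j<n. d j) \<le> (\<Sum>j<2*n. d j)"
        using d0 by (intro sum_mono2) auto
      also have "(\<Sum>j<2*n. d j) = (\<Sum>j<n. d (2*j+0)) + (\<Sum>j<n. d (2*j+1))"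
        by (induction n) auto
      finally show ?thesis using bound[of 0 n] bound[of 1 n] by linarith
    qed
    then have sd: "summable d" using d0 by (intro summableI_nonneg_bounded)
    show ?thesis
    proof (rule ennreal_le_epsilon)
      fix e :: real assume "0 < e"
      then obtain k where k: "norm (\<Sum>j. d (j + k)) < e"
        using suminf_exist_split[OF _ sd] by blast
      have sk: "summable (\<lambda>j. d (j + k))" using sd by (simp add: summable_iff_shift)
      have "A - C \<subseteq> B k \<union> (\<Union>j. D (j + k))"
      proof
        fix x assume x: "x \<in> A - C"
        then have pos: "0 < infdist x C"
          using C ne by (auto intro: infdist_pos_not_in_closed)
        show "x \<in> B k \<union> (\<Union>j. D (j + k))"
        proof (cases "x \<in> B k")
          case nB: False
          define m where "m = (LEAST m. 1 / (real m + 1) \<le> infdist x C)"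
          obtain m0 where "inverse (real (Suc m0)) < infdist x C"
            using reals_Archimedean[OF pos] by blast
          then have "1 / (real m0 + 1) \<le> infdist x C" by (simp add: field_simps)
          then have m: "1 / (real m + 1) \<le> infdist x C"
            unfolding m_def by (rule LeastI)
          have lt: "infdist x C < 1 / (real i + 1)" if "i < m" for i
            using not_less_Least[of i] that unfolding m_def by force
          have "k < m"
          proof (rule ccontr)
            assume "\<not> k < m"
            then have "1 / (real k + 1) \<le> 1 / (real m + 1)" by (intro divide_left_mono) auto
            with m nB x show False by (auto simp: B_def)
          qed
          then obtain i where i: "m = Suc i" "k \<le> i" by (cases m) auto
          then have "x \<in> D ((i - k) + k)" using m lt[of i] x by (simp add: D_def add.commute)
          then show ?thesis by blast
        qed auto
      qed
      then have "?H (A - C) \<le> ?H (B k \<union> (\<Union>j. D (j + k)))" by (rule hausdorff_outer_mono)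
      also have "\<dots> \<le> ?H (B k) + ?H (\<Union>j. D (j + k))" by (rule hausdorff_outer_Un)
      also have "\<dots> \<le> ?H (B k) + (\<Sum>j. ?H (D (j + k)))"
        by (intro add_left_mono hausdorff_outer_UN)
      also have "(\<Sum>j. ?H (D (j + k))) = ennreal (\<Sum>j. d (j + k))"
        unfolding Hd using d0 by (intro suminf_ennreal2 sk) auto
      also have "\<dots> \<le> ennreal e" using k by (intro ennreal_leI) auto
      finally have "?H (A \<inter> C) + ?H (A - C) \<le> ?H (A \<inter> C) + (?H (B k) + ennreal e)"
        by (simp add: add_left_mono)
      also have "\<dots> \<le> ?H A + ennreal e"
        using BC[of k] by (simp add: add_right_mono flip: add.assoc)
      finally show "?H (A \<inter> C) + ?H (A - C) \<le> ?H A + ennreal e" .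
    qed
  qed auto
qed

lemma measure_space_hausdorff: "measure_space UNIV (sets borel) (hausdorff_outer s)"
proof -
  let ?L = "lambda_system UNIV UNIV (hausdorff_outer s) :: 'a set set"
  have alg: "algebra UNIV (UNIV :: 'a set set)"
    using algebra_Pow[of "UNIV :: 'a set"] by simp
  have L: "measure_space UNIV ?L (hausdorff_outer s)"
    using sigma_algebra.caratheodory_lemma[OF sigma_algebra_Pow[of UNIV]] 
      outer_measure_space_hausdorff[of s] by simp
  then interpret L: sigma_algebra UNIV ?L by (simp add: measure_space_def)
  have "sigma_sets UNIV (Collect closed) \<subseteq> ?L"
  proof (rule L.sigma_sets_subset)
    show "Collect closed \<subseteq> ?L"
      using hausdorff_outer_closed by (auto simp: algebra.lambda_system_eq[OF alg])
  qed
  then have sub: "sets borel \<subseteq> ?L" by (simp add: borel_eq_closed)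
  show ?thesis
    unfolding measure_space_def
  proof (intro conjI)
    show "sigma_algebra UNIV (sets borel :: 'a set set)"
      using sets.sigma_algebra_axioms[of "borel :: 'a measure"] by simp
    show "positive (sets borel :: 'a set set) (hausdorff_outer s)" by (simp add: positive_def)
    show "countably_additive (sets borel :: 'a set set) (hausdorff_outer s)"
      using L sub unfolding measure_space_def countably_additive_def by blast
  qed
qed

lemma space_hausdorff_measure [simp]: "space (hausdorff_measure s) = UNIV"
  by (simp add: hausdorff_measure_def)

lemma sets_hausdorff_measure [simp, measurable_cong]: "sets (hausdorff_measure s) = sets borel"
  by (simp add: hausdorff_measure_def sets.sigma_sets_eq[of borel, simplified])

lemma emeasure_hausdorff_measure:
  "A \<in> sets borel \<Longrightarrow> emeasure (hausdorff_measure s) A = hausdorff_outer s A"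
  unfolding hausdorff_measure_def
  by (rule emeasure_measure_of_sigma) (use measure_space_hausdorff[of s] in \<open>auto simp: measure_space_def\<close>)


section \<open>Function spaces\<close>

text \<open>
  Elements of Lebesgue and Sobolev spaces are represented by functions; equality in the space is
  equality almost everywhere.
\<close>

definition L2 :: "'b measure \<Rightarrow> ('b \<Rightarrow> real) set" where
  "L2 M = {f \<in> borel_measurable M. integrable M (\<lambda>x. (f x)\<^sup>2)}"

definition L2_inner :: "'b measure \<Rightarrow> ('b \<Rightarrow> real) \<Rightarrow> ('b \<Rightarrow> real) \<Rightarrow> real" where
  "L2_inner M f g = (\<integral>x. f x * g x \<partial>M)"

definition L2_norm :: "'b measure \<Rightarrow> ('b \<Rightarrow> real) \<Rightarrow> real" where
  "L2_norm M f = sqrt (L2_inner M f f)"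

text \<open>Weak gradients are tested with \<open>C\<^sup>1\<close> functions of compact support in \<open>\<Omega>\<close> (as in Evans and Gariepy).\<close>

definition C1_compact :: "'a::euclidean_space set \<Rightarrow> ('a \<Rightarrow> real) set" where
  "C1_compact \<Omega> = {\<phi>. (\<forall>x. \<phi> differentiable (at x)) \<and>
     (\<forall>i. continuous_on UNIV (\<lambda>x. frechet_derivative \<phi> (at x) i)) \<and>
     compact (closure {x. \<phi> x \<noteq> 0}) \<and> closure {x. \<phi> x \<noteq> 0} \<subseteq> \<Omega>}"

definition weak_gradient :: "'a::euclidean_space set \<Rightarrow> ('a \<Rightarrow> real) \<Rightarrow> ('a \<Rightarrow> 'a) \<Rightarrow> bool" where
  "weak_gradient \<Omega> u G \<longleftrightarrow> (\<forall>\<phi>\<in>C1_compact \<Omega>. \<forall>i\<in>Basis.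
     (\<integral>x. u x * frechet_derivative \<phi> (at x) i \<partial>lebesgue_on \<Omega>) =
     - (\<integral>x. (G x \<bullet> i) * \<phi> x \<partial>lebesgue_on \<Omega>))"

definition H1_gradient :: "'a::euclidean_space set \<Rightarrow> ('a \<Rightarrow> real) \<Rightarrow> ('a \<Rightarrow> 'a) \<Rightarrow> bool" where
  "H1_gradient \<Omega> u G \<longleftrightarrow>
     weak_gradient \<Omega> u G \<and> (\<forall>i\<in>Basis. (\<lambda>x. G x \<bullet> i) \<in> L2 (lebesgue_on \<Omega>))"

definition H1 :: "'a::euclidean_space set \<Rightarrow> ('a \<Rightarrow> real) set" where
  "H1 \<Omega> = {u \<in> L2 (lebesgue_on \<Omega>). \<exists>G. H1_gradient \<Omega> u G}"

text \<open>The weak gradient, determined up to a null set.\<close>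

definition wgrad :: "'a::euclidean_space set \<Rightarrow> ('a \<Rightarrow> real) \<Rightarrow> 'a \<Rightarrow> 'a" where
  "wgrad \<Omega> u = (SOME G. H1_gradient \<Omega> u G)"

definition dirichlet_form :: "'a::euclidean_space set \<Rightarrow> ('a \<Rightarrow> real) \<Rightarrow> ('a \<Rightarrow> real) \<Rightarrow> real" where
  "dirichlet_form \<Omega> u v = (\<integral>x. wgrad \<Omega> u x \<bullet> wgrad \<Omega> v x \<partial>lebesgue_on \<Omega>)"

definition H1_norm :: "'a::euclidean_space set \<Rightarrow> ('a \<Rightarrow> real) \<Rightarrow> real" where
  "H1_norm \<Omega> u = sqrt ((L2_norm (lebesgue_on \<Omega>) u)\<^sup>2 + dirichlet_form \<Omega> u u)"

definition H1_dual :: "'a::euclidean_space set \<Rightarrow> (('a \<Rightarrow> real) \<Rightarrow> real) set" where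
  "H1_dual \<Omega> = {l.
     (\<forall>u\<in>H1 \<Omega>. \<forall>v\<in>H1 \<Omega>. \<forall>c d. l (\<lambda>x. c * u x + d * v x) = c * l u + d * l v) \<and>
     (\<exists>C. \<forall>v\<in>H1 \<Omega>. \<bar>l v\<bar> \<le> C * H1_norm \<Omega> v)}"

definition H1_dual_norm :: "'a::euclidean_space set \<Rightarrow> (('a \<Rightarrow> real) \<Rightarrow> real) \<Rightarrow> real" where
  "H1_dual_norm \<Omega> l = (SUP v\<in>{v \<in> H1 \<Omega>. H1_norm \<Omega> v \<le> 1}. \<bar>l v\<bar>)"


section \<open>Regular domains, surface measure and traces\<close>

text \<open>
  Near each boundary point, \<open>\<Omega>\<close> is the set above a Lipschitz graph in direction \<open>e\<close>; \<open>\<psi>\<close> is a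
  function of the coordinates orthogonal to \<open>e\<close>.
\<close>

definition lipschitz_boundary :: "'a::euclidean_space set \<Rightarrow> bool" where
  "lipschitz_boundary \<Omega> \<longleftrightarrow> (\<forall>x\<in>frontier \<Omega>. \<exists>r>0. \<exists>e \<psi> L. norm e = 1 \<and>
     L-lipschitz_on UNIV \<psi> \<and> (\<forall>y c. \<psi> (y + c *\<^sub>R e) = \<psi> y) \<and>
     \<Omega> \<inter> ball x r = {y \<in> ball x r. \<psi> y < y \<bullet> e})"

definition regular_domain :: "'a::euclidean_space set \<Rightarrow> bool" where
  "regular_domain \<Omega> \<longleftrightarrow>
     open \<Omega> \<and> connected \<Omega> \<and> \<Omega> \<noteq> {} \<and> bounded \<Omega> \<and> lipschitz_boundary \<Omega>"

abbreviation surface :: "'a::euclidean_space set \<Rightarrow> 'a measure" where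
  "surface \<Gamma> \<equiv> restrict_space (hausdorff_measure (DIM('a) - 1)) \<Gamma>"

text \<open>
  The trace operator of a regular domain: the bounded linear operator from \<open>H1 \<Omega>\<close> to \<open>L2\<close> of the
  boundary which restricts functions that are continuous up to the boundary.
\<close>

definition trace_operator ::
    "'a::euclidean_space set \<Rightarrow> (('a \<Rightarrow> real) \<Rightarrow> 'a \<Rightarrow> real) \<Rightarrow> bool" where
  "trace_operator \<Omega> \<gamma> \<longleftrightarrow>
     (\<forall>u\<in>H1 \<Omega>. \<gamma> u \<in> L2 (surface (frontier \<Omega>))) \<and>
     (\<forall>u\<in>H1 \<Omega>. \<forall>v\<in>H1 \<Omega>. \<forall>c d. AE x in surface (frontier \<Omega>).
        \<gamma> (\<lambda>y. c * u y + d * v y) x = c * \<gamma> u x + d * \<gamma> v x) \<and>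
     (\<exists>C. \<forall>u\<in>H1 \<Omega>. L2_norm (surface (frontier \<Omega>)) (\<gamma> u) \<le> C * H1_norm \<Omega> u) \<and>
     (\<forall>u\<in>H1 \<Omega>. continuous_on (closure \<Omega>) u \<longrightarrow> (AE x in surface (frontier \<Omega>). \<gamma> u x = u x))"

text \<open>\<open>H\<^sup>1\<^sup>/\<^sup>2(\<Gamma>)\<close> is the space of restrictions to \<open>\<Gamma>\<close> of traces, with the quotient norm.\<close>

definition Hhalf ::
    "'a::euclidean_space set \<Rightarrow> (('a \<Rightarrow> real) \<Rightarrow> 'a \<Rightarrow> real) \<Rightarrow> 'a set \<Rightarrow> ('a \<Rightarrow> real) set" where
  "Hhalf \<Omega> \<gamma> \<Gamma> = {w \<in> L2 (surface \<Gamma>). \<exists>v\<in>H1 \<Omega>. AE x in surface \<Gamma>. \<gamma> v x = w x}"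

definition Hhalf_norm ::
    "'a::euclidean_space set \<Rightarrow> (('a \<Rightarrow> real) \<Rightarrow> 'a \<Rightarrow> real) \<Rightarrow> 'a set \<Rightarrow> ('a \<Rightarrow> real) \<Rightarrow> real" where
  "Hhalf_norm \<Omega> \<gamma> \<Gamma> w = (INF v\<in>{v \<in> H1 \<Omega>. AE x in surface \<Gamma>. \<gamma> v x = w x}. H1_norm \<Omega> v)"

definition dirichlet_class ::
    "'a::euclidean_space set \<Rightarrow> (('a \<Rightarrow> real) \<Rightarrow> 'a \<Rightarrow> real) \<Rightarrow> 'a set \<Rightarrow> ('a \<Rightarrow> real) \<Rightarrow> ('a \<Rightarrow> real) set"
  where
  "dirichlet_class \<Omega> \<gamma> \<Gamma> w = {v \<in> H1 \<Omega>. AE x in surface \<Gamma>. \<gamma> v x = w x}"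


section \<open>Spaces of functions of time\<close>

abbreviation time :: "real \<Rightarrow> real measure" where
  "time T \<equiv> lebesgue_on {0<..<T}"

text \<open>
  \<open>L\<^sup>2(0,T;X)\<close> in the sense of Bochner, for a space \<open>X\<close> of real functions (or functionals) with
  seminorm \<open>N\<close>: strong measurability means approximation by simple functions almost everywhere.
\<close>

definition bochner_L2 :: "real \<Rightarrow> ('c \<Rightarrow> real) set \<Rightarrow> (('c \<Rightarrow> real) \<Rightarrow> real) \<Rightarrow> (real \<Rightarrow> 'c \<Rightarrow> real) set" where
  "bochner_L2 T X N = {u.
     (AE t in time T. u t \<in> X) \<and>
     (\<exists>s. (\<forall>k. simple_function (time T) (s k) \<and> (\<forall>t\<in>{0<..<T}. s k t \<in> X)) \<and>
        (AE t in time T. (\<lambda>k. N (\<lambda>x. s k t x - u t x)) \<longlonglongrightarrow> 0)) \<and>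
     integrable (time T) (\<lambda>t. (N (u t))\<^sup>2)}"

definition bochner_L2_norm :: "real \<Rightarrow> (('c \<Rightarrow> real) \<Rightarrow> real) \<Rightarrow> (real \<Rightarrow> 'c \<Rightarrow> real) \<Rightarrow> real" where
  "bochner_L2_norm T N u = sqrt (\<integral>t. (N (u t))\<^sup>2 \<partial>time T)"

abbreviation L2_L2 :: "real \<Rightarrow> 'a::euclidean_space set \<Rightarrow> (real \<Rightarrow> 'a \<Rightarrow> real) set" where
  "L2_L2 T \<Omega> \<equiv> bochner_L2 T (L2 (lebesgue_on \<Omega>)) (L2_norm (lebesgue_on \<Omega>))"

abbreviation L2_H1 :: "real \<Rightarrow> 'a::euclidean_space set \<Rightarrow> (real \<Rightarrow> 'a \<Rightarrow> real) set" where
  "L2_H1 T \<Omega> \<equiv> bochner_L2 T (H1 \<Omega>) (H1_norm \<Omega>)"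

definition C_L2 :: "real \<Rightarrow> 'a::euclidean_space set \<Rightarrow> (real \<Rightarrow> 'a \<Rightarrow> real) set" where
  "C_L2 T \<Omega> = {u. (\<forall>t\<in>{0..T}. u t \<in> L2 (lebesgue_on \<Omega>)) \<and>
     (\<forall>t\<in>{0..T}. ((\<lambda>r. L2_norm (lebesgue_on \<Omega>) (\<lambda>x. u r x - u t x)) \<longlongrightarrow> 0) (at t within {0..T}))}"

text \<open>
  A time derivative is given as a family of functionals \<open>l t\<close> on \<open>H1 \<Omega>\<close>, \<open>l t v\<close> being the duality
  pairing of the derivative at time \<open>t\<close> with \<open>v\<close>. The derivative belongs to \<open>L\<^sup>2(0,T;L\<^sup>2(\<Omega>))\<close> iff the
  pairing is the \<open>L\<^sup>2\<close> scalar product with an element of that space.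
\<close>

definition has_time_derivative ::
    "real \<Rightarrow> 'a::euclidean_space set \<Rightarrow> (real \<Rightarrow> 'a \<Rightarrow> real) \<Rightarrow> (real \<Rightarrow> ('a \<Rightarrow> real) \<Rightarrow> real) \<Rightarrow> bool" where
  "has_time_derivative T \<Omega> u l \<longleftrightarrow> (\<forall>\<theta>\<in>C1_compact {0<..<T}. \<forall>v\<in>H1 \<Omega>.
     (\<integral>t. deriv \<theta> t * L2_inner (lebesgue_on \<Omega>) (u t) v \<partial>time T) =
     - (\<integral>t. \<theta> t * l t v \<partial>time T))"

definition L2_derivatives ::
    "real \<Rightarrow> 'a::euclidean_space set \<Rightarrow> (real \<Rightarrow> ('a \<Rightarrow> real) \<Rightarrow> real) set" where
  "L2_derivatives T \<Omega> = {l. \<exists>w\<in>L2_L2 T \<Omega>. AE t in time T.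
     \<forall>v\<in>H1 \<Omega>. l t v = L2_inner (lebesgue_on \<Omega>) (w t) v}"

definition dual_derivatives ::
    "real \<Rightarrow> 'a::euclidean_space set \<Rightarrow> (real \<Rightarrow> ('a \<Rightarrow> real) \<Rightarrow> real) set" where
  "dual_derivatives T \<Omega> = bochner_L2 T (H1_dual \<Omega>) (H1_dual_norm \<Omega>)"


section \<open>The state problem and the control problem\<close>

definition friction ::
    "(('a::euclidean_space \<Rightarrow> real) \<Rightarrow> 'a \<Rightarrow> real) \<Rightarrow> 'a set \<Rightarrow> ('a \<Rightarrow> real) \<Rightarrow> ('a \<Rightarrow> real) \<Rightarrow> real" where
  "friction \<gamma> \<Gamma>\<^sub>2 q v = (\<integral>x. q x * \<bar>\<gamma> v x\<bar> \<partial>surface \<Gamma>\<^sub>2)"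

definition robin_form ::
    "'a::euclidean_space set \<Rightarrow> (('a \<Rightarrow> real) \<Rightarrow> 'a \<Rightarrow> real) \<Rightarrow> 'a set \<Rightarrow> real \<Rightarrow>
     ('a \<Rightarrow> real) \<Rightarrow> ('a \<Rightarrow> real) \<Rightarrow> real" where
  "robin_form \<Omega> \<gamma> \<Gamma>\<^sub>1 h u v =
     dirichlet_form \<Omega> u v + h * (\<integral>x. \<gamma> u x * \<gamma> v x \<partial>surface \<Gamma>\<^sub>1)"

text \<open>The variational inequality at a fixed time; \<open>l\<close> stands for the pairing with \<open>du/dt\<close>.\<close>

definition robin_inequality ::
    "'a::euclidean_space set \<Rightarrow> (('a \<Rightarrow> real) \<Rightarrow> 'a \<Rightarrow> real) \<Rightarrow> 'a set \<Rightarrow> 'a set \<Rightarrow> 'a set \<Rightarrow>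
     ('a \<Rightarrow> real) \<Rightarrow> ('a \<Rightarrow> real) \<Rightarrow> ('a \<Rightarrow> real) \<Rightarrow> real \<Rightarrow> ('a \<Rightarrow> real) \<Rightarrow>
     ('a \<Rightarrow> real) \<Rightarrow> (('a \<Rightarrow> real) \<Rightarrow> real) \<Rightarrow> bool" where
  "robin_inequality \<Omega> \<gamma> \<Gamma>\<^sub>1 \<Gamma>\<^sub>2 \<Gamma>\<^sub>3 g b q h f u l \<longleftrightarrow> (\<forall>v\<in>H1 \<Omega>.
     l (\<lambda>x. v x - u x) + robin_form \<Omega> \<gamma> \<Gamma>\<^sub>1 h u (\<lambda>x. v x - u x)
       + friction \<gamma> \<Gamma>\<^sub>2 q v - friction \<gamma> \<Gamma>\<^sub>2 q u
     \<ge> L2_inner (lebesgue_on \<Omega>) g (\<lambda>x. v x - u x)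
       - (\<integral>x. f x * \<gamma> (\<lambda>y. v y - u y) x \<partial>surface \<Gamma>\<^sub>3)
       + h * (\<integral>x. b x * \<gamma> (\<lambda>y. v y - u y) x \<partial>surface \<Gamma>\<^sub>1))"

text \<open>The parameter \<open>D\<close> is the space in which the time derivative is sought.\<close>

definition robin_solution ::
    "(real \<Rightarrow> ('a::euclidean_space \<Rightarrow> real) \<Rightarrow> real) set \<Rightarrow> 'a set \<Rightarrow> (('a \<Rightarrow> real) \<Rightarrow> 'a \<Rightarrow> real) \<Rightarrow>
     'a set \<Rightarrow> 'a set \<Rightarrow> 'a set \<Rightarrow> real \<Rightarrow> (real \<Rightarrow> 'a \<Rightarrow> real) \<Rightarrow> (real \<Rightarrow> 'a \<Rightarrow> real) \<Rightarrow>
     (real \<times> 'a \<Rightarrow> real) \<Rightarrow> ('a \<Rightarrow> real) \<Rightarrow> real \<Rightarrow> (real \<times> 'a \<Rightarrow> real) \<Rightarrow> (real \<Rightarrow> 'a \<Rightarrow> real) \<Rightarrow> bool" where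
  "robin_solution D \<Omega> \<gamma> \<Gamma>\<^sub>1 \<Gamma>\<^sub>2 \<Gamma>\<^sub>3 T g b q u\<^sub>b h f u \<longleftrightarrow>
     u \<in> C_L2 T \<Omega> \<and> u \<in> L2_H1 T \<Omega> \<and>
     (AE x in lebesgue_on \<Omega>. u 0 x = u\<^sub>b x) \<and>
     (\<exists>l\<in>D. has_time_derivative T \<Omega> u l \<and>
       (AE t in time T. robin_inequality \<Omega> \<gamma> \<Gamma>\<^sub>1 \<Gamma>\<^sub>2 \<Gamma>\<^sub>3 (g t) (b t) (\<lambda>x. q (t, x)) h
          (\<lambda>x. f (t, x)) (u t) (l t)))"

definition robin_state ::
    "(real \<Rightarrow> ('a::euclidean_space \<Rightarrow> real) \<Rightarrow> real) set \<Rightarrow> 'a set \<Rightarrow> (('a \<Rightarrow> real) \<Rightarrow> 'a \<Rightarrow> real) \<Rightarrow>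
     'a set \<Rightarrow> 'a set \<Rightarrow> 'a set \<Rightarrow> real \<Rightarrow> (real \<Rightarrow> 'a \<Rightarrow> real) \<Rightarrow> (real \<Rightarrow> 'a \<Rightarrow> real) \<Rightarrow>
     (real \<times> 'a \<Rightarrow> real) \<Rightarrow> ('a \<Rightarrow> real) \<Rightarrow> real \<Rightarrow> (real \<times> 'a \<Rightarrow> real) \<Rightarrow> real \<Rightarrow> 'a \<Rightarrow> real" where
  "robin_state D \<Omega> \<gamma> \<Gamma>\<^sub>1 \<Gamma>\<^sub>2 \<Gamma>\<^sub>3 T g b q u\<^sub>b h f =
     (SOME u. robin_solution D \<Omega> \<gamma> \<Gamma>\<^sub>1 \<Gamma>\<^sub>2 \<Gamma>\<^sub>3 T g b q u\<^sub>b h f u)"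

abbreviation lateral :: "real \<Rightarrow> 'a::euclidean_space set \<Rightarrow> (real \<times> 'a) measure" where
  "lateral T \<Gamma> \<equiv> time T \<Otimes>\<^sub>M surface \<Gamma>"

definition nonpos_controls :: "real \<Rightarrow> 'a::euclidean_space set \<Rightarrow> (real \<times> 'a \<Rightarrow> real) set" where
  "nonpos_controls T \<Gamma>\<^sub>3 = {f \<in> L2 (lateral T \<Gamma>\<^sub>3). AE z in lateral T \<Gamma>\<^sub>3. f z \<le> 0}"

text \<open>Existence, and uniqueness as an element of \<open>C([0,T];L\<^sup>2(\<Omega>))\<close>.\<close>

definition robin_well_posed ::
    "(real \<Rightarrow> ('a::euclidean_space \<Rightarrow> real) \<Rightarrow> real) set \<Rightarrow> 'a set \<Rightarrow> (('a \<Rightarrow> real) \<Rightarrow> 'a \<Rightarrow> real) \<Rightarrow>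
     'a set \<Rightarrow> 'a set \<Rightarrow> 'a set \<Rightarrow> real \<Rightarrow> (real \<Rightarrow> 'a \<Rightarrow> real) \<Rightarrow> (real \<Rightarrow> 'a \<Rightarrow> real) \<Rightarrow>
     (real \<times> 'a \<Rightarrow> real) \<Rightarrow> ('a \<Rightarrow> real) \<Rightarrow> bool" where
  "robin_well_posed D \<Omega> \<gamma> \<Gamma>\<^sub>1 \<Gamma>\<^sub>2 \<Gamma>\<^sub>3 T g b q u\<^sub>b \<longleftrightarrow> (\<forall>h>0. \<forall>f\<in>L2 (lateral T \<Gamma>\<^sub>3).
     (\<exists>u. robin_solution D \<Omega> \<gamma> \<Gamma>\<^sub>1 \<Gamma>\<^sub>2 \<Gamma>\<^sub>3 T g b q u\<^sub>b h f u) \<and>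
     (\<forall>u u'. robin_solution D \<Omega> \<gamma> \<Gamma>\<^sub>1 \<Gamma>\<^sub>2 \<Gamma>\<^sub>3 T g b q u\<^sub>b h f u \<longrightarrow>
        robin_solution D \<Omega> \<gamma> \<Gamma>\<^sub>1 \<Gamma>\<^sub>2 \<Gamma>\<^sub>3 T g b q u\<^sub>b h f u' \<longrightarrow>
        (\<forall>t\<in>{0..T}. AE x in lebesgue_on \<Omega>. u t x = u' t x)))"

definition robin_cost ::
    "(real \<Rightarrow> ('a::euclidean_space \<Rightarrow> real) \<Rightarrow> real) set \<Rightarrow> 'a set \<Rightarrow> (('a \<Rightarrow> real) \<Rightarrow> 'a \<Rightarrow> real) \<Rightarrow>
     'a set \<Rightarrow> 'a set \<Rightarrow> 'a set \<Rightarrow> real \<Rightarrow> (real \<Rightarrow> 'a \<Rightarrow> real) \<Rightarrow> (real \<Rightarrow> 'a \<Rightarrow> real) \<Rightarrow>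
     (real \<times> 'a \<Rightarrow> real) \<Rightarrow> ('a \<Rightarrow> real) \<Rightarrow> real \<Rightarrow> real \<Rightarrow> (real \<times> 'a \<Rightarrow> real) \<Rightarrow> real" where
  "robin_cost D \<Omega> \<gamma> \<Gamma>\<^sub>1 \<Gamma>\<^sub>2 \<Gamma>\<^sub>3 T g b q u\<^sub>b M h f =
     1/2 * (bochner_L2_norm T (L2_norm (lebesgue_on \<Omega>))
              (robin_state D \<Omega> \<gamma> \<Gamma>\<^sub>1 \<Gamma>\<^sub>2 \<Gamma>\<^sub>3 T g b q u\<^sub>b h f))\<^sup>2
     + M/2 * (L2_norm (lateral T \<Gamma>\<^sub>3) f)\<^sup>2"

text \<open>Strict convexity for functionals on spaces of classes of functions modulo \<open>P\<close>-null sets.\<close>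

definition strictly_convex_on_AE :: "'b measure \<Rightarrow> ('b \<Rightarrow> real) set \<Rightarrow> (('b \<Rightarrow> real) \<Rightarrow> real) \<Rightarrow> bool" where
  "strictly_convex_on_AE P K J \<longleftrightarrow> (\<forall>f\<in>K. \<forall>f'\<in>K. \<forall>\<mu>. 0 < \<mu> \<longrightarrow> \<mu> < 1 \<longrightarrow>
     \<not> (AE z in P. f z = f' z) \<longrightarrow>
     J (\<lambda>z. \<mu> * f z + (1 - \<mu>) * f' z) < \<mu> * J f + (1 - \<mu>) * J f')"

definition minimizer_on :: "'c set \<Rightarrow> ('c \<Rightarrow> real) \<Rightarrow> 'c \<Rightarrow> bool" where
  "minimizer_on K J f \<longleftrightarrow> f \<in> K \<and> (\<forall>f'\<in>K. J f \<le> J f')"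

end

theory Submission
  imports Defs
begin

text \<open>
  Testing with the negative part shows that the states of nonpositive controls are nonnegative, so that
  the friction functional is linear on them. For the convex combination \<open>f\<close> of two controls \<open>f\<^sub>1\<close>, \<open>f\<^sub>2\<close>
  with states \<open>u\<close>, \<open>u\<^sub>1\<close>, \<open>u\<^sub>2\<close> and \<open>w = u - (\<mu> u\<^sub>1 + (1 - \<mu>) u\<^sub>2)\<close>, the test functions \<open>u\<^sub>1 + w\<^sup>+\<close>,
  \<open>u\<^sub>2 + w\<^sup>+\<close> and \<open>u - w\<^sup>+\<close> give \<open>w \<le> 0\<close>. Hence the state part of the cost is convex and the control part
  makes the cost uniformly convex. A minimising sequence is therefore a Cauchy sequence, and the cost is
  continuous because the energy estimate and Gronwall's inequality make the state Lipschitz in the control.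

  That positive parts stay in \<open>H\<^sup>1(\<Omega>)\<close> and commute with the trace is proved by density of \<open>C\<^sup>1\<close>
  functions: near the boundary, a function is translated along an interior direction and mollified.
  The chain rule in time is replaced by the convexity inequality
  \<open>\<parallel>w\<^sup>+(t)\<parallel>\<^sup>2 - \<parallel>w\<^sup>+(t - \<delta>)\<parallel>\<^sup>2 \<le> 2 (w\<^sup>+(t), w(t) - w(t - \<delta>))\<close>, averaged over \<open>t\<close> as \<open>\<delta> \<rightarrow> 0\<close>.
\<close>

section \<open>The space of square integrable functions\<close>

lemma L2_measurable [measurable_dest]: "f \<in> L2 M \<Longrightarrow> f \<in> borel_measurable M"
  by (simp add: L2_def)

lemma L2_square_integrable: "f \<in> L2 M \<Longrightarrow> integrable M (\<lambda>x. (f x)\<^sup>2)"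
  by (simp add: L2_def)

lemma two_mult_le_squares: "2 * \<bar>a * b\<bar> \<le> a\<^sup>2 + (b::real)\<^sup>2"
  using zero_le_power2[of "\<bar>a\<bar> - \<bar>b\<bar>"] by (simp add: power2_diff abs_mult)

lemma L2_mult_integrable:
  assumes "f \<in> L2 M" "g \<in> L2 M"
  shows "integrable M (\<lambda>x. f x * g x)"
proof (rule Bochner_Integration.integrable_bound)
  show "integrable M (\<lambda>x. (f x)\<^sup>2 + (g x)\<^sup>2)"
    using assms by (intro Bochner_Integration.integrable_add L2_square_integrable)
  show "(\<lambda>x. f x * g x) \<in> borel_measurable M"
    using assms by (auto dest: L2_measurable)
  have "norm (f x * g x) \<le> norm ((f x)\<^sup>2 + (g x)\<^sup>2)" for x
    using two_mult_le_squares[of "f x" "g x"] by (simp add: abs_mult) (smt (verit) zero_le_mult_iff abs_ge_zero)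
  then show "AE x in M. norm (f x * g x) \<le> norm ((f x)\<^sup>2 + (g x)\<^sup>2)" by simp
qed

lemma L2_bound:
  assumes "f \<in> L2 M" "g \<in> borel_measurable M" "AE x in M. \<bar>g x\<bar> \<le> C * \<bar>f x\<bar>"
  shows "g \<in> L2 M"
  unfolding L2_def
proof (intro CollectI conjI assms(2), rule Bochner_Integration.integrable_bound)
  show "integrable M (\<lambda>x. C\<^sup>2 * (f x)\<^sup>2)"
    using assms(1) by (intro integrable_mult_right L2_square_integrable)
  show "(\<lambda>x. (g x)\<^sup>2) \<in> borel_measurable M" using assms(2) by simp
  show "AE x in M. norm ((g x)\<^sup>2) \<le> norm (C\<^sup>2 * (f x)\<^sup>2)"
    using assms(3)
  proof eventually_elim
    case (elim x)
    then have "\<bar>g x\<bar>\<^sup>2 \<le> (C * \<bar>f x\<bar>)\<^sup>2" by (rule power_mono) simp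
    then show ?case by (simp add: power_mult_distrib)
  qed
qed

lemma L2_lin:
  assumes "f \<in> L2 M" "g \<in> L2 M"
  shows "(\<lambda>x. c * f x + d * g x) \<in> L2 M"
proof -
  have "integrable M (\<lambda>x. c\<^sup>2 * (f x)\<^sup>2 + d\<^sup>2 * (g x)\<^sup>2 + 2 * (c * d) * (f x * g x))"
    using assms
    by (intro Bochner_Integration.integrable_add integrable_mult_right L2_square_integrable
        L2_mult_integrable)
  moreover have "(\<lambda>x. c\<^sup>2 * (f x)\<^sup>2 + d\<^sup>2 * (g x)\<^sup>2 + 2 * (c * d) * (f x * g x)) =
      (\<lambda>x. (c * f x + d * g x)\<^sup>2)"
    by (simp add: fun_eq_iff power2_eq_square algebra_simps)
  ultimately have "integrable M (\<lambda>x. (c * f x + d * g x)\<^sup>2)" by simp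
  then show ?thesis using assms by (auto simp: L2_def)
qed

lemma L2_add: "f \<in> L2 M \<Longrightarrow> g \<in> L2 M \<Longrightarrow> (\<lambda>x. f x + g x) \<in> L2 M"
  using L2_lin[of f M g 1 1] by simp

lemma L2_diff: "f \<in> L2 M \<Longrightarrow> g \<in> L2 M \<Longrightarrow> (\<lambda>x. f x - g x) \<in> L2 M"
  using L2_lin[of f M g 1 "-1"] by simp

lemma L2_cmult: "f \<in> L2 M \<Longrightarrow> (\<lambda>x. c * f x) \<in> L2 M"
  using L2_lin[of f M f c 0] by simp

lemma L2_zero: "(\<lambda>x. 0) \<in> L2 M"
  by (simp add: L2_def)

lemma L2_sum: "finite I \<Longrightarrow> (\<And>i. i \<in> I \<Longrightarrow> f i \<in> L2 M) \<Longrightarrow> (\<lambda>x. \<Sum>i\<in>I. f i x) \<in> L2 M"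
  by (induction I rule: finite_induct) (auto intro: L2_zero L2_add)

lemma L2_pos_part: "f \<in> L2 M \<Longrightarrow> (\<lambda>x. max 0 (f x)) \<in> L2 M"
  by (rule L2_bound[of f _ _ 1]) (auto dest: L2_measurable)

lemma L2_norm_power2: "(L2_norm M f)\<^sup>2 = (\<integral>x. (f x)\<^sup>2 \<partial>M)"
proof -
  have "0 \<le> (\<integral>x. f x * f x \<partial>M)" by (rule Bochner_Integration.integral_nonneg) simp
  then show ?thesis by (simp add: L2_norm_def L2_inner_def power2_eq_square)
qed

lemma L2_norm_nonneg [simp]: "0 \<le> L2_norm M f"
  unfolding L2_norm_def L2_inner_def
  by (intro real_sqrt_ge_zero Bochner_Integration.integral_nonneg) simp

lemma L2_inner_add_left:
  assumes "f \<in> L2 M" "g \<in> L2 M" "v \<in> L2 M"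
  shows "L2_inner M (\<lambda>x. c * f x + d * g x) v = c * L2_inner M f v + d * L2_inner M g v"
proof -
  have "L2_inner M (\<lambda>x. c * f x + d * g x) v = (\<integral>x. c * (f x * v x) + d * (g x * v x) \<partial>M)"
    by (simp add: L2_inner_def algebra_simps)
  then show ?thesis
    using assms by (simp add: L2_inner_def L2_mult_integrable)
qed

lemma L2_inner_commute: "L2_inner M f g = L2_inner M g f"
  by (simp add: L2_inner_def mult.commute)

lemma L2_inner_add_right:
  assumes "f \<in> L2 M" "g \<in> L2 M" "v \<in> L2 M"
  shows "L2_inner M v (\<lambda>x. c * f x + d * g x) = c * L2_inner M v f + d * L2_inner M v g"
  using L2_inner_add_left[OF assms, of c d] by (simp add: L2_inner_commute)

lemma L2_inner_cong_AE:
  assumes "AE x in M. f x = f' x" "AE x in M. g x = g' x"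
    "f \<in> borel_measurable M" "f' \<in> borel_measurable M" "g \<in> borel_measurable M" "g' \<in> borel_measurable M"
  shows "L2_inner M f g = L2_inner M f' g'"
  unfolding L2_inner_def using assms by (intro integral_cong_AE) auto

lemma L2_norm_lin_power2:
  assumes "f \<in> L2 M" "g \<in> L2 M"
  shows "(L2_norm M (\<lambda>x. c * f x + d * g x))\<^sup>2 =
    c\<^sup>2 * (L2_norm M f)\<^sup>2 + 2 * c * d * L2_inner M f g + d\<^sup>2 * (L2_norm M g)\<^sup>2"
proof -
  have "(\<integral>x. (c * f x + d * g x)\<^sup>2 \<partial>M) =
      (\<integral>x. c\<^sup>2 * (f x)\<^sup>2 + (2 * c * d) * (f x * g x) + d\<^sup>2 * (g x)\<^sup>2 \<partial>M)"
    by (simp add: power2_eq_square algebra_simps)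
  also have "\<dots> = c\<^sup>2 * (\<integral>x. (f x)\<^sup>2 \<partial>M) + 2 * c * d * (\<integral>x. f x * g x \<partial>M) + d\<^sup>2 * (\<integral>x. (g x)\<^sup>2 \<partial>M)"
    using assms by (simp add: L2_mult_integrable L2_square_integrable)
  finally show ?thesis by (simp add: L2_norm_power2 L2_inner_def)
qed

lemma L2_Cauchy_Schwarz:
  assumes "f \<in> L2 M" "g \<in> L2 M"
  shows "\<bar>L2_inner M f g\<bar> \<le> L2_norm M f * L2_norm M g"
proof -
  define a where "a = L2_norm M f"
  define b where "b = L2_norm M g"
  define i where "i = L2_inner M f g"
  have ab: "0 \<le> a" "0 \<le> b" by (simp_all add: a_def b_def)
  have *: "0 \<le> c\<^sup>2 * a\<^sup>2 + 2 * c * d * i + d\<^sup>2 * b\<^sup>2" for c d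
    using L2_norm_lin_power2[OF assms, of c d] zero_le_power2[of "L2_norm M (\<lambda>x. c * f x + d * g x)"]
    by (simp add: a_def b_def i_def)
  have "i\<^sup>2 \<le> a\<^sup>2 * b\<^sup>2"
  proof (cases "b = 0")
    case True
    have "i = 0"
    proof (rule ccontr)
      assume "i \<noteq> 0"
      then show False
        using *[of 1 "- (a\<^sup>2 + 1) / (2 * i)"] True by (simp add: field_simps)
    qed
    then show ?thesis by simp
  next
    case False
    then have "0 < b\<^sup>2" by simp
    have "0 \<le> b\<^sup>2 * (a\<^sup>2 * b\<^sup>2 - i\<^sup>2)"
      using *[of "b\<^sup>2" "- i"] by (simp add: power2_eq_square algebra_simps)
    then show ?thesis using \<open>0 < b\<^sup>2\<close> by (simp add: zero_le_mult_iff)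
  qed
  then have "\<bar>i\<bar>\<^sup>2 \<le> (a * b)\<^sup>2" by (simp add: power_mult_distrib)
  then have "\<bar>i\<bar> \<le> a * b" using ab by (auto intro: power2_le_imp_le[of "\<bar>i\<bar>"])
  then show ?thesis by (simp add: a_def b_def i_def)
qed

lemma L2_norm_lin_le:
  assumes "f \<in> L2 M" "g \<in> L2 M"
  shows "L2_norm M (\<lambda>x. c * f x + d * g x) \<le> \<bar>c\<bar> * L2_norm M f + \<bar>d\<bar> * L2_norm M g"
proof (rule power2_le_imp_le)
  have "c * d * L2_inner M f g \<le> \<bar>c * d * L2_inner M f g\<bar>" by simp
  also have "\<dots> \<le> \<bar>c * d\<bar> * (L2_norm M f * L2_norm M g)"
    using L2_Cauchy_Schwarz[OF assms] by (simp add: abs_mult mult_left_mono)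
  finally show "(L2_norm M (\<lambda>x. c * f x + d * g x))\<^sup>2 \<le> (\<bar>c\<bar> * L2_norm M f + \<bar>d\<bar> * L2_norm M g)\<^sup>2"
    unfolding L2_norm_lin_power2[OF assms] by (simp add: power2_sum power_mult_distrib abs_mult mult_ac)
qed simp

lemma L2_norm_add_le:
  "f \<in> L2 M \<Longrightarrow> g \<in> L2 M \<Longrightarrow> L2_norm M (\<lambda>x. f x + g x) \<le> L2_norm M f + L2_norm M g"
  using L2_norm_lin_le[of f M g 1 1] by simp

lemma L2_norm_cmult: "L2_norm M (\<lambda>x. c * f x) = \<bar>c\<bar> * L2_norm M f"
proof -
  have "(\<lambda>x. (c * f x) * (c * f x)) = (\<lambda>x. c\<^sup>2 * (f x * f x))"
    by (simp add: fun_eq_iff power2_eq_square algebra_simps)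
  then have "L2_inner M (\<lambda>x. c * f x) (\<lambda>x. c * f x) = c\<^sup>2 * L2_inner M f f"
    by (simp add: L2_inner_def)
  then show ?thesis by (simp add: L2_norm_def real_sqrt_mult)
qed

lemma L2_norm_minus_commute: "L2_norm M (\<lambda>x. f x - g x) = L2_norm M (\<lambda>x. g x - f x)"
  using L2_norm_cmult[of M "-1" "\<lambda>x. f x - g x"] by simp

lemma L2_norm_triangle:
  assumes "f \<in> L2 M" "g \<in> L2 M" "k \<in> L2 M"
  shows "L2_norm M (\<lambda>x. f x - k x) \<le> L2_norm M (\<lambda>x. f x - g x) + L2_norm M (\<lambda>x. g x - k x)"
  using L2_norm_add_le[OF L2_diff[OF assms(1,2)] L2_diff[OF assms(2,3)]] by simp

lemma L2_norm_reverse_triangle: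
  assumes "f \<in> L2 M" "g \<in> L2 M"
  shows "\<bar>L2_norm M f - L2_norm M g\<bar> \<le> L2_norm M (\<lambda>x. f x - g x)"
  using L2_norm_add_le[OF L2_diff[OF assms] assms(2)]
    L2_norm_add_le[OF L2_diff[OF assms(2,1)] assms(1)] L2_norm_minus_commute[of M f g] by simp

lemma L2_norm_mono:
  assumes "f \<in> borel_measurable M" "g \<in> L2 M" "AE x in M. \<bar>f x\<bar> \<le> \<bar>g x\<bar>"
  shows "L2_norm M f \<le> L2_norm M g"
proof (rule power2_le_imp_le)
  have f: "f \<in> L2 M" using L2_bound[of g M f 1] assms by simp
  show "(L2_norm M f)\<^sup>2 \<le> (L2_norm M g)\<^sup>2"
    unfolding L2_norm_power2
  proof (rule integral_mono_AE)
    show "AE x in M. (f x)\<^sup>2 \<le> (g x)\<^sup>2"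
      using assms(3) by eventually_elim (simp add: abs_le_square_iff)
  qed (use f assms L2_square_integrable in auto)
qed simp

lemma L2_norm_zero_iff:
  assumes "f \<in> L2 M"
  shows "L2_norm M f = 0 \<longleftrightarrow> (AE x in M. f x = 0)"
proof -
  have "L2_norm M f = 0 \<longleftrightarrow> (L2_norm M f)\<^sup>2 = 0" by simp
  also have "\<dots> \<longleftrightarrow> (AE x in M. (f x)\<^sup>2 = 0)"
    unfolding L2_norm_power2 by (rule integral_nonneg_eq_0_iff_AE) (auto intro: L2_square_integrable assms)
  finally show ?thesis by simp
qed

lemma L2_integrable: "finite_measure M \<Longrightarrow> f \<in> L2 M \<Longrightarrow> integrable M f"
  using L2_mult_integrable[of f M "\<lambda>_. 1"] finite_measure.integrable_const[of M "1::real"]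
  by (simp add: L2_def)

lemma L2_dominated_convergence:
  assumes f: "f \<in> borel_measurable M" "\<And>k. F k \<in> borel_measurable M" and G: "G \<in> L2 M"
    and conv: "AE x in M. (\<lambda>k. F k x) \<longlonglongrightarrow> f x"
    and bound: "\<And>k. AE x in M. \<bar>F k x - f x\<bar> \<le> G x"
  shows "(\<lambda>k::nat. L2_norm M (\<lambda>x. F k x - f x)) \<longlonglongrightarrow> 0"
proof -
  have "(\<lambda>k. \<integral>x. (F k x - f x)\<^sup>2 \<partial>M) \<longlonglongrightarrow> (\<integral>x. 0 \<partial>M)"
  proof (rule integral_dominated_convergence)
    show "integrable M (\<lambda>x. (G x)\<^sup>2)" by (rule L2_square_integrable[OF G])
    show "AE x in M. (\<lambda>k. (F k x - f x)\<^sup>2) \<longlonglongrightarrow> 0"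
      using conv
    proof eventually_elim
      case (elim x)
      have "(\<lambda>k. (F k x - f x)\<^sup>2) \<longlonglongrightarrow> (f x - f x)\<^sup>2"
        by (intro tendsto_intros elim)
      then show ?case by simp
    qed
    fix k show "AE x in M. norm ((F k x - f x)\<^sup>2) \<le> (G x)\<^sup>2"
      using bound[of k] by eventually_elim (metis abs_ge_zero norm_power power_mono real_norm_def)
  qed (use f in auto)
  then have "(\<lambda>k. sqrt ((L2_norm M (\<lambda>x. F k x - f x))\<^sup>2)) \<longlonglongrightarrow> sqrt 0"
    unfolding L2_norm_power2 by (intro tendsto_real_sqrt) simp
  then show ?thesis by simp
qed

lemma L2_tendsto_AE_subseq:
  assumes "\<And>n. F n \<in> L2 M" "f \<in> L2 M" "(\<lambda>n. L2_norm M (\<lambda>x. F n x - f x)) \<longlonglongrightarrow> 0"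
  obtains r :: "nat \<Rightarrow> nat" where "strict_mono r" "AE x in M. (\<lambda>n. F (r n) x) \<longlonglongrightarrow> f x"
proof -
  have "\<exists>r::nat\<Rightarrow>nat. strict_mono r \<and> (AE x in M. (\<lambda>n. (F (r n) x - f x)\<^sup>2) \<longlonglongrightarrow> 0)"
  proof (rule tendsto_L1_AE_subseq)
    show "integrable M (\<lambda>x. (F n x - f x)\<^sup>2)" for n
      by (intro L2_square_integrable L2_diff assms)
    have "(\<lambda>n. (L2_norm M (\<lambda>x. F n x - f x))\<^sup>2) \<longlonglongrightarrow> 0\<^sup>2" by (intro tendsto_power assms)
    then show "(\<lambda>n. \<integral>x. norm ((F n x - f x)\<^sup>2) \<partial>M) \<longlonglongrightarrow> 0" by (simp add: L2_norm_power2)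
  qed
  then obtain r where r: "strict_mono r" "AE x in M. (\<lambda>n. (F (r n) x - f x)\<^sup>2) \<longlonglongrightarrow> 0" by auto
  have "AE x in M. (\<lambda>n. F (r n) x) \<longlonglongrightarrow> f x"
    using r(2)
  proof eventually_elim
    case (elim x)
    then have "(\<lambda>n. sqrt ((F (r n) x - f x)\<^sup>2)) \<longlonglongrightarrow> sqrt 0" by (rule tendsto_real_sqrt)
    then have "(\<lambda>n. F (r n) x - f x) \<longlonglongrightarrow> 0" by (simp add: tendsto_rabs_zero_iff)
    then show ?case by (simp add: LIM_zero_iff)
  qed
  with r(1) show ?thesis by (rule that)
qed

lemma L2_complete:
  assumes M: "finite_measure M" and F: "\<And>n. F n \<in> L2 M"
    and Cauchy: "\<And>e. e > 0 \<Longrightarrow> \<exists>N. \<forall>i\<ge>N. \<forall>j\<ge>N. L2_norm M (\<lambda>x. F i x - F j x) < e"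
  obtains f where "f \<in> L2 M" "(\<lambda>n. L2_norm M (\<lambda>x. F n x - f x)) \<longlonglongrightarrow> 0"
proof -
  interpret finite_measure M by fact
  have one: "(\<lambda>_. 1) \<in> L2 M" by (simp add: L2_def)
  define m where "m = L2_norm M (\<lambda>_. 1) + 1"
  have m: "m > 0" by (simp add: m_def add_nonneg_pos)
  have "\<exists>r::nat\<Rightarrow>nat. strict_mono r \<and> (AE x in M. Cauchy (\<lambda>i. F (r i) x))"
  proof (rule cauchy_L1_AE_cauchy_subseq)
    show "integrable M (F n)" for n using L2_integrable[OF M F] .
    fix e :: real assume "e > 0"
    then obtain N where N: "\<forall>i\<ge>N. \<forall>j\<ge>N. L2_norm M (\<lambda>x. F i x - F j x) < e / m"
      using Cauchy[of "e / m"] m by auto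
    have "(\<integral>x. norm (F i x - F j x) \<partial>M) < e" if "i \<ge> N" "j \<ge> N" for i j
    proof -
      have D: "(\<lambda>x. \<bar>F i x - F j x\<bar>) \<in> L2 M"
        using L2_diff[OF F[of i] F[of j]] by (rule L2_bound[where C=1]) (use F in \<open>auto dest: L2_measurable\<close>)
      have "(\<integral>x. norm (F i x - F j x) \<partial>M) = L2_inner M (\<lambda>x. \<bar>F i x - F j x\<bar>) (\<lambda>_. 1)"
        by (simp add: L2_inner_def)
      also have "\<dots> \<le> L2_norm M (\<lambda>x. \<bar>F i x - F j x\<bar>) * L2_norm M (\<lambda>_. 1)"
        using L2_Cauchy_Schwarz[OF D one] by linarith
      also have "L2_norm M (\<lambda>x. \<bar>F i x - F j x\<bar>) = L2_norm M (\<lambda>x. F i x - F j x)"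
        by (simp add: L2_norm_def L2_inner_def)
      also have "\<dots> * L2_norm M (\<lambda>_. 1) \<le> \<dots> * m"
        by (intro mult_left_mono) (auto simp: m_def)
      also have "\<dots> < e" using N that m by (simp add: field_simps)
      finally show ?thesis .
    qed
    then show "\<exists>N. \<forall>i\<ge>N. \<forall>j\<ge>N. (\<integral>x. norm (F i x - F j x) \<partial>M) < e" by blast
  qed blast
  then obtain r :: "nat \<Rightarrow> nat" where r: "strict_mono r" "AE x in M. Cauchy (\<lambda>i. F (r i) x)" by blast
  define f where "f x = lim (\<lambda>i. F (r i) x)" for x
  have [measurable]: "F n \<in> borel_measurable M" for n using F by (rule L2_measurable)
  have f_meas [measurable]: "f \<in> borel_measurable M" unfolding f_def by (intro borel_measurable_lim_metric) simp
  have f_lim: "AE x in M. (\<lambda>i. F (r i) x) \<longlonglongrightarrow> f x"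
    using r(2) by eventually_elim (simp add: f_def Cauchy_convergent_iff convergent_LIMSEQ_iff)
  have key: "(\<lambda>x. F n x - f x) \<in> L2 M \<and> L2_norm M (\<lambda>x. F n x - f x) \<le> e"
    if e: "e > 0" and n: "\<forall>i\<ge>n. \<forall>j\<ge>n. L2_norm M (\<lambda>x. F i x - F j x) < e" for n e
  proof -
    have "(\<integral>\<^sup>+x. ennreal ((F n x - f x)\<^sup>2) \<partial>M) = (\<integral>\<^sup>+x. liminf (\<lambda>i. ennreal ((F n x - F (r i) x)\<^sup>2)) \<partial>M)"
      using f_lim
    proof (intro nn_integral_cong_AE, eventually_elim)
      case (elim x)
      have "(\<lambda>i. ennreal ((F n x - F (r i) x)\<^sup>2)) \<longlonglongrightarrow> ennreal ((F n x - f x)\<^sup>2)"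
        by (intro tendsto_ennrealI tendsto_intros elim)
      then show ?case by (metis lim_imp_Liminf sequentially_bot)
    qed
    also have "\<dots> \<le> liminf (\<lambda>i. \<integral>\<^sup>+x. ennreal ((F n x - F (r i) x)\<^sup>2) \<partial>M)"
      by (intro nn_integral_liminf) simp
    also have "\<dots> \<le> ennreal (e\<^sup>2)"
    proof (rule Liminf_le)
      have "\<forall>\<^sub>F i in sequentially. n \<le> i" by (rule eventually_ge_at_top)
      then show "\<forall>\<^sub>F i in sequentially. (\<integral>\<^sup>+x. ennreal ((F n x - F (r i) x)\<^sup>2) \<partial>M) \<le> ennreal (e\<^sup>2)"
      proof eventually_elim
        case (elim i)
        then have "n \<le> r i" using seq_suble[OF r(1), of i] by simp
        then have "L2_norm M (\<lambda>x. F n x - F (r i) x) \<le> e" using n by (metis le_refl less_imp_le)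
        then have "(L2_norm M (\<lambda>x. F n x - F (r i) x))\<^sup>2 \<le> e\<^sup>2" by (rule power_mono) simp
        moreover have "(\<integral>\<^sup>+x. ennreal ((F n x - F (r i) x)\<^sup>2) \<partial>M) = ennreal ((L2_norm M (\<lambda>x. F n x - F (r i) x))\<^sup>2)"
          unfolding L2_norm_power2 by (intro nn_integral_eq_integral L2_square_integrable L2_diff F) simp
        ultimately show ?case by (simp add: ennreal_leI)
      qed
    qed simp
    finally have le: "(\<integral>\<^sup>+x. ennreal ((F n x - f x)\<^sup>2) \<partial>M) \<le> ennreal (e\<^sup>2)" .
    then have "integrable M (\<lambda>x. (F n x - f x)\<^sup>2)"
      by (intro integrableI_nonneg) (auto simp: le_less_trans)
    then have D: "(\<lambda>x. F n x - f x) \<in> L2 M" by (simp add: L2_def)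
    have "ennreal ((L2_norm M (\<lambda>x. F n x - f x))\<^sup>2) \<le> ennreal (e\<^sup>2)"
      using le unfolding L2_norm_power2 by (subst nn_integral_eq_integral[symmetric]) (auto intro: L2_square_integrable D)
    then have "L2_norm M (\<lambda>x. F n x - f x) \<le> e"
      using e by (auto simp: ennreal_le_iff intro: power2_le_imp_le[of "L2_norm M f" for f])
    with D show ?thesis by simp
  qed
  obtain N where N: "\<forall>i\<ge>N. \<forall>j\<ge>N. L2_norm M (\<lambda>x. F i x - F j x) < 1" using Cauchy[of 1] by auto
  have "(\<lambda>x. F N x - (F N x - f x)) \<in> L2 M"
    by (rule L2_diff[OF F]) (use key[of 1 N] N in auto)
  then have fL2: "f \<in> L2 M" by simp
  moreover have "(\<lambda>n. L2_norm M (\<lambda>x. F n x - f x)) \<longlonglongrightarrow> 0"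
  proof (rule LIMSEQ_I)
    fix e :: real assume "e > 0"
    then obtain N where N: "\<forall>i\<ge>N. \<forall>j\<ge>N. L2_norm M (\<lambda>x. F i x - F j x) < e / 2"
      using Cauchy[of "e / 2"] by auto
    have "norm (L2_norm M (\<lambda>x. F n x - f x) - 0) < e" if "n \<ge> N" for n
      using key[of "e / 2" n] N that \<open>e > 0\<close> by auto
    then show "\<exists>N. \<forall>n\<ge>N. norm (L2_norm M (\<lambda>x. F n x - f x) - 0) < e" by blast
  qed
  ultimately show ?thesis by (rule that)
qed

section \<open>Continuously differentiable functions and mollifiers\<close>

definition C1_fun :: "('a::euclidean_space \<Rightarrow> real) \<Rightarrow> ('a \<Rightarrow> 'a \<Rightarrow> real) \<Rightarrow> bool" where
  "C1_fun f D \<longleftrightarrow> (\<forall>x. (f has_derivative D x) (at x)) \<and> (\<forall>i. continuous_on UNIV (\<lambda>x. D x i))"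

lemma C1_fun_frechet: "C1_fun f D \<Longrightarrow> frechet_derivative f (at x) = D x"
  unfolding C1_fun_def by (metis frechet_derivative_at)

lemma C1_fun_continuous: "C1_fun f D \<Longrightarrow> continuous_on S f"
  unfolding C1_fun_def
  by (meson continuous_at_imp_continuous_on has_derivative_continuous)

lemma C1_fun_measurable: "C1_fun f D \<Longrightarrow> f \<in> borel_measurable borel"
  using C1_fun_continuous borel_measurable_continuous_onI by blast

lemma C1_fun_deriv_measurable: "C1_fun f D \<Longrightarrow> (\<lambda>x. D x i) \<in> borel_measurable borel"
  unfolding C1_fun_def using borel_measurable_continuous_onI by blast

lemma C1_compactI:
  assumes f: "C1_fun f D" and K: "compact K" "K \<subseteq> \<Omega>" "\<And>x. x \<notin> K \<Longrightarrow> f x = 0"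
  shows "f \<in> C1_compact \<Omega>"
proof -
  have "closure {x. f x \<noteq> 0} \<subseteq> K"
    using K by (intro closure_minimal compact_imp_closed) auto
  moreover from this have "compact (closure {x. f x \<noteq> 0})"
    using K(1) by (meson closed_closure compact_closure bounded_subset closure_subset compact_imp_bounded)
  moreover have "f differentiable (at x)" for x
    using f unfolding C1_fun_def differentiable_def by blast
  moreover have "continuous_on UNIV (\<lambda>x. frechet_derivative f (at x) i)" for i
    unfolding C1_fun_frechet[OF f] using f by (simp add: C1_fun_def)
  ultimately show ?thesis using K(2) unfolding C1_compact_def by blast
qed

lemma C1_compactD:
  assumes "f \<in> C1_compact \<Omega>"
  obtains K where "compact K" "K \<subseteq> \<Omega>" "\<And>x. x \<notin> K \<Longrightarrow> f x = 0"
    "C1_fun f (\<lambda>x. frechet_derivative f (at x))"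
    "\<And>x i. x \<notin> K \<Longrightarrow> frechet_derivative f (at x) i = 0"
proof (rule that[of "closure {x. f x \<noteq> 0}"])
  show "C1_fun f (\<lambda>x. frechet_derivative f (at x))"
    using assms frechet_derivative_works unfolding C1_fun_def C1_compact_def by blast
  show "frechet_derivative f (at x) i = 0" if x: "x \<notin> closure {x. f x \<noteq> 0}" for x i
  proof -
    have "(f has_derivative (\<lambda>_. 0)) (at x)"
    proof (rule has_derivative_transform_within_open[of "\<lambda>_. 0" "\<lambda>_. 0" _ _ "- closure {x. f x \<noteq> 0}"])
      show "0 = f y" if "y \<in> - closure {x. f x \<noteq> 0}" for y
        using that closure_subset[of "{x. f x \<noteq> 0}"] by auto
    qed (use x in auto)
    then show ?thesis by (metis frechet_derivative_at)
  qed
qed (use assms closure_subset[of "{x. f x \<noteq> 0}"] in \<open>auto simp: C1_compact_def\<close>)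

lemma C1_fun_const: "C1_fun (\<lambda>_. c) (\<lambda>_ _. 0)"
  by (simp add: C1_fun_def)

lemma C1_fun_mult:
  assumes "C1_fun f D" "C1_fun g E"
  shows "C1_fun (\<lambda>x. f x * g x) (\<lambda>x h. f x * E x h + D x h * g x)"
  using assms C1_fun_continuous[OF assms(1)] C1_fun_continuous[OF assms(2)]
  by (auto simp: C1_fun_def intro!: has_derivative_mult continuous_intros)

lemma C1_fun_lin:
  assumes "C1_fun f D" "C1_fun g E"
  shows "C1_fun (\<lambda>x. c * f x + d * g x) (\<lambda>x h. c * D x h + d * E x h)"
  using assms
  by (auto simp: C1_fun_def intro!: has_derivative_add has_derivative_mult_right continuous_intros)

lemma C1_fun_compose:
  assumes f: "\<And>s. (f has_real_derivative f' s) (at s)" "continuous_on UNIV f'" and g: "C1_fun g D"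
  shows "C1_fun (\<lambda>x. f (g x)) (\<lambda>x h. f' (g x) * D x h)"
  unfolding C1_fun_def
proof (intro conjI allI)
  fix x
  show "((\<lambda>x. f (g x)) has_derivative (\<lambda>h. f' (g x) * D x h)) (at x)"
    using has_derivative_compose[of g "D x" x UNIV f "\<lambda>v. f' (g x) * v"] g f(1)[of "g x"]
    by (simp add: C1_fun_def has_field_derivative_def)
next
  fix i
  show "continuous_on UNIV (\<lambda>x. f' (g x) * D x i)"
    using g continuous_on_compose2[OF f(2) C1_fun_continuous[OF g, of UNIV]]
    by (auto simp: C1_fun_def intro!: continuous_on_mult)
qed

definition pos_sq :: "real \<Rightarrow> real" where
  "pos_sq s = (max 0 s)\<^sup>2"

lemma pos_sq_nonneg [simp]: "0 \<le> pos_sq s"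
  by (simp add: pos_sq_def)

lemma pos_sq_eq_0 [simp]: "s \<le> 0 \<Longrightarrow> pos_sq s = 0"
  by (simp add: pos_sq_def)

lemma pos_sq_Taylor: "\<bar>pos_sq b - pos_sq a - 2 * max 0 a * (b - a)\<bar> \<le> (b - a)\<^sup>2"
proof -
  consider "a \<ge> 0" "b \<ge> 0" | "a \<ge> 0" "b < 0" | "a < 0" "b \<ge> 0" | "a < 0" "b < 0" by linarith
  then show ?thesis
  proof cases
    case 1
    then have "pos_sq b - pos_sq a - 2 * max 0 a * (b - a) = (b - a)\<^sup>2"
      by (simp add: pos_sq_def max_def power2_eq_square algebra_simps)
    then show ?thesis by simp
  next
    case 2
    then have eq: "pos_sq b - pos_sq a - 2 * max 0 a * (b - a) = a * (a - 2 * b)"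
      by (simp add: pos_sq_def max_def power2_eq_square algebra_simps)
    have "0 \<le> a * (a - 2 * b)" using 2 by simp
    moreover have "a * (a - 2 * b) \<le> (b - a)\<^sup>2" by (simp add: power2_eq_square algebra_simps)
    ultimately show ?thesis unfolding eq by simp
  next
    case 3
    then have "b\<^sup>2 \<le> (b - a)\<^sup>2" by (intro power_mono) auto
    then show ?thesis using 3 by (simp add: pos_sq_def max_def)
  qed (simp add: pos_sq_def)
qed

lemma has_derivative_quadratic:
  fixes f :: "'a::euclidean_space \<Rightarrow> real"
  assumes D: "bounded_linear D" and C: "\<And>h. norm h \<le> 1 \<Longrightarrow> \<bar>f (x + h) - f x - D h\<bar> \<le> C * (norm h)\<^sup>2"
  shows "(f has_derivative D) (at x)"
  unfolding has_derivative_at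
proof (intro conjI D)
  show "(\<lambda>h. norm (f (x + h) - f x - D h) / norm h) \<midarrow>0\<rightarrow> 0"
  proof (rule tendsto_sandwich[where f="\<lambda>_. 0" and h="\<lambda>h. C * norm h"])
    show "\<forall>\<^sub>F h in at 0. norm (f (x + h) - f x - D h) / norm h \<le> C * norm h"
      unfolding eventually_at
    proof (intro exI[of _ 1] conjI ballI impI)
      fix h :: 'a assume "h \<noteq> 0 \<and> dist h 0 < 1"
      then show "norm (f (x + h) - f x - D h) / norm h \<le> C * norm h"
        using C[of h] by (simp add: divide_le_eq power2_eq_square mult.assoc)
    qed simp
    show "((\<lambda>h. C * norm h) \<longlongrightarrow> 0) (at (0::'a))"
      by (auto intro!: tendsto_eq_intros)
  qed auto
qed

lemma pos_sq_has_derivative: "(pos_sq has_real_derivative 2 * max 0 s) (at s)"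
  unfolding has_field_derivative_def
proof (rule has_derivative_quadratic[where C=1])
  show "bounded_linear (\<lambda>v. 2 * max 0 s * v)" by (rule bounded_linear_mult_right)
  show "\<bar>pos_sq (s + h) - pos_sq s - 2 * max 0 s * h\<bar> \<le> 1 * (norm h)\<^sup>2" for h
    using pos_sq_Taylor[of "s + h" s] by simp
qed

lemma pos_sq_deriv_continuous: "continuous_on UNIV (\<lambda>s::real. 2 * max 0 s)"
  by (intro continuous_intros)

lemmas C1_fun_pos_sq = C1_fun_compose[OF pos_sq_has_derivative pos_sq_deriv_continuous]

lemma C1_fun_square_dist:
  "C1_fun (\<lambda>x. a + b * ((x - z) \<bullet> (x - z))) (\<lambda>x h. b * (2 * ((x - z) \<bullet> h)))"
  unfolding C1_fun_def
  by (auto intro!: derivative_eq_intros continuous_intros simp: inner_commute algebra_simps)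

lemma C1_cutoff:
  fixes z :: "'a::euclidean_space"
  assumes r: "0 < r" "r < R"
  obtains \<zeta> D where "C1_fun \<zeta> D" "\<And>x. dist z x \<le> r \<Longrightarrow> \<zeta> x = 1" "\<And>x. dist z x \<ge> R \<Longrightarrow> \<zeta> x = 0"
proof -
  define d where "d = R\<^sup>2 - r\<^sup>2"
  have d: "d > 0" using r by (simp add: d_def power_strict_mono)
  define s where "s = (\<lambda>x::'a. - (r\<^sup>2 / d) + (1 / d) * ((x - z) \<bullet> (x - z)))"
  have s: "s x = ((dist z x)\<^sup>2 - r\<^sup>2) / d" for x
    by (simp add: s_def dist_norm power2_norm_eq_inner diff_divide_distrib norm_minus_commute)
  obtain D where D: "C1_fun s D" unfolding s_def using C1_fun_square_dist by blast
  define \<zeta> where "\<zeta> x = pos_sq (1 * 1 + (-1) * pos_sq (s x))" for x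
  show ?thesis
  proof (rule that)
    show "C1_fun \<zeta> (\<lambda>x h. 2 * max 0 (1 * 1 + (-1) * pos_sq (s x)) * (1 * 0 + (-1) * (2 * max 0 (s x) * D x h)))"
      unfolding \<zeta>_def by (intro C1_fun_pos_sq C1_fun_lin C1_fun_const D)
    show "\<zeta> x = 1" if "dist z x \<le> r" for x
    proof -
      have "(dist z x)\<^sup>2 \<le> r\<^sup>2" using that by (intro power_mono) auto
      then have "s x \<le> 0" using d by (simp add: s divide_le_0_iff)
      then show ?thesis by (simp add: \<zeta>_def) (simp add: pos_sq_def)
    qed
    show "\<zeta> x = 0" if "R \<le> dist z x" for x
    proof -
      have "R\<^sup>2 \<le> (dist z x)\<^sup>2" using that r by (intro power_mono) auto
      then have "1 \<le> s x" using d by (simp add: s d_def field_simps)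
      then have "1 \<le> pos_sq (s x)" by (simp add: pos_sq_def max_def one_le_power)
      then show ?thesis by (simp add: \<zeta>_def)
    qed
  qed
qed

definition mollifier0 :: "real \<Rightarrow> 'a::euclidean_space \<Rightarrow> real" where
  "mollifier0 e z = pos_sq (e\<^sup>2 - z \<bullet> z)"

definition mollifier_mass :: "'a::euclidean_space itself \<Rightarrow> real \<Rightarrow> real" where
  "mollifier_mass _ e = (\<integral>z. mollifier0 e (z::'a) \<partial>lborel)"

definition mollifier :: "real \<Rightarrow> 'a::euclidean_space \<Rightarrow> real" where
  "mollifier e z = mollifier0 e z / mollifier_mass TYPE('a) e"

definition mollifier_deriv :: "real \<Rightarrow> 'a::euclidean_space \<Rightarrow> 'a \<Rightarrow> real" where
  "mollifier_deriv e z h = - (4 * max 0 (e\<^sup>2 - z \<bullet> z) * (z \<bullet> h)) / mollifier_mass TYPE('a) e"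

lemma mollifier0_eq_0: "e > 0 \<Longrightarrow> e \<le> norm z \<Longrightarrow> mollifier0 e z = 0"
proof -
  assume "e > 0" "e \<le> norm z"
  then have "e\<^sup>2 \<le> (norm z)\<^sup>2" by (intro power_mono) auto
  then show ?thesis by (simp add: mollifier0_def power2_norm_eq_inner)
qed

lemma mollifier0_continuous: "continuous_on S (mollifier0 e)"
proof -
  have "continuous_on UNIV (\<lambda>z::'a. (max 0 (e\<^sup>2 - z \<bullet> z))\<^sup>2)"
    by (intro continuous_intros)
  moreover have "(\<lambda>z::'a. (max 0 (e\<^sup>2 - z \<bullet> z))\<^sup>2) = mollifier0 e"
    by (simp add: fun_eq_iff mollifier0_def pos_sq_def)
  ultimately show ?thesis using continuous_on_subset by (metis subset_UNIV)
qed

lemma mollifier0_integrable: 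
  assumes "e > 0"
  shows "integrable lborel (mollifier0 e :: 'a::euclidean_space \<Rightarrow> real)"
proof -
  have "integrable lborel (\<lambda>z. indicator (cball 0 e) z *\<^sub>R mollifier0 e (z::'a))"
    by (intro borel_integrable_compact mollifier0_continuous) simp
  moreover have "(\<lambda>z. indicator (cball 0 e) z *\<^sub>R mollifier0 e (z::'a)) = mollifier0 e"
    using mollifier0_eq_0[OF assms] by (force simp: indicator_def fun_eq_iff)
  ultimately show ?thesis by simp
qed

lemma mollifier_mass_pos:
  assumes "e > 0"
  shows "mollifier_mass TYPE('a::euclidean_space) e > 0"
proof -
  have "mollifier_mass TYPE('a) e \<noteq> 0"
  proof
    assume "mollifier_mass TYPE('a) e = 0"
    then have "AE z in lborel. mollifier0 e (z::'a) = 0"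
      unfolding mollifier_mass_def
      by (subst (asm) integral_nonneg_eq_0_iff_AE) (auto simp: mollifier0_integrable[OF assms] mollifier0_def)
    moreover have "mollifier0 e z \<noteq> 0" if "z \<in> ball 0 e" for z :: 'a
    proof -
      have "(norm z)\<^sup>2 < e\<^sup>2" using that assms by (intro power_strict_mono) auto
      then show ?thesis by (simp add: mollifier0_def pos_sq_def power2_norm_eq_inner)
    qed
    ultimately have "AE z in lborel. z \<notin> ball (0::'a) e"
      by (metis (mono_tags, lifting) eventually_mono)
    then have "ball (0::'a) e \<in> null_sets lborel" by (simp add: AE_iff_null_sets)
    then have "emeasure lborel (ball (0::'a) e) = 0" by blast
    then show False using assms open_not_negligible[of "ball (0::'a) e"]
      by (auto simp: negligible_iff_null_sets null_sets_def)
  qed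
  moreover have "mollifier_mass TYPE('a) e \<ge> 0"
    unfolding mollifier_mass_def by (rule Bochner_Integration.integral_nonneg) (simp add: mollifier0_def)
  ultimately show ?thesis by simp
qed

lemma mollifier_nonneg: "e > 0 \<Longrightarrow> 0 \<le> mollifier e (z::'a::euclidean_space)"
  using mollifier_mass_pos[of e, where 'a='a] by (simp add: mollifier_def mollifier0_def less_imp_le)

lemma mollifier_eq_0: "e > 0 \<Longrightarrow> e \<le> norm z \<Longrightarrow> mollifier e z = 0"
  by (simp add: mollifier_def mollifier0_eq_0)

lemma mollifier_measurable [measurable]: "mollifier e \<in> borel_measurable borel"
  unfolding mollifier_def[abs_def]
  by (intro borel_measurable_divide borel_measurable_const borel_measurable_continuous_onI mollifier0_continuous)

lemma mollifier_integrable: "e > 0 \<Longrightarrow> integrable lborel (mollifier e)"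
  unfolding mollifier_def[abs_def] by (intro integrable_divide mollifier0_integrable) auto

lemma mollifier_integral: "e > 0 \<Longrightarrow> (\<integral>z. mollifier e (z::'a::euclidean_space) \<partial>lborel) = 1"
  using mollifier_mass_pos[of e, where 'a='a] by (simp add: mollifier_def mollifier_mass_def)

lemma mollifier_le: "e > 0 \<Longrightarrow> mollifier e z \<le> e ^ 4 / mollifier_mass TYPE('a) e" for z :: "'a::euclidean_space"
proof -
  assume "e > 0"
  have "(max 0 (e\<^sup>2 - z \<bullet> z))\<^sup>2 \<le> (e\<^sup>2)\<^sup>2" by (intro power_mono) auto
  then have "mollifier0 e z \<le> e ^ 4" by (simp add: mollifier0_def pos_sq_def)
  then show ?thesis unfolding mollifier_def using mollifier_mass_pos[OF \<open>e > 0\<close>, where 'a='a]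
    by (intro divide_right_mono) auto
qed

lemma mollifier_deriv_le: 
  fixes z :: "'a::euclidean_space"
  assumes "e > 0"
  shows "\<bar>mollifier_deriv e z h\<bar> \<le> 4 * e ^ 3 * norm h / mollifier_mass TYPE('a) e"
proof -
  have "\<bar>4 * max 0 (e\<^sup>2 - z \<bullet> z) * (z \<bullet> h)\<bar> \<le> 4 * e ^ 3 * norm h"
  proof (cases "norm z \<le> e")
    case True
    have "\<bar>max 0 (e\<^sup>2 - z \<bullet> z)\<bar> \<le> e\<^sup>2" by simp
    moreover have "\<bar>z \<bullet> h\<bar> \<le> e * norm h"
      using Cauchy_Schwarz_ineq2[of z h] mult_right_mono[OF True norm_ge_zero[of h]] by linarith
    ultimately have "\<bar>max 0 (e\<^sup>2 - z \<bullet> z)\<bar> * \<bar>z \<bullet> h\<bar> \<le> e\<^sup>2 * (e * norm h)"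
      by (intro mult_mono) auto
    then show ?thesis by (simp add: abs_mult power2_eq_square power3_eq_cube mult.assoc)
  next
    case False
    then have "e\<^sup>2 \<le> (norm z)\<^sup>2" using assms by (intro power_mono) auto
    then have "max 0 (e\<^sup>2 - z \<bullet> z) = 0" by (simp add: power2_norm_eq_inner)
    then show ?thesis using assms by simp
  qed
  then show ?thesis
    unfolding mollifier_deriv_def using mollifier_mass_pos[OF assms, where 'a='a]
    by (simp add: abs_minus_cancel divide_right_mono)
qed

lemma mollifier_C1: "C1_fun (mollifier e) (mollifier_deriv e :: 'a::euclidean_space \<Rightarrow> 'a \<Rightarrow> real)"
proof -
  let ?m = "mollifier_mass TYPE('a) e"
  have "C1_fun (\<lambda>z. (1 / ?m) * pos_sq (e\<^sup>2 + (-1) * ((z - 0) \<bullet> (z - 0))) + 0 * 0)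
      (\<lambda>z h::'a. (1 / ?m) * (2 * max 0 (e\<^sup>2 + (-1) * ((z - 0) \<bullet> (z - 0))) * ((-1) * (2 * ((z - 0) \<bullet> h)))) + 0 * 0)"
    by (intro C1_fun_lin C1_fun_pos_sq C1_fun_square_dist C1_fun_const)
  moreover have "(\<lambda>z::'a. (1 / ?m) * pos_sq (e\<^sup>2 + (-1) * ((z - 0) \<bullet> (z - 0))) + 0 * 0) = mollifier e"
    by (simp add: fun_eq_iff mollifier_def mollifier0_def)
  moreover have "(\<lambda>z h::'a. (1 / ?m) * (2 * max 0 (e\<^sup>2 + (-1) * ((z - 0) \<bullet> (z - 0))) * ((-1) * (2 * ((z - 0) \<bullet> h)))) + 0 * 0)
      = mollifier_deriv e"
    by (simp add: fun_eq_iff mollifier_deriv_def)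
  ultimately show ?thesis by simp
qed

lemma mollifier_Taylor:
  assumes "e > 0"
  obtains C where "C \<ge> 0" "\<And>z h::'a::euclidean_space. norm h \<le> 1 \<Longrightarrow>
    \<bar>mollifier e (z + h) - mollifier e z - mollifier_deriv e z h\<bar> \<le> C * (norm h)\<^sup>2"
proof -
  let ?m = "mollifier_mass TYPE('a) e"
  have m: "?m > 0" by (rule mollifier_mass_pos[OF assms])
  define C where "C = (2 * e + 3)\<^sup>2 + 2 * e\<^sup>2"
  have main: "\<bar>pos_sq (e\<^sup>2 - (z + h) \<bullet> (z + h)) - pos_sq (e\<^sup>2 - z \<bullet> z) + 4 * max 0 (e\<^sup>2 - z \<bullet> z) * (z \<bullet> h)\<bar>
      \<le> C * (norm h)\<^sup>2" if h: "norm h \<le> 1" for z h :: 'a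
  proof (cases "norm z \<le> e + 1")
    case True
    define a where "a = e\<^sup>2 - z \<bullet> z"
    define b where "b = e\<^sup>2 - (z + h) \<bullet> (z + h)"
    have ba: "b - a = - 2 * (z \<bullet> h) - h \<bullet> h"
      by (simp add: a_def b_def inner_add_left inner_add_right inner_commute)
    have zh: "\<bar>z \<bullet> h\<bar> \<le> (e + 1) * norm h"
      using Cauchy_Schwarz_ineq2[of z h] mult_right_mono[OF True norm_ge_zero[of h]] by linarith
    have hh: "h \<bullet> h \<le> norm h" "0 \<le> h \<bullet> h"
      using h by (simp_all add: power2_norm_eq_inner[symmetric] power2_eq_square mult_left_le)
    have "\<bar>b - a\<bar> \<le> 2 * ((e + 1) * norm h) + norm h"
      unfolding ba using zh hh by linarith
    then have "\<bar>b - a\<bar> \<le> (2 * e + 3) * norm h" by (simp add: algebra_simps)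
    then have "\<bar>b - a\<bar>\<^sup>2 \<le> ((2 * e + 3) * norm h)\<^sup>2" by (rule power_mono) simp
    then have 1: "(b - a)\<^sup>2 \<le> (2 * e + 3)\<^sup>2 * (norm h)\<^sup>2" by (simp add: power_mult_distrib)
    have "max 0 a \<le> e\<^sup>2" by (simp add: a_def)
    then have "2 * max 0 a * (h \<bullet> h) \<le> 2 * e\<^sup>2 * (h \<bullet> h)" using hh by (intro mult_right_mono) auto
    then have 2: "\<bar>2 * max 0 a * (h \<bullet> h)\<bar> \<le> 2 * e\<^sup>2 * (norm h)\<^sup>2"
      using hh by (simp add: abs_mult power2_norm_eq_inner)
    have "pos_sq b - pos_sq a + 4 * max 0 a * (z \<bullet> h) =
        (pos_sq b - pos_sq a - 2 * max 0 a * (b - a)) - 2 * max 0 a * (h \<bullet> h)"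
      unfolding ba by (simp add: algebra_simps)
    then have "\<bar>pos_sq b - pos_sq a + 4 * max 0 a * (z \<bullet> h)\<bar> \<le> (b - a)\<^sup>2 + \<bar>2 * max 0 a * (h \<bullet> h)\<bar>"
      using pos_sq_Taylor[of b a] by linarith
    also have "\<dots> \<le> C * (norm h)\<^sup>2"
      using 1 2 by (simp add: C_def algebra_simps)
    finally show ?thesis by (simp add: a_def b_def)
  next
    case False
    have "e \<le> norm (z + h)" using False h norm_triangle_ineq2[of z "- h"] by simp
    then have "mollifier0 e (z + h) = 0" by (intro mollifier0_eq_0 assms)
    moreover have "mollifier0 e z = 0" using False by (intro mollifier0_eq_0 assms) simp
    moreover have "e\<^sup>2 \<le> (norm z)\<^sup>2" using False assms by (intro power_mono) auto
    then have "max 0 (e\<^sup>2 - z \<bullet> z) = 0" by (simp add: power2_norm_eq_inner)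
    ultimately show ?thesis by (simp add: mollifier0_def C_def)
  qed
  show ?thesis
  proof (rule that[of "C / ?m"])
    fix z h :: 'a assume h: "norm h \<le> 1"
    have "mollifier e (z + h) - mollifier e z - mollifier_deriv e z h =
        (pos_sq (e\<^sup>2 - (z + h) \<bullet> (z + h)) - pos_sq (e\<^sup>2 - z \<bullet> z) + 4 * max 0 (e\<^sup>2 - z \<bullet> z) * (z \<bullet> h)) / ?m"
      by (simp add: mollifier_def mollifier0_def mollifier_deriv_def add_divide_distrib diff_divide_distrib)
    then show "\<bar>mollifier e (z + h) - mollifier e z - mollifier_deriv e z h\<bar> \<le> C / ?m * (norm h)\<^sup>2"
      using main[OF h, of z] m by (simp add: divide_right_mono)
  qed (use m in \<open>simp add: C_def\<close>)
qed

definition mollify :: "real \<Rightarrow> 'a::euclidean_space \<Rightarrow> ('a \<Rightarrow> real) \<Rightarrow> 'a \<Rightarrow> real" where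
  "mollify e a v x = (\<integral>y. v y * mollifier e (x + a - y) \<partial>lborel)"

lemma integrable_mult_bounded:
  fixes v :: "'b \<Rightarrow> real"
  assumes "integrable M v" "k \<in> borel_measurable M" "\<And>y. \<bar>k y\<bar> \<le> C"
  shows "integrable M (\<lambda>y. v y * k y)"
proof (rule Bochner_Integration.integrable_bound)
  show "integrable M (\<lambda>y. C * v y)" using assms(1) by simp
  have "\<bar>v y * k y\<bar> \<le> \<bar>C * v y\<bar>" for y
  proof -
    have "\<bar>v y * k y\<bar> \<le> \<bar>v y\<bar> * C" using assms(3)[of y] by (simp add: abs_mult mult_left_mono)
    also have "\<dots> \<le> \<bar>C * v y\<bar>" by (simp add: abs_mult mult.commute mult_right_mono)
    finally show ?thesis .
  qed
  then show "AE y in M. norm (v y * k y) \<le> norm (C * v y)" by simp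
qed (use assms in auto)

lemma mollifier_deriv_measurable [measurable]: "(\<lambda>z. mollifier_deriv e z h) \<in> borel_measurable borel"
  using C1_fun_deriv_measurable[OF mollifier_C1] .

lemma mollify_C1:
  fixes v :: "'a::euclidean_space \<Rightarrow> real"
  assumes e: "e > 0" and v: "integrable lborel v"
  shows "C1_fun (mollify e a v) (\<lambda>x h. \<integral>y. v y * mollifier_deriv e (x + a - y) h \<partial>lborel)"
proof -
  let ?m = "mollifier_mass TYPE('a) e"
  have m: "?m > 0" by (rule mollifier_mass_pos[OF e])
  have [measurable]: "v \<in> borel_measurable borel" using v by simp
  have "\<bar>mollifier e z\<bar> \<le> e ^ 4 / ?m" for z :: 'a
    using mollifier_le[OF e, of z] mollifier_nonneg[OF e, of z] by simp
  then have iK: "integrable lborel (\<lambda>y. v y * mollifier e (x + a - y))" for x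
    by (intro integrable_mult_bounded[OF v]) auto
  have iD: "integrable lborel (\<lambda>y. v y * mollifier_deriv e (x + a - y) h)" for x h
    by (rule integrable_mult_bounded[OF v _ mollifier_deriv_le[OF e]]) simp
  obtain C where C: "C \<ge> 0" "\<And>z h::'a. norm h \<le> 1 \<Longrightarrow>
    \<bar>mollifier e (z + h) - mollifier e z - mollifier_deriv e z h\<bar> \<le> C * (norm h)\<^sup>2"
    using mollifier_Taylor[OF e, where 'a='a] by blast
  have lin: "linear (mollifier_deriv e z)" for z :: 'a
    by (auto intro!: linearI simp: mollifier_deriv_def inner_add_right algebra_simps add_divide_distrib diff_divide_distrib)
  show ?thesis
    unfolding C1_fun_def
  proof (intro conjI allI)
    fix x
    show "(mollify e a v has_derivative (\<lambda>h. \<integral>y. v y * mollifier_deriv e (x + a - y) h \<partial>lborel)) (at x)"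
    proof (rule has_derivative_quadratic)
      have "linear (\<lambda>h. \<integral>y. v y * mollifier_deriv e (x + a - y) h \<partial>lborel)"
      proof (rule linearI)
        show "(\<integral>y. v y * mollifier_deriv e (x + a - y) (h + k) \<partial>lborel) =
          (\<integral>y. v y * mollifier_deriv e (x + a - y) h \<partial>lborel) + (\<integral>y. v y * mollifier_deriv e (x + a - y) k \<partial>lborel)" for h k
          by (simp add: linear_add[OF lin] distrib_left iD)
        show "(\<integral>y. v y * mollifier_deriv e (x + a - y) (r *\<^sub>R h) \<partial>lborel) =
          r *\<^sub>R (\<integral>y. v y * mollifier_deriv e (x + a - y) h \<partial>lborel)" for r h
          by (simp add: linear_scale[OF lin] mult.left_commute)
      qed
      then show "bounded_linear (\<lambda>h. \<integral>y. v y * mollifier_deriv e (x + a - y) h \<partial>lborel)"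
        by (rule linear_conv_bounded_linear[THEN iffD1])
      fix h :: 'a assume h: "norm h \<le> 1"
      let ?R = "\<lambda>y. mollifier e (x + a - y + h) - mollifier e (x + a - y) - mollifier_deriv e (x + a - y) h"
      have sh: "x + h + a - y = x + a - y + h" for y by (simp add: algebra_simps)
      have "mollify e a v (x + h) - mollify e a v x - (\<integral>y. v y * mollifier_deriv e (x + a - y) h \<partial>lborel)
          = (\<integral>y. v y * mollifier e (x + h + a - y) - v y * mollifier e (x + a - y) - v y * mollifier_deriv e (x + a - y) h \<partial>lborel)"
        unfolding mollify_def using iK[of "x + h"] iK[of x] iD[of x h] by simp
      also have "\<dots> = (\<integral>y. v y * ?R y \<partial>lborel)" by (simp add: sh algebra_simps)
      finally have "\<bar>mollify e a v (x + h) - mollify e a v x - (\<integral>y. v y * mollifier_deriv e (x + a - y) h \<partial>lborel)\<bar>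
          = \<bar>\<integral>y. v y * ?R y \<partial>lborel\<bar>" by simp
      also have "\<dots> \<le> (\<integral>y. C * (norm h)\<^sup>2 * \<bar>v y\<bar> \<partial>lborel)"
      proof (rule integral_abs_bound_integral)
        show "integrable lborel (\<lambda>y. v y * ?R y)"
          by (rule integrable_mult_bounded[OF v _ C(2)[OF h]]) simp
        show "integrable lborel (\<lambda>y. C * (norm h)\<^sup>2 * \<bar>v y\<bar>)" using v by simp
        show "\<bar>v y * ?R y\<bar> \<le> C * (norm h)\<^sup>2 * \<bar>v y\<bar>" for y
          using C(2)[OF h, of "x + a - y"] by (simp add: abs_mult mult.commute mult_left_mono)
      qed
      also have "\<dots> = (C * (\<integral>y. \<bar>v y\<bar> \<partial>lborel)) * (norm h)\<^sup>2" by simp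
      finally show "\<bar>mollify e a v (x + h) - mollify e a v x - (\<integral>y. v y * mollifier_deriv e (x + a - y) h \<partial>lborel)\<bar>
        \<le> (C * (\<integral>y. \<bar>v y\<bar> \<partial>lborel)) * (norm h)\<^sup>2" .
    qed
  next
    fix i
    show "continuous_on UNIV (\<lambda>x. \<integral>y. v y * mollifier_deriv e (x + a - y) i \<partial>lborel)"
      unfolding continuous_on_sequentially comp_def
    proof (intro allI impI ballI, elim conjE)
      fix X and x :: 'a assume X: "X \<longlonglongrightarrow> x"
      show "(\<lambda>n. \<integral>y. v y * mollifier_deriv e (X n + a - y) i \<partial>lborel) \<longlonglongrightarrow> (\<integral>y. v y * mollifier_deriv e (x + a - y) i \<partial>lborel)"
      proof (rule integral_dominated_convergence)
        show "integrable lborel (\<lambda>y. (4 * e ^ 3 * norm i / ?m) * \<bar>v y\<bar>)" using v by simp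
        show "AE y in lborel. (\<lambda>n. v y * mollifier_deriv e (X n + a - y) i) \<longlonglongrightarrow> v y * mollifier_deriv e (x + a - y) i"
        proof (intro AE_I2 tendsto_mult_left)
          fix y
          have "continuous_on UNIV (\<lambda>z::'a. mollifier_deriv e z i)" using mollifier_C1 by (auto simp: C1_fun_def)
          then show "(\<lambda>n. mollifier_deriv e (X n + a - y) i) \<longlonglongrightarrow> mollifier_deriv e (x + a - y) i"
            by (rule continuous_on_tendsto_compose) (auto intro!: tendsto_intros X)
        qed
        show "AE y in lborel. norm (v y * mollifier_deriv e (X n + a - y) i) \<le> (4 * e ^ 3 * norm i / ?m) * \<bar>v y\<bar>" for n
          using mollifier_deriv_le[OF e, of "X n + a - y" i for y]
          by (intro AE_I2) (simp only: real_norm_def abs_mult, subst mult.commute, intro mult_right_mono, auto)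
      qed auto
    qed
  qed
qed

section \<open>Approximation in the space of square integrable functions\<close>

lemma lebesgue_on_integral_borel:
  fixes f :: "'a::euclidean_space \<Rightarrow> real"
  assumes [measurable]: "f \<in> borel_measurable borel" "\<Omega> \<in> sets borel" and f0: "\<And>x. x \<notin> \<Omega> \<Longrightarrow> f x = 0"
  shows "integrable (lebesgue_on \<Omega>) f \<longleftrightarrow> integrable lborel f"
    "(\<integral>x. f x \<partial>lebesgue_on \<Omega>) = (\<integral>x. f x \<partial>lborel)"
proof -
  have eq: "(\<lambda>x. indicator \<Omega> x *\<^sub>R f x) = f"
    using f0 by (force simp: indicator_def fun_eq_iff)
  show "integrable (lebesgue_on \<Omega>) f \<longleftrightarrow> integrable lborel f"
    by (simp add: integrable_restrict_space eq[simplified] integrable_completion)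
  show "(\<integral>x. f x \<partial>lebesgue_on \<Omega>) = (\<integral>x. f x \<partial>lborel)"
    by (simp add: integral_restrict_space eq[simplified] integral_completion)
qed

lemma lebesgue_on_measurable_borel:
  "f \<in> borel_measurable borel \<Longrightarrow> f \<in> borel_measurable (lebesgue_on \<Omega>)"
  by (intro measurable_restrict_space1 measurable_completion) simp

lemma L2_lebesgue_on_borel:
  fixes f :: "'a::euclidean_space \<Rightarrow> real"
  assumes "f \<in> borel_measurable borel" "\<Omega> \<in> sets borel" "\<And>x. x \<notin> \<Omega> \<Longrightarrow> f x = 0"
  shows "f \<in> L2 (lebesgue_on \<Omega>) \<longleftrightarrow> f \<in> L2 lborel" "L2_norm (lebesgue_on \<Omega>) f = L2_norm lborel f"
  using lebesgue_on_integral_borel[of "\<lambda>x. (f x)\<^sup>2" \<Omega>] lebesgue_on_integral_borel[of "\<lambda>x. f x * f x" \<Omega>] assms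
  by (auto simp: L2_def L2_norm_def L2_inner_def lebesgue_on_measurable_borel)

lemma AE_lebesgue_on_borelI:
  "\<Omega> \<in> sets borel \<Longrightarrow> AE x in lborel. P x \<Longrightarrow> AE x in lebesgue_on \<Omega>. P x"
  by (subst AE_restrict_space_iff) (auto dest: AE_completion)

lemma finite_measure_lebesgue_on_open:
  "open \<Omega> \<Longrightarrow> bounded \<Omega> \<Longrightarrow> finite_measure (lebesgue_on (\<Omega>::'a::euclidean_space set))"
  by (intro finite_measure_lebesgue_on lmeasurable_open)

lemma L2_borel_representative:
  fixes u :: "'a::euclidean_space \<Rightarrow> real"
  assumes u: "u \<in> L2 (lebesgue_on \<Omega>)" and \<Omega>: "open \<Omega>"
  obtains v where "v \<in> borel_measurable borel" "\<And>x. x \<notin> \<Omega> \<Longrightarrow> v x = 0"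
    "AE x in lebesgue_on \<Omega>. u x = v x" "v \<in> L2 (lebesgue_on \<Omega>)" "v \<in> L2 lborel"
proof -
  have [measurable]: "\<Omega> \<in> sets borel" using \<Omega> by simp
  have "(\<lambda>x. indicator \<Omega> x * u x) \<in> borel_measurable lebesgue"
    using L2_measurable[OF u] by (simp add: borel_measurable_restrict_space_iff mult.commute)
  then obtain w where w: "w \<in> borel_measurable lborel" "AE x in lborel. indicator \<Omega> x * u x = w x"
    using completion_ex_borel_measurable_real by blast
  define v where "v x = indicator \<Omega> x * w x" for x
  have v: "v \<in> borel_measurable borel" using w(1) unfolding v_def by simp
  have "AE x in lebesgue_on \<Omega>. indicator \<Omega> x * u x = w x"
    by (rule AE_lebesgue_on_borelI[OF _ w(2)]) simp
  then have uv: "AE x in lebesgue_on \<Omega>. u x = v x"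
    using AE_space by eventually_elim (auto simp: v_def)
  have "v \<in> L2 (lebesgue_on \<Omega>)"
  proof (rule L2_bound[OF u])
    show "v \<in> borel_measurable (lebesgue_on \<Omega>)" by (rule lebesgue_on_measurable_borel[OF v])
    show "AE x in lebesgue_on \<Omega>. \<bar>v x\<bar> \<le> 1 * \<bar>u x\<bar>" using uv by eventually_elim simp
  qed
  moreover from this have "v \<in> L2 lborel"
    using L2_lebesgue_on_borel(1)[OF v, of \<Omega>] by (simp add: v_def)
  ultimately show ?thesis using v uv by (intro that[of v]) (auto simp: v_def)
qed

definition L2_continuous_approx :: "'a::euclidean_space set \<Rightarrow> ('a \<Rightarrow> real) \<Rightarrow> bool" where
  "L2_continuous_approx \<Omega> g \<longleftrightarrow> g \<in> L2 (lebesgue_on \<Omega>) \<and> (\<forall>\<eta>>0. \<exists>c. continuous_on UNIV c \<and>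
     (\<forall>x. x \<notin> \<Omega> \<longrightarrow> c x = 0) \<and> L2_norm (lebesgue_on \<Omega>) (\<lambda>x. g x - c x) \<le> \<eta>)"

lemma continuous_bounded_L2:
  fixes c :: "'a::euclidean_space \<Rightarrow> real"
  assumes \<Omega>: "open \<Omega>" "bounded \<Omega>" and c: "continuous_on (closure \<Omega>) c"
  shows "c \<in> L2 (lebesgue_on \<Omega>)"
proof -
  have "compact (c ` closure \<Omega>)" using \<Omega> c by (intro compact_continuous_image) auto
  then have "bounded (c ` closure \<Omega>)" by (rule compact_imp_bounded)
  then obtain B where B: "\<And>x. x \<in> closure \<Omega> \<Longrightarrow> \<bar>c x\<bar> \<le> B" unfolding bounded_iff by auto
  interpret finite_measure "lebesgue_on \<Omega>" using \<Omega> by (rule finite_measure_lebesgue_on_open)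
  show ?thesis
  proof (rule L2_bound[of "\<lambda>_. B"])
    show "(\<lambda>_. B) \<in> L2 (lebesgue_on \<Omega>)" by (simp add: L2_def)
    have "continuous_on \<Omega> c" using c closure_subset continuous_on_subset by blast
    then show "c \<in> borel_measurable (lebesgue_on \<Omega>)"
      using \<Omega> by (intro continuous_imp_measurable_on_sets_lebesgue) auto
    show "AE x in lebesgue_on \<Omega>. \<bar>c x\<bar> \<le> 1 * \<bar>B\<bar>"
      using AE_space by eventually_elim (use B closure_subset in \<open>force simp: abs_le_iff\<close>)
  qed
qed

lemma L2_continuous_approx_lin:
  assumes \<Omega>: "open \<Omega>" "bounded \<Omega>" and f: "L2_continuous_approx \<Omega> f" and g: "L2_continuous_approx \<Omega> g"
  shows "L2_continuous_approx \<Omega> (\<lambda>x. a * f x + b * g x)"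
  unfolding L2_continuous_approx_def
proof (intro conjI allI impI)
  show "(\<lambda>x. a * f x + b * g x) \<in> L2 (lebesgue_on \<Omega>)"
    using f g by (auto simp: L2_continuous_approx_def intro: L2_lin)
  fix \<eta> :: real assume "\<eta> > 0"
  define \<epsilon> where "\<epsilon> = \<eta> / (\<bar>a\<bar> + \<bar>b\<bar> + 1)"
  have \<epsilon>: "\<epsilon> > 0" using \<open>\<eta> > 0\<close> by (simp add: \<epsilon>_def add_nonneg_pos)
  obtain c where c: "continuous_on UNIV c" "\<forall>x. x \<notin> \<Omega> \<longrightarrow> c x = 0" "L2_norm (lebesgue_on \<Omega>) (\<lambda>x. f x - c x) \<le> \<epsilon>"
    using f \<epsilon> unfolding L2_continuous_approx_def by blast
  obtain d where d: "continuous_on UNIV d" "\<forall>x. x \<notin> \<Omega> \<longrightarrow> d x = 0" "L2_norm (lebesgue_on \<Omega>) (\<lambda>x. g x - d x) \<le> \<epsilon>"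
    using g \<epsilon> unfolding L2_continuous_approx_def by blast
  have cd: "c \<in> L2 (lebesgue_on \<Omega>)" "d \<in> L2 (lebesgue_on \<Omega>)"
    using c(1) d(1) by (auto intro!: continuous_bounded_L2[OF \<Omega>] intro: continuous_on_subset)
  have "L2_norm (lebesgue_on \<Omega>) (\<lambda>x. (a * f x + b * g x) - (a * c x + b * d x)) =
      L2_norm (lebesgue_on \<Omega>) (\<lambda>x. a * (f x - c x) + b * (g x - d x))"
    by (simp add: algebra_simps)
  also have "\<dots> \<le> \<bar>a\<bar> * L2_norm (lebesgue_on \<Omega>) (\<lambda>x. f x - c x) + \<bar>b\<bar> * L2_norm (lebesgue_on \<Omega>) (\<lambda>x. g x - d x)"
    using f g cd by (intro L2_norm_lin_le L2_diff) (auto simp: L2_continuous_approx_def)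
  also have "\<dots> \<le> \<bar>a\<bar> * \<epsilon> + \<bar>b\<bar> * \<epsilon>"
    using c(3) d(3) by (intro add_mono mult_left_mono) auto
  also have "\<dots> \<le> (\<bar>a\<bar> + \<bar>b\<bar> + 1) * \<epsilon>" using \<epsilon> by (simp add: algebra_simps)
  also have "\<dots> = \<eta>" by (simp add: \<epsilon>_def)
  finally show "\<exists>c. continuous_on UNIV c \<and> (\<forall>x. x \<notin> \<Omega> \<longrightarrow> c x = 0) \<and>
      L2_norm (lebesgue_on \<Omega>) (\<lambda>x. (a * f x + b * g x) - c x) \<le> \<eta>"
    using c d by (intro exI[of _ "\<lambda>x. a * c x + b * d x"]) (auto intro!: continuous_intros)
qed

lemma L2_continuous_approx_sum:
  assumes \<Omega>: "open \<Omega>" "bounded \<Omega>" and "finite I" "\<And>i. i \<in> I \<Longrightarrow> L2_continuous_approx \<Omega> (f i)"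
  shows "L2_continuous_approx \<Omega> (\<lambda>x. \<Sum>i\<in>I. a i * f i x)"
  using assms(3,4)
proof (induction I rule: finite_induct)
  case empty
  have "L2_norm M (\<lambda>x. 0) = 0" for M :: "'a measure" by (simp add: L2_norm_def L2_inner_def)
  then show ?case by (auto simp: L2_continuous_approx_def L2_zero intro!: exI[of _ "\<lambda>_. 0"])
next
  case (insert i I)
  then show ?case
    using L2_continuous_approx_lin[OF \<Omega>, of "f i" "\<lambda>x. \<Sum>i\<in>I. a i * f i x" "a i" 1] by simp
qed

lemma L2_continuous_approx_indicator:
  fixes \<Omega> :: "'a::euclidean_space set"
  assumes \<Omega>: "open \<Omega>" "bounded \<Omega>" and A: "A \<in> sets (lebesgue_on \<Omega>)"
  shows "L2_continuous_approx \<Omega> (indicator A)"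
  unfolding L2_continuous_approx_def
proof (intro conjI allI impI)
  interpret finite_measure "lebesgue_on \<Omega>" using \<Omega> by (rule finite_measure_lebesgue_on_open)
  have A\<Omega>: "A \<subseteq> \<Omega>" and AL: "A \<in> sets lebesgue" using A \<Omega> by (auto simp: sets_restrict_space)
  have iA: "indicator A \<in> borel_measurable (lebesgue_on \<Omega>)" using A by simp
  show L: "indicator A \<in> L2 (lebesgue_on \<Omega>)"
    by (rule L2_bound[of "\<lambda>_. 1" _ _ 1]) (use iA in \<open>auto simp: L2_def indicator_def\<close>)
  fix \<eta> :: real assume "\<eta> > 0"
  define \<epsilon> where "\<epsilon> = \<eta>\<^sup>2 / 2"
  have \<epsilon>: "\<epsilon> > 0" using \<open>\<eta> > 0\<close> by (simp add: \<epsilon>_def)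
  obtain U where U: "open U" "A \<subseteq> U" "U - A \<in> lmeasurable" "emeasure lebesgue (U - A) < ennreal \<epsilon>"
    using sets_lebesgue_outer_open[OF AL \<epsilon>] .
  obtain K where K: "closed K" "K \<subseteq> A" "A - K \<in> lmeasurable" "emeasure lebesgue (A - K) < ennreal \<epsilon>"
    using sets_lebesgue_inner_closed[OF AL \<epsilon>] .
  have UO: "open (U \<inter> \<Omega>)" using U \<Omega> by auto
  obtain c :: "'a \<Rightarrow> real" where c: "continuous_on UNIV c" "\<And>x. c x \<in> closed_segment 0 1"
    "\<And>x. x \<in> - (U \<inter> \<Omega>) \<Longrightarrow> c x = 0" "\<And>x. x \<in> K \<Longrightarrow> c x = 1"
  proof (rule Urysohn[of "- (U \<inter> \<Omega>)" K "0::real" 1])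
    show "closed (- (U \<inter> \<Omega>))" using UO by (simp only: closed_Compl)
    show "- (U \<inter> \<Omega>) \<inter> K = {}" using K U A\<Omega> by auto
  qed (use K in auto)
  have c01: "0 \<le> c x" "c x \<le> 1" for x using c(2)[of x] by (auto simp: closed_segment_eq_real_ivl)
  have [measurable]: "c \<in> borel_measurable (lebesgue_on \<Omega>)"
    using c(1) by (intro lebesgue_on_measurable_borel borel_measurable_continuous_onI)
  let ?D = "(U - A) \<union> (A - K)"
  have D: "?D \<in> lmeasurable" using U K by auto
  have "measure lebesgue ?D \<le> measure lebesgue (U - A) + measure lebesgue (A - K)"
    using U K by (intro measure_Un_le) (auto simp: fmeasurableD)
  also have "\<dots> \<le> \<epsilon> + \<epsilon>"
    using U K \<epsilon> by (intro add_mono) (auto simp: measure_def enn2real_leI less_imp_le)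
  finally have mD: "measure lebesgue ?D \<le> \<eta>\<^sup>2" by (simp add: \<epsilon>_def)
  have le: "(indicator A x - c x)\<^sup>2 \<le> indicator ?D x" if "x \<in> \<Omega>" for x
  proof (cases "x \<in> ?D")
    case True
    have "\<bar>indicator A x - c x\<bar> \<le> 1" using c01[of x] by (auto simp: indicator_def)
    then show ?thesis using True by (simp add: abs_square_le_1)
  next
    case False
    then have "indicator A x = c x" using c(3)[of x] c(4)[of x] U K A\<Omega> by (auto simp: indicator_def)
    then show ?thesis by simp
  qed
  have iD: "integrable lebesgue (indicator ?D :: 'a \<Rightarrow> real)"
    using D by (simp only: lmeasurable_iff_integrable)
  have "integrable lebesgue (\<lambda>x. indicator \<Omega> x *\<^sub>R (indicator ?D x :: real))"
    using \<Omega> by (intro integrable_mult_indicator iD) auto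
  then have iD': "integrable (lebesgue_on \<Omega>) (indicator ?D :: 'a \<Rightarrow> real)"
    using \<Omega> by (subst integrable_restrict_space) auto
  have "(L2_norm (lebesgue_on \<Omega>) (\<lambda>x. indicator A x - c x))\<^sup>2 \<le> (\<integral>x. indicator ?D x \<partial>lebesgue_on \<Omega>)"
    unfolding L2_norm_power2
  proof (rule integral_mono_AE')
    show "AE x in lebesgue_on \<Omega>. (indicator A x - c x)\<^sup>2 \<le> indicator ?D x"
      using AE_space by eventually_elim (use le in auto)
  qed (use iD' in auto)
  also have "\<dots> = (\<integral>x. indicator \<Omega> x *\<^sub>R indicator ?D x \<partial>lebesgue)"
    using \<Omega> by (intro integral_restrict_space) auto
  also have "\<dots> \<le> (\<integral>x. indicator ?D x \<partial>lebesgue)"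
    using \<open>integrable lebesgue (\<lambda>x. indicator \<Omega> x *\<^sub>R (indicator ?D x :: real))\<close> iD
    by (rule Bochner_Integration.integral_mono) (simp add: indicator_def)
  also have "\<dots> \<le> \<eta>\<^sup>2" using mD by simp
  finally have "L2_norm (lebesgue_on \<Omega>) (\<lambda>x. indicator A x - c x) \<le> \<eta>"
    using \<open>\<eta> > 0\<close> power2_le_imp_le by fastforce
  then show "\<exists>c. continuous_on UNIV c \<and> (\<forall>x. x \<notin> \<Omega> \<longrightarrow> c x = 0) \<and> L2_norm (lebesgue_on \<Omega>) (\<lambda>x. indicator A x - c x) \<le> \<eta>"
    using c by blast
qed

lemma L2_continuous_dense:
  fixes g :: "'a::euclidean_space \<Rightarrow> real"
  assumes \<Omega>: "open \<Omega>" "bounded \<Omega>" and g: "g \<in> L2 (lebesgue_on \<Omega>)"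
  shows "L2_continuous_approx \<Omega> g"
  unfolding L2_continuous_approx_def
proof (intro conjI g allI impI)
  let ?M = "lebesgue_on \<Omega>"
  fix \<eta> :: real assume "\<eta> > 0"
  obtain s where s: "\<And>i. simple_function ?M (s i)" "\<And>x. x \<in> space ?M \<Longrightarrow> (\<lambda>i::nat. s i x) \<longlonglongrightarrow> g x"
    "\<And>i x. x \<in> space ?M \<Longrightarrow> dist (s i x) 0 \<le> 2 * dist (g x) 0"
    using borel_measurable_implies_sequence_metric[OF L2_measurable[OF g], of 0] by metis
  have [measurable]: "s i \<in> borel_measurable ?M" for i
    using s(1) by (simp add: borel_measurable_simple_function)
  have g3: "(\<lambda>x. 3 * \<bar>g x\<bar>) \<in> L2 ?M"
    by (rule L2_bound[OF g, of _ 3]) (use L2_measurable[OF g] in auto)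
  have "(\<lambda>i. L2_norm ?M (\<lambda>x. s i x - g x)) \<longlonglongrightarrow> 0"
  proof (rule L2_dominated_convergence[OF L2_measurable[OF g] _ g3])
    fix i show "AE x in ?M. \<bar>s i x - g x\<bar> \<le> 3 * \<bar>g x\<bar>"
      using AE_space
    proof eventually_elim
      case (elim x)
      then have "\<bar>s i x\<bar> \<le> 2 * \<bar>g x\<bar>" using s(3)[of x i] by simp
      then show ?case by linarith
    qed
  qed (use s(2) in auto)
  then have "eventually (\<lambda>i. L2_norm ?M (\<lambda>x. s i x - g x) < \<eta> / 2) sequentially"
    using \<open>\<eta> > 0\<close> by (intro order_tendstoD) auto
  then obtain i where i: "L2_norm ?M (\<lambda>x. s i x - g x) < \<eta> / 2"
    by (meson eventually_sequentially order_refl)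
  let ?I = "s i ` space ?M"
  let ?A = "\<lambda>y. s i -` {y} \<inter> space ?M"
  have fin: "finite ?I" using s(1) by (rule simple_functionD)
  have "L2_continuous_approx \<Omega> (\<lambda>x. \<Sum>y\<in>?I. y * indicator (?A y) x)"
    by (intro L2_continuous_approx_sum[OF \<Omega> fin] L2_continuous_approx_indicator[OF \<Omega>] simple_functionD(2)[OF s(1)])
  moreover have sx: "(\<Sum>y\<in>?I. y * indicator (?A y) x) = s i x" if "x \<in> \<Omega>" for x
  proof -
    have "(\<Sum>y\<in>?I. y * indicator (?A y) x) = (\<Sum>y\<in>?I. if y = s i x then y else 0)"
      using that by (intro sum.cong) (auto simp: indicator_def)
    also have "\<dots> = s i x" using that fin by simp
    finally show ?thesis .
  qed
  ultimately obtain c where c: "continuous_on UNIV c" "\<forall>x. x \<notin> \<Omega> \<longrightarrow> c x = 0"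
    "L2_norm ?M (\<lambda>x. (\<Sum>y\<in>?I. y * indicator (?A y) x) - c x) \<le> \<eta> / 2"
    using \<open>\<eta> > 0\<close> unfolding L2_continuous_approx_def by (meson half_gt_zero)
  have "L2_norm ?M (\<lambda>x. (\<Sum>y\<in>?I. y * indicator (?A y) x) - c x) = L2_norm ?M (\<lambda>x. s i x - c x)"
    unfolding L2_norm_def L2_inner_def using sx
    by (intro arg_cong[of _ _ sqrt] Bochner_Integration.integral_cong) auto
  with c(3) have c3: "L2_norm ?M (\<lambda>x. s i x - c x) \<le> \<eta> / 2" by simp
  have si: "s i \<in> L2 ?M"
  proof (rule L2_bound[OF g])
    show "AE x in ?M. \<bar>s i x\<bar> \<le> 2 * \<bar>g x\<bar>"
      using AE_space by eventually_elim (use s(3) in auto)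
  qed simp
  have cL: "c \<in> L2 ?M" using c(1) by (intro continuous_bounded_L2[OF \<Omega>]) (auto intro: continuous_on_subset)
  have "L2_norm ?M (\<lambda>x. g x - c x) \<le> L2_norm ?M (\<lambda>x. g x - s i x) + L2_norm ?M (\<lambda>x. s i x - c x)"
    by (rule L2_norm_triangle[OF g si cL])
  also have "\<dots> \<le> \<eta>" using i c3 by (simp add: L2_norm_minus_commute[of _ g])
  finally show "\<exists>c. continuous_on UNIV c \<and> (\<forall>x. x \<notin> \<Omega> \<longrightarrow> c x = 0) \<and> L2_norm ?M (\<lambda>x. g x - c x) \<le> \<eta>"
    using c by blast
qed

lemma continuous_vanishing_uniform:
  fixes c :: "'a::euclidean_space \<Rightarrow> real"
  assumes c: "continuous_on UNIV c" "\<And>x. x \<notin> \<Omega> \<Longrightarrow> c x = 0" and \<Omega>: "bounded \<Omega>" and \<epsilon>: "\<epsilon> > 0"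
  obtains \<delta> where "\<delta> > 0" "\<And>x y. dist x y < \<delta> \<Longrightarrow> \<bar>c x - c y\<bar> \<le> \<epsilon>"
proof -
  obtain R where R: "\<Omega> \<subseteq> ball 0 R" using \<Omega> bounded_subset_ballD by blast
  have "uniformly_continuous_on (cball 0 (R + 1)) c"
    using c(1) by (intro compact_uniformly_continuous) (auto intro: continuous_on_subset)
  then obtain d where d: "d > 0" "\<And>x y. x \<in> cball 0 (R + 1) \<Longrightarrow> y \<in> cball 0 (R + 1) \<Longrightarrow> dist y x < d \<Longrightarrow> dist (c y) (c x) < \<epsilon>"
    unfolding uniformly_continuous_on_def using \<epsilon> by metis
  show ?thesis
  proof (rule that[of "min d 1"])
    fix x y :: 'a assume xy: "dist x y < min d 1"
    show "\<bar>c x - c y\<bar> \<le> \<epsilon>"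
    proof (cases "x \<in> cball 0 (R + 1) \<and> y \<in> cball 0 (R + 1)")
      case True
      then show ?thesis using d(2)[of y x] xy by (auto simp: dist_real_def)
    next
      case False
      then have "norm x \<ge> R \<and> norm y \<ge> R"
        using xy norm_triangle_ineq2[of x y] norm_triangle_ineq2[of y x]
        by (auto simp: dist_norm norm_minus_commute)
      then have "x \<notin> \<Omega>" "y \<notin> \<Omega>" using R by auto
      then show ?thesis using c(2) \<epsilon> by simp
    qed
  qed (use d in auto)
qed

lemma lborel_translation:
  fixes f :: "'a::euclidean_space \<Rightarrow> real"
  assumes "f \<in> borel_measurable borel"
  shows "(\<integral>x. f (x + z) \<partial>lborel) = (\<integral>x. f x \<partial>lborel)" "integrable lborel (\<lambda>x. f (x + z)) \<longleftrightarrow> integrable lborel f"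
proof -
  have L: "lborel = distr lborel borel ((+) z)" by (simp add: lborel_distr_plus)
  show "(\<integral>x. f (x + z) \<partial>lborel) = (\<integral>x. f x \<partial>lborel)"
    by (subst (2) L, subst integral_distr) (use assms in \<open>auto simp: add.commute\<close>)
  show "integrable lborel (\<lambda>x. f (x + z)) \<longleftrightarrow> integrable lborel f"
    by (subst (2) L, subst integrable_distr_eq) (use assms in \<open>auto simp: add.commute\<close>)
qed

lemma L2_translation:
  fixes f :: "'a::euclidean_space \<Rightarrow> real"
  assumes "f \<in> L2 lborel"
  shows "(\<lambda>x. f (x + z)) \<in> L2 lborel" "L2_norm lborel (\<lambda>x. f (x + z)) = L2_norm lborel f"
  using assms lborel_translation[of "\<lambda>x. (f x)\<^sup>2" z] lborel_translation(1)[of "\<lambda>x. f x * f x" z]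
  by (auto simp: L2_def L2_norm_def L2_inner_def)

lemma L2_translation_continuous:
  fixes g :: "'a::euclidean_space \<Rightarrow> real"
  assumes \<Omega>: "open \<Omega>" "bounded \<Omega>" and g: "g \<in> L2 lborel" "\<And>x. x \<notin> \<Omega> \<Longrightarrow> g x = 0" and \<eta>: "\<eta> > 0"
  obtains \<tau> where "\<tau> > 0" "\<And>z. norm z < \<tau> \<Longrightarrow> L2_norm lborel (\<lambda>x. g (x + z) - g x) \<le> \<eta>"
proof -
  have gm: "g \<in> borel_measurable borel" using g(1) by (auto dest: L2_measurable)
  have \<Omega>b: "\<Omega> \<in> sets borel" using \<Omega> by simp
  have gO: "g \<in> L2 (lebesgue_on \<Omega>)" using L2_lebesgue_on_borel(1)[OF gm \<Omega>b g(2)] g(1) by simp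
  obtain c where c: "continuous_on UNIV c" "\<And>x. x \<notin> \<Omega> \<Longrightarrow> c x = 0" "L2_norm (lebesgue_on \<Omega>) (\<lambda>x. g x - c x) \<le> \<eta> / 3"
    using L2_continuous_dense[OF \<Omega> gO] \<eta> unfolding L2_continuous_approx_def
    by (metis divide_pos_pos zero_less_numeral)
  have cm: "c \<in> borel_measurable borel" using c(1) by (rule borel_measurable_continuous_onI)
  have cO: "c \<in> L2 (lebesgue_on \<Omega>)" using c(1) by (intro continuous_bounded_L2[OF \<Omega>]) (auto intro: continuous_on_subset)
  then have cL: "c \<in> L2 lborel" using L2_lebesgue_on_borel(1)[OF cm \<Omega>b c(2)] by simp
  have gc: "L2_norm lborel (\<lambda>x. g x - c x) \<le> \<eta> / 3"
    using c(3) L2_lebesgue_on_borel(2)[of "\<lambda>x. g x - c x" \<Omega>] gm cm \<Omega>b g(2) c(2) by auto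
  obtain R where R: "\<Omega> \<subseteq> ball 0 R" using \<Omega> bounded_subset_ballD by blast
  let ?B = "cball (0::'a) (R + 1)"
  define m where "m = L2_norm lborel (indicator ?B :: 'a \<Rightarrow> real) + 1"
  have m: "m > 0" by (simp add: m_def add_nonneg_pos)
  have BL: "(indicator ?B :: 'a \<Rightarrow> real) \<in> L2 lborel"
    using emeasure_lborel_cball_finite[of "0::'a" "R + 1"]
    by (simp add: L2_def power2_eq_square integrable_indicator_iff borel_measurable_indicator flip: indicator_inter_arith)
  obtain d where d: "d > 0" "\<And>x y. dist x y < d \<Longrightarrow> \<bar>c x - c y\<bar> \<le> \<eta> / (3 * m)"
    using continuous_vanishing_uniform[OF c(1,2), of \<Omega> "\<eta> / (3 * m)"] \<Omega> \<eta> m by auto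
  show ?thesis
  proof (rule that[of "min d 1"])
    fix z :: 'a assume z: "norm z < min d 1"
    have czB: "\<bar>c (x + z) - c x\<bar> \<le> \<bar>\<eta> / (3 * m) * indicator ?B x\<bar>" for x
    proof (cases "x \<in> ?B")
      case True
      then show ?thesis using d(2)[of "x + z" x] z \<eta> m by (simp add: dist_norm)
    next
      case False
      then have "norm (x + z) \<ge> R" "norm x \<ge> R" using z norm_triangle_ineq2[of x "- z"] by auto
      then have "x + z \<notin> \<Omega>" "x \<notin> \<Omega>" using R by auto
      then show ?thesis using c(2) by simp
    qed
    have cz: "(\<lambda>x. c (x + z)) \<in> L2 lborel" "(\<lambda>x. g (x + z)) \<in> L2 lborel"
      using L2_translation(1) cL g(1) by auto
    have 1: "L2_norm lborel (\<lambda>x. g (x + z) - c (x + z)) \<le> \<eta> / 3"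
      using L2_translation(2)[OF L2_diff[OF g(1) cL], of z] gc by simp
    have "L2_norm lborel (\<lambda>x. c (x + z) - c x) \<le> L2_norm lborel (\<lambda>x. \<eta> / (3 * m) * indicator ?B x)"
      by (rule L2_norm_mono[OF L2_measurable[OF L2_diff[OF cz(1) cL]] L2_cmult[OF BL]]) (use czB in blast)
    also have "\<dots> = \<eta> / (3 * m) * L2_norm lborel (indicator ?B :: 'a \<Rightarrow> real)"
      using \<eta> m by (simp only: L2_norm_cmult) simp
    also have "\<dots> \<le> \<eta> / (3 * m) * m" using \<eta> m by (intro mult_left_mono) (auto simp: m_def)
    also have "\<dots> = \<eta> / 3" using m by simp
    finally have 2: "L2_norm lborel (\<lambda>x. c (x + z) - c x) \<le> \<eta> / 3" .
    have "L2_norm lborel (\<lambda>x. g (x + z) - g x)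
        \<le> L2_norm lborel (\<lambda>x. g (x + z) - c (x + z)) + L2_norm lborel (\<lambda>x. c (x + z) - g x)"
      by (rule L2_norm_triangle[OF cz(2,1) g(1)])
    also have "L2_norm lborel (\<lambda>x. c (x + z) - g x) \<le> L2_norm lborel (\<lambda>x. c (x + z) - c x) + L2_norm lborel (\<lambda>x. c x - g x)"
      by (rule L2_norm_triangle[OF cz(1) cL g(1)])
    finally show "L2_norm lborel (\<lambda>x. g (x + z) - g x) \<le> \<eta>"
      using 1 2 gc by (simp add: L2_norm_minus_commute[of _ c g])
  qed (use d in auto)
qed

lemma L2_lborel_integrable:
  fixes g :: "'a::euclidean_space \<Rightarrow> real"
  assumes \<Omega>: "open \<Omega>" "bounded \<Omega>" and g: "g \<in> L2 lborel" "\<And>x. x \<notin> \<Omega> \<Longrightarrow> g x = 0"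
  shows "integrable lborel g"
proof -
  have gm: "g \<in> borel_measurable borel" "\<Omega> \<in> sets borel" using g(1) \<Omega> by (auto dest: L2_measurable)
  have "integrable (lebesgue_on \<Omega>) g"
    using L2_lebesgue_on_borel(1)[OF gm g(2)] g(1) by (intro L2_integrable finite_measure_lebesgue_on_open \<Omega>) auto
  then show ?thesis using lebesgue_on_integral_borel(1)[OF gm g(2)] by simp
qed

lemma mollify_L2:
  fixes g :: "'a::euclidean_space \<Rightarrow> real"
  assumes \<Omega>: "open \<Omega>" "bounded \<Omega>" and g: "g \<in> L2 lborel" "\<And>x. x \<notin> \<Omega> \<Longrightarrow> g x = 0" and \<eta>: "\<eta> > 0"
  obtains \<tau> where "\<tau> > 0" "\<And>e a. e > 0 \<Longrightarrow> e + norm a < \<tau> \<Longrightarrow>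
    (\<lambda>x. mollify e a g x - g x) \<in> L2 lborel \<and> L2_norm lborel (\<lambda>x. mollify e a g x - g x) \<le> \<eta>"
proof -
  have [measurable]: "g \<in> borel_measurable borel" using g(1) by (auto dest: L2_measurable)
  have gi: "integrable lborel g" by (rule L2_lborel_integrable[OF \<Omega> g])
  obtain \<tau> where \<tau>: "\<tau> > 0" "\<And>z. norm z < \<tau> \<Longrightarrow> L2_norm lborel (\<lambda>x. g (x + z) - g x) \<le> \<eta>"
    using L2_translation_continuous[OF \<Omega> g \<eta>] by blast
  show ?thesis
  proof (rule that[OF \<tau>(1)])
    fix e :: real and a :: 'a assume e: "e > 0" and ea: "e + norm a < \<tau>"
    let ?k = "mollifier e :: 'a \<Rightarrow> real"
    define C where "C = e ^ 4 / mollifier_mass TYPE('a) e"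
    have k: "0 \<le> ?k z" "\<bar>?k z\<bar> \<le> C" for z
      using mollifier_le[OF e, of z] mollifier_nonneg[OF e, of z] by (auto simp: C_def)
    have L: "lborel = distr lborel borel (\<lambda>y::'a. b + (-1) *\<^sub>R y)" for b
      using lborel_affine[of "-1" b] by (simp add: density_1)
    have sub: "integrable lborel (\<lambda>z. f (b - z)) \<longleftrightarrow> integrable lborel f"
      "(\<integral>z. f (b - z) \<partial>lborel) = (\<integral>z. f z \<partial>lborel)" if "f \<in> borel_measurable borel" for f :: "'a \<Rightarrow> real" and b
      using that by (subst (2) L[of b], subst integrable_distr_eq integral_distr; simp)+
    have moll: "mollify e a g x = (\<integral>z. g (x + a - z) * ?k z \<partial>lborel)" for x
      unfolding mollify_def using sub(2)[of "\<lambda>z. g (x + a - z) * ?k z" "x + a"] by simp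
    have ig: "integrable lborel (\<lambda>z. g (x + a - z))" for x using sub(1)[of g "x + a"] gi by simp
    have ig2: "integrable lborel (\<lambda>z. (g (x + a - z))\<^sup>2)" for x
      using sub(1)[of "\<lambda>z. (g z)\<^sup>2" "x + a"] L2_square_integrable[OF g(1)] by simp
    have ik: "integrable lborel ?k" by (rule mollifier_integrable[OF e])
    have i1: "integrable lborel (\<lambda>z. g (x + a - z) * ?k z)" for x
      by (rule integrable_mult_bounded[OF ig]) (use k in auto)
    have i2: "integrable lborel (\<lambda>z. (g (x + a - z))\<^sup>2 * ?k z)" for x
      by (rule integrable_mult_bounded[OF ig2]) (use k in auto)
    have i3: "integrable lborel (\<lambda>z. ?k z * (g (x + a - z) - g x)\<^sup>2)"
      and jensen: "(mollify e a g x - g x)\<^sup>2 \<le> (\<integral>z. ?k z * (g (x + a - z) - g x)\<^sup>2 \<partial>lborel)" for x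
    proof -
      let ?s = "g x" and ?m = "mollify e a g x"
      have exp: "?k z * (g (x + a - z) - c)\<^sup>2 = (g (x + a - z))\<^sup>2 * ?k z - 2 * c * (g (x + a - z) * ?k z) + c\<^sup>2 * ?k z" for z c
        by (simp add: power2_eq_square algebra_simps)
      have I: "integrable lborel (\<lambda>z. ?k z * (g (x + a - z) - c)\<^sup>2)"
        and E: "(\<integral>z. ?k z * (g (x + a - z) - c)\<^sup>2 \<partial>lborel) = (\<integral>z. (g (x + a - z))\<^sup>2 * ?k z \<partial>lborel) - 2 * c * ?m + c\<^sup>2" for c
        unfolding exp using i1[of x] i2[of x] ik by (simp_all add: moll mollifier_integral[OF e])
      show "integrable lborel (\<lambda>z. ?k z * (g (x + a - z) - g x)\<^sup>2)" by (rule I)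
      have "0 \<le> (\<integral>z. ?k z * (g (x + a - z) - ?m)\<^sup>2 \<partial>lborel)"
        using k(1) by (intro Bochner_Integration.integral_nonneg) simp
      then show "(?m - ?s)\<^sup>2 \<le> (\<integral>z. ?k z * (g (x + a - z) - g x)\<^sup>2 \<partial>lborel)"
        unfolding E by (simp add: power2_eq_square algebra_simps)
    qed
    have [measurable]: "mollify e a g \<in> borel_measurable borel"
      by (rule C1_fun_measurable[OF mollify_C1[OF e gi]])
    have "(\<integral>\<^sup>+x. ennreal ((mollify e a g x - g x)\<^sup>2) \<partial>lborel)
        \<le> (\<integral>\<^sup>+x. (\<integral>\<^sup>+z. ennreal (?k z * (g (x + a - z) - g x)\<^sup>2) \<partial>lborel) \<partial>lborel)"
    proof (rule nn_integral_mono)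
      fix x :: 'a
      show "ennreal ((mollify e a g x - g x)\<^sup>2) \<le> (\<integral>\<^sup>+z. ennreal (?k z * (g (x + a - z) - g x)\<^sup>2) \<partial>lborel)"
        using jensen[of x] k(1) by (subst nn_integral_eq_integral[OF i3]) (auto intro: ennreal_leI)
    qed
    also have "\<dots> = (\<integral>\<^sup>+z. (\<integral>\<^sup>+x. ennreal (?k z * (g (x + a - z) - g x)\<^sup>2) \<partial>lborel) \<partial>lborel)"
      by (rule lborel_pair.Fubini'[symmetric]) (measurable)
    also have "\<dots> \<le> (\<integral>\<^sup>+z. ennreal (\<eta>\<^sup>2 * ?k z) \<partial>lborel)"
    proof (rule nn_integral_mono)
      fix z :: 'a
      show "(\<integral>\<^sup>+x. ennreal (?k z * (g (x + a - z) - g x)\<^sup>2) \<partial>lborel) \<le> ennreal (\<eta>\<^sup>2 * ?k z)"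
      proof (cases "norm z < e")
        case False
        then show ?thesis using mollifier_eq_0[OF e, of z] by simp
      next
        case True
        have d: "(\<lambda>x. g (x + (a - z)) - g x) \<in> L2 lborel" by (intro L2_diff L2_translation g)
        have "norm (a - z) < \<tau>" using True ea norm_triangle_ineq4[of a z] by linarith
        then have "(L2_norm lborel (\<lambda>x. g (x + (a - z)) - g x))\<^sup>2 \<le> \<eta>\<^sup>2"
          using \<tau>(2)[of "a - z"] by (intro power_mono) auto
        then have *: "(\<integral>x. (g (x + a - z) - g x)\<^sup>2 \<partial>lborel) \<le> \<eta>\<^sup>2"
          unfolding L2_norm_power2 by (simp add: algebra_simps)
        have di: "integrable lborel (\<lambda>x. (g (x + a - z) - g x)\<^sup>2)"
          using L2_square_integrable[OF d] by (simp add: algebra_simps)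
        have "(\<integral>\<^sup>+x. ennreal (?k z * (g (x + a - z) - g x)\<^sup>2) \<partial>lborel) = ennreal (\<integral>x. ?k z * (g (x + a - z) - g x)\<^sup>2 \<partial>lborel)"
          using di k(1)[of z] by (intro nn_integral_eq_integral) auto
        also have "\<dots> \<le> ennreal (\<eta>\<^sup>2 * ?k z)"
          using * k(1)[of z] by (intro ennreal_leI) (simp add: mult.commute[of _ "?k z"] mult_left_mono)
        finally show ?thesis .
      qed
    qed
    also have "\<dots> = ennreal (\<eta>\<^sup>2)"
      using ik k(1) by (subst nn_integral_eq_integral) (auto simp: mollifier_integral[OF e])
    finally have le: "(\<integral>\<^sup>+x. ennreal ((mollify e a g x - g x)\<^sup>2) \<partial>lborel) \<le> ennreal (\<eta>\<^sup>2)" .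
    then have int: "integrable lborel (\<lambda>x. (mollify e a g x - g x)\<^sup>2)"
      by (intro integrableI_nonneg) (auto simp: le_less_trans)
    have "ennreal ((L2_norm lborel (\<lambda>x. mollify e a g x - g x))\<^sup>2) \<le> ennreal (\<eta>\<^sup>2)"
      using le unfolding L2_norm_power2 by (subst nn_integral_eq_integral[symmetric]) (auto intro: int)
    then have "L2_norm lborel (\<lambda>x. mollify e a g x - g x) \<le> \<eta>"
      using \<eta> power2_le_imp_le[of "L2_norm lborel (\<lambda>x. mollify e a g x - g x)" \<eta>] by (simp add: ennreal_le_iff)
    moreover have "(\<lambda>x. mollify e a g x - g x) \<in> L2 lborel" using int by (simp add: L2_def)
    ultimately show "(\<lambda>x. mollify e a g x - g x) \<in> L2 lborel \<and> L2_norm lborel (\<lambda>x. mollify e a g x - g x) \<le> \<eta>"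
      by simp
  qed
qed

section \<open>Weak gradients\<close>

locale bounded_open =
  fixes \<Omega> :: "'a::euclidean_space set"
  assumes open_dom: "open \<Omega>" and bounded_dom: "bounded \<Omega>"
begin

lemma dom_borel [measurable]: "\<Omega> \<in> sets borel"
  using open_dom by simp

lemma continuous_L2: "continuous_on UNIV c \<Longrightarrow> c \<in> L2 (lebesgue_on \<Omega>)"
  by (rule continuous_bounded_L2[OF open_dom bounded_dom]) (auto intro: continuous_on_subset)

lemma C1_fun_L2:
  assumes "C1_fun f D"
  shows "f \<in> L2 (lebesgue_on \<Omega>)" "(\<lambda>x. D x i) \<in> L2 (lebesgue_on \<Omega>)"
  using assms C1_fun_continuous[OF assms, of UNIV] by (auto simp: C1_fun_def intro!: continuous_L2)

lemma C1_fun_bounded: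
  assumes "C1_fun f D"
  obtains B where "\<And>x. x \<in> \<Omega> \<Longrightarrow> \<bar>f x\<bar> \<le> B" "\<And>x i. x \<in> \<Omega> \<Longrightarrow> i \<in> Basis \<Longrightarrow> \<bar>D x i\<bar> \<le> B"
proof -
  have comp: "compact (closure \<Omega>)" using bounded_dom by simp
  have "\<exists>B. \<forall>x\<in>closure \<Omega>. \<bar>h x\<bar> \<le> B" if "continuous_on UNIV h" for h :: "'a \<Rightarrow> real"
  proof -
    have "bounded (h ` closure \<Omega>)"
      using that comp by (intro compact_imp_bounded compact_continuous_image) (auto intro: continuous_on_subset)
    then show ?thesis by (auto simp: bounded_iff)
  qed
  then have "\<exists>B. \<forall>x\<in>closure \<Omega>. \<bar>f x\<bar> \<le> B" "\<forall>i. \<exists>B. \<forall>x\<in>closure \<Omega>. \<bar>D x i\<bar> \<le> B"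
    using C1_fun_continuous[OF assms] assms by (auto simp: C1_fun_def)
  then obtain B b where B: "\<forall>x\<in>closure \<Omega>. \<bar>f x\<bar> \<le> B" "\<forall>i. \<forall>x\<in>closure \<Omega>. \<bar>D x i\<bar> \<le> b i" by metis
  have "b i \<le> (\<Sum>i\<in>Basis. \<bar>b i\<bar>)" if "i \<in> Basis" for i
    using member_le_sum[of i Basis "\<lambda>i. \<bar>b i\<bar>"] that by force
  moreover have "0 \<le> (\<Sum>i\<in>Basis. \<bar>b i\<bar>)" by (rule sum_nonneg) simp
  moreover have "x \<in> closure \<Omega>" if "x \<in> \<Omega>" for x using that closure_subset by blast
  ultimately show ?thesis
    using B by (intro that[of "\<bar>B\<bar> + (\<Sum>i\<in>Basis. \<bar>b i\<bar>)"]) (smt (verit, best))+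
qed

lemma C1_compact_L2:
  assumes "\<phi> \<in> C1_compact \<Omega>"
  shows "\<phi> \<in> L2 (lebesgue_on \<Omega>)" "(\<lambda>x. frechet_derivative \<phi> (at x) i) \<in> L2 (lebesgue_on \<Omega>)"
  using C1_compactD[OF assms] C1_fun_L2 by metis+

lemma H1_gradientD:
  assumes "H1_gradient \<Omega> u G"
  shows "i \<in> Basis \<Longrightarrow> (\<lambda>x. G x \<bullet> i) \<in> L2 (lebesgue_on \<Omega>)"
    "\<phi> \<in> C1_compact \<Omega> \<Longrightarrow> i \<in> Basis \<Longrightarrow>
      (\<integral>x. u x * frechet_derivative \<phi> (at x) i \<partial>lebesgue_on \<Omega>) = - (\<integral>x. (G x \<bullet> i) * \<phi> x \<partial>lebesgue_on \<Omega>)"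
  using assms by (auto simp: H1_gradient_def weak_gradient_def)

lemma H1_gradient_lin:
  assumes u: "u \<in> L2 (lebesgue_on \<Omega>)" "H1_gradient \<Omega> u G" and v: "v \<in> L2 (lebesgue_on \<Omega>)" "H1_gradient \<Omega> v H"
  shows "H1_gradient \<Omega> (\<lambda>x. c * u x + d * v x) (\<lambda>x. c *\<^sub>R G x + d *\<^sub>R H x)"
  unfolding H1_gradient_def weak_gradient_def
proof (intro conjI ballI)
  fix i :: 'a assume i: "i \<in> Basis"
  show "(\<lambda>x. (c *\<^sub>R G x + d *\<^sub>R H x) \<bullet> i) \<in> L2 (lebesgue_on \<Omega>)"
    unfolding inner_add_left inner_scaleR_left
    by (intro L2_lin H1_gradientD(1)[OF u(2)] H1_gradientD(1)[OF v(2)] i)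
  fix \<phi> assume \<phi>: "\<phi> \<in> C1_compact \<Omega>"
  note D = C1_compact_L2(2)[OF \<phi>, of i] C1_compact_L2(1)[OF \<phi>]
  note G = H1_gradientD(1)[OF u(2) i] H1_gradientD(1)[OF v(2) i]
  show "(\<integral>x. (c * u x + d * v x) * frechet_derivative \<phi> (at x) i \<partial>lebesgue_on \<Omega>) =
     - (\<integral>x. ((c *\<^sub>R G x + d *\<^sub>R H x) \<bullet> i) * \<phi> x \<partial>lebesgue_on \<Omega>)"
    using L2_inner_add_left[OF u(1) v(1) D(1), of c d] L2_inner_add_left[OF G D(2), of c d]
      H1_gradientD(2)[OF u(2) \<phi> i] H1_gradientD(2)[OF v(2) \<phi> i]
    by (simp add: L2_inner_def inner_add_left)
qed

lemma mollifier_test: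
  fixes w :: 'a
  assumes e: "e > 0" and w: "cball w e \<subseteq> \<Omega>"
  shows "(\<lambda>y. mollifier e (w - y)) \<in> C1_compact \<Omega>"
    "frechet_derivative (\<lambda>y. mollifier e (w - y)) (at y) = (\<lambda>h. - mollifier_deriv e (w - y) h)"
proof -
  have lin: "mollifier_deriv e z (- h) = - mollifier_deriv e z h" for z h :: 'a
    by (simp add: mollifier_deriv_def)
  have C: "C1_fun (\<lambda>y. mollifier e (w - y)) (\<lambda>y h. - mollifier_deriv e (w - y) h)"
    unfolding C1_fun_def
  proof (intro conjI allI)
    fix y
    have "((\<lambda>y. w - y) has_derivative (\<lambda>h. - h)) (at y)"
      by (auto intro!: derivative_eq_intros)
    then have "((\<lambda>y. mollifier e (w - y)) has_derivative (\<lambda>h. mollifier_deriv e (w - y) (- h))) (at y)"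
      by (rule has_derivative_compose) (use mollifier_C1 in \<open>auto simp: C1_fun_def\<close>)
    then show "((\<lambda>y. mollifier e (w - y)) has_derivative (\<lambda>h. - mollifier_deriv e (w - y) h)) (at y)"
      by (simp add: lin)
  next
    fix i
    have "continuous_on UNIV (\<lambda>z::'a. mollifier_deriv e z i)" using mollifier_C1 by (auto simp: C1_fun_def)
    then have "continuous_on UNIV (\<lambda>y. mollifier_deriv e (w - y) i)"
      by (rule continuous_on_compose2) (auto intro!: continuous_intros)
    then show "continuous_on UNIV (\<lambda>y. - mollifier_deriv e (w - y) i)" by (rule continuous_on_minus)
  qed
  then show "frechet_derivative (\<lambda>y. mollifier e (w - y)) (at y) = (\<lambda>h. - mollifier_deriv e (w - y) h)"
    by (rule C1_fun_frechet)
  show "(\<lambda>y. mollifier e (w - y)) \<in> C1_compact \<Omega>"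
    by (rule C1_compactI[OF C _ w]) (auto intro!: mollifier_eq_0[OF e] simp: dist_norm)
qed

lemma L2_zero_if_orthogonal:
  assumes d: "d \<in> L2 (lebesgue_on \<Omega>)" and orth: "\<And>\<phi>. \<phi> \<in> C1_compact \<Omega> \<Longrightarrow> (\<integral>x. d x * \<phi> x \<partial>lebesgue_on \<Omega>) = 0"
  shows "AE x in lebesgue_on \<Omega>. d x = 0"
proof -
  obtain v where v: "v \<in> borel_measurable borel" "\<And>x. x \<notin> \<Omega> \<Longrightarrow> v x = 0"
    "AE x in lebesgue_on \<Omega>. d x = v x" "v \<in> L2 (lebesgue_on \<Omega>)" "v \<in> L2 lborel"
    using L2_borel_representative[OF d open_dom] by blast
  note [measurable] = v(1)
  have moll0: "mollify e 0 v y = 0" if e: "e > 0" and y: "cball y e \<subseteq> \<Omega>" for e y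
  proof -
    have "mollify e 0 v y = (\<integral>z. v z * mollifier e (y - z) \<partial>lebesgue_on \<Omega>)"
      unfolding mollify_def by (subst lebesgue_on_integral_borel(2)) (auto simp: v(2))
    also have "\<dots> = (\<integral>z. d z * mollifier e (y - z) \<partial>lebesgue_on \<Omega>)"
    proof (rule integral_cong_AE)
      have "(\<lambda>z. mollifier e (y - z)) \<in> borel_measurable (lebesgue_on \<Omega>)"
        by (rule lebesgue_on_measurable_borel) simp
      then show "(\<lambda>z. v z * mollifier e (y - z)) \<in> borel_measurable (lebesgue_on \<Omega>)"
        "(\<lambda>z. d z * mollifier e (y - z)) \<in> borel_measurable (lebesgue_on \<Omega>)"
        using L2_measurable[OF v(4)] L2_measurable[OF d] by auto
      show "AE z in lebesgue_on \<Omega>. v z * mollifier e (y - z) = d z * mollifier e (y - z)"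
        using v(3) by eventually_elim simp
    qed
    also have "\<dots> = 0" by (rule orth[OF mollifier_test(1)[OF e y]])
    finally show ?thesis .
  qed
  let ?N = "{x. v x \<noteq> 0}"
  have "negligible ?N"
    unfolding locally_negligible_alt[of ?N]
  proof
    fix x assume "x \<in> ?N"
    then have "x \<in> \<Omega>" using v(2) by auto
    then obtain r0 where r0: "r0 > 0" "cball x r0 \<subseteq> \<Omega>" using open_dom open_contains_cball by blast
    define r where "r = r0 / 2"
    have r: "r > 0" "cball x (2 * r) \<subseteq> \<Omega>" using r0 by (auto simp: r_def)
    define w where "w y = indicator (ball x r) y * v y" for y
    have [measurable]: "w \<in> borel_measurable borel"
      unfolding w_def[abs_def] by (intro borel_measurable_times borel_measurable_indicator v(1)) simp
    have wL: "w \<in> L2 lborel"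
      by (rule L2_bound[OF v(5), of _ 1]) (auto simp: w_def indicator_def)
    have "L2_norm lborel w \<le> \<eta>" if "\<eta> > 0" for \<eta>
    proof -
      obtain \<tau> where \<tau>: "\<tau> > 0" "\<And>e a. e > 0 \<Longrightarrow> e + norm a < \<tau> \<Longrightarrow>
          (\<lambda>x. mollify e a v x - v x) \<in> L2 lborel \<and> L2_norm lborel (\<lambda>x. mollify e a v x - v x) \<le> \<eta>"
        using mollify_L2[OF open_dom bounded_dom v(5,2) \<open>\<eta> > 0\<close>] by blast
      define e where "e = min (\<tau> / 2) r"
      have e: "e > 0" "e + norm (0::'a) < \<tau>" "e \<le> r" using \<tau>(1) r(1) by (auto simp: e_def)
      have "\<bar>w y\<bar> \<le> \<bar>mollify e 0 v y - v y\<bar>" for y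
      proof (cases "y \<in> ball x r")
        case True
        have "cball y e \<subseteq> cball x (2 * r)"
        proof
          fix z assume "z \<in> cball y e"
          then show "z \<in> cball x (2 * r)" using True e(3) dist_triangle[of x z y] by auto
        qed
        then have "mollify e 0 v y = 0" using r(2) by (intro moll0 e) auto
        then show ?thesis by (simp add: w_def indicator_def)
      qed (simp add: w_def)
      then have "L2_norm lborel w \<le> L2_norm lborel (\<lambda>x. mollify e 0 v x - v x)"
        using \<tau>(2)[OF e(1,2)] wL by (intro L2_norm_mono) (auto dest: L2_measurable)
      also have "\<dots> \<le> \<eta>" using \<tau>(2)[OF e(1,2)] by simp
      finally show ?thesis .
    qed
    then have "L2_norm lborel w = 0" by (meson antisym dense_ge L2_norm_nonneg)
    then have "AE y in lborel. w y = 0" using L2_norm_zero_iff[OF wL] by simp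
    then have "{y. w y \<noteq> 0} \<in> null_sets lborel"
      by (subst AE_iff_null_sets) auto
    then have "negligible {y. w y \<noteq> 0}" using null_sets_completionI negligible_iff_null_sets by blast
    moreover have "?N \<inter> ball x r \<subseteq> {y. w y \<noteq> 0}" by (auto simp: w_def)
    ultimately have "negligible (?N \<inter> ball x r)" by (rule negligible_subset)
    then show "\<exists>U. openin (top_of_set ?N) U \<and> x \<in> U \<and> negligible U"
      using \<open>x \<in> ?N\<close> r(1) by (intro exI[of _ "?N \<inter> ball x r"]) auto
  qed
  then have "?N \<in> null_sets lebesgue" by (simp add: negligible_iff_null_sets)
  then have "AE x in lebesgue. v x = 0" by (auto dest: AE_not_in)
  then have "AE x in lebesgue_on \<Omega>. v x = 0" by (subst AE_restrict_space_iff) auto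
  with v(3) show ?thesis by eventually_elim simp
qed

lemma H1_gradient_unique:
  assumes u: "H1_gradient \<Omega> u G" and v: "H1_gradient \<Omega> v H"
    and uv: "u \<in> L2 (lebesgue_on \<Omega>)" "v \<in> L2 (lebesgue_on \<Omega>)" "AE x in lebesgue_on \<Omega>. u x = v x"
  shows "AE x in lebesgue_on \<Omega>. G x = H x"
proof -
  have "AE x in lebesgue_on \<Omega>. G x \<bullet> i - H x \<bullet> i = 0" if i: "i \<in> Basis" for i
  proof (rule L2_zero_if_orthogonal)
    note G = H1_gradientD(1)[OF u i] H1_gradientD(1)[OF v i]
    show "(\<lambda>x. G x \<bullet> i - H x \<bullet> i) \<in> L2 (lebesgue_on \<Omega>)" by (rule L2_diff[OF G])
    fix \<phi> assume \<phi>: "\<phi> \<in> C1_compact \<Omega>"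
    have "(\<integral>x. u x * frechet_derivative \<phi> (at x) i \<partial>lebesgue_on \<Omega>) = (\<integral>x. v x * frechet_derivative \<phi> (at x) i \<partial>lebesgue_on \<Omega>)"
      using L2_inner_cong_AE[OF uv(3), of "\<lambda>x. frechet_derivative \<phi> (at x) i" "\<lambda>x. frechet_derivative \<phi> (at x) i"]
        uv(1,2) C1_compact_L2(2)[OF \<phi>, of i] by (simp add: L2_inner_def L2_measurable)
    then show "(\<integral>x. (G x \<bullet> i - H x \<bullet> i) * \<phi> x \<partial>lebesgue_on \<Omega>) = 0"
      using L2_inner_add_left[OF G C1_compact_L2(1)[OF \<phi>], of 1 "-1"]
        H1_gradientD(2)[OF u \<phi> i] H1_gradientD(2)[OF v \<phi> i] by (simp add: L2_inner_def)
  qed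
  then have "AE x in lebesgue_on \<Omega>. \<forall>i\<in>Basis. G x \<bullet> i - H x \<bullet> i = 0"
    by (intro AE_ball_countable' countable_finite[OF finite_Basis])
  then show ?thesis by eventually_elim (simp add: euclidean_eq_iff[where 'a='a])
qed

lemma C1_compact_mult:
  assumes \<phi>: "\<phi> \<in> C1_compact \<Omega>" and \<zeta>: "C1_fun \<zeta> D"
  shows "(\<lambda>x. \<zeta> x * \<phi> x) \<in> C1_compact \<Omega>"
    "frechet_derivative (\<lambda>x. \<zeta> x * \<phi> x) (at x) = (\<lambda>h. \<zeta> x * frechet_derivative \<phi> (at x) h + D x h * \<phi> x)"
proof -
  obtain K where K: "compact K" "K \<subseteq> \<Omega>" "\<And>x. x \<notin> K \<Longrightarrow> \<phi> x = 0" "C1_fun \<phi> (\<lambda>x. frechet_derivative \<phi> (at x))"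
    using C1_compactD[OF \<phi>] by metis
  note C = C1_fun_mult[OF \<zeta> K(4)]
  show "(\<lambda>x. \<zeta> x * \<phi> x) \<in> C1_compact \<Omega>" by (rule C1_compactI[OF C K(1,2)]) (simp add: K(3))
  show "frechet_derivative (\<lambda>x. \<zeta> x * \<phi> x) (at x) = (\<lambda>h. \<zeta> x * frechet_derivative \<phi> (at x) h + D x h * \<phi> x)"
    by (rule C1_fun_frechet[OF C])
qed

lemma integral_derivative_zero:
  assumes \<psi>: "\<psi> \<in> C1_compact \<Omega>" and i: "i \<in> Basis"
  shows "(\<integral>x. frechet_derivative \<psi> (at x) i \<partial>lebesgue_on \<Omega>) = 0"
proof -
  define E where "E x h = frechet_derivative \<psi> (at x) h" for x h
  obtain K where K: "compact K" "K \<subseteq> \<Omega>" "\<And>x. x \<notin> K \<Longrightarrow> \<psi> x = 0" "C1_fun \<psi> E"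
    "\<And>x i. x \<notin> K \<Longrightarrow> E x i = 0"
    using C1_compactD[OF \<psi>] unfolding E_def by metis
  have cE: "continuous_on UNIV (\<lambda>x. E x i)" using K(4) by (auto simp: C1_fun_def)
  obtain B where B: "\<And>x i. x \<in> \<Omega> \<Longrightarrow> i \<in> Basis \<Longrightarrow> \<bar>E x i\<bar> \<le> B" using C1_fun_bounded[OF K(4)] by metis
  have EB: "\<bar>E x i\<bar> \<le> \<bar>B\<bar>" for x
    using B[of x i] i K(2) K(5)[of x i] by (cases "x \<in> K") fastforce+
  have der: "((\<lambda>s. \<psi> (x + s *\<^sub>R i)) has_real_derivative E (x + s *\<^sub>R i) i) (at s)" for x s
  proof -
    have "((\<lambda>s. x + s *\<^sub>R i) has_derivative (\<lambda>h. h *\<^sub>R i)) (at s)"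
      by (auto intro!: derivative_eq_intros)
    then have "((\<lambda>s. \<psi> (x + s *\<^sub>R i)) has_derivative (\<lambda>h. E (x + s *\<^sub>R i) (h *\<^sub>R i))) (at s)"
      by (rule has_derivative_compose) (use K(4) in \<open>auto simp: C1_fun_def\<close>)
    moreover have "linear (E (x + s *\<^sub>R i))"
      using K(4) by (auto simp: C1_fun_def intro: has_derivative_linear)
    then have "(\<lambda>h. E (x + s *\<^sub>R i) (h *\<^sub>R i)) = (\<lambda>h. E (x + s *\<^sub>R i) i * h)"
      by (simp add: fun_eq_iff linear_scale mult.commute)
    ultimately show ?thesis by (simp add: has_field_derivative_def)
  qed
  have lip: "\<bar>\<psi> (x + t *\<^sub>R i) - \<psi> x\<bar> \<le> \<bar>B\<bar> * t" if "t > 0" for x t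
  proof -
    obtain z where "\<psi> (x + t *\<^sub>R i) - \<psi> (x + 0 *\<^sub>R i) = (t - 0) * E (x + z *\<^sub>R i) i"
      using MVT2[OF \<open>t > 0\<close>, of "\<lambda>s. \<psi> (x + s *\<^sub>R i)" "\<lambda>s. E (x + s *\<^sub>R i) i"] der[of x] by blast
    then have "\<bar>\<psi> (x + t *\<^sub>R i) - \<psi> x\<bar> = t * \<bar>E (x + z *\<^sub>R i) i\<bar>" using that by (simp add: abs_mult)
    also have "\<dots> \<le> t * \<bar>B\<bar>" using that EB by (intro mult_left_mono) auto
    finally show ?thesis by (simp add: mult.commute)
  qed
  obtain R where R: "\<Omega> \<subseteq> ball 0 R" using bounded_dom bounded_subset_ballD by blast
  let ?B = "cball (0::'a) (R + 1)"
  let ?q = "\<lambda>n x. (\<psi> (x + (1 / real (Suc n)) *\<^sub>R i) - \<psi> x) * real (Suc n)"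
  have [measurable]: "\<psi> \<in> borel_measurable borel" by (rule C1_fun_measurable[OF K(4)])
  have \<psi>i: "integrable lborel \<psi>"
  proof (rule L2_lborel_integrable[OF open_dom bounded_dom])
    show z: "\<psi> x = 0" if "x \<notin> \<Omega>" for x using that K by auto
    show "\<psi> \<in> L2 lborel"
      using L2_lebesgue_on_borel(1)[of \<psi> \<Omega>] z C1_compact_L2(1)[OF \<psi>] by auto
  qed
  have q0: "(\<integral>x. ?q n x \<partial>lborel) = 0" for n
    using lborel_translation[of \<psi> "(1 / real (Suc n)) *\<^sub>R i"] \<psi>i
    by (simp add: Bochner_Integration.integral_diff)
  have "(\<lambda>n. \<integral>x. ?q n x \<partial>lborel) \<longlonglongrightarrow> (\<integral>x. E x i \<partial>lborel)"
  proof (rule integral_dominated_convergence)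
    show "(\<lambda>x. E x i) \<in> borel_measurable lborel" using cE borel_measurable_continuous_onI by auto
    show "?q n \<in> borel_measurable lborel" for n by measurable
    show "integrable lborel (\<lambda>x. \<bar>B\<bar> * indicator ?B x)"
      using emeasure_lborel_cball_finite[of "0::'a" "R + 1"] by (intro integrable_mult_right) (simp add: integrable_indicator_iff)
    show "AE x in lborel. (\<lambda>n. ?q n x) \<longlonglongrightarrow> E x i"
    proof (rule AE_I2)
      fix x
      have "((\<lambda>s. \<psi> (x + s *\<^sub>R i)) has_real_derivative E x i) (at 0)" using der[of x 0] by simp
      then have L: "((\<lambda>s. (\<psi> (x + s *\<^sub>R i) - \<psi> x) / s) \<longlongrightarrow> E x i) (at 0)"
        by (simp add: has_field_derivative_iff)
      have "filterlim (\<lambda>n. 1 / real (Suc n)) (at 0) sequentially"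
        using LIMSEQ_inverse_real_of_nat by (simp add: filterlim_at inverse_eq_divide)
      from filterlim_compose[OF L this] show "(\<lambda>n. ?q n x) \<longlonglongrightarrow> E x i" by simp
    qed
    fix n
    show "AE x in lborel. norm (?q n x) \<le> \<bar>B\<bar> * indicator ?B x"
    proof (rule AE_I2)
      fix x
      let ?t = "1 / real (Suc n)"
      show "norm (?q n x) \<le> \<bar>B\<bar> * indicator ?B x"
      proof (cases "x \<in> ?B")
        case True
        have "norm (?q n x) = \<bar>\<psi> (x + ?t *\<^sub>R i) - \<psi> x\<bar> * real (Suc n)" by (simp add: abs_mult)
        also have "\<dots> \<le> (\<bar>B\<bar> * ?t) * real (Suc n)" using lip[of ?t x] by (intro mult_right_mono) auto
        also have "\<dots> = \<bar>B\<bar>" by simp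
        finally show ?thesis using True by simp
      next
        case False
        have "norm (?t *\<^sub>R i) \<le> 1" using i by simp
        moreover have "norm x - norm (?t *\<^sub>R i) \<le> norm (x + ?t *\<^sub>R i)"
          using norm_triangle_ineq2[of x "- (?t *\<^sub>R i)"] by simp
        moreover have "norm x > R + 1" using False by simp
        ultimately have "norm x \<ge> R" "norm (x + ?t *\<^sub>R i) \<ge> R" by linarith+
        then have "x \<notin> \<Omega>" "x + ?t *\<^sub>R i \<notin> \<Omega>" using R by auto
        then have "x \<notin> K" "x + ?t *\<^sub>R i \<notin> K" using K(2) by auto
        then show ?thesis using K(3) by simp
      qed
    qed
  qed
  then have "(\<integral>x. E x i \<partial>lborel) = 0" unfolding q0 by (simp add: LIMSEQ_const_iff)
  then show ?thesis
    using lebesgue_on_integral_borel(2)[of "\<lambda>x. E x i" \<Omega>] cE K(2,5) borel_measurable_continuous_onI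
    unfolding E_def by (metis dom_borel subsetD)
qed

definition gradient :: "('a \<Rightarrow> 'a \<Rightarrow> real) \<Rightarrow> 'a \<Rightarrow> 'a" where
  "gradient D x = (\<Sum>i\<in>Basis. D x i *\<^sub>R i)"

lemma gradient_inner: "i \<in> Basis \<Longrightarrow> gradient D x \<bullet> i = D x i"
  by (simp add: gradient_def inner_sum_left inner_Basis if_distrib cong: if_cong)

lemma C1_fun_H1_gradient:
  assumes w: "C1_fun w D"
  shows "H1_gradient \<Omega> w (gradient D)"
  unfolding H1_gradient_def weak_gradient_def
proof (intro conjI ballI)
  fix i :: 'a assume i: "i \<in> Basis"
  show "(\<lambda>x. gradient D x \<bullet> i) \<in> L2 (lebesgue_on \<Omega>)"
    using C1_fun_L2(2)[OF w] by (simp add: gradient_inner[OF i])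
  fix \<phi> assume \<phi>: "\<phi> \<in> C1_compact \<Omega>"
  have "0 = (\<integral>x. w x * frechet_derivative \<phi> (at x) i + D x i * \<phi> x \<partial>lebesgue_on \<Omega>)"
    using integral_derivative_zero[OF C1_compact_mult(1)[OF \<phi> w] i] by (simp add: C1_compact_mult(2)[OF \<phi> w])
  also have "\<dots> = (\<integral>x. w x * frechet_derivative \<phi> (at x) i \<partial>lebesgue_on \<Omega>) + (\<integral>x. D x i * \<phi> x \<partial>lebesgue_on \<Omega>)"
    by (intro Bochner_Integration.integral_add L2_mult_integrable C1_fun_L2[OF w] C1_compact_L2[OF \<phi>])
  finally show "(\<integral>x. w x * frechet_derivative \<phi> (at x) i \<partial>lebesgue_on \<Omega>) = - (\<integral>x. (gradient D x \<bullet> i) * \<phi> x \<partial>lebesgue_on \<Omega>)"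
    by (simp add: gradient_inner[OF i])
qed

lemma C1_fun_times_L2:
  assumes "C1_fun \<zeta> D" "u \<in> L2 (lebesgue_on \<Omega>)"
  shows "(\<lambda>x. \<zeta> x * u x) \<in> L2 (lebesgue_on \<Omega>)" "i \<in> Basis \<Longrightarrow> (\<lambda>x. D x i * u x) \<in> L2 (lebesgue_on \<Omega>)"
proof -
  obtain B where B: "\<And>x. x \<in> \<Omega> \<Longrightarrow> \<bar>\<zeta> x\<bar> \<le> B" "\<And>x i. x \<in> \<Omega> \<Longrightarrow> i \<in> Basis \<Longrightarrow> \<bar>D x i\<bar> \<le> B"
    using C1_fun_bounded[OF assms(1)] by blast
  have *: "(\<lambda>x. f x * u x) \<in> L2 (lebesgue_on \<Omega>)" if f: "f \<in> L2 (lebesgue_on \<Omega>)" "\<And>x. x \<in> \<Omega> \<Longrightarrow> \<bar>f x\<bar> \<le> B" for f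
  proof (rule L2_bound[OF assms(2)])
    show "(\<lambda>x. f x * u x) \<in> borel_measurable (lebesgue_on \<Omega>)"
      using L2_measurable[OF f(1)] L2_measurable[OF assms(2)] by simp
    show "AE x in lebesgue_on \<Omega>. \<bar>f x * u x\<bar> \<le> B * \<bar>u x\<bar>"
      using AE_space by eventually_elim (use f(2) in \<open>auto simp: abs_mult intro: mult_right_mono\<close>)
  qed
  show "(\<lambda>x. \<zeta> x * u x) \<in> L2 (lebesgue_on \<Omega>)" using * C1_fun_L2(1)[OF assms(1)] B(1) by blast
  show "(\<lambda>x. D x i * u x) \<in> L2 (lebesgue_on \<Omega>)" if "i \<in> Basis"
    using *[of "\<lambda>x. D x i"] C1_fun_L2(2)[OF assms(1)] B(2) that by blast
qed

lemma H1_gradient_mult: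
  assumes \<zeta>: "C1_fun \<zeta> D" and u: "u \<in> L2 (lebesgue_on \<Omega>)" "H1_gradient \<Omega> u G"
  shows "H1_gradient \<Omega> (\<lambda>x. \<zeta> x * u x) (\<lambda>x. \<zeta> x *\<^sub>R G x + u x *\<^sub>R gradient D x)"
  unfolding H1_gradient_def weak_gradient_def
proof (intro conjI ballI)
  fix i :: 'a assume i: "i \<in> Basis"
  have eq: "(\<zeta> x *\<^sub>R G x + u x *\<^sub>R gradient D x) \<bullet> i = \<zeta> x * (G x \<bullet> i) + D x i * u x" for x
    by (simp add: inner_add_left gradient_inner[OF i])
  note L = C1_fun_times_L2(1)[OF \<zeta> H1_gradientD(1)[OF u(2) i]] C1_fun_times_L2(2)[OF \<zeta> u(1) i]
  show "(\<lambda>x. (\<zeta> x *\<^sub>R G x + u x *\<^sub>R gradient D x) \<bullet> i) \<in> L2 (lebesgue_on \<Omega>)"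
    unfolding eq by (rule L2_add[OF L])
  fix \<phi> assume \<phi>: "\<phi> \<in> C1_compact \<Omega>"
  have "(\<integral>x. u x * (\<zeta> x * frechet_derivative \<phi> (at x) i + D x i * \<phi> x) \<partial>lebesgue_on \<Omega>) =
      - (\<integral>x. (G x \<bullet> i) * (\<zeta> x * \<phi> x) \<partial>lebesgue_on \<Omega>)"
    using H1_gradientD(2)[OF u(2) C1_compact_mult(1)[OF \<phi> \<zeta>] i] by (simp add: C1_compact_mult(2)[OF \<phi> \<zeta>])
  moreover have "(\<integral>x. u x * (\<zeta> x * frechet_derivative \<phi> (at x) i + D x i * \<phi> x) \<partial>lebesgue_on \<Omega>) =
      (\<integral>x. \<zeta> x * u x * frechet_derivative \<phi> (at x) i \<partial>lebesgue_on \<Omega>) + (\<integral>x. D x i * u x * \<phi> x \<partial>lebesgue_on \<Omega>)"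
    using L2_mult_integrable[OF C1_fun_times_L2(1)[OF \<zeta> u(1)] C1_compact_L2(2)[OF \<phi>, of i]]
      L2_mult_integrable[OF L(2) C1_compact_L2(1)[OF \<phi>]]
    by (subst Bochner_Integration.integral_add[symmetric]) (auto simp: algebra_simps)
  moreover have "(\<integral>x. ((\<zeta> x *\<^sub>R G x + u x *\<^sub>R gradient D x) \<bullet> i) * \<phi> x \<partial>lebesgue_on \<Omega>) =
      (\<integral>x. (G x \<bullet> i) * (\<zeta> x * \<phi> x) \<partial>lebesgue_on \<Omega>) + (\<integral>x. D x i * u x * \<phi> x \<partial>lebesgue_on \<Omega>)"
    using L2_mult_integrable[OF L(1) C1_compact_L2(1)[OF \<phi>]]
      L2_mult_integrable[OF L(2) C1_compact_L2(1)[OF \<phi>]]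
    unfolding eq by (subst Bochner_Integration.integral_add[symmetric]) (auto simp: algebra_simps)
  ultimately show "(\<integral>x. \<zeta> x * u x * frechet_derivative \<phi> (at x) i \<partial>lebesgue_on \<Omega>) =
      - (\<integral>x. ((\<zeta> x *\<^sub>R G x + u x *\<^sub>R gradient D x) \<bullet> i) * \<phi> x \<partial>lebesgue_on \<Omega>)" by linarith
qed

lemma H1_L2: "u \<in> H1 \<Omega> \<Longrightarrow> u \<in> L2 (lebesgue_on \<Omega>)"
  by (simp add: H1_def)

lemma H1_I: "u \<in> L2 (lebesgue_on \<Omega>) \<Longrightarrow> H1_gradient \<Omega> u G \<Longrightarrow> u \<in> H1 \<Omega>"
  by (auto simp: H1_def)

lemma H1_wgrad: "u \<in> H1 \<Omega> \<Longrightarrow> H1_gradient \<Omega> u (wgrad \<Omega> u)"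
  using someI_ex[of "H1_gradient \<Omega> u"] by (auto simp: wgrad_def H1_def)

lemma C1_fun_H1: "C1_fun w D \<Longrightarrow> w \<in> H1 \<Omega>"
  by (rule H1_I[OF C1_fun_L2(1) C1_fun_H1_gradient])

lemma H1_lin: "u \<in> H1 \<Omega> \<Longrightarrow> v \<in> H1 \<Omega> \<Longrightarrow> (\<lambda>x. c * u x + d * v x) \<in> H1 \<Omega>"
  by (rule H1_I[OF L2_lin[OF H1_L2 H1_L2] H1_gradient_lin[OF H1_L2 H1_wgrad H1_L2 H1_wgrad]])

lemma H1_add: "u \<in> H1 \<Omega> \<Longrightarrow> v \<in> H1 \<Omega> \<Longrightarrow> (\<lambda>x. u x + v x) \<in> H1 \<Omega>"
  using H1_lin[of u v 1 1] by simp

lemma H1_diff: "u \<in> H1 \<Omega> \<Longrightarrow> v \<in> H1 \<Omega> \<Longrightarrow> (\<lambda>x. u x - v x) \<in> H1 \<Omega>"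
  using H1_lin[of u v 1 "-1"] by simp

lemma H1_cmult: "u \<in> H1 \<Omega> \<Longrightarrow> (\<lambda>x. c * u x) \<in> H1 \<Omega>"
  using H1_lin[of u u c 0] by simp

lemma H1_uminus: "u \<in> H1 \<Omega> \<Longrightarrow> (\<lambda>x. - u x) \<in> H1 \<Omega>"
  using H1_cmult[of u "-1"] by simp

lemma H1_zero: "(\<lambda>x. 0) \<in> H1 \<Omega>"
  using C1_fun_H1[OF C1_fun_const[of 0]] .

lemma H1_gradient_inner_integrable:
  assumes "H1_gradient \<Omega> u G" "H1_gradient \<Omega> v H"
  shows "integrable (lebesgue_on \<Omega>) (\<lambda>x. G x \<bullet> H x)"
    "(\<lambda>x. G x \<bullet> H x) \<in> borel_measurable (lebesgue_on \<Omega>)"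
proof -
  have eq: "G x \<bullet> H x = (\<Sum>i\<in>Basis. (G x \<bullet> i) * (H x \<bullet> i))" for x by (rule euclidean_inner)
  show "integrable (lebesgue_on \<Omega>) (\<lambda>x. G x \<bullet> H x)"
    unfolding eq
    by (intro Bochner_Integration.integrable_sum L2_mult_integrable H1_gradientD(1)[OF assms(1)] H1_gradientD(1)[OF assms(2)])
  then show "(\<lambda>x. G x \<bullet> H x) \<in> borel_measurable (lebesgue_on \<Omega>)" by simp
qed

lemma dirichlet_form_eq:
  assumes u: "u \<in> L2 (lebesgue_on \<Omega>)" "H1_gradient \<Omega> u G" and v: "v \<in> L2 (lebesgue_on \<Omega>)" "H1_gradient \<Omega> v H"
  shows "dirichlet_form \<Omega> u v = (\<integral>x. G x \<bullet> H x \<partial>lebesgue_on \<Omega>)"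
  unfolding dirichlet_form_def
proof (rule integral_cong_AE)
  have uH: "H1_gradient \<Omega> u (wgrad \<Omega> u)" "H1_gradient \<Omega> v (wgrad \<Omega> v)"
    using H1_wgrad[OF H1_I[OF u]] H1_wgrad[OF H1_I[OF v]] .
  show "AE x in lebesgue_on \<Omega>. wgrad \<Omega> u x \<bullet> wgrad \<Omega> v x = G x \<bullet> H x"
    using H1_gradient_unique[OF uH(1) u(2,1,1)] H1_gradient_unique[OF uH(2) v(2,1,1)] by auto
qed (use H1_gradient_inner_integrable(2) u v H1_wgrad[OF H1_I[OF u]] H1_wgrad[OF H1_I[OF v]] in blast)+

lemma dirichlet_form_lin_left:
  assumes "u \<in> H1 \<Omega>" "v \<in> H1 \<Omega>" "w \<in> H1 \<Omega>"
  shows "dirichlet_form \<Omega> (\<lambda>x. c * u x + d * v x) w = c * dirichlet_form \<Omega> u w + d * dirichlet_form \<Omega> v w"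
proof -
  note g = assms[THEN H1_wgrad] and l = assms[THEN H1_L2]
  have "dirichlet_form \<Omega> (\<lambda>x. c * u x + d * v x) w =
      (\<integral>x. c * (wgrad \<Omega> u x \<bullet> wgrad \<Omega> w x) + d * (wgrad \<Omega> v x \<bullet> wgrad \<Omega> w x) \<partial>lebesgue_on \<Omega>)"
    using dirichlet_form_eq[OF L2_lin[OF l(1,2)] H1_gradient_lin[OF l(1) g(1) l(2) g(2)] l(3) g(3), of c d]
    by (simp add: inner_add_left)
  then show ?thesis
    using H1_gradient_inner_integrable(1)[OF g(1,3)] H1_gradient_inner_integrable(1)[OF g(2,3)]
    by (simp add: dirichlet_form_def)
qed

lemma dirichlet_form_commute: "dirichlet_form \<Omega> u v = dirichlet_form \<Omega> v u"
  by (simp add: dirichlet_form_def inner_commute)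

lemma dirichlet_form_lin_right:
  assumes "u \<in> H1 \<Omega>" "v \<in> H1 \<Omega>" "w \<in> H1 \<Omega>"
  shows "dirichlet_form \<Omega> w (\<lambda>x. c * u x + d * v x) = c * dirichlet_form \<Omega> w u + d * dirichlet_form \<Omega> w v"
  using dirichlet_form_lin_left[OF assms, of c d] by (simp add: dirichlet_form_commute)

lemma dirichlet_form_nonneg: "0 \<le> dirichlet_form \<Omega> u u"
  unfolding dirichlet_form_def by (rule Bochner_Integration.integral_nonneg) simp

lemma H1_norm_power2: "(H1_norm \<Omega> u)\<^sup>2 = (L2_norm (lebesgue_on \<Omega>) u)\<^sup>2 + dirichlet_form \<Omega> u u"
  using dirichlet_form_nonneg[of u] by (simp add: H1_norm_def)

lemma H1_norm_nonneg: "0 \<le> H1_norm \<Omega> u"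
  using dirichlet_form_nonneg[of u] by (simp add: H1_norm_def)

lemma L2_norm_le_H1_norm: "L2_norm (lebesgue_on \<Omega>) u \<le> H1_norm \<Omega> u"
  using H1_norm_power2[of u] dirichlet_form_nonneg[of u] H1_norm_nonneg[of u]
  by (auto intro: power2_le_imp_le[of "L2_norm (lebesgue_on \<Omega>) u"])

lemma H1_norm_lin_power2:
  assumes "u \<in> H1 \<Omega>" "v \<in> H1 \<Omega>"
  shows "(H1_norm \<Omega> (\<lambda>x. c * u x + d * v x))\<^sup>2 = c\<^sup>2 * (H1_norm \<Omega> u)\<^sup>2 + d\<^sup>2 * (H1_norm \<Omega> v)\<^sup>2
    + 2 * c * d * (L2_inner (lebesgue_on \<Omega>) u v + dirichlet_form \<Omega> u v)"
  unfolding H1_norm_power2 L2_norm_lin_power2[OF assms[THEN H1_L2]]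
  by (simp add: dirichlet_form_lin_left assms H1_lin dirichlet_form_lin_right dirichlet_form_commute[of v u]
      power2_eq_square algebra_simps)

lemma H1_norm_lin_le_power2:
  assumes "u \<in> H1 \<Omega>" "v \<in> H1 \<Omega>"
  shows "(H1_norm \<Omega> (\<lambda>x. c * u x + d * v x))\<^sup>2 \<le> 2 * c\<^sup>2 * (H1_norm \<Omega> u)\<^sup>2 + 2 * d\<^sup>2 * (H1_norm \<Omega> v)\<^sup>2"
proof -
  define I where "I = L2_inner (lebesgue_on \<Omega>) u v + dirichlet_form \<Omega> u v"
  have "2 * c * (- d) * I = - (2 * c * d * I)" by simp
  then have "0 \<le> c\<^sup>2 * (H1_norm \<Omega> u)\<^sup>2 + d\<^sup>2 * (H1_norm \<Omega> v)\<^sup>2 - 2 * c * d * I"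
    using H1_norm_lin_power2[OF assms, of c "- d"] zero_le_power2[of "H1_norm \<Omega> (\<lambda>x. c * u x + (- d) * v x)"]
    unfolding I_def power2_minus by linarith
  then show ?thesis using H1_norm_lin_power2[OF assms, of c d] unfolding I_def by linarith
qed

lemma H1_norm_cmult: "u \<in> H1 \<Omega> \<Longrightarrow> H1_norm \<Omega> (\<lambda>x. c * u x) = \<bar>c\<bar> * H1_norm \<Omega> u"
proof -
  assume "u \<in> H1 \<Omega>"
  then have "(H1_norm \<Omega> (\<lambda>x. c * u x))\<^sup>2 = (\<bar>c\<bar> * H1_norm \<Omega> u)\<^sup>2"
    using H1_norm_lin_power2[of u u c 0] by (simp add: power_mult_distrib)
  then show ?thesis by (rule power2_eq_imp_eq) (auto simp: H1_norm_nonneg)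
qed

lemma H1_norm_le:
  assumes "u \<in> L2 (lebesgue_on \<Omega>)" "H1_gradient \<Omega> u G" "L2_norm (lebesgue_on \<Omega>) u \<le> \<epsilon>"
    "\<And>i. i \<in> Basis \<Longrightarrow> L2_norm (lebesgue_on \<Omega>) (\<lambda>x. G x \<bullet> i) \<le> \<epsilon>"
  shows "H1_norm \<Omega> u \<le> sqrt (1 + DIM('a)) * \<epsilon>"
proof (rule power2_le_imp_le)
  have \<epsilon>: "0 \<le> \<epsilon>" using assms(3) L2_norm_nonneg order_trans by blast
  then show "0 \<le> sqrt (1 + DIM('a)) * \<epsilon>" by simp
  have "dirichlet_form \<Omega> u u = (\<integral>x. (\<Sum>i\<in>Basis. (G x \<bullet> i)\<^sup>2) \<partial>lebesgue_on \<Omega>)"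
    unfolding dirichlet_form_eq[OF assms(1,2,1,2)] by (subst euclidean_inner) (simp add: power2_eq_square)
  also have "\<dots> = (\<Sum>i\<in>Basis. (L2_norm (lebesgue_on \<Omega>) (\<lambda>x. G x \<bullet> i))\<^sup>2)"
    unfolding L2_norm_power2
    by (intro Bochner_Integration.integral_sum L2_square_integrable H1_gradientD(1)[OF assms(2)])
  also have "\<dots> \<le> (\<Sum>i\<in>(Basis::'a set). \<epsilon>\<^sup>2)" using assms(4) by (intro sum_mono power_mono) auto
  finally have "dirichlet_form \<Omega> u u \<le> DIM('a) * \<epsilon>\<^sup>2" by simp
  moreover have "(L2_norm (lebesgue_on \<Omega>) u)\<^sup>2 \<le> \<epsilon>\<^sup>2" using assms(3) by (intro power_mono) auto
  ultimately show "(H1_norm \<Omega> u)\<^sup>2 \<le> (sqrt (1 + DIM('a)) * \<epsilon>)\<^sup>2"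
    unfolding H1_norm_power2 by (simp add: power_mult_distrib algebra_simps)
qed

end

section \<open>Density of continuously differentiable functions\<close>

definition cone_patch :: "'a::euclidean_space set \<Rightarrow> 'a \<Rightarrow> real \<Rightarrow> 'a \<Rightarrow> real \<Rightarrow> real \<Rightarrow> bool" where
  "cone_patch \<Omega> x\<^sub>0 r d \<kappa> s\<^sub>0 \<longleftrightarrow> 0 < r \<and> norm d \<le> 1 \<and> 0 < \<kappa> \<and> 0 < s\<^sub>0 \<and>
     (\<forall>x\<in>\<Omega> \<inter> ball x\<^sub>0 r. \<forall>s. 0 < s \<longrightarrow> s < s\<^sub>0 \<longrightarrow> ball (x + s *\<^sub>R d) (\<kappa> * s) \<subseteq> \<Omega>)"

lemma regular_domain_cone_patch:
  fixes \<Omega> :: "'a::euclidean_space set"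
  assumes \<Omega>: "regular_domain \<Omega>" and x0: "x\<^sub>0 \<in> closure \<Omega>"
  obtains r d \<kappa> s\<^sub>0 where "cone_patch \<Omega> x\<^sub>0 r d \<kappa> s\<^sub>0"
proof (cases "x\<^sub>0 \<in> \<Omega>")
  case True
  then obtain R where R: "R > 0" "ball x\<^sub>0 R \<subseteq> \<Omega>"
    using \<Omega> open_contains_ball unfolding regular_domain_def by blast
  have "ball (x + s *\<^sub>R 0) (1 * s) \<subseteq> \<Omega>" if "x \<in> \<Omega> \<inter> ball x\<^sub>0 (R/2)" "0 < s" "s < R / 2" for x s
  proof
    fix y assume "y \<in> ball (x + s *\<^sub>R 0) (1 * s)"
    then have "dist x\<^sub>0 y < R" using that dist_triangle[of x\<^sub>0 y x] by auto
    then show "y \<in> \<Omega>" using R(2) by auto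
  qed
  then have "cone_patch \<Omega> x\<^sub>0 (R/2) 0 1 (R/2)" using R(1) by (simp add: cone_patch_def)
  then show ?thesis by (rule that)
next
  case False
  then have "x\<^sub>0 \<in> frontier \<Omega>" using x0 \<Omega> by (simp add: frontier_def regular_domain_def interior_open)
  then obtain R d \<psi> L where R: "R > 0" and d: "norm d = 1" and \<psi>: "L-lipschitz_on UNIV \<psi>"
    "\<And>y c. \<psi> (y + c *\<^sub>R d) = \<psi> y" and \<Omega>R: "\<Omega> \<inter> ball x\<^sub>0 R = {y \<in> ball x\<^sub>0 R. \<psi> y < y \<bullet> d}"
    using \<Omega> unfolding regular_domain_def lipschitz_boundary_def by meson
  have L: "0 \<le> L" using \<psi>(1) by (rule lipschitz_on_nonneg)
  have \<kappa>1: "1 / (1 + L) \<le> 1" using L by simp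
  have "ball (x + s *\<^sub>R d) (1 / (1 + L) * s) \<subseteq> \<Omega>" if x: "x \<in> \<Omega> \<inter> ball x\<^sub>0 (R/2)" and s: "0 < s" "s < R / 4" for x s
  proof
    fix y assume y: "y \<in> ball (x + s *\<^sub>R d) (1 / (1 + L) * s)"
    define z where "z = y - (x + s *\<^sub>R d)"
    have yz: "y = (x + z) + s *\<^sub>R d" by (simp add: z_def)
    have z: "norm z < s / (1 + L)" using y by (simp add: z_def dist_norm norm_minus_commute)
    then have zL: "(1 + L) * norm z < s" using L by (simp add: field_simps)
    have "norm z + L * norm z < s" using zL by (simp add: distrib_right)
    moreover have "0 \<le> L * norm z" using L by simp
    ultimately have zs: "norm z < s" by linarith
    have "dist x y = norm (z + s *\<^sub>R d)" by (subst dist_commute) (simp add: yz dist_norm)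
    then have "dist x y \<le> norm z + s" using norm_triangle_ineq[of z "s *\<^sub>R d"] d s(1) by simp
    then have yR: "y \<in> ball x\<^sub>0 R" using dist_triangle[of x\<^sub>0 y x] x s zs by auto
    have "x \<in> \<Omega> \<inter> ball x\<^sub>0 R" using x R by auto
    then have "\<psi> x < x \<bullet> d" unfolding \<Omega>R by blast
    moreover have "\<psi> y = \<psi> (x + z)" unfolding yz by (rule \<psi>(2))
    moreover have "\<bar>\<psi> (x + z) - \<psi> x\<bar> \<le> L * norm z"
      using lipschitz_onD[OF \<psi>(1), of "x + z" x] by (simp add: dist_norm)
    moreover have "\<bar>z \<bullet> d\<bar> \<le> norm z" using Cauchy_Schwarz_ineq2[of z d] d by simp
    moreover have "y \<bullet> d = x \<bullet> d + z \<bullet> d + s"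
      using d by (simp add: yz inner_add_left norm_eq_1)
    ultimately have "\<psi> y < y \<bullet> d" using zL by (simp add: algebra_simps)
    then have "y \<in> {y \<in> ball x\<^sub>0 R. \<psi> y < y \<bullet> d}" using yR by blast
    then show "y \<in> \<Omega>" unfolding \<Omega>R[symmetric] by blast
  qed
  then have "cone_patch \<Omega> x\<^sub>0 (R/2) d (1 / (1 + L)) (R/4)"
    using R d L by (auto simp: cone_patch_def)
  then show ?thesis by (rule that)
qed

lemma mollifier_deriv_eq_0: "e > 0 \<Longrightarrow> e \<le> norm z \<Longrightarrow> mollifier_deriv e z h = 0"
proof -
  assume "e > 0" "e \<le> norm z"
  then have "e\<^sup>2 \<le> (norm z)\<^sup>2" by (intro power_mono) auto
  then show ?thesis by (simp add: mollifier_deriv_def power2_norm_eq_inner)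
qed

lemma C1_fun_deriv_zero:
  assumes f: "C1_fun f D" and S: "open S" "\<And>y. y \<in> S \<Longrightarrow> f y = 0" and x: "x \<in> S"
  shows "D x h = 0"
proof -
  have "(f has_derivative (\<lambda>_. 0)) (at x)"
    by (rule has_derivative_transform_within_open[of "\<lambda>_. 0" "\<lambda>_. 0" _ _ S]) (use S x in auto)
  then have "D x = (\<lambda>_. 0)" using f has_derivative_unique unfolding C1_fun_def by blast
  then show ?thesis by simp
qed

lemma L2_norm_lebesgue_on_le:
  fixes f :: "'a::euclidean_space \<Rightarrow> real"
  assumes f: "f \<in> L2 lborel" and \<Omega>: "\<Omega> \<in> sets borel"
  shows "L2_norm (lebesgue_on \<Omega>) f \<le> L2_norm lborel f"
proof -
  have fm: "f \<in> borel_measurable borel" using f by (auto dest: L2_measurable)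
  let ?g = "\<lambda>x. indicator \<Omega> x * f x"
  have "L2_norm (lebesgue_on \<Omega>) f = L2_norm (lebesgue_on \<Omega>) ?g"
    unfolding L2_norm_def L2_inner_def by (intro arg_cong[of _ _ sqrt] Bochner_Integration.integral_cong) auto
  also have "\<dots> = L2_norm lborel ?g"
    using fm \<Omega> by (intro L2_lebesgue_on_borel(2)) auto
  also have "\<dots> \<le> L2_norm lborel f"
    using fm \<Omega> f by (intro L2_norm_mono) (auto simp: indicator_def)
  finally show ?thesis .
qed

context bounded_open
begin

definition C1_approximable :: "('a \<Rightarrow> real) \<Rightarrow> ('a \<Rightarrow> 'a) \<Rightarrow> bool" where
  "C1_approximable u G \<longleftrightarrow> (\<forall>\<eta>>0. \<exists>w D. C1_fun w D \<and> L2_norm (lebesgue_on \<Omega>) (\<lambda>x. u x - w x) \<le> \<eta> \<and>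
     (\<forall>i\<in>Basis. L2_norm (lebesgue_on \<Omega>) (\<lambda>x. G x \<bullet> i - D x i) \<le> \<eta>))"

lemma mollify_representative:
  assumes u: "u \<in> L2 (lebesgue_on \<Omega>)"
    and v: "v \<in> borel_measurable borel" "\<And>x. x \<notin> \<Omega> \<Longrightarrow> v x = 0" "AE x in lebesgue_on \<Omega>. u x = v x"
    and k: "k \<in> borel_measurable borel"
  shows "(\<integral>y. v y * k (c - y) \<partial>lborel) = (\<integral>y. u y * k (c - y) \<partial>lebesgue_on \<Omega>)"
proof -
  note [measurable] = v(1) k
  have km: "(\<lambda>y. k (c - y)) \<in> borel_measurable (lebesgue_on \<Omega>)"
    by (rule lebesgue_on_measurable_borel) simp
  have "(\<integral>y. v y * k (c - y) \<partial>lborel) = (\<integral>y. v y * k (c - y) \<partial>lebesgue_on \<Omega>)"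
    by (rule lebesgue_on_integral_borel(2)[symmetric]) (auto simp: v(2))
  also have "\<dots> = (\<integral>y. u y * k (c - y) \<partial>lebesgue_on \<Omega>)"
  proof (rule integral_cong_AE)
    show "AE y in lebesgue_on \<Omega>. v y * k (c - y) = u y * k (c - y)"
      using v(3) by eventually_elim simp
  qed (use km L2_measurable[OF u] lebesgue_on_measurable_borel[OF v(1)] in auto)
  finally show ?thesis .
qed

lemma C1_approximable_local:
  assumes patch: "cone_patch \<Omega> x\<^sub>0 r d \<kappa> s\<^sub>0"
    and u: "u \<in> L2 (lebesgue_on \<Omega>)" "H1_gradient \<Omega> u G"
    and u0: "\<And>x. x \<in> \<Omega> \<Longrightarrow> dist x\<^sub>0 x \<ge> r / 2 \<Longrightarrow> u x = 0 \<and> G x = 0"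
  shows "C1_approximable u G"
  unfolding C1_approximable_def
proof (intro allI impI)
  fix \<eta> :: real assume \<eta>: "\<eta> > 0"
  have p: "0 < r" "norm d \<le> 1" "0 < \<kappa>" "0 < s\<^sub>0"
    "\<And>x s. x \<in> \<Omega> \<Longrightarrow> dist x\<^sub>0 x < r \<Longrightarrow> 0 < s \<Longrightarrow> s < s\<^sub>0 \<Longrightarrow> ball (x + s *\<^sub>R d) (\<kappa> * s) \<subseteq> \<Omega>"
    using patch unfolding cone_patch_def by auto
  have rep: "\<exists>v. v \<in> borel_measurable borel \<and> (\<forall>x. x \<notin> \<Omega> \<longrightarrow> v x = 0) \<and> (AE x in lebesgue_on \<Omega>. f x = v x) \<and>
      v \<in> L2 (lebesgue_on \<Omega>) \<and> v \<in> L2 lborel" if "f \<in> L2 (lebesgue_on \<Omega>)" for f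
    using L2_borel_representative[OF that open_dom] by metis
  obtain v where v: "v \<in> borel_measurable borel" "\<And>x. x \<notin> \<Omega> \<Longrightarrow> v x = 0" "AE x in lebesgue_on \<Omega>. u x = v x"
    "v \<in> L2 (lebesgue_on \<Omega>)" "v \<in> L2 lborel" using rep[OF u(1)] by blast
  have "\<forall>i\<in>Basis. \<exists>v. v \<in> borel_measurable borel \<and> (\<forall>x. x \<notin> \<Omega> \<longrightarrow> v x = 0) \<and> (AE x in lebesgue_on \<Omega>. G x \<bullet> i = v x) \<and>
      v \<in> L2 (lebesgue_on \<Omega>) \<and> v \<in> L2 lborel" (is "\<forall>i\<in>Basis. \<exists>v. ?R i v")
    using rep H1_gradientD(1)[OF u(2)] by blast
  then obtain g where "\<forall>i\<in>Basis. ?R i (g i)" using bchoice[of Basis ?R] by blast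
  then have g: "\<And>i. i \<in> Basis \<Longrightarrow> g i \<in> borel_measurable borel" "\<And>i x. i \<in> Basis \<Longrightarrow> x \<notin> \<Omega> \<Longrightarrow> g i x = 0"
    "\<And>i. i \<in> Basis \<Longrightarrow> AE x in lebesgue_on \<Omega>. G x \<bullet> i = g i x" "\<And>i. i \<in> Basis \<Longrightarrow> g i \<in> L2 (lebesgue_on \<Omega>)"
    "\<And>i. i \<in> Basis \<Longrightarrow> g i \<in> L2 lborel" by blast+
  let ?P = "\<lambda>\<tau> f. \<tau> > 0 \<and> (\<forall>e a. e > 0 \<longrightarrow> e + norm a < \<tau> \<longrightarrow>
    (\<lambda>x. mollify e a f x - f x) \<in> L2 lborel \<and> L2_norm lborel (\<lambda>x. mollify e a f x - f x) \<le> \<eta>)"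
  obtain \<tau>\<^sub>0 where \<tau>0: "?P \<tau>\<^sub>0 v" using mollify_L2[OF open_dom bounded_dom v(5,2) \<eta>] by metis
  have "\<exists>\<tau>. ?P \<tau> (g i)" if i: "i \<in> Basis" for i
    using mollify_L2[OF open_dom bounded_dom g(5)[OF i] g(2)[OF i] \<eta>] by metis
  then have "\<forall>i\<in>Basis. \<exists>\<tau>. ?P \<tau> (g i)" by blast
  then obtain \<tau> where "\<forall>i\<in>Basis. ?P (\<tau> i) (g i)" using bchoice[of Basis "\<lambda>i \<tau>. ?P \<tau> (g i)"] by blast
  then have \<tau>: "\<And>i. i \<in> Basis \<Longrightarrow> ?P (\<tau> i) (g i)" by blast
  define t where "t = Min (insert \<tau>\<^sub>0 (\<tau> ` Basis))"
  have "t > 0" unfolding t_def using \<tau>0 \<tau> by (subst Min_gr_iff) auto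
  moreover have "t \<le> \<tau>\<^sub>0" unfolding t_def by (rule Min_le) auto
  moreover have "t \<le> \<tau> i" if "i \<in> Basis" for i unfolding t_def using that by (intro Min_le) auto
  ultimately have t: "t > 0" "t \<le> \<tau>\<^sub>0" "\<And>i. i \<in> Basis \<Longrightarrow> t \<le> \<tau> i" by auto
  define s where "s = min (s\<^sub>0 / 2) (min (r / 4) (t / 2) / (1 + \<kappa>))"
  have q: "0 < min (r / 4) (t / 2) / (1 + \<kappa>)" using p t by simp
  then have s: "s > 0" "s < s\<^sub>0" using p by (auto simp: s_def)
  have "s * (1 + \<kappa>) \<le> min (r / 4) (t / 2)"
    using p(3) mult_right_mono[of s "min (r / 4) (t / 2) / (1 + \<kappa>)" "1 + \<kappa>"] by (simp add: s_def)
  then have s': "s * (1 + \<kappa>) < r / 2" "s * (1 + \<kappa>) < t" using p t by auto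
  define e where "e = \<kappa> * s / 2"
  define a where "a = s *\<^sub>R d"
  have e: "e > 0" "e < \<kappa> * s" using s p by (auto simp: e_def)
  have na: "norm a \<le> s" using p(2) s by (simp add: a_def mult_left_le)
  have ea: "e + norm a < r / 2" "e + norm a < t" using e na s' by (auto simp: algebra_simps)
  define D where "D x h = (\<integral>y. v y * mollifier_deriv e (x + a - y) h \<partial>lborel)" for x h
  have vi: "integrable lborel v" by (rule L2_lborel_integrable[OF open_dom bounded_dom v(5,2)])
  have C1: "C1_fun (mollify e a v) D" unfolding D_def by (rule mollify_C1[OF e(1) vi])
  have Dg: "D x i = mollify e a (g i) x" if x: "x \<in> \<Omega>" and i: "i \<in> Basis" for x i
  proof -
    have D1: "D x i = (\<integral>y. u y * mollifier_deriv e (x + a - y) i \<partial>lebesgue_on \<Omega>)"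
      unfolding D_def by (rule mollify_representative[OF u(1) v(1-3)]) auto
    have D2: "mollify e a (g i) x = (\<integral>y. (G y \<bullet> i) * mollifier e (x + a - y) \<partial>lebesgue_on \<Omega>)"
      unfolding mollify_def by (rule mollify_representative[OF H1_gradientD(1)[OF u(2) i] g(1-3)[OF i]]) (auto simp: i)
    show ?thesis
    proof (cases "dist x\<^sub>0 x < r")
      case True
      have "cball (x + a) e \<subseteq> ball (x + s *\<^sub>R d) (\<kappa> * s)" using e by (auto simp: a_def)
      also have "\<dots> \<subseteq> \<Omega>" by (rule p(5)[OF x True s])
      finally have sub: "cball (x + a) e \<subseteq> \<Omega>" .
      show ?thesis
        using H1_gradientD(2)[OF u(2) mollifier_test(1)[OF e(1) sub] i]
        unfolding D1 D2 by (simp add: mollifier_test(2)[OF e(1) sub])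
    next
      case False
      have zero: "u y * mollifier_deriv e (x + a - y) i = 0 \<and> (G y \<bullet> i) * mollifier e (x + a - y) = 0" if y: "y \<in> \<Omega>" for y
      proof (cases "dist x\<^sub>0 y \<ge> r / 2")
        case True
        then show ?thesis using u0[OF y] by simp
      next
        case near: False
        have "dist x\<^sub>0 x \<le> dist x\<^sub>0 y + dist y x" by (rule dist_triangle)
        then have "norm (x - y) > r / 2" using False near by (simp add: dist_norm norm_minus_commute)
        moreover have "norm (x - y) \<le> norm (x + a - y) + norm a"
          using norm_triangle_ineq4[of "x + a - y" a] by (simp add: algebra_simps)
        ultimately have "e \<le> norm (x + a - y)" using ea(1) by linarith
        then show ?thesis by (simp add: mollifier_eq_0[OF e(1)] mollifier_deriv_eq_0[OF e(1)])
      qed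
      have "D x i = (\<integral>y. 0 \<partial>lebesgue_on \<Omega>)" unfolding D1
        by (rule Bochner_Integration.integral_cong) (use zero in auto)
      moreover have "mollify e a (g i) x = (\<integral>y. 0 \<partial>lebesgue_on \<Omega>)" unfolding D2
        by (rule Bochner_Integration.integral_cong) (use zero in auto)
      ultimately show ?thesis by simp
    qed
  qed
  have close: "L2_norm (lebesgue_on \<Omega>) (\<lambda>x. f x - F x) \<le> \<eta>"
    if f: "f \<in> L2 (lebesgue_on \<Omega>)" and k: "k \<in> borel_measurable borel" "AE x in lebesgue_on \<Omega>. f x = k x"
      "(\<lambda>x. mollify e a k x - k x) \<in> L2 lborel" "L2_norm lborel (\<lambda>x. mollify e a k x - k x) \<le> \<eta>"
      "\<And>x. x \<in> \<Omega> \<Longrightarrow> F x = mollify e a k x" for f F k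
  proof -
    have kL: "k \<in> L2 (lebesgue_on \<Omega>)"
      by (rule L2_bound[OF f lebesgue_on_measurable_borel[OF k(1)], of 1]) (use k(2) in auto)
    have "(\<lambda>x. mollify e a k x - k x + k x) \<in> borel_measurable borel"
      using L2_measurable[OF k(3)] k(1) by (intro borel_measurable_add) auto
    then have m: "mollify e a k \<in> borel_measurable (lebesgue_on \<Omega>)"
      by (intro lebesgue_on_measurable_borel) simp
    have "AE x in lebesgue_on \<Omega>. f x - F x = - (mollify e a k x - k x)"
      using AE_space k(2) by eventually_elim (simp add: k(5))
    moreover have "F \<in> borel_measurable (lebesgue_on \<Omega>)"
      by (rule measurable_cong[THEN iffD2, OF _ m]) (use k(5) in auto)
    ultimately have "L2_norm (lebesgue_on \<Omega>) (\<lambda>x. f x - F x) = L2_norm (lebesgue_on \<Omega>) (\<lambda>x. - (mollify e a k x - k x))"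
      unfolding L2_norm_def using m L2_measurable[OF f] L2_measurable[OF kL]
      by (intro arg_cong[of _ _ sqrt] L2_inner_cong_AE) auto
    also have "\<dots> = L2_norm (lebesgue_on \<Omega>) (\<lambda>x. mollify e a k x - k x)"
      by (simp, rule L2_norm_minus_commute)
    also have "\<dots> \<le> L2_norm lborel (\<lambda>x. mollify e a k x - k x)"
      by (rule L2_norm_lebesgue_on_le[OF k(3)]) simp
    finally show ?thesis using k(4) by linarith
  qed
  have "L2_norm (lebesgue_on \<Omega>) (\<lambda>x. u x - mollify e a v x) \<le> \<eta>"
    using \<tau>0 e(1) ea(2) t(2) by (intro close[OF u(1) v(1,3)]) auto
  moreover have "L2_norm (lebesgue_on \<Omega>) (\<lambda>x. G x \<bullet> i - D x i) \<le> \<eta>" if i: "i \<in> Basis" for i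
    using \<tau>[OF i] e(1) ea(2) t(3)[OF i] Dg i
    by (intro close[OF H1_gradientD(1)[OF u(2) i] g(1,3)[OF i]]) auto
  ultimately show "\<exists>w D. C1_fun w D \<and> L2_norm (lebesgue_on \<Omega>) (\<lambda>x. u x - w x) \<le> \<eta> \<and>
     (\<forall>i\<in>Basis. L2_norm (lebesgue_on \<Omega>) (\<lambda>x. G x \<bullet> i - D x i) \<le> \<eta>)"
    using C1 by blast
qed

lemma C1_approximable_add:
  assumes u: "u \<in> L2 (lebesgue_on \<Omega>)" "H1_gradient \<Omega> u G" "C1_approximable u G"
    and v: "v \<in> L2 (lebesgue_on \<Omega>)" "H1_gradient \<Omega> v H" "C1_approximable v H"
  shows "C1_approximable (\<lambda>x. u x + v x) (\<lambda>x. G x + H x)"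
  unfolding C1_approximable_def
proof (intro allI impI)
  fix \<eta> :: real assume "\<eta> > 0"
  then have \<eta>2: "\<eta> / 2 > 0" by simp
  obtain w D where w: "C1_fun w D" "L2_norm (lebesgue_on \<Omega>) (\<lambda>x. u x - w x) \<le> \<eta> / 2"
    "\<forall>i\<in>Basis. L2_norm (lebesgue_on \<Omega>) (\<lambda>x. G x \<bullet> i - D x i) \<le> \<eta> / 2"
    using u(3) \<eta>2 unfolding C1_approximable_def by meson
  obtain z E where z: "C1_fun z E" "L2_norm (lebesgue_on \<Omega>) (\<lambda>x. v x - z x) \<le> \<eta> / 2"
    "\<forall>i\<in>Basis. L2_norm (lebesgue_on \<Omega>) (\<lambda>x. H x \<bullet> i - E x i) \<le> \<eta> / 2"
    using v(3) \<eta>2 unfolding C1_approximable_def by meson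
  have C: "C1_fun (\<lambda>x. 1 * w x + 1 * z x) (\<lambda>x h. 1 * D x h + 1 * E x h)"
    by (rule C1_fun_lin[OF w(1) z(1)])
  have *: "L2_norm (lebesgue_on \<Omega>) (\<lambda>x. f x + g x - (1 * h x + 1 * k x)) \<le> \<eta>"
    if "f \<in> L2 (lebesgue_on \<Omega>)" "g \<in> L2 (lebesgue_on \<Omega>)" "h \<in> L2 (lebesgue_on \<Omega>)" "k \<in> L2 (lebesgue_on \<Omega>)"
      "L2_norm (lebesgue_on \<Omega>) (\<lambda>x. f x - h x) \<le> \<eta> / 2" "L2_norm (lebesgue_on \<Omega>) (\<lambda>x. g x - k x) \<le> \<eta> / 2" for f g h k
    using L2_norm_add_le[OF L2_diff[OF that(1,3)] L2_diff[OF that(2,4)]] that(5,6) by (simp add: algebra_simps)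
  have "L2_norm (lebesgue_on \<Omega>) (\<lambda>x. u x + v x - (1 * w x + 1 * z x)) \<le> \<eta>"
    by (rule *[OF u(1) v(1) C1_fun_L2(1)[OF w(1)] C1_fun_L2(1)[OF z(1)] w(2) z(2)])
  moreover have "L2_norm (lebesgue_on \<Omega>) (\<lambda>x. (G x + H x) \<bullet> i - (1 * D x i + 1 * E x i)) \<le> \<eta>" if i: "i \<in> Basis" for i
    unfolding inner_add_left
    by (rule *[OF H1_gradientD(1)[OF u(2) i] H1_gradientD(1)[OF v(2) i] C1_fun_L2(2)[OF w(1)] C1_fun_L2(2)[OF z(1)]])
      (use w(3) z(3) i in blast)+
  ultimately show "\<exists>w D. C1_fun w D \<and> L2_norm (lebesgue_on \<Omega>) (\<lambda>x. u x + v x - w x) \<le> \<eta> \<and>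
     (\<forall>i\<in>Basis. L2_norm (lebesgue_on \<Omega>) (\<lambda>x. (G x + H x) \<bullet> i - D x i) \<le> \<eta>)"
    using C by blast
qed

lemma C1_approximable_cover:
  assumes X: "finite X" and patch: "\<And>x. x \<in> X \<Longrightarrow> cone_patch \<Omega> x (r x) (d x) (\<kappa> x) (s x)"
    and u: "u \<in> L2 (lebesgue_on \<Omega>)" "H1_gradient \<Omega> u G"
    and u0: "\<And>y. y \<in> \<Omega> \<Longrightarrow> (\<And>x. x \<in> X \<Longrightarrow> dist x y > r x / 4) \<Longrightarrow> u y = 0"
  shows "C1_approximable u G"
  using X patch u u0
proof (induction X arbitrary: u G rule: finite_induct)
  case empty
  have z: "C1_fun (\<lambda>_. 0) (\<lambda>_ _. 0 :: real)" by (rule C1_fun_const)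
  have u0: "AE x in lebesgue_on \<Omega>. u x = 0" using AE_space by eventually_elim (use empty in auto)
  have "AE x in lebesgue_on \<Omega>. G x = gradient (\<lambda>_ _. 0) x"
    by (rule H1_gradient_unique[OF empty(3) C1_fun_H1_gradient[OF z] empty(2) C1_fun_L2(1)[OF z] u0])
  then have "AE x in lebesgue_on \<Omega>. G x = 0" by (simp add: gradient_def)
  then have "L2_norm (lebesgue_on \<Omega>) (\<lambda>x. G x \<bullet> i) = 0" if "i \<in> Basis" for i
    using L2_norm_zero_iff[OF H1_gradientD(1)[OF empty(3) that]] by auto
  moreover have "L2_norm (lebesgue_on \<Omega>) u = 0" using L2_norm_zero_iff[OF empty(2)] u0 by simp
  ultimately show ?case
    unfolding C1_approximable_def
    by (intro allI impI exI[of _ "\<lambda>_. 0"] exI[of _ "\<lambda>_ _. 0"] conjI z ballI) auto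
next
  case (insert x X)
  have p: "cone_patch \<Omega> x (r x) (d x) (\<kappa> x) (s x)" using insert.prems by simp
  then have r: "0 < r x / 4" "r x / 4 < r x / 3" by (auto simp: cone_patch_def)
  obtain \<zeta> D where \<zeta>: "C1_fun \<zeta> D" "\<And>y. dist x y \<le> r x / 4 \<Longrightarrow> \<zeta> y = 1" "\<And>y. dist x y \<ge> r x / 3 \<Longrightarrow> \<zeta> y = 0"
    using C1_cutoff[OF r] by blast
  have D0: "gradient D y = 0" if "dist x y \<ge> r x / 2" for y
  proof -
    have "D y h = 0" for h
    proof (rule C1_fun_deriv_zero[OF \<zeta>(1), of "- cball x (r x / 3)"])
      show "y \<in> - cball x (r x / 3)" using that r by auto
    qed (use \<zeta>(3) in auto)
    then show ?thesis by (simp add: gradient_def)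
  qed
  have C: "C1_fun (\<lambda>y. 1 * 1 + (-1) * \<zeta> y) (\<lambda>y h. 1 * 0 + (-1) * D y h)"
    by (rule C1_fun_lin[OF C1_fun_const \<zeta>(1)])
  note m1 = C1_fun_times_L2(1)[OF \<zeta>(1) insert.prems(2)] H1_gradient_mult[OF \<zeta>(1) insert.prems(2,3)]
  note m2 = C1_fun_times_L2(1)[OF C insert.prems(2)] H1_gradient_mult[OF C insert.prems(2,3)]
  have a1: "C1_approximable (\<lambda>y. \<zeta> y * u y) (\<lambda>y. \<zeta> y *\<^sub>R G y + u y *\<^sub>R gradient D y)"
    by (rule C1_approximable_local[OF p m1]) (use \<zeta>(3) D0 r in auto)
  have a2: "C1_approximable (\<lambda>y. (1 * 1 + (-1) * \<zeta> y) * u y)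
      (\<lambda>y. (1 * 1 + (-1) * \<zeta> y) *\<^sub>R G y + u y *\<^sub>R gradient (\<lambda>y h. 1 * 0 + (-1) * D y h) y)"
  proof (rule insert.IH[OF _ m2])
    fix y assume y: "y \<in> \<Omega>" "\<And>x. x \<in> X \<Longrightarrow> r x / 4 < dist x y"
    show "(1 * 1 + - 1 * \<zeta> y) * u y = 0"
    proof (cases "dist x y \<le> r x / 4")
      case True
      then show ?thesis using \<zeta>(2) by simp
    next
      case False
      then have "u y = 0" using insert.prems(4)[OF y(1)] y(2) by (metis insertE not_le)
      then show ?thesis by simp
    qed
  qed (use insert.prems in auto)
  have g: "gradient (\<lambda>y h. - D y h) y = - gradient D y" for y
    by (simp add: gradient_def sum_negf)
  have "(\<lambda>y. \<zeta> y * u y + (1 * 1 + (-1) * \<zeta> y) * u y) = u" by (simp add: fun_eq_iff algebra_simps)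
  moreover have "(\<lambda>y. (\<zeta> y *\<^sub>R G y + u y *\<^sub>R gradient D y) +
      ((1 * 1 + (-1) * \<zeta> y) *\<^sub>R G y + u y *\<^sub>R gradient (\<lambda>y h. 1 * 0 + (-1) * D y h) y)) = G"
    by (simp add: g fun_eq_iff algebra_simps)
  ultimately show ?case using C1_approximable_add[OF m1 a1 m2 a2] by simp
qed

lemma C1_dense:
  assumes reg: "regular_domain \<Omega>" and u: "u \<in> L2 (lebesgue_on \<Omega>)" "H1_gradient \<Omega> u G"
  obtains w D where "\<And>n::nat. C1_fun (w n) (D n)" "(\<lambda>n. L2_norm (lebesgue_on \<Omega>) (\<lambda>x. w n x - u x)) \<longlonglongrightarrow> 0"
    "\<And>i. i \<in> Basis \<Longrightarrow> (\<lambda>n. L2_norm (lebesgue_on \<Omega>) (\<lambda>x. D n x i - G x \<bullet> i)) \<longlonglongrightarrow> 0"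
proof -
  have "\<forall>x\<in>closure \<Omega>. \<exists>r d \<kappa> s. cone_patch \<Omega> x r d \<kappa> s"
    using regular_domain_cone_patch[OF reg] by metis
  then obtain r d \<kappa> s where p: "\<And>x. x \<in> closure \<Omega> \<Longrightarrow> cone_patch \<Omega> x (r x) (d x) (\<kappa> x) (s x)" by metis
  have comp: "compact (closure \<Omega>)" using bounded_dom by simp
  have "closure \<Omega> \<subseteq> (\<Union>x\<in>closure \<Omega>. ball x (r x / 4))"
    using p by (force simp: cone_patch_def)
  then obtain X where X: "X \<subseteq> closure \<Omega>" "finite X" "closure \<Omega> \<subseteq> (\<Union>x\<in>X. ball x (r x / 4))"
    using compactE_image[OF comp, of "closure \<Omega>" "\<lambda>x. ball x (r x / 4)"] by blast
  have "C1_approximable u G"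
  proof (rule C1_approximable_cover[OF X(2) _ u])
    fix y assume "y \<in> \<Omega>" and far: "\<And>x. x \<in> X \<Longrightarrow> r x / 4 < dist x y"
    then have "y \<in> closure \<Omega>" using closure_subset by blast
    then obtain x where "x \<in> X" "y \<in> ball x (r x / 4)" using X(3) by blast
    then show "u y = 0" using far[of x] by simp
  qed (use p X in blast)
  then have "\<forall>n. \<exists>w D. C1_fun w D \<and> L2_norm (lebesgue_on \<Omega>) (\<lambda>x. u x - w x) \<le> 1 / real (Suc n) \<and>
     (\<forall>i\<in>Basis. L2_norm (lebesgue_on \<Omega>) (\<lambda>x. G x \<bullet> i - D x i) \<le> 1 / real (Suc n))" (is "\<forall>n. \<exists>w D. ?Q n w D")
    unfolding C1_approximable_def by simp
  then obtain w where "\<forall>n. \<exists>D. ?Q n (w n) D" using choice[of "\<lambda>n w. \<exists>D. ?Q n w D"] by blast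
  then obtain D where "\<forall>n. ?Q n (w n) (D n)" using choice[of "\<lambda>n D. ?Q n (w n) D"] by blast
  then have wD: "\<And>n. C1_fun (w n) (D n)" "\<And>n. L2_norm (lebesgue_on \<Omega>) (\<lambda>x. u x - w n x) \<le> 1 / real (Suc n)"
    "\<And>n i. i \<in> Basis \<Longrightarrow> L2_norm (lebesgue_on \<Omega>) (\<lambda>x. G x \<bullet> i - D n x i) \<le> 1 / real (Suc n)"
    by blast+
  have lim: "f \<longlonglongrightarrow> 0" if "\<And>n. 0 \<le> f n" "\<And>n. f n \<le> 1 / real (Suc n)" for f :: "nat \<Rightarrow> real"
    using LIMSEQ_inverse_real_of_nat that by (intro tendsto_sandwich[of "\<lambda>_. 0" f _ "\<lambda>n. 1 / real (Suc n)"]) (auto simp: inverse_eq_divide)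
  show ?thesis
  proof (rule that[OF wD(1)])
    show "(\<lambda>n. L2_norm (lebesgue_on \<Omega>) (\<lambda>x. w n x - u x)) \<longlonglongrightarrow> 0"
      by (rule lim) (use wD(2) in \<open>auto simp: L2_norm_minus_commute[of _ _ u]\<close>)
    fix i :: 'a assume "i \<in> Basis"
    then show "(\<lambda>n. L2_norm (lebesgue_on \<Omega>) (\<lambda>x. D n x i - G x \<bullet> i)) \<longlonglongrightarrow> 0"
      by (intro lim) (use wD(3) in \<open>auto simp: L2_norm_minus_commute[of _ "\<lambda>x. D _ x i"]\<close>)
  qed
qed

end

section \<open>Positive parts and their traces\<close>

definition smooth_pos :: "real \<Rightarrow> real \<Rightarrow> real" where
  "smooth_pos \<delta> s = (pos_sq s - pos_sq (s - \<delta>)) / (2 * \<delta>)"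

definition smooth_pos' :: "real \<Rightarrow> real \<Rightarrow> real" where
  "smooth_pos' \<delta> s = (max 0 s - max 0 (s - \<delta>)) / \<delta>"

lemma real_null_squeeze:
  fixes f g :: "nat \<Rightarrow> real"
  assumes "\<And>n. 0 \<le> f n" "\<And>n. f n \<le> g n" "g \<longlonglongrightarrow> 0"
  shows "f \<longlonglongrightarrow> 0"
  by (rule tendsto_sandwich[OF _ _ tendsto_const assms(3)]) (use assms in auto)

lemma pos_sq_measurable [measurable]: "pos_sq \<in> borel_measurable borel"
  unfolding pos_sq_def[abs_def] by measurable

lemma smooth_pos_measurable [measurable]: "smooth_pos \<delta> \<in> borel_measurable borel"
  unfolding smooth_pos_def[abs_def] by measurable

lemma smooth_pos'_measurable [measurable]: "smooth_pos' \<delta> \<in> borel_measurable borel"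
  unfolding smooth_pos'_def[abs_def] by measurable

lemma smooth_pos_deriv: "\<delta> > 0 \<Longrightarrow> (smooth_pos \<delta> has_real_derivative smooth_pos' \<delta> s) (at s)"
proof -
  assume "\<delta> > 0"
  have "((\<lambda>s. pos_sq (s - \<delta>)) has_real_derivative 2 * max 0 (s - \<delta>) * 1) (at s)"
    by (rule DERIV_chain2[OF pos_sq_has_derivative]) (auto intro!: derivative_eq_intros)
  then have "((\<lambda>s. (pos_sq s - pos_sq (s - \<delta>)) / (2 * \<delta>)) has_real_derivative
      (2 * max 0 s - 2 * max 0 (s - \<delta>) * 1) / (2 * \<delta>)) (at s)"
    by (intro DERIV_cdivide DERIV_diff pos_sq_has_derivative)
  then show ?thesis
    using \<open>\<delta> > 0\<close> unfolding smooth_pos_def[abs_def] smooth_pos'_def by (simp add: diff_divide_distrib)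
qed

lemma smooth_pos'_bounds: "\<delta> > 0 \<Longrightarrow> 0 \<le> smooth_pos' \<delta> s" "\<delta> > 0 \<Longrightarrow> smooth_pos' \<delta> s \<le> 1"
  by (auto simp: smooth_pos'_def divide_le_eq)

lemma smooth_pos'_continuous: "\<delta> > 0 \<Longrightarrow> continuous_on UNIV (smooth_pos' \<delta>)"
  unfolding smooth_pos'_def[abs_def] by (intro continuous_intros) auto

lemma smooth_pos_lipschitz:
  assumes "\<delta> > 0"
  shows "\<bar>smooth_pos \<delta> a - smooth_pos \<delta> b\<bar> \<le> \<bar>a - b\<bar>"
proof -
  have "norm (smooth_pos \<delta> a - smooth_pos \<delta> b) \<le> 1 * norm (a - b)"
    by (rule field_differentiable_bound[of UNIV _ "smooth_pos' \<delta>"])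
      (use smooth_pos_deriv[OF assms] smooth_pos'_bounds[OF assms] in auto)
  then show ?thesis by simp
qed

lemma smooth_pos_abs_le: "\<delta> > 0 \<Longrightarrow> \<bar>smooth_pos \<delta> s\<bar> \<le> \<bar>s\<bar>"
  using smooth_pos_lipschitz[of \<delta> s 0] by (simp add: smooth_pos_def)

lemma smooth_pos_dist:
  assumes "\<delta> > 0"
  shows "\<bar>smooth_pos \<delta> s - max 0 s\<bar> \<le> \<delta>"
proof -
  consider "s \<le> 0" | "0 < s" "s \<le> \<delta>" | "s > \<delta>" by linarith
  then show ?thesis
  proof cases
    case 1
    then show ?thesis using assms by (simp add: smooth_pos_def)
  next
    case 2
    then have "smooth_pos \<delta> s = s * (s / (2 * \<delta>))"
      using assms by (simp add: smooth_pos_def) (simp add: pos_sq_def power2_eq_square)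
    moreover have "s / (2 * \<delta>) \<le> 1" "0 \<le> s / (2 * \<delta>)" using 2 assms by (auto simp: divide_le_eq)
    ultimately have "0 \<le> smooth_pos \<delta> s" "smooth_pos \<delta> s \<le> s"
      using 2 mult_left_le[of "s / (2 * \<delta>)" s] by auto
    then show ?thesis using 2 by simp
  next
    case 3
    have "s\<^sup>2 - (s - \<delta>)\<^sup>2 = 2 * \<delta> * s - \<delta>\<^sup>2" by (simp add: power2_diff)
    then have "smooth_pos \<delta> s = s - \<delta> / 2"
      using 3 assms by (simp add: smooth_pos_def pos_sq_def max_def diff_divide_distrib power2_eq_square)
    then show ?thesis using 3 assms by simp
  qed
qed

lemma smooth_pos'_tendsto: "(\<lambda>n. smooth_pos' (1 / real (Suc n)) s) \<longlonglongrightarrow> (if s > 0 then 1 else 0)"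
proof (cases "s > 0")
  case True
  have "(\<lambda>n. 1 / real (Suc n)) \<longlonglongrightarrow> 0" using LIMSEQ_inverse_real_of_nat by (simp add: inverse_eq_divide)
  then have "eventually (\<lambda>n. 1 / real (Suc n) < s) sequentially" using True by (rule order_tendstoD)
  then have "eventually (\<lambda>n. smooth_pos' (1 / real (Suc n)) s = 1) sequentially"
    by eventually_elim (use True in \<open>simp add: smooth_pos'_def max_def\<close>)
  then show ?thesis using True by (simp add: tendsto_eventually)
next
  case False
  then have "smooth_pos' (1 / real (Suc n)) s = 0" for n
    by (simp add: smooth_pos'_def max_def) (smt (verit) of_nat_0_le_iff divide_pos_pos)
  then show ?thesis using False by simp
qed

lemma smooth_pos_tendsto: "(\<lambda>n. smooth_pos (1 / real (Suc n)) s) \<longlonglongrightarrow> max 0 s"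
proof (rule LIM_zero_cancel, rule tendsto_rabs_zero_cancel, rule real_null_squeeze)
  show "(\<lambda>n. 1 / real (Suc n)) \<longlonglongrightarrow> 0" using LIMSEQ_inverse_real_of_nat by (simp add: inverse_eq_divide)
  show "\<bar>smooth_pos (1 / real (Suc n)) s - max 0 s\<bar> \<le> 1 / real (Suc n)" for n
    by (rule smooth_pos_dist) simp
qed simp

lemma L2_inner_tendsto:
  assumes "\<And>n. f n \<in> L2 M" "f' \<in> L2 M" "g \<in> L2 M" "(\<lambda>n. L2_norm M (\<lambda>x. f n x - f' x)) \<longlonglongrightarrow> 0"
  shows "(\<lambda>n::nat. L2_inner M (f n) g) \<longlonglongrightarrow> L2_inner M f' g"
proof (rule LIM_zero_cancel, rule tendsto_rabs_zero_cancel, rule real_null_squeeze)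
  show "(\<lambda>n. L2_norm M (\<lambda>x. f n x - f' x) * L2_norm M g) \<longlonglongrightarrow> 0"
    using tendsto_mult_right[OF assms(4), of "L2_norm M g"] by simp
  show "\<bar>L2_inner M (f n) g - L2_inner M f' g\<bar> \<le> L2_norm M (\<lambda>x. f n x - f' x) * L2_norm M g" for n
    using L2_Cauchy_Schwarz[OF L2_diff[OF assms(1)[of n] assms(2)] assms(3)]
      L2_inner_add_left[OF assms(1)[of n] assms(2,3), of 1 "-1"] by simp
qed simp

lemma L2_limit_unique:
  assumes L: "\<And>n. F n \<in> L2 M" "\<And>n. G n \<in> L2 M" "f \<in> L2 M" "g \<in> L2 M"
    and lim: "(\<lambda>n::nat. L2_norm M (\<lambda>x. F n x - f x)) \<longlonglongrightarrow> 0" "(\<lambda>n. L2_norm M (\<lambda>x. G n x - g x)) \<longlonglongrightarrow> 0"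
    and eq: "\<And>n. AE x in M. F n x = G n x"
  shows "AE x in M. f x = g x"
proof -
  have le: "L2_norm M (\<lambda>x. f x - g x) \<le> L2_norm M (\<lambda>x. F n x - f x) + L2_norm M (\<lambda>x. G n x - g x)" for n
  proof -
    have "L2_norm M (\<lambda>x. f x - g x) \<le> L2_norm M (\<lambda>x. f x - F n x) + L2_norm M (\<lambda>x. F n x - g x)"
      by (rule L2_norm_triangle[OF L(3,1,4)])
    also have "L2_norm M (\<lambda>x. F n x - g x) = L2_norm M (\<lambda>x. G n x - g x)"
    proof -
      have "AE x in M. F n x - g x = G n x - g x" using eq[of n] by eventually_elim simp
      then show ?thesis
        unfolding L2_norm_def using L2_diff[OF L(1,4), of n] L2_diff[OF L(2,4), of n]
        by (intro arg_cong[of _ _ sqrt] L2_inner_cong_AE) (auto dest: L2_measurable)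
    qed
    finally show ?thesis by (simp add: L2_norm_minus_commute[of M f])
  qed
  have "L2_norm M (\<lambda>x. f x - g x) \<le> 0"
    using tendsto_add[OF lim] le by (intro LIMSEQ_le_const[of _ _ "L2_norm M (\<lambda>x. f x - g x)"]) auto
  then have "L2_norm M (\<lambda>x. f x - g x) = 0" by (simp add: antisym)
  then show ?thesis using L2_norm_zero_iff[OF L2_diff[OF L(3,4)]] by simp
qed

context bounded_open
begin

lemma H1_gradient_closed:
  assumes un: "\<And>n::nat. u n \<in> L2 (lebesgue_on \<Omega>)" "\<And>n. H1_gradient \<Omega> (u n) (G n)"
    and v: "v \<in> L2 (lebesgue_on \<Omega>)" "\<And>i. i \<in> Basis \<Longrightarrow> (\<lambda>x. H x \<bullet> i) \<in> L2 (lebesgue_on \<Omega>)"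
    and lim: "(\<lambda>n. L2_norm (lebesgue_on \<Omega>) (\<lambda>x. u n x - v x)) \<longlonglongrightarrow> 0"
      "\<And>i. i \<in> Basis \<Longrightarrow> (\<lambda>n. L2_norm (lebesgue_on \<Omega>) (\<lambda>x. G n x \<bullet> i - H x \<bullet> i)) \<longlonglongrightarrow> 0"
  shows "H1_gradient \<Omega> v H" "(\<lambda>n. H1_norm \<Omega> (\<lambda>x. u n x - v x)) \<longlonglongrightarrow> 0"
proof -
  show vH: "H1_gradient \<Omega> v H"
    unfolding H1_gradient_def weak_gradient_def
  proof (intro conjI ballI v(2))
    fix \<phi> and i :: 'a assume \<phi>: "\<phi> \<in> C1_compact \<Omega>" and i: "i \<in> Basis"
    have "(\<lambda>n. L2_inner (lebesgue_on \<Omega>) (u n) (\<lambda>x. frechet_derivative \<phi> (at x) i))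
        \<longlonglongrightarrow> L2_inner (lebesgue_on \<Omega>) v (\<lambda>x. frechet_derivative \<phi> (at x) i)"
      by (rule L2_inner_tendsto[OF un(1) v(1) C1_compact_L2(2)[OF \<phi>] lim(1)])
    moreover have "(\<lambda>n. - L2_inner (lebesgue_on \<Omega>) (\<lambda>x. G n x \<bullet> i) \<phi>) \<longlonglongrightarrow> - L2_inner (lebesgue_on \<Omega>) (\<lambda>x. H x \<bullet> i) \<phi>"
      by (intro tendsto_minus L2_inner_tendsto[OF H1_gradientD(1)[OF un(2) i] v(2)[OF i] C1_compact_L2(1)[OF \<phi>] lim(2)[OF i]])
    ultimately have "L2_inner (lebesgue_on \<Omega>) v (\<lambda>x. frechet_derivative \<phi> (at x) i) = - L2_inner (lebesgue_on \<Omega>) (\<lambda>x. H x \<bullet> i) \<phi>"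
      using H1_gradientD(2)[OF un(2) \<phi> i] by (intro LIMSEQ_unique) (simp_all add: L2_inner_def)
    then show "(\<integral>x. v x * frechet_derivative \<phi> (at x) i \<partial>lebesgue_on \<Omega>) = - (\<integral>x. (H x \<bullet> i) * \<phi> x \<partial>lebesgue_on \<Omega>)"
      by (simp add: L2_inner_def)
  qed
  define \<epsilon> where "\<epsilon> n = L2_norm (lebesgue_on \<Omega>) (\<lambda>x. u n x - v x)
    + (\<Sum>i\<in>Basis. L2_norm (lebesgue_on \<Omega>) (\<lambda>x. G n x \<bullet> i - H x \<bullet> i))" for n
  have "\<epsilon> \<longlonglongrightarrow> 0 + (\<Sum>i\<in>(Basis::'a set). 0)"
    unfolding \<epsilon>_def by (intro tendsto_add tendsto_sum lim)
  then have "(\<lambda>n. sqrt (1 + DIM('a)) * \<epsilon> n) \<longlonglongrightarrow> 0"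
    using tendsto_mult_left[of \<epsilon> 0 sequentially "sqrt (1 + DIM('a))"] by simp
  moreover have "H1_norm \<Omega> (\<lambda>x. u n x - v x) \<le> sqrt (1 + DIM('a)) * \<epsilon> n" for n
  proof (rule H1_norm_le)
    show "(\<lambda>x. u n x - v x) \<in> L2 (lebesgue_on \<Omega>)" by (rule L2_diff[OF un(1) v(1)])
    show "H1_gradient \<Omega> (\<lambda>x. u n x - v x) (\<lambda>x. 1 *\<^sub>R G n x + (-1) *\<^sub>R H x)"
      using H1_gradient_lin[OF un(1)[of n] un(2)[of n] v(1) vH, of 1 "-1"] by simp
    show "L2_norm (lebesgue_on \<Omega>) (\<lambda>x. u n x - v x) \<le> \<epsilon> n"
      by (simp add: \<epsilon>_def sum_nonneg)
    fix i :: 'a assume i: "i \<in> Basis"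
    have "L2_norm (lebesgue_on \<Omega>) (\<lambda>x. G n x \<bullet> i - H x \<bullet> i) \<le> (\<Sum>i\<in>Basis. L2_norm (lebesgue_on \<Omega>) (\<lambda>x. G n x \<bullet> i - H x \<bullet> i))"
      using i by (intro member_le_sum) auto
    also have "\<dots> \<le> \<epsilon> n" by (simp add: \<epsilon>_def)
    finally show "L2_norm (lebesgue_on \<Omega>) (\<lambda>x. (1 *\<^sub>R G n x + (-1) *\<^sub>R H x) \<bullet> i) \<le> \<epsilon> n"
      by (simp add: inner_diff_left)
  qed
  ultimately show "(\<lambda>n. H1_norm \<Omega> (\<lambda>x. u n x - v x)) \<longlonglongrightarrow> 0"
    by (rule real_null_squeeze[OF H1_norm_nonneg, rotated])
qed

lemma bounded_times_L2:
  assumes f: "f \<in> borel_measurable (lebesgue_on \<Omega>)" "\<And>x. \<bar>f x\<bar> \<le> B" and u: "u \<in> L2 (lebesgue_on \<Omega>)"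
  shows "(\<lambda>x. f x * u x) \<in> L2 (lebesgue_on \<Omega>)"
  by (rule L2_bound[OF u, of _ B]) (use f L2_measurable[OF u] in \<open>auto simp: abs_mult intro!: mult_right_mono AE_I2\<close>)

lemma smooth_pos_H1:
  assumes reg: "regular_domain \<Omega>" and u: "u \<in> L2 (lebesgue_on \<Omega>)" "H1_gradient \<Omega> u G" and \<delta>: "\<delta> > 0"
  shows "(\<lambda>x. smooth_pos \<delta> (u x)) \<in> L2 (lebesgue_on \<Omega>)"
    "H1_gradient \<Omega> (\<lambda>x. smooth_pos \<delta> (u x)) (\<lambda>x. smooth_pos' \<delta> (u x) *\<^sub>R G x)"
    "\<exists>w D. (\<forall>n::nat. C1_fun (w n) (D n)) \<and> (\<lambda>n. H1_norm \<Omega> (\<lambda>x. w n x - u x)) \<longlonglongrightarrow> 0 \<and>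
      (\<lambda>n. H1_norm \<Omega> (\<lambda>x. smooth_pos \<delta> (w n x) - smooth_pos \<delta> (u x))) \<longlonglongrightarrow> 0"
proof -
  let ?F = "smooth_pos \<delta>" and ?F' = "smooth_pos' \<delta>"
  let ?M = "lebesgue_on \<Omega>"
  obtain w0 D0 where w0: "\<And>n::nat. C1_fun (w0 n) (D0 n)" "(\<lambda>n. L2_norm ?M (\<lambda>x. w0 n x - u x)) \<longlonglongrightarrow> 0"
    "\<And>i. i \<in> Basis \<Longrightarrow> (\<lambda>n. L2_norm ?M (\<lambda>x. D0 n x i - G x \<bullet> i)) \<longlonglongrightarrow> 0"
    using C1_dense[OF reg u] by blast
  obtain r :: "nat \<Rightarrow> nat" where r: "strict_mono r" "AE x in ?M. (\<lambda>n. w0 (r n) x) \<longlonglongrightarrow> u x"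
    using L2_tendsto_AE_subseq[OF C1_fun_L2(1)[OF w0(1)] u(1) w0(2)] by blast
  define w where "w n = w0 (r n)" for n
  define D where "D n = D0 (r n)" for n
  have w: "\<And>n. C1_fun (w n) (D n)" "(\<lambda>n. L2_norm ?M (\<lambda>x. w n x - u x)) \<longlonglongrightarrow> 0"
    "\<And>i. i \<in> Basis \<Longrightarrow> (\<lambda>n. L2_norm ?M (\<lambda>x. D n x i - G x \<bullet> i)) \<longlonglongrightarrow> 0"
    using w0 LIMSEQ_subseq_LIMSEQ[OF w0(2) r(1)] LIMSEQ_subseq_LIMSEQ[OF w0(3) r(1)]
    by (auto simp: w_def D_def comp_def)
  have wu: "AE x in ?M. (\<lambda>n. w n x) \<longlonglongrightarrow> u x" using r(2) by (simp add: w_def)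
  have [measurable]: "u \<in> borel_measurable ?M" "\<And>n. w n \<in> borel_measurable ?M"
    using L2_measurable[OF u(1)] L2_measurable[OF C1_fun_L2(1)[OF w(1)]] by auto
  show FuL: "(\<lambda>x. ?F (u x)) \<in> L2 ?M"
    by (rule L2_bound[OF u(1), of _ 1]) (use smooth_pos_abs_le[OF \<delta>] in auto)
  have FC: "C1_fun (\<lambda>x. ?F (w n x)) (\<lambda>x h. ?F' (w n x) * D n x h)" for n
    by (rule C1_fun_compose[OF smooth_pos_deriv[OF \<delta>] smooth_pos'_continuous[OF \<delta>] w(1)])
  have F'b: "\<bar>?F' s\<bar> \<le> 1" for s using smooth_pos'_bounds[OF \<delta>, of s] by simp
  note GL = H1_gradientD(1)[OF u(2)]
  have F'uG: "(\<lambda>x. (?F' (u x) *\<^sub>R G x) \<bullet> i) \<in> L2 ?M" if "i \<in> Basis" for i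
    using bounded_times_L2[OF _ F'b GL[OF that], of u] by simp
  have lim1: "(\<lambda>n. L2_norm ?M (\<lambda>x. ?F (w n x) - ?F (u x))) \<longlonglongrightarrow> 0"
  proof (rule real_null_squeeze[OF L2_norm_nonneg _ w(2)])
    show "L2_norm ?M (\<lambda>x. ?F (w n x) - ?F (u x)) \<le> L2_norm ?M (\<lambda>x. w n x - u x)" for n
      by (rule L2_norm_mono[OF _ L2_diff[OF C1_fun_L2(1)[OF w(1)] u(1)]]) (use smooth_pos_lipschitz[OF \<delta>] in auto)
  qed
  have lim2: "(\<lambda>n. L2_norm ?M (\<lambda>x. gradient (\<lambda>x h. ?F' (w n x) * D n x h) x \<bullet> i - (?F' (u x) *\<^sub>R G x) \<bullet> i)) \<longlonglongrightarrow> 0"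
    if i: "i \<in> Basis" for i
  proof -
    note GLi = GL[OF i]
    have [measurable]: "(\<lambda>x. G x \<bullet> i) \<in> borel_measurable ?M" "\<And>n. (\<lambda>x. D n x i) \<in> borel_measurable ?M"
      using L2_measurable[OF GLi] L2_measurable[OF C1_fun_L2(2)[OF w(1)]] by auto
    have "(\<lambda>n. L2_norm ?M (\<lambda>x. ?F' (w n x) * (G x \<bullet> i) - ?F' (u x) * (G x \<bullet> i))) \<longlonglongrightarrow> 0"
    proof (rule L2_dominated_convergence)
      show "(\<lambda>x. 2 * \<bar>G x \<bullet> i\<bar>) \<in> L2 ?M" by (rule L2_bound[OF GLi, of _ 2]) auto
      show "AE x in ?M. (\<lambda>n. ?F' (w n x) * (G x \<bullet> i)) \<longlonglongrightarrow> ?F' (u x) * (G x \<bullet> i)"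
        using wu by eventually_elim
          (intro tendsto_mult_right, rule continuous_on_tendsto_compose[OF smooth_pos'_continuous[OF \<delta>]], auto)
      fix n
      have "\<bar>?F' (w n x) * (G x \<bullet> i) - ?F' (u x) * (G x \<bullet> i)\<bar> \<le> 2 * \<bar>G x \<bullet> i\<bar>" for x
      proof -
        have "\<bar>?F' (w n x) - ?F' (u x)\<bar> \<le> 2" using F'b[of "w n x"] F'b[of "u x"] by linarith
        then have "\<bar>?F' (w n x) - ?F' (u x)\<bar> * \<bar>G x \<bullet> i\<bar> \<le> 2 * \<bar>G x \<bullet> i\<bar>" by (rule mult_right_mono) simp
        then show ?thesis by (simp add: abs_mult[symmetric] left_diff_distrib)
      qed
      then show "AE x in ?M. \<bar>?F' (w n x) * (G x \<bullet> i) - ?F' (u x) * (G x \<bullet> i)\<bar> \<le> 2 * \<bar>G x \<bullet> i\<bar>" by simp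
    qed auto
    from tendsto_add[OF w(3)[OF i] this]
    have lim: "(\<lambda>n. L2_norm ?M (\<lambda>x. D n x i - G x \<bullet> i) + L2_norm ?M (\<lambda>x. ?F' (w n x) * (G x \<bullet> i) - ?F' (u x) * (G x \<bullet> i))) \<longlonglongrightarrow> 0"
      by simp
    show ?thesis
    proof (rule real_null_squeeze[OF L2_norm_nonneg _ lim])
      show "L2_norm ?M (\<lambda>x. gradient (\<lambda>x h. ?F' (w n x) * D n x h) x \<bullet> i - (?F' (u x) *\<^sub>R G x) \<bullet> i)
        \<le> L2_norm ?M (\<lambda>x. D n x i - G x \<bullet> i) + L2_norm ?M (\<lambda>x. ?F' (w n x) * (G x \<bullet> i) - ?F' (u x) * (G x \<bullet> i))" for n
      proof -
        have d: "(\<lambda>x. D n x i - G x \<bullet> i) \<in> L2 ?M" by (rule L2_diff[OF C1_fun_L2(2)[OF w(1)] GLi])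
        have d1: "(\<lambda>x. ?F' (w n x) * (D n x i - G x \<bullet> i)) \<in> L2 ?M"
          by (rule bounded_times_L2[OF _ F'b d]) simp
        have d2: "(\<lambda>x. ?F' (w n x) * (G x \<bullet> i) - ?F' (u x) * (G x \<bullet> i)) \<in> L2 ?M"
          by (intro L2_diff bounded_times_L2[OF _ F'b GLi]) simp_all
        have "L2_norm ?M (\<lambda>x. gradient (\<lambda>x h. ?F' (w n x) * D n x h) x \<bullet> i - (?F' (u x) *\<^sub>R G x) \<bullet> i)
          = L2_norm ?M (\<lambda>x. ?F' (w n x) * (D n x i - G x \<bullet> i) + (?F' (w n x) * (G x \<bullet> i) - ?F' (u x) * (G x \<bullet> i)))"
          by (simp add: gradient_inner[OF i] algebra_simps)
        also have "\<dots> \<le> L2_norm ?M (\<lambda>x. ?F' (w n x) * (D n x i - G x \<bullet> i)) + L2_norm ?M (\<lambda>x. ?F' (w n x) * (G x \<bullet> i) - ?F' (u x) * (G x \<bullet> i))"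
          by (rule L2_norm_add_le[OF d1 d2])
        also have "L2_norm ?M (\<lambda>x. ?F' (w n x) * (D n x i - G x \<bullet> i)) \<le> L2_norm ?M (\<lambda>x. D n x i - G x \<bullet> i)"
        proof (rule L2_norm_mono[OF L2_measurable[OF d1] d])
          show "AE x in ?M. \<bar>?F' (w n x) * (D n x i - G x \<bullet> i)\<bar> \<le> \<bar>D n x i - G x \<bullet> i\<bar>"
            using F'b mult_right_mono[of _ 1] by (auto simp: abs_mult intro!: mult_left_le_one_le)
        qed
        finally show ?thesis by simp
      qed
    qed
  qed
  note closed = H1_gradient_closed[OF C1_fun_L2(1)[OF FC] C1_fun_H1_gradient[OF FC] FuL F'uG lim1 lim2]
  show "H1_gradient \<Omega> (\<lambda>x. ?F (u x)) (\<lambda>x. ?F' (u x) *\<^sub>R G x)" by (rule closed(1))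
  have "(\<lambda>n. H1_norm \<Omega> (\<lambda>x. w n x - u x)) \<longlonglongrightarrow> 0"
    by (rule H1_gradient_closed(2)[OF C1_fun_L2(1)[OF w(1)] C1_fun_H1_gradient[OF w(1)] u(1) GL w(2)])
      (use w(3) in \<open>auto simp: gradient_inner\<close>)
  then show "\<exists>w D. (\<forall>n::nat. C1_fun (w n) (D n)) \<and> (\<lambda>n. H1_norm \<Omega> (\<lambda>x. w n x - u x)) \<longlonglongrightarrow> 0 \<and>
      (\<lambda>n. H1_norm \<Omega> (\<lambda>x. smooth_pos \<delta> (w n x) - smooth_pos \<delta> (u x))) \<longlonglongrightarrow> 0"
    using w(1) closed(2) by blast
qed

end

locale trace_domain =
  fixes \<Omega> :: "'a::euclidean_space set" and \<gamma> :: "('a \<Rightarrow> real) \<Rightarrow> 'a \<Rightarrow> real"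
  assumes regular: "regular_domain \<Omega>" and trace: "trace_operator \<Omega> \<gamma>"
begin

sublocale bounded_open \<Omega>
  using regular by unfold_locales (auto simp: regular_domain_def)

lemma trace_L2: "u \<in> H1 \<Omega> \<Longrightarrow> \<gamma> u \<in> L2 (surface (frontier \<Omega>))"
  using trace by (auto simp: trace_operator_def)

lemma trace_lin:
  "u \<in> H1 \<Omega> \<Longrightarrow> v \<in> H1 \<Omega> \<Longrightarrow> AE x in surface (frontier \<Omega>). \<gamma> (\<lambda>y. c * u y + d * v y) x = c * \<gamma> u x + d * \<gamma> v x"
  using trace unfolding trace_operator_def by blast

lemma trace_diff:
  "u \<in> H1 \<Omega> \<Longrightarrow> v \<in> H1 \<Omega> \<Longrightarrow> AE x in surface (frontier \<Omega>). \<gamma> (\<lambda>y. u y - v y) x = \<gamma> u x - \<gamma> v x"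
  using trace_lin[of u v 1 "-1"] by simp

lemma trace_C1: "C1_fun w D \<Longrightarrow> AE x in surface (frontier \<Omega>). \<gamma> w x = w x"
  using trace C1_fun_H1 C1_fun_continuous unfolding trace_operator_def by blast

lemma trace_bound:
  obtains C where "C \<ge> 0" "\<And>u. u \<in> H1 \<Omega> \<Longrightarrow> L2_norm (surface (frontier \<Omega>)) (\<gamma> u) \<le> C * H1_norm \<Omega> u"
proof -
  obtain C where C: "\<forall>u\<in>H1 \<Omega>. L2_norm (surface (frontier \<Omega>)) (\<gamma> u) \<le> C * H1_norm \<Omega> u"
    using trace unfolding trace_operator_def by blast
  have "C * H1_norm \<Omega> u \<le> \<bar>C\<bar> * H1_norm \<Omega> u" for u
    by (rule mult_right_mono) (auto simp: H1_norm_nonneg)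
  with C show ?thesis by (intro that[of "\<bar>C\<bar>"]) (auto intro: order_trans)
qed

lemma trace_tendsto:
  assumes u: "\<And>n::nat. u n \<in> H1 \<Omega>" "v \<in> H1 \<Omega>" "(\<lambda>n. H1_norm \<Omega> (\<lambda>x. u n x - v x)) \<longlonglongrightarrow> 0"
  shows "(\<lambda>n. L2_norm (surface (frontier \<Omega>)) (\<lambda>x. \<gamma> (u n) x - \<gamma> v x)) \<longlonglongrightarrow> 0"
proof -
  obtain C where C: "C \<ge> 0" "\<And>u. u \<in> H1 \<Omega> \<Longrightarrow> L2_norm (surface (frontier \<Omega>)) (\<gamma> u) \<le> C * H1_norm \<Omega> u"
    using trace_bound by blast
  have "L2_norm (surface (frontier \<Omega>)) (\<lambda>x. \<gamma> (u n) x - \<gamma> v x) \<le> C * H1_norm \<Omega> (\<lambda>x. u n x - v x)" for n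
  proof -
    have "L2_norm (surface (frontier \<Omega>)) (\<lambda>x. \<gamma> (u n) x - \<gamma> v x) = L2_norm (surface (frontier \<Omega>)) (\<gamma> (\<lambda>x. u n x - v x))"
      unfolding L2_norm_def
      using trace_diff[OF u(1)[of n] u(2)] L2_measurable[OF trace_L2[OF H1_diff[OF u(1)[of n] u(2)]]]
        L2_measurable[OF trace_L2[OF u(1)[of n]]] L2_measurable[OF trace_L2[OF u(2)]]
      by (intro arg_cong[of _ _ sqrt] L2_inner_cong_AE) auto
    then show ?thesis using C(2)[OF H1_diff[OF u(1)[of n] u(2)]] by simp
  qed
  moreover have "(\<lambda>n. C * H1_norm \<Omega> (\<lambda>x. u n x - v x)) \<longlonglongrightarrow> 0"
    using tendsto_mult_left[OF u(3), of C] by simp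
  ultimately show ?thesis
    by (rule real_null_squeeze[OF L2_norm_nonneg])
qed

lemma trace_smooth_pos:
  assumes u: "u \<in> H1 \<Omega>" and \<delta>: "\<delta> > 0"
  shows "AE x in surface (frontier \<Omega>). \<gamma> (\<lambda>y. smooth_pos \<delta> (u y)) x = smooth_pos \<delta> (\<gamma> u x)"
proof -
  let ?S = "surface (frontier \<Omega>)" and ?F = "smooth_pos \<delta>"
  note sp = smooth_pos_H1[OF regular H1_L2[OF u] H1_wgrad[OF u] \<delta>]
  have Fu: "(\<lambda>x. ?F (u x)) \<in> H1 \<Omega>" by (rule H1_I[OF sp(1,2)])
  obtain w D where w: "\<And>n::nat. C1_fun (w n) (D n)" "(\<lambda>n. H1_norm \<Omega> (\<lambda>x. w n x - u x)) \<longlonglongrightarrow> 0"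
    "(\<lambda>n. H1_norm \<Omega> (\<lambda>x. ?F (w n x) - ?F (u x))) \<longlonglongrightarrow> 0" using sp(3) by blast
  have FC: "C1_fun (\<lambda>x. ?F (w n x)) (\<lambda>x h. smooth_pos' \<delta> (w n x) * D n x h)" for n
    by (rule C1_fun_compose[OF smooth_pos_deriv[OF \<delta>] smooth_pos'_continuous[OF \<delta>] w(1)])
  have FL: "(\<lambda>x. ?F (f x)) \<in> L2 ?S" if "f \<in> L2 ?S" for f
    by (rule L2_bound[OF that, of _ 1]) (use smooth_pos_abs_le[OF \<delta>] L2_measurable[OF that] in auto)
  note gw = trace_L2[OF C1_fun_H1[OF w(1)]] and gu = trace_L2[OF u]
  show ?thesis
  proof (rule L2_limit_unique)
    show "(\<lambda>n. L2_norm ?S (\<lambda>x. \<gamma> (\<lambda>y. ?F (w n y)) x - \<gamma> (\<lambda>y. ?F (u y)) x)) \<longlonglongrightarrow> 0"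
      by (rule trace_tendsto[OF C1_fun_H1[OF FC] Fu w(3)])
    have "L2_norm ?S (\<lambda>x. ?F (\<gamma> (w n) x) - ?F (\<gamma> u x)) \<le> L2_norm ?S (\<lambda>x. \<gamma> (w n) x - \<gamma> u x)" for n
      by (rule L2_norm_mono[OF L2_measurable[OF L2_diff[OF FL[OF gw] FL[OF gu]]] L2_diff[OF gw gu]])
        (use smooth_pos_lipschitz[OF \<delta>] in auto)
    then show "(\<lambda>n. L2_norm ?S (\<lambda>x. ?F (\<gamma> (w n) x) - ?F (\<gamma> u x))) \<longlonglongrightarrow> 0"
      by (rule real_null_squeeze[OF L2_norm_nonneg _ trace_tendsto[OF C1_fun_H1[OF w(1)] u w(2)]])
    fix n
    show "AE x in ?S. \<gamma> (\<lambda>y. ?F (w n y)) x = ?F (\<gamma> (w n) x)"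
      using trace_C1[OF FC[of n]] trace_C1[OF w(1)[of n]] by eventually_elim simp
  qed (intro trace_L2 C1_fun_H1[OF FC] Fu FL gw gu)+
qed

lemma pos_part_H1:
  assumes u: "u \<in> L2 (lebesgue_on \<Omega>)" "H1_gradient \<Omega> u G"
  shows "H1_gradient \<Omega> (\<lambda>x. max 0 (u x)) (\<lambda>x. (if u x > 0 then 1 else 0) *\<^sub>R G x)"
    "(\<lambda>x. max 0 (u x)) \<in> H1 \<Omega>"
    "AE x in surface (frontier \<Omega>). \<gamma> (\<lambda>y. max 0 (u y)) x = max 0 (\<gamma> u x)"
proof -
  let ?M = "lebesgue_on \<Omega>" and ?S = "surface (frontier \<Omega>)"
  let ?d = "\<lambda>n. 1 / real (Suc n)"
  have dp: "?d n > 0" for n by simp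
  have uH: "u \<in> H1 \<Omega>" by (rule H1_I[OF u])
  note sp = smooth_pos_H1[OF regular u dp]
  have um [measurable]: "u \<in> borel_measurable ?M" by (rule L2_measurable[OF u(1)])
  have posL: "(\<lambda>x. max 0 (u x)) \<in> L2 ?M" by (rule L2_pos_part[OF u(1)])
  have conv: "(\<lambda>n. L2_norm N (\<lambda>x. smooth_pos (?d n) (f x) - max 0 (f x))) \<longlonglongrightarrow> 0" if f: "f \<in> L2 N" for f and N :: "'a measure"
  proof (rule L2_dominated_convergence)
    have [measurable]: "f \<in> borel_measurable N" by (rule L2_measurable[OF f])
    show "(\<lambda>x. 2 * \<bar>f x\<bar>) \<in> L2 N" by (rule L2_bound[OF f, of _ 2]) auto
    show "AE x in N. (\<lambda>n. smooth_pos (?d n) (f x)) \<longlonglongrightarrow> max 0 (f x)" using smooth_pos_tendsto by simp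
    fix n
    have "\<bar>smooth_pos (?d n) (f x) - max 0 (f x)\<bar> \<le> 2 * \<bar>f x\<bar>" for x
      using smooth_pos_abs_le[OF dp[of n], of "f x"] by linarith
    then show "AE x in N. \<bar>smooth_pos (?d n) (f x) - max 0 (f x)\<bar> \<le> 2 * \<bar>f x\<bar>" by simp
    show "(\<lambda>x. smooth_pos (?d n) (f x)) \<in> borel_measurable N" by measurable
    show "(\<lambda>x. max 0 (f x)) \<in> borel_measurable N" by measurable
  qed
  have gL: "(\<lambda>x. ((if u x > 0 then 1 else 0) *\<^sub>R G x) \<bullet> i) \<in> L2 ?M" if "i \<in> Basis" for i
    using bounded_times_L2[OF _ _ H1_gradientD(1)[OF u(2) that], of "\<lambda>x. if u x > 0 then 1 else 0" 1] by simp
  have glim: "(\<lambda>n. L2_norm ?M (\<lambda>x. (smooth_pos' (?d n) (u x) *\<^sub>R G x) \<bullet> i - ((if u x > 0 then 1 else 0) *\<^sub>R G x) \<bullet> i)) \<longlonglongrightarrow> 0"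
    if i: "i \<in> Basis" for i
  proof (rule L2_dominated_convergence)
    have [measurable]: "(\<lambda>x. G x \<bullet> i) \<in> borel_measurable ?M" by (rule L2_measurable[OF H1_gradientD(1)[OF u(2) i]])
    show "(\<lambda>x. 2 * \<bar>G x \<bullet> i\<bar>) \<in> L2 ?M" by (rule L2_bound[OF H1_gradientD(1)[OF u(2) i], of _ 2]) auto
    show "AE x in ?M. (\<lambda>n. (smooth_pos' (?d n) (u x) *\<^sub>R G x) \<bullet> i) \<longlonglongrightarrow> ((if u x > 0 then 1 else 0) *\<^sub>R G x) \<bullet> i"
      unfolding inner_scaleR_left by (intro AE_I2 tendsto_mult_right smooth_pos'_tendsto)
    fix n
    have "\<bar>(smooth_pos' (?d n) (u x) *\<^sub>R G x) \<bullet> i - ((if u x > 0 then 1 else 0) *\<^sub>R G x) \<bullet> i\<bar> \<le> 2 * \<bar>G x \<bullet> i\<bar>" for x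
    proof -
      have "\<bar>smooth_pos' (?d n) (u x) - (if u x > 0 then 1 else 0)\<bar> \<le> 2"
        using smooth_pos'_bounds[OF dp[of n], of "u x"] by auto
      then have "\<bar>smooth_pos' (?d n) (u x) - (if u x > 0 then 1 else 0)\<bar> * \<bar>G x \<bullet> i\<bar> \<le> 2 * \<bar>G x \<bullet> i\<bar>"
        by (rule mult_right_mono) simp
      then show ?thesis unfolding inner_scaleR_left by (simp only: abs_mult[symmetric] left_diff_distrib)
    qed
    then show "AE x in ?M. \<bar>(smooth_pos' (?d n) (u x) *\<^sub>R G x) \<bullet> i - ((if u x > 0 then 1 else 0) *\<^sub>R G x) \<bullet> i\<bar> \<le> 2 * \<bar>G x \<bullet> i\<bar>"
      by simp
    show "(\<lambda>x. (smooth_pos' (?d n) (u x) *\<^sub>R G x) \<bullet> i) \<in> borel_measurable ?M" unfolding inner_scaleR_left by measurable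
    show "(\<lambda>x. ((if u x > 0 then 1 else 0) *\<^sub>R G x) \<bullet> i) \<in> borel_measurable ?M" by (rule L2_measurable[OF gL[OF i]])
  qed
  note closed = H1_gradient_closed[OF sp(1,2) posL gL conv[OF u(1)] glim]
  show g: "H1_gradient \<Omega> (\<lambda>x. max 0 (u x)) (\<lambda>x. (if u x > 0 then 1 else 0) *\<^sub>R G x)" by (rule closed(1))
  show pH: "(\<lambda>x. max 0 (u x)) \<in> H1 \<Omega>" by (rule H1_I[OF posL g])
  have FL: "(\<lambda>x. smooth_pos (?d n) (\<gamma> u x)) \<in> L2 ?S" for n
    by (rule L2_bound[OF trace_L2[OF uH], of _ 1]) (use smooth_pos_abs_le[OF dp] L2_measurable[OF trace_L2[OF uH]] in auto)
  show "AE x in ?S. \<gamma> (\<lambda>y. max 0 (u y)) x = max 0 (\<gamma> u x)"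
  proof (rule L2_limit_unique)
    show "(\<lambda>n. L2_norm ?S (\<lambda>x. \<gamma> (\<lambda>y. smooth_pos (?d n) (u y)) x - \<gamma> (\<lambda>y. max 0 (u y)) x)) \<longlonglongrightarrow> 0"
      by (rule trace_tendsto[OF H1_I[OF sp(1,2)] pH closed(2)])
    show "(\<lambda>n. L2_norm ?S (\<lambda>x. smooth_pos (?d n) (\<gamma> u x) - max 0 (\<gamma> u x))) \<longlonglongrightarrow> 0"
      by (rule conv[OF trace_L2[OF uH]])
    show "AE x in ?S. \<gamma> (\<lambda>y. smooth_pos (?d n) (u y)) x = smooth_pos (?d n) (\<gamma> u x)" for n
      by (rule trace_smooth_pos[OF uH dp])
  qed (intro trace_L2 H1_I[OF sp(1,2)] pH FL L2_pos_part[OF trace_L2[OF uH]])+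
qed

lemma dirichlet_form_pos_part:
  assumes u: "u \<in> H1 \<Omega>"
  shows "dirichlet_form \<Omega> u (\<lambda>x. max 0 (u x)) = dirichlet_form \<Omega> (\<lambda>x. max 0 (u x)) (\<lambda>x. max 0 (u x))"
proof -
  note uL = H1_L2[OF u] H1_wgrad[OF u]
  note p = L2_pos_part[OF uL(1)] pos_part_H1(1)[OF uL]
  show ?thesis unfolding dirichlet_form_eq[OF uL p] dirichlet_form_eq[OF p p]
    by (intro Bochner_Integration.integral_cong) auto
qed

lemma H1_norm_pos_part:
  assumes u: "u \<in> H1 \<Omega>"
  shows "H1_norm \<Omega> (\<lambda>x. max 0 (u x)) \<le> H1_norm \<Omega> u"
proof -
  note uL = H1_L2[OF u] H1_wgrad[OF u]
  note p = L2_pos_part[OF uL(1)] pos_part_H1(1)[OF uL]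
  have "L2_norm (lebesgue_on \<Omega>) (\<lambda>x. max 0 (u x)) \<le> L2_norm (lebesgue_on \<Omega>) u"
    by (rule L2_norm_mono[OF L2_measurable[OF p(1)] uL(1)]) auto
  then have n: "(L2_norm (lebesgue_on \<Omega>) (\<lambda>x. max 0 (u x)))\<^sup>2 \<le> (L2_norm (lebesgue_on \<Omega>) u)\<^sup>2"
    by (rule power_mono) simp
  have "dirichlet_form \<Omega> (\<lambda>x. max 0 (u x)) (\<lambda>x. max 0 (u x)) \<le> dirichlet_form \<Omega> u u"
    unfolding dirichlet_form_eq[OF uL uL] dirichlet_form_eq[OF p p]
    by (rule Bochner_Integration.integral_mono[OF H1_gradient_inner_integrable(1)[OF p(2,2)] H1_gradient_inner_integrable(1)[OF uL(2,2)]]) auto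
  with n show ?thesis unfolding H1_norm_def[of \<Omega>] by (intro real_sqrt_le_mono add_mono)
qed

lemma finite_measure_frontier: "finite_measure (surface (frontier \<Omega>))"
proof -
  let ?S = "surface (frontier \<Omega>)"
  have C: "C1_fun (\<lambda>_::'a. 1::real) (\<lambda>_ _. 0)" by (rule C1_fun_const)
  have [measurable]: "\<gamma> (\<lambda>_. 1) \<in> borel_measurable ?S"
    by (rule L2_measurable[OF trace_L2[OF C1_fun_H1[OF C]]])
  have "integrable ?S (\<lambda>x. (\<gamma> (\<lambda>_. 1) x)\<^sup>2)"
    by (rule L2_square_integrable[OF trace_L2[OF C1_fun_H1[OF C]]])
  moreover have "AE x in ?S. (\<gamma> (\<lambda>_. 1) x)\<^sup>2 = 1" using trace_C1[OF C] by eventually_elim simp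
  ultimately have "integrable ?S (\<lambda>_. 1::real)" by (subst (asm) integrable_cong_AE) auto
  moreover have "integrable ?S (\<lambda>_. 1::real) \<longleftrightarrow> integrable ?S (indicator (space ?S) :: 'a \<Rightarrow> real)"
    by (rule Bochner_Integration.integrable_cong) auto
  ultimately have "integrable ?S (indicator (space ?S) :: 'a \<Rightarrow> real)" by simp
  then show ?thesis by (intro finite_measureI) (simp add: integrable_indicator_iff less_top)
qed

end

section \<open>Strongly measurable functions of time\<close>

lemma measurable_lebesgue_on_AE:
  fixes f g :: "'a::euclidean_space \<Rightarrow> real"
  assumes f: "f \<in> borel_measurable (lebesgue_on S)" and S: "S \<in> sets lebesgue"
    and eq: "AE x in lebesgue_on S. f x = g x"
  shows "g \<in> borel_measurable (lebesgue_on S)"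
proof -
  have "(\<lambda>x. indicator S x *\<^sub>R f x) \<in> borel_measurable lebesgue"
    using f S by (simp add: borel_measurable_restrict_space_iff)
  moreover have "AE x in lebesgue. indicator S x *\<^sub>R f x = indicator S x *\<^sub>R g x"
    using eq S by (subst (asm) AE_restrict_space_iff) (auto elim: eventually_mono)
  ultimately have "(\<lambda>x. indicator S x *\<^sub>R g x) \<in> borel_measurable lebesgue" by (rule borel_measurable_AE)
  then show ?thesis using S by (simp add: borel_measurable_restrict_space_iff)
qed

lemma L2_norm_sum_le:
  assumes "finite I" "\<And>i. i \<in> I \<Longrightarrow> f i \<in> L2 M"
  shows "L2_norm M (\<lambda>x. \<Sum>i\<in>I. a i * f i x) \<le> (\<Sum>i\<in>I. \<bar>a i\<bar> * L2_norm M (f i))"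
  using assms
proof (induction I rule: finite_induct)
  case (insert i I)
  have "L2_norm M (\<lambda>x. a i * f i x + (\<Sum>i\<in>I. a i * f i x)) \<le> L2_norm M (\<lambda>x. a i * f i x) + L2_norm M (\<lambda>x. \<Sum>i\<in>I. a i * f i x)"
    using insert by (intro L2_norm_add_le L2_cmult L2_sum) auto
  then show ?case using insert by (simp add: L2_norm_cmult)
qed (simp add: L2_norm_def L2_inner_def)

lemma L2_abs: "f \<in> L2 M \<Longrightarrow> (\<lambda>x. \<bar>f x\<bar>) \<in> L2 M"
  by (rule L2_bound[of f _ _ 1]) (auto dest: L2_measurable)

lemma L2_norm_abs: "L2_norm M (\<lambda>x. \<bar>f x\<bar>) = L2_norm M f"
  by (simp add: L2_norm_def L2_inner_def)

locale seminorm_space =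
  fixes X :: "('c \<Rightarrow> real) set" and N :: "('c \<Rightarrow> real) \<Rightarrow> real"
  assumes zero_in: "(\<lambda>_. 0) \<in> X"
    and lin_in: "u \<in> X \<Longrightarrow> v \<in> X \<Longrightarrow> (\<lambda>x. c * u x + d * v x) \<in> X"
    and lin_le: "u \<in> X \<Longrightarrow> v \<in> X \<Longrightarrow> N (\<lambda>x. c * u x + d * v x) \<le> \<bar>c\<bar> * N u + \<bar>d\<bar> * N v"
    and nonneg: "u \<in> X \<Longrightarrow> 0 \<le> N u"
begin

lemma diff_in: "u \<in> X \<Longrightarrow> v \<in> X \<Longrightarrow> (\<lambda>x. u x - v x) \<in> X"
  using lin_in[of u v 1 "-1"] by simp

lemma N_zero: "N (\<lambda>_. 0) = 0"
  using lin_le[OF zero_in zero_in, of 0 0] nonneg[OF zero_in] by simp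

lemma N_diff_le: "u \<in> X \<Longrightarrow> v \<in> X \<Longrightarrow> N (\<lambda>x. u x - v x) \<le> N u + N v"
  using lin_le[of u v 1 "-1"] by simp

lemma N_commute: "u \<in> X \<Longrightarrow> v \<in> X \<Longrightarrow> N (\<lambda>x. u x - v x) = N (\<lambda>x. v x - u x)"
  using lin_le[of "\<lambda>x. u x - v x" "\<lambda>x. u x - v x" "-1" 0] lin_le[of "\<lambda>x. v x - u x" "\<lambda>x. v x - u x" "-1" 0]
  by (simp add: diff_in)

lemma N_triangle: "u \<in> X \<Longrightarrow> v \<in> X \<Longrightarrow> w \<in> X \<Longrightarrow> N (\<lambda>x. u x - w x) \<le> N (\<lambda>x. u x - v x) + N (\<lambda>x. v x - w x)"
  using lin_le[of "\<lambda>x. u x - v x" "\<lambda>x. v x - w x" 1 1] by (simp add: diff_in)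

text \<open>
  A substitute for continuity in time: up to an error that is small in \<open>L\<^sup>2\<close>, an element of
  \<open>L\<^sup>2(0,T;X)\<close> is uniformly continuous off a null set.
\<close>

lemma bochner_L2_equicontinuous:
  assumes u: "u \<in> bochner_L2 T X N" and \<epsilon>: "\<epsilon> > 0"
  obtains e \<delta> A where "e \<in> L2 (time T)" "\<And>t. 0 \<le> e t" "L2_norm (time T) e \<le> \<epsilon>" "\<delta> > 0"
    "AE t in time T. t \<in> A"
    "\<And>s t. s \<in> A \<Longrightarrow> t \<in> A \<Longrightarrow> \<bar>s - t\<bar> < \<delta> \<Longrightarrow> u s \<in> X \<and> u t \<in> X \<and> N (\<lambda>x. u s x - u t x) \<le> e s + e t + \<epsilon>"
proof -
  let ?M = "time T"
  have fin: "finite_measure ?M" by (rule finite_measure_lebesgue_on_open) auto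
  then interpret finite_measure ?M .
  have one: "(\<lambda>_. 1) \<in> L2 ?M" by (simp add: L2_def)
  obtain s where s: "\<And>k. simple_function ?M (s k)" "\<And>k t. t \<in> {0<..<T} \<Longrightarrow> s k t \<in> X"
    "AE t in ?M. (\<lambda>k. N (\<lambda>x. s k t x - u t x)) \<longlonglongrightarrow> 0"
    using u unfolding bochner_L2_def by blast
  define A where "A = {t\<in>{0<..<T}. u t \<in> X \<and> (\<lambda>k. N (\<lambda>x. s k t x - u t x)) \<longlonglongrightarrow> 0}"
  have "AE t in ?M. u t \<in> X" using u unfolding bochner_L2_def by auto
  then have A: "AE t in ?M. t \<in> A"
    using AE_space s(3) by eventually_elim (simp add: A_def)
  define m where "m t = sqrt ((N (u t))\<^sup>2)" for t
  have m2: "integrable ?M (\<lambda>t. (N (u t))\<^sup>2)" using u by (simp add: bochner_L2_def)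
  have [measurable]: "m \<in> borel_measurable ?M" 
    unfolding m_def[abs_def] by (rule measurable_compose[OF borel_measurable_integrable[OF m2] borel_measurable_sqrt])
  have mL: "m \<in> L2 ?M" using m2 by (simp add: L2_def) (simp add: m_def)
  have mA: "m t = N (u t)" if "t \<in> A" for t using that nonneg[of "u t"] by (simp add: A_def m_def)
  have m0: "0 \<le> m t" for t by (simp add: m_def)
  define E where "E k t = lim (\<lambda>j. N (\<lambda>x. s k t x - s j t x))" for k t
  have [measurable]: "E k \<in> borel_measurable ?M" for k
    unfolding E_def
    by (intro borel_measurable_lim_metric borel_measurable_simple_function
        simple_function_compose2[of _ _ _ "\<lambda>f g. N (\<lambda>x. f x - g x)"] s)
  have EA: "E k t = N (\<lambda>x. s k t x - u t x)" if t: "t \<in> A" for k t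
    unfolding E_def
  proof (rule limI, rule LIM_zero_cancel, rule tendsto_rabs_zero_cancel, rule real_null_squeeze)
    have X: "s j t \<in> X" "u t \<in> X" for j using t s(2) by (auto simp: A_def)
    show "(\<lambda>k. N (\<lambda>x. s k t x - u t x)) \<longlonglongrightarrow> 0" using t by (simp add: A_def)
    fix j
    show "\<bar>N (\<lambda>x. s k t x - s j t x) - N (\<lambda>x. s k t x - u t x)\<bar> \<le> N (\<lambda>x. s j t x - u t x)"
      using N_triangle[OF X(1,2,1), of k j] N_triangle[OF X(1,1,2), of k j] N_commute[OF X, of j] by linarith
  qed simp
  define B where "B k = {t\<in>space ?M. E k t \<le> m t + 1}" for k
  have Bm [measurable]: "B k \<in> sets ?M" for k unfolding B_def by measurable
  define e' where "e' k t = (if t \<in> B k then \<bar>E k t\<bar> else \<bar>m t\<bar>)" for k t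
  have [measurable]: "e' k \<in> borel_measurable ?M" for k unfolding e'_def by measurable
  have e'A: "e' k t \<le> m t + 1" if "t \<in> A" for k t
    using that EA[of t k] nonneg[OF diff_in[of "s k t" "u t"]] s(2)[of t k] m0[of t]
    by (auto simp: e'_def B_def A_def)
  have e'0: "0 \<le> e' k t" for k t by (simp add: e'_def)
  have m1: "(\<lambda>t. m t + 1) \<in> L2 ?M" by (rule L2_add[OF mL one])
  have e'L: "e' k \<in> L2 ?M" for k
    by (rule L2_bound[OF m1, of _ 1]) (use A in \<open>auto elim!: eventually_mono intro: order_trans[OF e'A] simp: e'0 m0\<close>)
  have "(\<lambda>k. L2_norm ?M (\<lambda>t. e' k t - 0)) \<longlonglongrightarrow> 0"
  proof (rule L2_dominated_convergence[OF _ _ m1])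
    show "AE t in ?M. (\<lambda>k. e' k t) \<longlonglongrightarrow> 0"
      using A
    proof eventually_elim
      case (elim t)
      have lim: "(\<lambda>k. E k t) \<longlonglongrightarrow> 0" using elim by (simp add: EA) (simp add: A_def)
      then have "eventually (\<lambda>k. E k t < 1) sequentially" by (rule order_tendstoD) simp
      then have "eventually (\<lambda>k. \<bar>E k t\<bar> = e' k t) sequentially"
        by eventually_elim (use elim m0[of t] in \<open>auto simp: e'_def B_def A_def\<close>)
      moreover have "(\<lambda>k. \<bar>E k t\<bar>) \<longlonglongrightarrow> 0" using tendsto_rabs[OF lim] by simp
      ultimately show ?case by (rule Lim_transform_eventually[rotated])
    qed
    show "AE t in ?M. \<bar>e' k t - 0\<bar> \<le> m t + 1" for k
      using A by eventually_elim (simp add: e'A e'0)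
  qed auto
  then have "eventually (\<lambda>k. L2_norm ?M (\<lambda>t. e' k t - 0) < \<epsilon> / 2) sequentially"
    using \<epsilon> by (intro order_tendstoD) auto
  then obtain k where k: "L2_norm ?M (e' k) < \<epsilon> / 2" by (auto simp: eventually_sequentially)
  define s' where "s' t = (if t \<in> B k then s k t else (\<lambda>_. 0))" for t
  have ss: "simple_function ?M s'"
    unfolding s'_def[abs_def] by (rule simple_function_If_set[OF s(1) simple_function_const sets.Int[OF Bm sets.top]])
  have s'X: "s' t \<in> X" if "t \<in> {0<..<T}" for t using s(2)[OF that] zero_in by (simp add: s'_def)
  have s'u: "N (\<lambda>x. s' t x - u t x) \<le> e' k t" if t: "t \<in> A" for t
  proof (cases "t \<in> B k")
    case True
    then show ?thesis using EA[OF t, of k] by (simp add: s'_def e'_def)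
  next
    case False
    have "N (\<lambda>x. 0 - u t x) \<le> N (\<lambda>_. 0) + N (u t)" using t by (intro N_diff_le zero_in) (simp add: A_def)
    then show ?thesis using False mA[OF t] N_zero by (simp add: s'_def e'_def)
  qed
  define Y where "Y = s' ` {0<..<T}"
  have Y: "finite Y" using ss by (auto simp: Y_def simple_function_def)
  have YX: "y \<in> X" if "y \<in> Y" for y using that s'X by (auto simp: Y_def)
  define I where "I y = s' -` {y} \<inter> space ?M" for y
  have I: "I y \<in> sets ?M" for y unfolding I_def using ss by (rule simple_functionD)
  define K where "K = (\<Sum>y\<in>Y. N y) + 1"
  have K: "K > 0" unfolding K_def using YX nonneg by (intro add_nonneg_pos sum_nonneg) auto
  have "\<exists>c. continuous_on UNIV c \<and> (\<forall>x. x \<notin> {0<..<T} \<longrightarrow> c x = 0) \<and> L2_norm ?M (\<lambda>t. indicator (I y) t - c t) \<le> \<epsilon> / (2 * K)" for y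
    using L2_continuous_approx_indicator[OF _ _ I[of y]] \<epsilon> K unfolding L2_continuous_approx_def by simp
  then have "\<forall>y. \<exists>c. continuous_on UNIV c \<and> (\<forall>x. x \<notin> {0<..<T} \<longrightarrow> c x = 0) \<and> L2_norm ?M (\<lambda>t. indicator (I y) t - c t) \<le> \<epsilon> / (2 * K)"
    (is "\<forall>y. \<exists>c. ?Q y c") by blast
  then obtain c where "\<forall>y. ?Q y (c y)" using choice[of ?Q] by blast
  then have c: "\<And>y. continuous_on UNIV (c y)" "\<And>y x. x \<notin> {0<..<T} \<Longrightarrow> c y x = 0"
    "\<And>y. L2_norm ?M (\<lambda>t. indicator (I y) t - c y t) \<le> \<epsilon> / (2 * K)" by blast+
  have \<epsilon>K: "\<epsilon> / K > 0" using \<epsilon> K by simp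
  have "\<exists>\<delta>. \<delta> > 0 \<and> (\<forall>x z. dist x z < \<delta> \<longrightarrow> \<bar>c y x - c y z\<bar> \<le> \<epsilon> / K)" for y
    using continuous_vanishing_uniform[OF c(1)[of y] c(2)[of _ y] _ \<epsilon>K] by (metis bounded_box box_real(1))
  then have "\<forall>y. \<exists>\<delta>. \<delta> > 0 \<and> (\<forall>x z. dist x z < \<delta> \<longrightarrow> \<bar>c y x - c y z\<bar> \<le> \<epsilon> / K)"
    (is "\<forall>y. \<exists>\<delta>. ?R y \<delta>") by blast
  then obtain \<delta>' where "\<forall>y. ?R y (\<delta>' y)" using choice[of ?R] by blast
  then have \<delta>': "\<And>y. \<delta>' y > 0" "\<And>y x z. dist x z < \<delta>' y \<Longrightarrow> \<bar>c y x - c y z\<bar> \<le> \<epsilon> / K" by blast+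
  define \<delta> where "\<delta> = Min (insert 1 (\<delta>' ` Y))"
  have \<delta>: "\<delta> > 0" unfolding \<delta>_def using Y \<delta>' by (subst Min_gr_iff) auto
  have \<delta>Y: "\<delta> \<le> \<delta>' y" if "y \<in> Y" for y unfolding \<delta>_def using Y that by (intro Min_le) auto
  define d where "d y t = \<bar>indicator (I y) t - c y t\<bar>" for y t
  define e where "e t = e' k t + (\<Sum>y\<in>Y. N y * d y t)" for t
  have IL: "indicator (I y) \<in> L2 ?M" for y
    using I[of y] by (intro L2_bound[OF one, of _ 1]) (auto simp: indicator_def)
  have cL: "c y \<in> L2 ?M" for y
    by (rule continuous_bounded_L2) (auto intro: continuous_on_subset[OF c(1)])
  have dL: "d y \<in> L2 ?M" for y
    unfolding d_def using L2_abs[OF L2_diff[OF IL cL]] .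
  have sL: "(\<lambda>t. \<Sum>y\<in>Y. N y * d y t) \<in> L2 ?M" using Y by (intro L2_sum L2_cmult dL)
  show ?thesis
  proof (rule that[OF _ _ _ \<delta> A])
    show "e \<in> L2 ?M" unfolding e_def by (intro L2_add e'L sL)
    show "0 \<le> e t" for t
      unfolding e_def using YX nonneg e'0 by (intro add_nonneg_nonneg sum_nonneg mult_nonneg_nonneg) (auto simp: d_def)
    have "L2_norm ?M e \<le> L2_norm ?M (e' k) + L2_norm ?M (\<lambda>t. \<Sum>y\<in>Y. N y * d y t)"
      unfolding e_def by (rule L2_norm_add_le[OF e'L sL])
    also have "L2_norm ?M (\<lambda>t. \<Sum>y\<in>Y. N y * d y t) \<le> (\<Sum>y\<in>Y. \<bar>N y\<bar> * L2_norm ?M (d y))"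
      using Y by (rule L2_norm_sum_le) (rule dL)
    also have "\<dots> \<le> (\<Sum>y\<in>Y. N y * (\<epsilon> / (2 * K)))"
    proof (rule sum_mono)
      fix y assume "y \<in> Y"
      then have "0 \<le> N y" using YX nonneg by auto
      then show "\<bar>N y\<bar> * L2_norm ?M (d y) \<le> N y * (\<epsilon> / (2 * K))"
        using mult_left_mono[OF c(3)[of y], of "N y"] unfolding d_def L2_norm_abs by simp
    qed
    also have "\<dots> = (K - 1) * (\<epsilon> / (2 * K))" by (simp only: sum_distrib_right[symmetric]) (simp add: K_def)
    also have "\<dots> \<le> K * (\<epsilon> / (2 * K))" using \<epsilon> K by (intro mult_right_mono) auto
    also have "\<dots> = \<epsilon> / 2" using K by simp
    finally show "L2_norm ?M e \<le> \<epsilon>" using k by simp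
    fix r t assume r: "r \<in> A" and t: "t \<in> A" and rt: "\<bar>r - t\<bar> < \<delta>"
    have X: "u r \<in> X" "u t \<in> X" "s' r \<in> X" "s' t \<in> X" "s' r \<in> Y" "s' t \<in> Y"
      using r t s'X by (auto simp: A_def Y_def)
    have rT: "r \<in> space ?M" "t \<in> space ?M" using r t by (auto simp: A_def)
    have sumd: "0 \<le> N y * \<bar>indicator (I y) r - indicator (I y) t\<bar>" if "y \<in> Y" for y
      using YX[OF that] nonneg by simp
    have "N (\<lambda>x. s' r x - s' t x) \<le> (\<Sum>y\<in>Y. N y * \<bar>indicator (I y) r - indicator (I y) t\<bar>)"
    proof (cases "s' r = s' t")
      case True
      then show ?thesis using N_zero sumd by (simp add: sum_nonneg)
    next
      case False
      have "N (\<lambda>x. s' r x - s' t x) \<le> N (s' r) + N (s' t)" by (rule N_diff_le[OF X(3,4)])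
      also have "\<dots> = (\<Sum>y\<in>{s' r, s' t}. N y * \<bar>indicator (I y) r - indicator (I y) t\<bar>)"
        using False rT by (simp add: I_def indicator_def)
      also have "\<dots> \<le> (\<Sum>y\<in>Y. N y * \<bar>indicator (I y) r - indicator (I y) t\<bar>)"
        using Y X sumd by (intro sum_mono2) auto
      finally show ?thesis .
    qed
    also have "\<dots> \<le> (\<Sum>y\<in>Y. N y * d y r + N y * d y t + N y * (\<epsilon> / K))"
    proof (rule sum_mono)
      fix y assume y: "y \<in> Y"
      have "\<bar>c y r - c y t\<bar> \<le> \<epsilon> / K" using rt \<delta>Y[OF y] by (intro \<delta>'(2)) (simp add: dist_real_def)
      then have "\<bar>indicator (I y) r - indicator (I y) t\<bar> \<le> d y r + d y t + \<epsilon> / K" unfolding d_def by linarith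
      then have "N y * \<bar>indicator (I y) r - indicator (I y) t\<bar> \<le> N y * (d y r + d y t + \<epsilon> / K)"
        using YX[OF y] nonneg by (intro mult_left_mono) auto
      then show "N y * \<bar>indicator (I y) r - indicator (I y) t\<bar> \<le> N y * d y r + N y * d y t + N y * (\<epsilon> / K)"
        by (simp add: algebra_simps)
    qed
    also have "\<dots> = (\<Sum>y\<in>Y. N y * d y r) + (\<Sum>y\<in>Y. N y * d y t) + (K - 1) * (\<epsilon> / K)"
      by (simp only: sum.distrib sum_distrib_right[symmetric]) (simp add: K_def)
    also have "(K - 1) * (\<epsilon> / K) \<le> K * (\<epsilon> / K)" using \<epsilon>K by (intro mult_right_mono) auto
    also have "K * (\<epsilon> / K) = \<epsilon>" using K by simp
    finally have "N (\<lambda>x. s' r x - s' t x) \<le> (\<Sum>y\<in>Y. N y * d y r) + (\<Sum>y\<in>Y. N y * d y t) + \<epsilon>" by simp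
    moreover have "N (\<lambda>x. u r x - u t x) \<le> N (\<lambda>x. s' r x - u r x) + N (\<lambda>x. s' r x - s' t x) + N (\<lambda>x. s' t x - u t x)"
      using N_triangle[OF X(1,3,2)] N_triangle[OF X(3,4,2)] N_commute[OF X(1,3)] by linarith
    ultimately show "u r \<in> X \<and> u t \<in> X \<and> N (\<lambda>x. u r x - u t x) \<le> e r + e t + \<epsilon>"
      using s'u[OF r] s'u[OF t] X by (simp add: e_def)
  qed
qed

end

context bounded_open
begin

definition dual_modulus :: "real \<Rightarrow> (real \<Rightarrow> ('a \<Rightarrow> real) \<Rightarrow> real) \<Rightarrow> real \<Rightarrow> (real \<Rightarrow> real) \<Rightarrow> real \<Rightarrow> real set \<Rightarrow> bool" where
  "dual_modulus T l \<epsilon> e \<delta> A \<longleftrightarrow> e \<in> L2 (time T) \<and> (\<forall>t. 0 \<le> e t) \<and> L2_norm (time T) e \<le> \<epsilon> \<and> \<delta> > 0 \<and>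
     (AE t in time T. t \<in> A) \<and> (\<forall>s\<in>A. \<forall>t\<in>A. \<bar>s - t\<bar> < \<delta> \<longrightarrow>
       (\<forall>v\<in>H1 \<Omega>. \<bar>l s v - l t v\<bar> \<le> (e s + e t + \<epsilon>) * H1_norm \<Omega> v))"

lemma dual_modulusD:
  assumes "dual_modulus T l \<epsilon> e \<delta> A"
  shows "e \<in> L2 (time T)" "0 \<le> e t" "L2_norm (time T) e \<le> \<epsilon>" "\<delta> > 0" "AE t in time T. t \<in> A"
    "s \<in> A \<Longrightarrow> t \<in> A \<Longrightarrow> \<bar>s - t\<bar> < \<delta> \<Longrightarrow> v \<in> H1 \<Omega> \<Longrightarrow> \<bar>l s v - l t v\<bar> \<le> (e s + e t + \<epsilon>) * H1_norm \<Omega> v"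
  using assms unfolding dual_modulus_def by blast+

text \<open>
  The properties of a time derivative that the energy estimates use; they hold both for derivatives
  in \<open>L\<^sup>2(0,T;L\<^sup>2(\<Omega>))\<close> and for derivatives in the dual space.
\<close>

definition dual_path :: "real \<Rightarrow> (real \<Rightarrow> ('a \<Rightarrow> real) \<Rightarrow> real) \<Rightarrow> bool" where
  "dual_path T l \<longleftrightarrow>
     (AE t in time T. \<forall>u\<in>H1 \<Omega>. \<forall>v\<in>H1 \<Omega>. \<forall>c d. l t (\<lambda>x. c * u x + d * v x) = c * l t u + d * l t v) \<and>
     (\<forall>v\<in>H1 \<Omega>. integrable (time T) (\<lambda>t. l t v)) \<and>
     (\<forall>\<epsilon>>0. \<exists>e \<delta> A. dual_modulus T l \<epsilon> e \<delta> A)"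

lemma dual_path_lin:
  assumes l: "dual_path T l" and k: "dual_path T k"
  shows "dual_path T (\<lambda>t v. a * l t v + b * k t v)"
  unfolding dual_path_def
proof (intro conjI allI impI ballI)
  show "AE t in time T. \<forall>u\<in>H1 \<Omega>. \<forall>v\<in>H1 \<Omega>. \<forall>c d. a * l t (\<lambda>x. c * u x + d * v x) + b * k t (\<lambda>x. c * u x + d * v x)
      = c * (a * l t u + b * k t u) + d * (a * l t v + b * k t v)"
    using l[unfolded dual_path_def, THEN conjunct1] k[unfolded dual_path_def, THEN conjunct1]
    by eventually_elim (simp add: algebra_simps)
  show "integrable (time T) (\<lambda>t. a * l t v + b * k t v)" if "v \<in> H1 \<Omega>" for v
    using l k that by (auto simp: dual_path_def)
  fix \<epsilon> :: real assume \<epsilon>: "\<epsilon> > 0"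
  define \<eta> where "\<eta> = \<epsilon> / (\<bar>a\<bar> + \<bar>b\<bar> + 1)"
  have p: "\<bar>a\<bar> + \<bar>b\<bar> + 1 > 0" by (simp add: add_nonneg_pos)
  have \<eta>: "\<eta> > 0" "(\<bar>a\<bar> + \<bar>b\<bar>) * \<eta> \<le> \<epsilon>"
    using \<epsilon> p by (auto simp: \<eta>_def divide_le_eq mult.commute)
  obtain e \<delta> A where "dual_modulus T l \<eta> e \<delta> A" using l \<eta>(1) unfolding dual_path_def by blast
  note e = dual_modulusD[OF this]
  obtain e' \<delta>' A' where "dual_modulus T k \<eta> e' \<delta>' A'" using k \<eta>(1) unfolding dual_path_def by blast
  note e' = dual_modulusD[OF this]
  let ?e = "\<lambda>t. \<bar>a\<bar> * e t + \<bar>b\<bar> * e' t"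
  have "L2_norm (time T) ?e \<le> \<bar>\<bar>a\<bar>\<bar> * L2_norm (time T) e + \<bar>\<bar>b\<bar>\<bar> * L2_norm (time T) e'"
    by (rule L2_norm_lin_le[OF e(1) e'(1)])
  also have "\<dots> \<le> \<bar>a\<bar> * \<eta> + \<bar>b\<bar> * \<eta>" using e(3) e'(3) by (intro add_mono) (auto intro: mult_left_mono)
  finally have "L2_norm (time T) ?e \<le> \<epsilon>" using \<eta>(2) by (simp add: algebra_simps)
  moreover have "\<bar>(a * l s v + b * k s v) - (a * l t v + b * k t v)\<bar> \<le> (?e s + ?e t + \<epsilon>) * H1_norm \<Omega> v"
    if st: "s \<in> A \<inter> A'" "t \<in> A \<inter> A'" "\<bar>s - t\<bar> < min \<delta> \<delta>'" and v: "v \<in> H1 \<Omega>" for s t v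
  proof -
    have "\<bar>(a * l s v + b * k s v) - (a * l t v + b * k t v)\<bar> = \<bar>a * (l s v - l t v) + b * (k s v - k t v)\<bar>"
      by (simp add: algebra_simps)
    also have "\<dots> \<le> \<bar>a\<bar> * \<bar>l s v - l t v\<bar> + \<bar>b\<bar> * \<bar>k s v - k t v\<bar>"
      using abs_triangle_ineq[of "a * (l s v - l t v)" "b * (k s v - k t v)"] by (simp add: abs_mult)
    also have "\<dots> \<le> \<bar>a\<bar> * ((e s + e t + \<eta>) * H1_norm \<Omega> v) + \<bar>b\<bar> * ((e' s + e' t + \<eta>) * H1_norm \<Omega> v)"
      using e(6)[of s t v] e'(6)[of s t v] st v e(4) e'(4) by (intro add_mono mult_left_mono) auto
    also have "\<dots> = (?e s + ?e t + (\<bar>a\<bar> + \<bar>b\<bar>) * \<eta>) * H1_norm \<Omega> v" by (simp add: algebra_simps)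
    also have "\<dots> \<le> (?e s + ?e t + \<epsilon>) * H1_norm \<Omega> v"
      using \<eta>(2) by (intro mult_right_mono H1_norm_nonneg) simp
    finally show ?thesis .
  qed
  moreover have "AE t in time T. t \<in> A \<inter> A'" using e(5) e'(5) by eventually_elim simp
  moreover have "?e \<in> L2 (time T)" by (rule L2_lin[OF e(1) e'(1)])
  ultimately have "dual_modulus T (\<lambda>t v. a * l t v + b * k t v) \<epsilon> ?e (min \<delta> \<delta>') (A \<inter> A')"
    using e(2,4) e'(2,4) unfolding dual_modulus_def by simp
  then show "\<exists>e \<delta> A. dual_modulus T (\<lambda>t v. a * l t v + b * k t v) \<epsilon> e \<delta> A" by blast
qed

lemma bochner_dual_path:
  assumes X: "seminorm_space X N" and w: "w \<in> bochner_L2 T X N"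
    and p_lin: "\<And>f u v c d. f \<in> X \<Longrightarrow> u \<in> H1 \<Omega> \<Longrightarrow> v \<in> H1 \<Omega> \<Longrightarrow> p f (\<lambda>x. c * u x + d * v x) = c * p f u + d * p f v"
    and p_le: "\<And>f g v. f \<in> X \<Longrightarrow> g \<in> X \<Longrightarrow> v \<in> H1 \<Omega> \<Longrightarrow> \<bar>p f v - p g v\<bar> \<le> N (\<lambda>x. f x - g x) * H1_norm \<Omega> v"
    and p_zero: "\<And>v. v \<in> H1 \<Omega> \<Longrightarrow> p (\<lambda>_. 0) v = 0"
    and l: "AE t in time T. \<forall>v\<in>H1 \<Omega>. l t v = p (w t) v"
  shows "dual_path T l"
  unfolding dual_path_def
proof (intro conjI allI impI ballI)
  interpret X: seminorm_space X N by fact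
  let ?M = "time T"
  have fin: "finite_measure ?M" by (rule finite_measure_lebesgue_on_open) auto
  then interpret finite_measure ?M .
  have wX: "AE t in ?M. w t \<in> X" using w by (simp add: bochner_L2_def)
  show "AE t in time T. \<forall>u\<in>H1 \<Omega>. \<forall>v\<in>H1 \<Omega>. \<forall>c d. l t (\<lambda>x. c * u x + d * v x) = c * l t u + d * l t v"
    using wX l by eventually_elim (simp add: p_lin H1_lin)
  obtain s where s: "\<And>k. simple_function ?M (s k)" "\<And>k t. t \<in> {0<..<T} \<Longrightarrow> s k t \<in> X"
    "AE t in ?M. (\<lambda>k. N (\<lambda>x. s k t x - w t x)) \<longlonglongrightarrow> 0"
    using w unfolding bochner_L2_def by blast
  fix v assume v: "v \<in> H1 \<Omega>"
  have ae: "AE t in ?M. lim (\<lambda>k. p (s k t) v) = l t v"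
    using AE_space wX l s(3)
  proof eventually_elim
    case (elim t)
    have "(\<lambda>k. p (s k t) v) \<longlonglongrightarrow> p (w t) v"
    proof (rule LIM_zero_cancel, rule tendsto_rabs_zero_cancel, rule real_null_squeeze)
      show "(\<lambda>k. N (\<lambda>x. s k t x - w t x) * H1_norm \<Omega> v) \<longlonglongrightarrow> 0"
        using tendsto_mult_right[OF elim(4), of "H1_norm \<Omega> v"] by simp
      show "\<bar>p (s k t) v - p (w t) v\<bar> \<le> N (\<lambda>x. s k t x - w t x) * H1_norm \<Omega> v" for k
        using elim s(2)[of t k] by (intro p_le v) auto
    qed simp
    then show ?case using elim v by (simp add: limI)
  qed
  have "(\<lambda>t. lim (\<lambda>k. p (s k t) v)) \<in> borel_measurable ?M"
    by (intro borel_measurable_lim_metric borel_measurable_simple_function simple_function_compose1[of _ _ "\<lambda>f. p f v"] s)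
  then have lm: "(\<lambda>t. l t v) \<in> borel_measurable ?M"
    by (rule measurable_lebesgue_on_AE[OF _ _ ae]) simp
  show "integrable ?M (\<lambda>t. l t v)"
  proof (rule Bochner_Integration.integrable_bound[OF _ lm])
    show "integrable ?M (\<lambda>t. (1 + (N (w t))\<^sup>2) * H1_norm \<Omega> v)"
      using w by (intro integrable_mult_left Bochner_Integration.integrable_add) (auto simp: bochner_L2_def)
    show "AE t in ?M. norm (l t v) \<le> norm ((1 + (N (w t))\<^sup>2) * H1_norm \<Omega> v)"
      using wX l
    proof eventually_elim
      case (elim t)
      have "\<bar>l t v\<bar> \<le> N (w t) * H1_norm \<Omega> v"
        using elim p_le[OF elim(1) X.zero_in v] by (simp add: p_zero v)
      also have "\<dots> \<le> (1 + (N (w t))\<^sup>2) * H1_norm \<Omega> v"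
      proof (rule mult_right_mono[OF _ H1_norm_nonneg])
        show "N (w t) \<le> 1 + (N (w t))\<^sup>2"
          using two_mult_le_squares[of "N (w t)" 1] by simp
      qed
      finally show ?case using H1_norm_nonneg[of v] by (simp add: abs_mult)
    qed
  qed
next
  interpret X: seminorm_space X N by fact
  fix \<epsilon> :: real assume \<epsilon>: "\<epsilon> > 0"
  obtain e \<delta> A where e: "e \<in> L2 (time T)" "\<And>t. 0 \<le> e t" "L2_norm (time T) e \<le> \<epsilon>" "\<delta> > 0" "AE t in time T. t \<in> A"
    "\<And>s t. s \<in> A \<Longrightarrow> t \<in> A \<Longrightarrow> \<bar>s - t\<bar> < \<delta> \<Longrightarrow> w s \<in> X \<and> w t \<in> X \<and> N (\<lambda>x. w s x - w t x) \<le> e s + e t + \<epsilon>"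
    using X.bochner_L2_equicontinuous[OF w \<epsilon>] by blast
  let ?A = "{t\<in>A. \<forall>v\<in>H1 \<Omega>. l t v = p (w t) v}"
  have "AE t in time T. t \<in> ?A" using e(5) l by eventually_elim simp
  moreover have "\<bar>l s v - l t v\<bar> \<le> (e s + e t + \<epsilon>) * H1_norm \<Omega> v"
    if "s \<in> ?A" "t \<in> ?A" "\<bar>s - t\<bar> < \<delta>" "v \<in> H1 \<Omega>" for s t v
  proof -
    have *: "w s \<in> X" "w t \<in> X" "N (\<lambda>x. w s x - w t x) \<le> e s + e t + \<epsilon>" using that e(6)[of s t] by auto
    have "\<bar>l s v - l t v\<bar> = \<bar>p (w s) v - p (w t) v\<bar>" using that by simp
    also have "\<dots> \<le> N (\<lambda>x. w s x - w t x) * H1_norm \<Omega> v" by (rule p_le[OF *(1,2) that(4)])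
    also have "\<dots> \<le> (e s + e t + \<epsilon>) * H1_norm \<Omega> v" by (rule mult_right_mono[OF *(3) H1_norm_nonneg])
    finally show ?thesis .
  qed
  ultimately have "dual_modulus T l \<epsilon> e \<delta> ?A" using e(1-4) unfolding dual_modulus_def by simp
  then show "\<exists>e \<delta> A. dual_modulus T l \<epsilon> e \<delta> A" by blast
qed

lemma L2_seminorm_space: "seminorm_space (L2 M) (L2_norm M)"
  by unfold_locales (auto intro: L2_zero L2_lin L2_norm_lin_le)

lemma L2_derivatives_dual_path:
  assumes "l \<in> L2_derivatives T \<Omega>"
  shows "dual_path T l"
proof -
  obtain w where w: "w \<in> L2_L2 T \<Omega>" "AE t in time T. \<forall>v\<in>H1 \<Omega>. l t v = L2_inner (lebesgue_on \<Omega>) (w t) v"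
    using assms unfolding L2_derivatives_def by blast
  show ?thesis
  proof (rule bochner_dual_path[OF L2_seminorm_space w(1) _ _ _ w(2)])
    show "\<bar>L2_inner (lebesgue_on \<Omega>) f v - L2_inner (lebesgue_on \<Omega>) g v\<bar> \<le> L2_norm (lebesgue_on \<Omega>) (\<lambda>x. f x - g x) * H1_norm \<Omega> v"
      if "f \<in> L2 (lebesgue_on \<Omega>)" "g \<in> L2 (lebesgue_on \<Omega>)" "v \<in> H1 \<Omega>" for f g v
    proof -
      have "\<bar>L2_inner (lebesgue_on \<Omega>) f v - L2_inner (lebesgue_on \<Omega>) g v\<bar> = \<bar>L2_inner (lebesgue_on \<Omega>) (\<lambda>x. f x - g x) v\<bar>"
        using L2_inner_add_left[OF that(1,2) H1_L2[OF that(3)], of 1 "-1"] by simp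
      also have "\<dots> \<le> L2_norm (lebesgue_on \<Omega>) (\<lambda>x. f x - g x) * L2_norm (lebesgue_on \<Omega>) v"
        by (rule L2_Cauchy_Schwarz[OF L2_diff[OF that(1,2)] H1_L2[OF that(3)]])
      also have "\<dots> \<le> L2_norm (lebesgue_on \<Omega>) (\<lambda>x. f x - g x) * H1_norm \<Omega> v"
        by (intro mult_left_mono L2_norm_le_H1_norm L2_norm_nonneg)
      finally show ?thesis .
    qed
    show "L2_inner (lebesgue_on \<Omega>) (\<lambda>_. 0) v = 0" for v by (simp add: L2_inner_def)
  qed (rule L2_inner_add_right[OF H1_L2 H1_L2])
qed

lemma H1_dual_bound:
  assumes l: "l \<in> H1_dual \<Omega>" and v: "v \<in> H1 \<Omega>"
  shows "\<bar>l v\<bar> \<le> H1_dual_norm \<Omega> l * H1_norm \<Omega> v" "bdd_above ((\<lambda>v. \<bar>l v\<bar>) ` {v \<in> H1 \<Omega>. H1_norm \<Omega> v \<le> 1})"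
proof -
  obtain C where C: "\<And>v. v \<in> H1 \<Omega> \<Longrightarrow> \<bar>l v\<bar> \<le> C * H1_norm \<Omega> v"
    using l unfolding H1_dual_def by blast
  show bdd: "bdd_above ((\<lambda>v. \<bar>l v\<bar>) ` {v \<in> H1 \<Omega>. H1_norm \<Omega> v \<le> 1})"
  proof (rule bdd_aboveI2[where M="\<bar>C\<bar>"])
    fix v assume v: "v \<in> {v \<in> H1 \<Omega>. H1_norm \<Omega> v \<le> 1}"
    then have "\<bar>l v\<bar> \<le> C * H1_norm \<Omega> v" by (intro C) simp
    also have "\<dots> \<le> \<bar>C\<bar> * 1" using v H1_norm_nonneg[of v] by (intro mult_mono) auto
    finally show "\<bar>l v\<bar> \<le> \<bar>C\<bar>" by simp
  qed
  show "\<bar>l v\<bar> \<le> H1_dual_norm \<Omega> l * H1_norm \<Omega> v"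
  proof (cases "H1_norm \<Omega> v = 0")
    case True
    then show ?thesis using C[OF v] by simp
  next
    case False
    let ?n = "H1_norm \<Omega> v"
    have n: "?n > 0" using False H1_norm_nonneg[of v] by simp
    have "H1_norm \<Omega> (\<lambda>x. (1 / ?n) * v x) = 1" using H1_norm_cmult[OF v, of "1 / ?n"] n by simp
    then have "(\<lambda>x. (1 / ?n) * v x) \<in> {v \<in> H1 \<Omega>. H1_norm \<Omega> v \<le> 1}" using H1_cmult[OF v, of "1 / ?n"] by simp
    then have "\<bar>l (\<lambda>x. (1 / ?n) * v x)\<bar> \<le> H1_dual_norm \<Omega> l"
      unfolding H1_dual_norm_def by (rule cSUP_upper[OF _ bdd])
    moreover have "l (\<lambda>x. (1 / ?n) * v x + 0 * v x) = (1 / ?n) * l v + 0 * l v"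
      using l v unfolding H1_dual_def by blast
    ultimately have "\<bar>l v\<bar> / ?n \<le> H1_dual_norm \<Omega> l" using n by (simp add: abs_divide)
    then show ?thesis using n by (simp add: divide_le_eq)
  qed
qed

lemma H1_dual_seminorm_space: "seminorm_space (H1_dual \<Omega>) (H1_dual_norm \<Omega>)"
proof
  show "(\<lambda>_. 0) \<in> H1_dual \<Omega>" by (auto simp: H1_dual_def intro: exI[of _ 0])
  have nonneg: "0 \<le> H1_dual_norm \<Omega> u" if "u \<in> H1_dual \<Omega>" for u
  proof -
    have z: "(\<lambda>_. 0) \<in> {v \<in> H1 \<Omega>. H1_norm \<Omega> v \<le> 1}" using H1_zero H1_norm_cmult[OF H1_zero, of 0] by simp
    have "0 \<le> \<bar>u (\<lambda>_. 0)\<bar>" by simp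
    also have "\<dots> \<le> H1_dual_norm \<Omega> u"
      unfolding H1_dual_norm_def by (rule cSUP_upper[OF z H1_dual_bound(2)[OF that H1_zero]])
    finally show ?thesis .
  qed
  fix u v and c d :: real assume u: "u \<in> H1_dual \<Omega>" and v: "v \<in> H1_dual \<Omega>"
  show "0 \<le> H1_dual_norm \<Omega> u" by (rule nonneg[OF u])
  have le: "\<bar>c * u x + d * v x\<bar> \<le> (\<bar>c\<bar> * H1_dual_norm \<Omega> u + \<bar>d\<bar> * H1_dual_norm \<Omega> v) * H1_norm \<Omega> x" if x: "x \<in> H1 \<Omega>" for x
  proof -
    have "\<bar>c * u x + d * v x\<bar> \<le> \<bar>c\<bar> * \<bar>u x\<bar> + \<bar>d\<bar> * \<bar>v x\<bar>"
      using abs_triangle_ineq[of "c * u x" "d * v x"] by (simp add: abs_mult)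
    also have "\<dots> \<le> \<bar>c\<bar> * (H1_dual_norm \<Omega> u * H1_norm \<Omega> x) + \<bar>d\<bar> * (H1_dual_norm \<Omega> v * H1_norm \<Omega> x)"
      using H1_dual_bound(1)[OF u x] H1_dual_bound(1)[OF v x] by (intro add_mono mult_left_mono) auto
    finally show ?thesis by (simp add: algebra_simps)
  qed
  show "(\<lambda>x. c * u x + d * v x) \<in> H1_dual \<Omega>"
    unfolding H1_dual_def
  proof (intro CollectI conjI ballI allI)
    fix f g and a b :: real assume fg: "f \<in> H1 \<Omega>" "g \<in> H1 \<Omega>"
    have "u (\<lambda>x. a * f x + b * g x) = a * u f + b * u g" "v (\<lambda>x. a * f x + b * g x) = a * v f + b * v g"
      using u v fg unfolding H1_dual_def by blast+
    then show "c * u (\<lambda>x. a * f x + b * g x) + d * v (\<lambda>x. a * f x + b * g x) = a * (c * u f + d * v f) + b * (c * u g + d * v g)"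
      by (simp add: algebra_simps)
  qed (use le in blast)
  show "H1_dual_norm \<Omega> (\<lambda>x. c * u x + d * v x) \<le> \<bar>c\<bar> * H1_dual_norm \<Omega> u + \<bar>d\<bar> * H1_dual_norm \<Omega> v"
    unfolding H1_dual_norm_def[of _ "\<lambda>x. c * u x + d * v x"]
  proof (rule cSUP_least)
    show "{v \<in> H1 \<Omega>. H1_norm \<Omega> v \<le> 1} \<noteq> {}" using H1_zero H1_norm_cmult[OF H1_zero, of 0] by auto
    fix x assume x: "x \<in> {v \<in> H1 \<Omega>. H1_norm \<Omega> v \<le> 1}"
    have "0 \<le> \<bar>c\<bar> * H1_dual_norm \<Omega> u + \<bar>d\<bar> * H1_dual_norm \<Omega> v"
      using nonneg u v by simp
    from mult_left_mono[OF _ this, of "H1_norm \<Omega> x" 1]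
    show "\<bar>c * u x + d * v x\<bar> \<le> \<bar>c\<bar> * H1_dual_norm \<Omega> u + \<bar>d\<bar> * H1_dual_norm \<Omega> v"
      using le[of x] x by auto
  qed
qed

lemma dual_derivatives_dual_path:
  assumes "l \<in> dual_derivatives T \<Omega>"
  shows "dual_path T l"
proof (rule bochner_dual_path[OF H1_dual_seminorm_space assms[unfolded dual_derivatives_def], of "\<lambda>f v. f v"])
  interpret seminorm_space "H1_dual \<Omega>" "H1_dual_norm \<Omega>" by (rule H1_dual_seminorm_space)
  show "\<bar>f v - g v\<bar> \<le> H1_dual_norm \<Omega> (\<lambda>x. f x - g x) * H1_norm \<Omega> v"
    if "f \<in> H1_dual \<Omega>" "g \<in> H1_dual \<Omega>" "v \<in> H1 \<Omega>" for f g v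
    using H1_dual_bound(1)[OF diff_in[OF that(1,2)] that(3)] .
qed (auto simp: H1_dual_def)

end

section \<open>Energy estimates\<close>

lemma time_integrable_on:
  fixes f :: "real \<Rightarrow> real"
  assumes "integrable (time T) f"
  shows "f integrable_on {0..T}"
proof -
  have "f integrable_on {0<..<T}" using assms by (rule integrable_on_lebesgue_on) simp
  then show ?thesis using has_integral_Icc_iff_Ioo unfolding integrable_on_def by blast
qed

lemma time_integral_slice:
  fixes f :: "real \<Rightarrow> real"
  assumes f: "integrable (time T) f" and st: "0 \<le> s" "t \<le> T"
  shows "(\<integral>x. indicator {s<..<t} x * f x \<partial>time T) = integral {s..t} f"
    "integrable (time T) (\<lambda>x. indicator {s<..<t} x * f x)"
proof -
  have sub: "(\<lambda>x. indicator {0<..<T} x * (indicator {s<..<t} x * f x)) = (\<lambda>x. indicator {s<..<t} x * f x)"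
    using st by (auto simp: indicator_def fun_eq_iff)
  have "integrable lebesgue (\<lambda>x. indicator {0<..<T} x *\<^sub>R f x)"
    using f by (simp add: integrable_restrict_space)
  then have "integrable lebesgue (\<lambda>x. indicator {s<..<t} x *\<^sub>R (indicator {0<..<T} x *\<^sub>R f x))"
    by (rule integrable_mult_indicator[rotated]) simp
  moreover have "(\<lambda>x. indicator {s<..<t} x *\<^sub>R (indicator {0<..<T} x *\<^sub>R f x)) = (\<lambda>x. indicator {s<..<t} x *\<^sub>R f x)"
    using st by (auto simp: indicator_def fun_eq_iff)
  ultimately have i: "integrable lebesgue (\<lambda>x. indicator {s<..<t} x *\<^sub>R f x)" by (simp only:)
  then have "integrable (lebesgue_on {s<..<t}) f" by (simp add: integrable_restrict_space)
  then have "(\<integral>x. f x \<partial>lebesgue_on {s<..<t}) = integral {s<..<t} f"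
    by (rule lebesgue_integral_eq_integral) simp
  then show "(\<integral>x. indicator {s<..<t} x * f x \<partial>time T) = integral {s..t} f"
    unfolding integral_open_interval_real by (simp add: integral_restrict_space sub)
  show "integrable (time T) (\<lambda>x. indicator {s<..<t} x * f x)"
    using i by (simp add: integrable_restrict_space sub)
qed

lemma time_integral_mono_AE:
  fixes f g :: "real \<Rightarrow> real"
  assumes f: "integrable (time T) f" and g: "integrable (time T) g" and st: "0 \<le> s" "t \<le> T"
    and le: "AE x in time T. x \<in> {s<..<t} \<longrightarrow> f x \<le> g x"
  shows "integral {s..t} f \<le> integral {s..t} g"
  unfolding time_integral_slice(1)[OF f st, symmetric] time_integral_slice(1)[OF g st, symmetric]
proof (rule integral_mono_AE)
  show "AE x in time T. indicator {s<..<t} x * f x \<le> indicator {s<..<t} x * g x"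
    using le by eventually_elim (auto simp: indicator_def)
qed (use time_integral_slice(2)[OF f st] time_integral_slice(2)[OF g st] in auto)

lemma time_integral_diff:
  fixes f :: "real \<Rightarrow> real"
  assumes f: "f integrable_on {0..T}" and st: "0 \<le> s" "s \<le> t" "t \<le> T"
  shows "integral {s..t} f = integral {0..t} f - integral {0..s} f"
proof -
  have "f integrable_on {0..t}" using f st by (auto intro: integrable_subinterval_real)
  then show ?thesis using Henstock_Kurzweil_Integration.integral_combine[of 0 s t f] st by simp
qed

definition smooth_step :: "real \<Rightarrow> real" where
  "smooth_step x = 1 - pos_sq (1 - pos_sq x)"

definition smooth_step' :: "real \<Rightarrow> real" where
  "smooth_step' x = 2 * max 0 (1 - pos_sq x) * (2 * max 0 x)"

lemma smooth_step_deriv: "(smooth_step has_real_derivative smooth_step' x) (at x)"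
proof -
  have "((\<lambda>x. pos_sq (1 - pos_sq x)) has_real_derivative 2 * max 0 (1 - pos_sq x) * (0 - 2 * max 0 x)) (at x)"
    by (intro DERIV_chain2[OF pos_sq_has_derivative] DERIV_diff DERIV_const pos_sq_has_derivative)
  then have "((\<lambda>x. 1 - pos_sq (1 - pos_sq x)) has_real_derivative 0 - 2 * max 0 (1 - pos_sq x) * (0 - 2 * max 0 x)) (at x)"
    by (intro DERIV_diff DERIV_const)
  then show ?thesis by (simp add: smooth_step_def[abs_def] smooth_step'_def)
qed

lemma pos_sq_ge_1: "1 \<le> x \<Longrightarrow> 1 \<le> pos_sq x"
  by (simp add: pos_sq_def max_def one_le_power)

lemma smooth_step_0: "x \<le> 0 \<Longrightarrow> smooth_step x = 0"
  by (simp add: smooth_step_def) (simp add: pos_sq_def)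

lemma smooth_step_1: "1 \<le> x \<Longrightarrow> smooth_step x = 1"
  using pos_sq_ge_1[of x] by (simp add: smooth_step_def)

lemma smooth_step_bounds: "0 \<le> smooth_step x" "smooth_step x \<le> 1"
proof -
  have "max 0 (1 - pos_sq x) \<le> 1" by simp
  then have "(max 0 (1 - pos_sq x))\<^sup>2 \<le> 1" by (intro power_le_one) auto
  then show "0 \<le> smooth_step x" by (simp add: smooth_step_def) (simp add: pos_sq_def)
  show "smooth_step x \<le> 1" by (simp add: smooth_step_def)
qed

lemma smooth_step'_nonneg: "0 \<le> smooth_step' x"
  by (simp add: smooth_step'_def)

lemma smooth_step'_0: "x \<le> 0 \<or> 1 \<le> x \<Longrightarrow> smooth_step' x = 0"
  using pos_sq_ge_1[of x] by (auto simp: smooth_step'_def)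

lemma pos_sq_continuous: "continuous_on S pos_sq"
  unfolding pos_sq_def[abs_def] by (intro continuous_intros)

lemma smooth_step'_continuous: "continuous_on UNIV smooth_step'"
  unfolding smooth_step'_def[abs_def] by (intro continuous_intros pos_sq_continuous)

lemma continuous_time_L2:
  fixes y :: "real \<Rightarrow> real"
  assumes "continuous_on {0..T} y"
  shows "y \<in> L2 (time T)"
proof (rule continuous_bounded_L2)
  show "continuous_on (closure {0<..<T}) y"
    by (rule continuous_on_subset[OF assms]) (auto intro: closure_minimal[THEN subsetD, rotated 2])
qed auto

lemma finite_measure_time: "finite_measure (time T)"
  by (rule finite_measure_lebesgue_on_open) auto

lemma smooth_step_integrable:
  assumes "continuous_on {0..T} y"
  shows "integrable (time T) (\<lambda>x. k * smooth_step' (k * (x - a)) * y x)"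
  by (intro L2_mult_integrable continuous_time_L2 assms continuous_intros
      continuous_on_compose2[OF smooth_step'_continuous]) auto

text \<open>The derivatives of steep steps are approximate identities.\<close>

lemma smooth_step_average:
  assumes y: "continuous_on {0..T} y" and k: "k > 0" and a: "0 < a" "a + 1 / k < T"
    and close: "\<And>x. x \<in> {a..a + 1 / k} \<Longrightarrow> \<bar>y x - c\<bar> \<le> \<eta>"
  shows "\<bar>(\<integral>x. k * smooth_step' (k * (x - a)) * y x \<partial>time T) - c\<bar> \<le> \<eta>"
proof -
  let ?D = "\<lambda>x. k * smooth_step' (k * (x - a))"
  have Dc: "continuous_on UNIV ?D"
    by (intro continuous_intros continuous_on_compose2[OF smooth_step'_continuous]) auto
  have Dm: "?D \<in> borel_measurable borel" using Dc by (rule borel_measurable_continuous_onI)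
  have D0: "?D x = 0" if "x \<notin> {a<..<a + 1 / k}" for x
  proof -
    have "k * (x - a) \<le> 0 \<or> 1 \<le> k * (x - a)"
      using that k by (auto simp: mult_le_0_iff field_simps not_less)
    then show ?thesis by (simp add: smooth_step'_0)
  qed
  have DT: "?D x = 0" if "x \<notin> {0<..<T}" for x by (rule D0) (use that a k in auto)
  have "(\<integral>x. ?D x * indicator {0..T} x \<partial>lborel) = smooth_step (k * (T - a)) - smooth_step (k * (0 - a))"
  proof (rule integral_FTC_Icc_real)
    show "0 \<le> T" using a k by (smt (verit) divide_pos_pos)
    show "((\<lambda>x. smooth_step (k * (x - a))) has_real_derivative ?D x) (at x)" for x
    proof -
      have "((\<lambda>x. k * (x - a)) has_real_derivative k) (at x)" by (auto intro!: derivative_eq_intros)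
      from DERIV_chain2[OF smooth_step_deriv this] show ?thesis by (simp add: mult.commute)
    qed
    show "isCont ?D x" for x using Dc by (simp add: continuous_on_eq_continuous_at)
  qed
  also have "\<dots> = 1"
  proof -
    have "1 \<le> k * (T - a)" using a k by (simp add: field_simps)
    moreover have "k * (0 - a) \<le> 0" using a k by simp
    ultimately show ?thesis by (simp only: smooth_step_0 smooth_step_1)
  qed
  also have "(\<lambda>x. ?D x * indicator {0..T} x) = ?D"
  proof
    fix x
    show "?D x * indicator {0..T} x = ?D x"
    proof (cases "x \<in> {0..T}")
      case False
      then have "?D x = 0" by (intro DT) auto
      then show ?thesis by (simp only: mult_zero_left)
    qed simp
  qed
  finally have "(\<integral>x. ?D x \<partial>lborel) = 1" .
  moreover have "(\<integral>x. ?D x \<partial>time T) = (\<integral>x. ?D x \<partial>lborel)"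
    by (rule lebesgue_on_integral_borel(2)[OF Dm _ DT]) simp_all
  ultimately have D1: "(\<integral>x. ?D x \<partial>time T) = 1" by (simp only:)
  have i: "integrable (time T) (\<lambda>x. ?D x * y x)" by (rule smooth_step_integrable[OF y])
  have "continuous_on {0..T} (\<lambda>_. 1::real)" by simp
  from smooth_step_integrable[OF this, of k a] have iD: "integrable (time T) ?D" by simp
  have i2: "integrable (time T) (\<lambda>x. ?D x * (y x - c))" using i iD by (simp add: right_diff_distrib)
  have "(\<integral>x. ?D x * y x \<partial>time T) - c = (\<integral>x. ?D x * (y x - c) \<partial>time T)"
    using i iD D1 by (simp add: right_diff_distrib)
  also have "\<bar>\<dots>\<bar> \<le> (\<integral>x. \<eta> * ?D x \<partial>time T)"
  proof (rule integral_abs_bound_integral[OF i2])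
    show "integrable (time T) (\<lambda>x. \<eta> * ?D x)" using iD by simp
    fix x
    have D_nn: "0 \<le> ?D x" using k smooth_step'_nonneg by simp
    show "\<bar>?D x * (y x - c)\<bar> \<le> \<eta> * ?D x"
    proof (cases "x \<in> {a<..<a + 1 / k}")
      case True
      then have "\<bar>y x - c\<bar> \<le> \<eta>" by (intro close) auto
      then show ?thesis
        using D_nn mult_left_mono[of "\<bar>y x - c\<bar>" \<eta> "?D x"] abs_mult_pos'[OF D_nn, of "y x - c"] by (simp only: mult.commute[of \<eta>])
    next
      case False
      show ?thesis by (simp only: D0[OF False] mult_zero_left mult_zero_right abs_zero order_refl)
    qed
  qed
  also have "\<dots> = \<eta>" using D1 by simp
  finally show "\<bar>(\<integral>x. ?D x * y x \<partial>time T) - c\<bar> \<le> \<eta>" .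
qed

lemma weak_derivative_integral:
  assumes y: "continuous_on {0..T} y" and z: "integrable (time T) z"
    and weak: "\<And>\<theta>. \<theta> \<in> C1_compact {0<..<T} \<Longrightarrow> (\<integral>t. deriv \<theta> t * y t \<partial>time T) = - (\<integral>t. \<theta> t * z t \<partial>time T)"
    and st: "0 < s" "s < t" "t < T"
  shows "y t - y s = integral {s..t} z"
proof -
  obtain n\<^sub>0 where n0: "n\<^sub>0 > 0" "1 / real n\<^sub>0 < t - s"
    using ex_inverse_of_nat_less[of "t - s"] st by (auto simp: inverse_eq_divide)
  define k where "k n = real (n + n\<^sub>0)" for n
  have k: "k n > 0" "1 / k n \<le> t - s" for n
  proof -
    show "k n > 0" using n0 by (simp add: k_def)
    have "1 / k n \<le> 1 / real n\<^sub>0" using n0 by (intro divide_left_mono) (auto simp: k_def)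
    then show "1 / k n \<le> t - s" using n0 by simp
  qed
  have kinf: "filterlim k at_top sequentially"
    unfolding k_def by (rule filterlim_compose[OF filterlim_real_sequentially filterlim_add_const_nat_at_top])
  have k0: "(\<lambda>n. 1 / k n) \<longlonglongrightarrow> 0"
    using tendsto_divide_0[OF tendsto_const filterlim_at_top_imp_at_infinity[OF kinf]] by simp
  define b where "b n = t - 1 / k n" for n
  define \<theta> where "\<theta> n x = smooth_step (k n * (x - s)) - smooth_step (k n * (x - b n))" for n x
  define D where "D n a x = k n * smooth_step' (k n * (x - a))" for n a x
  have kb: "k n * (x - b n) = k n * (x - t) + 1" for n x
    using k(1)[of n] by (simp add: b_def field_simps)
  have d: "(\<theta> n has_real_derivative D n s x - D n (b n) x) (at x)" for n x
  proof -
    have "((\<lambda>x. smooth_step (k n * (x - a))) has_real_derivative D n a x) (at x)" for a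
    proof -
      have "((\<lambda>x. k n * (x - a)) has_real_derivative k n) (at x)" by (auto intro!: derivative_eq_intros)
      from DERIV_chain2[OF smooth_step_deriv this] show ?thesis by (simp add: mult.commute D_def)
    qed
    from DERIV_diff[OF this this] show ?thesis by (simp add: \<theta>_def[abs_def])
  qed
  have Dc: "continuous_on UNIV (D n a)" for n a
    unfolding D_def[abs_def]
    by (intro continuous_intros continuous_on_compose2[OF smooth_step'_continuous]) auto
  have C: "C1_fun (\<theta> n) (\<lambda>x h. (D n s x - D n (b n) x) * h)" for n
    unfolding C1_fun_def
    using d[of n, unfolded has_field_derivative_def] by (auto intro!: continuous_intros Dc)
  have \<theta>0: "\<theta> n x = 0" if "x \<notin> {s<..<t}" for n x
  proof (cases "x \<le> s")
    case True
    have "k n * (x - s) \<le> 0" using True k(1)[of n] by (simp add: mult_le_0_iff)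
    moreover have "x - b n \<le> 0" using True k(2)[of n] by (simp add: b_def)
    then have "k n * (x - b n) \<le> 0" using k(1)[of n] by (simp add: mult_le_0_iff)
    ultimately show ?thesis by (simp add: \<theta>_def smooth_step_0)
  next
    case False
    then have x: "t \<le> x" using that by auto
    then have 1: "1 \<le> k n * (x - b n)" unfolding kb using k(1)[of n] by simp
    have "1 / k n \<le> x - s" using k(2)[of n] x by linarith
    then have "1 \<le> k n * (x - s)" using k(1)[of n] by (simp add: divide_le_eq mult.commute)
    then show ?thesis using 1 by (simp add: \<theta>_def smooth_step_1)
  qed
  have \<theta>C: "\<theta> n \<in> C1_compact {0<..<T}" for n
    by (rule C1_compactI[OF C, of "{s..t}"]) (use st \<theta>0 in auto)
  have lim: "(\<lambda>n. \<integral>x. D n (a n) x * y x \<partial>time T) \<longlonglongrightarrow> y c"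
    and int: "integrable (time T) (\<lambda>x. D n (a n) x * y x)"
    if c: "c \<in> {0..T}" and a: "\<And>n. s \<le> a n" "\<And>n. a n + 1 / k n \<le> t" "\<And>n x. x \<in> {a n..a n + 1 / k n} \<Longrightarrow> \<bar>x - c\<bar> \<le> 1 / k n"
    for c a n
  proof -
    have aT: "0 < a n" "a n + 1 / k n < T" for n using a(1)[of n] a(2)[of n] st by auto
    show "integrable (time T) (\<lambda>x. D n (a n) x * y x)"
      unfolding D_def by (rule smooth_step_integrable[OF y])
    show "(\<lambda>n. \<integral>x. D n (a n) x * y x \<partial>time T) \<longlonglongrightarrow> y c"
    proof (rule LIMSEQ_I)
      fix r :: real assume r: "r > 0"
      then obtain \<delta> where \<delta>: "\<delta> > 0" "\<And>x. x \<in> {0..T} \<Longrightarrow> dist x c < \<delta> \<Longrightarrow> dist (y x) (y c) < r / 2"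
        using y c unfolding continuous_on_iff by (meson half_gt_zero)
      have "eventually (\<lambda>n. 1 / k n < \<delta>) sequentially" using k0 \<delta>(1) by (rule order_tendstoD)
      then obtain N where N: "\<And>n. n \<ge> N \<Longrightarrow> 1 / k n < \<delta>" by (auto simp: eventually_sequentially)
      have "norm ((\<integral>x. D n (a n) x * y x \<partial>time T) - y c) < r" if "n \<ge> N" for n
      proof -
        have "\<bar>(\<integral>x. k n * smooth_step' (k n * (x - a n)) * y x \<partial>time T) - y c\<bar> \<le> r / 2"
        proof (rule smooth_step_average[OF y k(1) aT])
          fix x assume x: "x \<in> {a n..a n + 1 / k n}"
          then have "x \<in> {0..T}" using aT[of n] by auto
          moreover have "dist x c < \<delta>" using a(3)[OF x] N[OF that] by (simp add: dist_real_def)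
          ultimately show "\<bar>y x - y c\<bar> \<le> r / 2" using \<delta>(2) by (fastforce simp: dist_real_def)
        qed
        then show ?thesis using r by (simp add: D_def)
      qed
      then show "\<exists>N. \<forall>n\<ge>N. norm ((\<integral>x. D n (a n) x * y x \<partial>time T) - y c) < r" by blast
    qed
  qed
  have kk: "s + 1 / k n \<le> t" "s \<le> b n" for n using k(2)[of n] by (simp_all add: b_def)
  have lim1: "(\<lambda>n. \<integral>x. D n s x * y x \<partial>time T) \<longlonglongrightarrow> y s" and i1: "\<And>n. integrable (time T) (\<lambda>x. D n s x * y x)"
    using st kk by (auto intro!: lim[of s "\<lambda>_. s"] int[of s "\<lambda>_. s"])
  have tb: "b n + 1 / k n \<le> t" "x \<in> {b n..b n + 1 / k n} \<Longrightarrow> \<bar>x - t\<bar> \<le> 1 / k n" for n x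
    by (auto simp: b_def abs_le_iff)
  have lim2: "(\<lambda>n. \<integral>x. D n (b n) x * y x \<partial>time T) \<longlonglongrightarrow> y t" and i2: "\<And>n. integrable (time T) (\<lambda>x. D n (b n) x * y x)"
    using lim[OF _ kk(2) tb] int[OF _ kk(2) tb] st by simp_all
  have "(\<lambda>n. (\<integral>x. D n s x * y x \<partial>time T) - (\<integral>x. D n (b n) x * y x \<partial>time T)) \<longlonglongrightarrow> y s - y t"
    by (rule tendsto_diff[OF lim1 lim2])
  moreover have "(\<integral>x. D n s x * y x \<partial>time T) - (\<integral>x. D n (b n) x * y x \<partial>time T) = - (\<integral>x. \<theta> n x * z x \<partial>time T)" for n
  proof -
    have "deriv (\<theta> n) x = D n s x - D n (b n) x" for x by (rule DERIV_imp_deriv[OF d])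
    then show ?thesis using weak[OF \<theta>C[of n]] i1[of n] i2[of n] by (simp add: left_diff_distrib)
  qed
  ultimately have L1: "(\<lambda>n. - (\<integral>x. \<theta> n x * z x \<partial>time T)) \<longlonglongrightarrow> y s - y t" by simp
  have "(\<lambda>n. \<integral>x. \<theta> n x * z x \<partial>time T) \<longlonglongrightarrow> (\<integral>x. indicator {s<..<t} x * z x \<partial>time T)"
  proof (rule integral_dominated_convergence)
    show "integrable (time T) (\<lambda>x. \<bar>z x\<bar>)" using z by simp
    have [measurable]: "\<theta> n \<in> borel_measurable (time T)" for n
      by (rule lebesgue_on_measurable_borel[OF C1_fun_measurable[OF C]])
    have [measurable]: "z \<in> borel_measurable (time T)" using z by simp
    show "(\<lambda>x. \<theta> n x * z x) \<in> borel_measurable (time T)" for n by measurable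
    show "(\<lambda>x. indicator {s<..<t} x * z x) \<in> borel_measurable (time T)"
      using time_integral_slice(2)[OF z, of s t] st by simp
    have "\<bar>\<theta> n x\<bar> \<le> 1" for n x
      using smooth_step_bounds[of "k n * (x - s)"] smooth_step_bounds[of "k n * (x - b n)"] by (simp add: \<theta>_def)
    then show "AE x in time T. norm (\<theta> n x * z x) \<le> \<bar>z x\<bar>" for n
      by (intro AE_I2) (simp add: abs_mult mult_left_le_one_le)
    show "AE x in time T. (\<lambda>n. \<theta> n x * z x) \<longlonglongrightarrow> indicator {s<..<t} x * z x"
    proof (intro AE_I2 tendsto_mult_right)
      fix x
      show "(\<lambda>n. \<theta> n x) \<longlonglongrightarrow> indicator {s<..<t} x"
      proof (cases "x \<in> {s<..<t}")
        case False
        then show ?thesis using \<theta>0[OF False] by simp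
      next
        case True
        have "eventually (\<lambda>n. 1 / k n < min (x - s) (t - x)) sequentially"
          using k0 True by (intro order_tendstoD) auto
        then have "eventually (\<lambda>n. \<theta> n x = 1) sequentially"
        proof eventually_elim
          case (elim n)
          have "1 \<le> k n * (x - s)" using elim k(1)[of n] by (simp add: divide_less_eq mult.commute)
          moreover have "x - b n \<le> 0" using elim by (simp add: b_def)
          then have "k n * (x - b n) \<le> 0" using k(1)[of n] by (simp add: mult_le_0_iff)
          ultimately show ?case by (simp add: \<theta>_def smooth_step_0 smooth_step_1)
        qed
        then show ?thesis using True by (simp add: tendsto_eventually)
      qed
    qed
  qed
  from tendsto_minus[OF this] have "(\<lambda>n. - (\<integral>x. \<theta> n x * z x \<partial>time T)) \<longlonglongrightarrow> - integral {s..t} z"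
    using time_integral_slice(1)[OF z, of s t] st by simp
  from LIMSEQ_unique[OF L1 this] show ?thesis by simp
qed

lemma increment_integral_bound:
  assumes \<psi>: "continuous_on {0..T} \<psi>" and \<rho>: "integrable (time T) \<rho>" and d0: "\<delta>\<^sub>0 > 0"
    and incr: "AE t in time T. \<forall>\<delta>. 0 < \<delta> \<longrightarrow> \<delta> < \<delta>\<^sub>0 \<longrightarrow> \<delta> < t \<longrightarrow> \<psi> t - \<psi> (t - \<delta>) \<le> \<delta> * \<rho> t"
    and st: "0 < s" "s < t" "t < T"
  shows "\<psi> t - \<psi> s \<le> integral {s..t} \<rho>"
proof -
  define P where "P x = integral {0..x} \<psi>" for x
  define R where "R x = integral {0..x} \<rho>" for x
  have \<psi>i: "\<psi> integrable_on {0..T}" using \<psi> by (rule integrable_continuous_interval)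
  have \<rho>i: "\<rho> integrable_on {0..T}" by (rule time_integrable_on[OF \<rho>])
  have P: "(P has_real_derivative \<psi> x) (at x)" if "0 < x" "x < T" for x
    using integral_has_real_derivative[OF \<psi>, of x] that unfolding P_def by (simp add: at_within_Icc_at)
  have Rc: "continuous_on {0..T} R" unfolding R_def by (rule indefinite_integral_continuous_1[OF \<rho>i])
  have \<psi>L: "integrable (time T) f" if "continuous_on {0..T} f" for f :: "real \<Rightarrow> real"
    by (rule L2_integrable[OF finite_measure_time continuous_time_L2[OF that]])
  have main: "(P t - P (t - \<delta>)) / \<delta> - (P (s + \<delta>) - P s) / \<delta> \<le> R t - R (s + \<delta>)"
    if \<delta>: "0 < \<delta>" "\<delta> < \<delta>\<^sub>0" "\<delta> < t - s" for \<delta>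
  proof -
    define g where "g x = \<psi> (max 0 (min T (x - \<delta>)))" for x
    have g: "continuous_on {0..T} g"
      unfolding g_def using st by (intro continuous_on_compose2[OF \<psi>] continuous_intros) auto
    have "integral {s + \<delta>..t} (\<lambda>x. \<psi> x - g x) \<le> integral {s + \<delta>..t} (\<lambda>x. \<delta> * \<rho> x)"
    proof (rule time_integral_mono_AE)
      show "integrable (time T) (\<lambda>x. \<psi> x - g x)" using \<psi>L[OF \<psi>] \<psi>L[OF g] by simp
      show "integrable (time T) (\<lambda>x. \<delta> * \<rho> x)" using \<rho> by simp
      show "AE x in time T. x \<in> {s + \<delta><..<t} \<longrightarrow> \<psi> x - g x \<le> \<delta> * \<rho> x"
        using incr by eventually_elim (use \<delta> st in \<open>auto simp: g_def max_def min_def\<close>)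
    qed (use \<delta> st in auto)
    also have "integral {s + \<delta>..t} (\<lambda>x. \<delta> * \<rho> x) = \<delta> * integral {s + \<delta>..t} \<rho>" by simp
    also have "integral {s + \<delta>..t} \<rho> = R t - R (s + \<delta>)"
      unfolding R_def using \<delta> st by (intro time_integral_diff[OF \<rho>i]) auto
    also have "integral {s + \<delta>..t} (\<lambda>x. \<psi> x - g x) = integral {s + \<delta>..t} \<psi> - integral {s + \<delta>..t} g"
      using \<delta> st by (intro Henstock_Kurzweil_Integration.integral_diff integrable_continuous_interval continuous_on_subset[OF \<psi>] continuous_on_subset[OF g]) auto
    also have "integral {s + \<delta>..t} \<psi> = P t - P (s + \<delta>)"
      unfolding P_def using \<delta> st by (intro time_integral_diff[OF \<psi>i]) auto
    also have "integral {s + \<delta>..t} g = integral {s + \<delta>..t} (\<lambda>x. \<psi> (x - \<delta>))"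
      using \<delta> st by (intro Henstock_Kurzweil_Integration.integral_cong) (auto simp: g_def max_def min_def)
    also have "\<dots> = integral {s..t - \<delta>} \<psi>"
      using integral_shift_real_ivl[of s "-\<delta>" "t - \<delta>" \<psi>] by simp
    also have "\<dots> = P (t - \<delta>) - P s"
      unfolding P_def using \<delta> st by (intro time_integral_diff[OF \<psi>i]) auto
    finally have "(P t - P (t - \<delta>)) - (P (s + \<delta>) - P s) \<le> \<delta> * (R t - R (s + \<delta>))" by simp
    then have "((P t - P (t - \<delta>)) - (P (s + \<delta>) - P s)) / \<delta> \<le> R t - R (s + \<delta>)"
      using \<delta>(1) by (simp add: divide_le_eq mult.commute)
    then show ?thesis by (simp add: diff_divide_distrib)
  qed
  have "\<psi> t - \<psi> s \<le> R t - R s"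
  proof (rule tendsto_le[OF trivial_limit_at_right_real])
    have "((\<lambda>h. (P (s + h) - P s) / h) \<longlongrightarrow> \<psi> s) (at_right 0)"
      using P[of s] st by (auto simp: DERIV_def intro: tendsto_mono[OF at_le])
    moreover have "((\<lambda>h. (P t - P (t - h)) / h) \<longlongrightarrow> \<psi> t) (at_right 0)"
    proof -
      have "((\<lambda>h. (P (t + h) - P t) / h) \<longlongrightarrow> \<psi> t) (at 0)" using P[of t] st by (simp add: DERIV_def)
      moreover have "filterlim (\<lambda>h::real. - h) (at 0) (at_right 0)"
        unfolding filterlim_at by (auto intro!: tendsto_eq_intros simp: eventually_at_filter)
      ultimately have "((\<lambda>h. (P (t + - h) - P t) / - h) \<longlongrightarrow> \<psi> t) (at_right 0)"
        by (rule filterlim_compose)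
      moreover have "(P (t + - h) - P t) / - h = (P t - P (t - h)) / h" for h
        by (simp add: minus_divide_left[symmetric] diff_divide_distrib)
      ultimately show ?thesis by simp
    qed
    ultimately show "((\<lambda>h. (P t - P (t - h)) / h - (P (s + h) - P s) / h) \<longlongrightarrow> \<psi> t - \<psi> s) (at_right 0)"
      by (intro tendsto_diff)
    have "isCont R s" using Rc st by (intro continuous_on_interior[of "{0..T}"]) (auto simp: interior_atLeastAtMost_real)
    then have "((\<lambda>h. R (s + h)) \<longlongrightarrow> R s) (at 0)" by (simp add: isCont_iff)
    then have "((\<lambda>h. R (s + h)) \<longlongrightarrow> R s) (at_right 0)"
      by (rule tendsto_mono[OF at_le, rotated]) simp
    then show "((\<lambda>h. R t - R (s + h)) \<longlongrightarrow> R t - R s) (at_right 0)" by (intro tendsto_intros)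
    show "\<forall>\<^sub>F h in at_right 0. (P t - P (t - h)) / h - (P (s + h) - P s) / h \<le> R t - R (s + h)"
      unfolding eventually_at_right_field
      using main d0 st by (intro exI[of _ "min \<delta>\<^sub>0 (t - s)"]) auto
  qed
  also have "R t - R s = integral {s..t} \<rho>"
    unfolding R_def using st by (intro time_integral_diff[OF \<rho>i, symmetric]) auto
  finally show ?thesis .
qed

lemma antimono_on_closed_interval:
  fixes G :: "real \<Rightarrow> real"
  assumes G: "continuous_on {0..T} G" and anti: "\<And>s t. 0 < s \<Longrightarrow> s < t \<Longrightarrow> t < T \<Longrightarrow> G t \<le> G s"
    and st: "0 \<le> s" "s \<le> t" "t \<le> T" and T: "T > 0"
  shows "G t \<le> G s"
proof (cases "s = t")
  case False
  define c where "c x n = (1 - 1 / real (n + 2)) * x + 1 / real (n + 2) * (T / 2)" for x n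
  have a: "(\<lambda>n. 1 / real (n + 2)) \<longlonglongrightarrow> 0"
    using LIMSEQ_ignore_initial_segment[OF lim_1_over_n, of 2] by simp
  have c01: "0 < c x n" "c x n < T" if "0 \<le> x" "x \<le> T" for x n
  proof -
    have w: "0 < 1 / real (n + 2)" "1 / real (n + 2) < 1" by auto
    show "0 < c x n" using that T w unfolding c_def by (intro add_nonneg_pos mult_nonneg_nonneg) auto
    have "(1 - 1 / real (n + 2)) * x \<le> (1 - 1 / real (n + 2)) * T" using that w by (intro mult_left_mono) auto
    moreover have "1 / real (n + 2) * (T / 2) < 1 / real (n + 2) * T" using T w by (intro mult_strict_left_mono) auto
    ultimately show "c x n < T" unfolding c_def by (simp add: algebra_simps)
  qed
  have lim: "(\<lambda>n. G (c x n)) \<longlonglongrightarrow> G x" if x: "0 \<le> x" "x \<le> T" for x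
  proof (rule continuous_on_tendsto_compose[OF G])
    have "c x \<longlonglongrightarrow> (1 - 0) * x + 0 * (T / 2)" unfolding c_def by (intro tendsto_intros a)
    then show "c x \<longlonglongrightarrow> x" by simp
    show "\<forall>\<^sub>F n in sequentially. c x n \<in> {0..T}" using c01[OF x] by (simp add: less_imp_le)
  qed (use x in auto)
  have "c s n < c t n" for n
    using False st unfolding c_def by (intro add_strict_right_mono mult_strict_left_mono) auto
  then have "G (c t n) \<le> G (c s n)" for n using c01 st by (intro anti) auto
  then show ?thesis using lim[of t] lim[of s] st by (intro LIMSEQ_le[of "\<lambda>n. G (c t n)" _ "\<lambda>n. G (c s n)"]) auto
qed simp

context bounded_open
begin

lemma energy_bound:
  assumes T: "T > 0" and l: "dual_path T l"
    and w: "\<And>s t v. 0 < s \<Longrightarrow> s < t \<Longrightarrow> t < T \<Longrightarrow> v \<in> H1 \<Omega> \<Longrightarrow>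
      L2_inner (lebesgue_on \<Omega>) (w t) v - L2_inner (lebesgue_on \<Omega>) (w s) v = integral {s..t} (\<lambda>\<tau>. l \<tau> v)"
    and F: "continuous_on {0..T} F"
    and n: "n \<in> L2 (time T)" "\<And>t. 0 \<le> n t" and R: "integrable (time T) R"
    and z: "AE t in time T. z t \<in> H1 \<Omega> \<and> H1_norm \<Omega> (z t) \<le> n t \<and> l t (z t) \<le> R t"
    and convex: "AE t in time T. \<forall>s. 0 < s \<longrightarrow> s < t \<longrightarrow>
      F t - F s \<le> L2_inner (lebesgue_on \<Omega>) (w t) (z t) - L2_inner (lebesgue_on \<Omega>) (w s) (z t)"
    and st: "0 \<le> s" "s \<le> t" "t \<le> T"
  shows "F t - F s \<le> integral {s..t} R"
proof -
  let ?M = "time T"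
  interpret finite_measure ?M by (rule finite_measure_time)
  have one: "(\<lambda>_. 1) \<in> L2 ?M" by (simp add: L2_def)
  have Ri: "R integrable_on {0..T}" by (rule time_integrable_on[OF R])
  define nn where "nn = L2_norm ?M n"
  define K where "K = 1/2 + nn + L2_norm ?M (\<lambda>_. 1) * nn + nn\<^sup>2 / 2"
  have interior: "F t - F s \<le> integral {s..t} R" if st: "0 < s" "s < t" "t < T" for s t
  proof (rule field_le_epsilon)
    fix \<eta> :: real assume \<eta>: "\<eta> > 0"
    have K: "K > 0" unfolding K_def nn_def
      by (intro add_pos_nonneg mult_nonneg_nonneg) auto
    define \<epsilon> where "\<epsilon> = \<eta> / K"
    have \<epsilon>: "\<epsilon> > 0" using \<eta> K by (simp add: \<epsilon>_def)
    obtain e \<delta>\<^sub>0 A where "dual_modulus T l \<epsilon> e \<delta>\<^sub>0 A" using l \<epsilon> unfolding dual_path_def by blast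
    note e = dual_modulusD[OF this]
    have e2: "integrable ?M (\<lambda>x. (e x)\<^sup>2)" by (rule L2_square_integrable[OF e(1)])
    define E where "E x = integral {0..x} (\<lambda>x. (e x)\<^sup>2)" for x
    have Ei: "(\<lambda>x. (e x)\<^sup>2) integrable_on {0..T}" by (rule time_integrable_on[OF e2])
    define rest where "rest t = (e t + \<epsilon>) * n t + \<epsilon> / 2 * (n t)\<^sup>2" for t
    have en: "integrable ?M (\<lambda>t. (e t + \<epsilon> * 1) * n t)"
      by (rule L2_mult_integrable[OF L2_add[OF e(1) L2_cmult[OF one]] n(1)])
    have rest: "integrable ?M rest"
      unfolding rest_def using en L2_square_integrable[OF n(1)] by simp
    have rest0: "0 \<le> rest t" for t
      unfolding rest_def using e(2)[of t] n(2)[of t] \<epsilon> by simp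
    define \<psi> where "\<psi> x = F x - E x / (2 * \<epsilon>)" for x
    have "\<psi> t - \<psi> s \<le> integral {s..t} (\<lambda>t. R t + rest t)"
    proof (rule increment_integral_bound[OF _ _ e(4) _ st])
      show "continuous_on {0..T} \<psi>"
        unfolding \<psi>_def E_def using \<epsilon> by (intro continuous_intros F indefinite_integral_continuous_1[OF Ei]) auto
      show "integrable ?M (\<lambda>t. R t + rest t)" using R rest by simp
      show "AE t in ?M. \<forall>\<delta>. 0 < \<delta> \<longrightarrow> \<delta> < \<delta>\<^sub>0 \<longrightarrow> \<delta> < t \<longrightarrow> \<psi> t - \<psi> (t - \<delta>) \<le> \<delta> * (R t + rest t)"
        using z convex e(5) AE_space
      proof eventually_elim
        case (elim t)
        show ?case
        proof (intro allI impI)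
          fix \<delta> assume \<delta>: "0 < \<delta>" "\<delta> < \<delta>\<^sub>0" "\<delta> < t"
          have t: "0 < t" "t < T" using elim(4) by auto
          have zt: "z t \<in> H1 \<Omega>" "H1_norm \<Omega> (z t) \<le> n t" "l t (z t) \<le> R t" using elim(1) by auto
          have "F t - F (t - \<delta>) \<le> L2_inner (lebesgue_on \<Omega>) (w t) (z t) - L2_inner (lebesgue_on \<Omega>) (w (t - \<delta>)) (z t)"
            using elim(2) \<delta> by simp
          also have "\<dots> = integral {t - \<delta>..t} (\<lambda>\<tau>. l \<tau> (z t))"
            using \<delta> t by (intro w zt(1)) auto
          also have "\<dots> \<le> integral {t - \<delta>..t} (\<lambda>\<tau>. (R t + rest t) + (e \<tau>)\<^sup>2 / (2 * \<epsilon>))"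
          proof (rule time_integral_mono_AE)
            show "integrable ?M (\<lambda>\<tau>. l \<tau> (z t))" using l zt(1) by (auto simp: dual_path_def)
            show "integrable ?M (\<lambda>\<tau>. (R t + rest t) + (e \<tau>)\<^sup>2 / (2 * \<epsilon>))" using e2 by simp
            show "AE \<tau> in ?M. \<tau> \<in> {t - \<delta><..<t} \<longrightarrow> l \<tau> (z t) \<le> (R t + rest t) + (e \<tau>)\<^sup>2 / (2 * \<epsilon>)"
              using e(5)
            proof eventually_elim
              case \<tau>: (elim \<tau>)
              show ?case
              proof
                assume "\<tau> \<in> {t - \<delta><..<t}"
                then have "\<bar>\<tau> - t\<bar> < \<delta>\<^sub>0" using \<delta> by auto
                then have "l \<tau> (z t) \<le> l t (z t) + (e \<tau> + e t + \<epsilon>) * H1_norm \<Omega> (z t)"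
                  using e(6)[OF \<tau> elim(3) _ zt(1)] by linarith
                also have "\<dots> \<le> R t + (e \<tau> + e t + \<epsilon>) * n t"
                  using zt e(2)[of \<tau>] e(2)[of t] \<epsilon> by (intro add_mono mult_left_mono) auto
                also have "\<dots> = R t + (e t + \<epsilon>) * n t + e \<tau> * n t" by (simp add: algebra_simps)
                also have "e \<tau> * n t \<le> (e \<tau>)\<^sup>2 / (2 * \<epsilon>) + \<epsilon> / 2 * (n t)\<^sup>2"
                proof -
                  have "0 \<le> (e \<tau> - \<epsilon> * n t)\<^sup>2 / (2 * \<epsilon>)" using \<epsilon> by simp
                  also have "\<dots> = (e \<tau>)\<^sup>2 / (2 * \<epsilon>) + \<epsilon> / 2 * (n t)\<^sup>2 - e \<tau> * n t"
                    using \<epsilon> by (simp add: power2_eq_square field_simps)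
                  finally show ?thesis by simp
                qed
                finally show "l \<tau> (z t) \<le> (R t + rest t) + (e \<tau>)\<^sup>2 / (2 * \<epsilon>)" by (simp add: rest_def)
              qed
            qed
          qed (use \<delta> t in auto)
          also have "\<dots> = \<delta> * (R t + rest t) + integral {t - \<delta>..t} (\<lambda>\<tau>. (e \<tau>)\<^sup>2) / (2 * \<epsilon>)"
          proof -
            have "(\<lambda>\<tau>. (e \<tau>)\<^sup>2) integrable_on {t - \<delta>..t}" using Ei by (rule integrable_subinterval_real) (use \<delta> t in auto)
            then show ?thesis using \<delta> by (subst Henstock_Kurzweil_Integration.integral_add) (auto intro: integrable_on_divide)
          qed
          also have "integral {t - \<delta>..t} (\<lambda>\<tau>. (e \<tau>)\<^sup>2) = E t - E (t - \<delta>)"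
            unfolding E_def using \<delta> t by (intro time_integral_diff[OF Ei]) auto
          finally show "\<psi> t - \<psi> (t - \<delta>) \<le> \<delta> * (R t + rest t)" by (simp add: \<psi>_def diff_divide_distrib)
        qed
      qed
    qed
    also have "integral {s..t} (\<lambda>t. R t + rest t) = integral {s..t} R + integral {s..t} rest"
      using st by (intro Henstock_Kurzweil_Integration.integral_add integrable_subinterval_real[OF Ri] integrable_subinterval_real[OF time_integrable_on[OF rest]]) auto
    finally have 1: "F t - F s \<le> integral {s..t} R + integral {s..t} rest + (E t - E s) / (2 * \<epsilon>)"
      by (simp add: \<psi>_def diff_divide_distrib)
    have slice_le: "integral {s..t} f \<le> (\<integral>x. f x \<partial>?M)" if "integrable ?M f" "\<And>x. 0 \<le> f x" for f :: "real \<Rightarrow> real"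
      unfolding time_integral_slice(1)[OF that(1), of s t, symmetric, OF less_imp_le[OF st(1)] less_imp_le[OF st(3)]]
      using st that time_integral_slice(2)[OF that(1), of s t] by (intro Bochner_Integration.integral_mono) (auto simp: indicator_def)
    have "E t - E s = integral {s..t} (\<lambda>x. (e x)\<^sup>2)"
      unfolding E_def using st by (intro time_integral_diff[OF Ei, symmetric]) auto
    also have "\<dots> \<le> (L2_norm ?M e)\<^sup>2" unfolding L2_norm_power2 by (rule slice_le[OF e2]) simp
    also have "\<dots> \<le> \<epsilon>\<^sup>2" using e(3) by (intro power_mono) auto
    finally have "(E t - E s) / (2 * \<epsilon>) \<le> \<epsilon>\<^sup>2 / (2 * \<epsilon>)" using \<epsilon> by (intro divide_right_mono) auto
    then have 2: "(E t - E s) / (2 * \<epsilon>) \<le> \<epsilon> * (1/2)" using \<epsilon> by (simp add: power2_eq_square)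
    have "integral {s..t} rest \<le> (\<integral>x. rest x \<partial>?M)" by (rule slice_le[OF rest rest0])
    also have "\<dots> = (\<integral>x. (e x + \<epsilon> * 1) * n x \<partial>?M) + \<epsilon> / 2 * nn\<^sup>2"
      unfolding rest_def nn_def L2_norm_power2 using en L2_square_integrable[OF n(1)] by simp
    also have "(\<integral>x. (e x + \<epsilon> * 1) * n x \<partial>?M) \<le> L2_norm ?M (\<lambda>x. e x + \<epsilon> * 1) * nn"
      unfolding nn_def using L2_Cauchy_Schwarz[OF L2_add[OF e(1) L2_cmult[OF one, of \<epsilon>]] n(1)] by (simp add: L2_inner_def)
    also have "L2_norm ?M (\<lambda>x. e x + \<epsilon> * 1) \<le> \<epsilon> + \<epsilon> * L2_norm ?M (\<lambda>_. 1)"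
      using L2_norm_add_le[OF e(1) L2_cmult[OF one, of \<epsilon>]] L2_norm_cmult[of ?M \<epsilon> "\<lambda>_. 1"] e(3) \<epsilon> by simp
    finally have 3: "integral {s..t} rest \<le> (\<epsilon> + \<epsilon> * L2_norm ?M (\<lambda>_. 1)) * nn + \<epsilon> / 2 * nn\<^sup>2"
      by (simp add: nn_def mult_right_mono)
    have "\<epsilon> * (1/2) + ((\<epsilon> + \<epsilon> * L2_norm ?M (\<lambda>_. 1)) * nn + \<epsilon> / 2 * nn\<^sup>2) = \<epsilon> * K"
      by (simp add: K_def algebra_simps)
    moreover have "\<epsilon> * K = \<eta>" using K by (simp add: \<epsilon>_def)
    ultimately show "F t - F s \<le> integral {s..t} R + \<eta>" using 1 2 3 by linarith
  qed
  let ?G = "\<lambda>x. F x - integral {0..x} R"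
  have "?G t \<le> ?G s"
  proof (rule antimono_on_closed_interval[OF _ _ st T])
    show "continuous_on {0..T} ?G" by (intro continuous_intros F indefinite_integral_continuous_1[OF Ri])
    show "?G t \<le> ?G s" if "0 < s" "s < t" "t < T" for s t
      using interior[OF that] time_integral_diff[OF Ri, of s t] that by simp
  qed
  then show ?thesis using time_integral_diff[OF Ri st] by simp
qed

end

section \<open>Evolutions\<close>

lemma C_L2_D: "u \<in> C_L2 T \<Omega> \<Longrightarrow> t \<in> {0..T} \<Longrightarrow> u t \<in> L2 (lebesgue_on \<Omega>)"
  by (simp add: C_L2_def)

lemma C_L2_I:
  assumes u: "u \<in> C_L2 T \<Omega>" and v: "v \<in> C_L2 T \<Omega>"
    and z: "\<And>t. t \<in> {0..T} \<Longrightarrow> z t \<in> L2 (lebesgue_on \<Omega>)"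
    and le: "\<And>r t. r \<in> {0..T} \<Longrightarrow> t \<in> {0..T} \<Longrightarrow> L2_norm (lebesgue_on \<Omega>) (\<lambda>x. z r x - z t x)
      \<le> c * L2_norm (lebesgue_on \<Omega>) (\<lambda>x. u r x - u t x) + d * L2_norm (lebesgue_on \<Omega>) (\<lambda>x. v r x - v t x)"
  shows "z \<in> C_L2 T \<Omega>"
  unfolding C_L2_def
proof (intro CollectI conjI ballI z)
  fix t assume t: "t \<in> {0..T}"
  have "((\<lambda>r. L2_norm (lebesgue_on \<Omega>) (\<lambda>x. w r x - w t x)) \<longlongrightarrow> 0) (at t within {0..T})" if "w \<in> C_L2 T \<Omega>" for w
    using that t by (simp add: C_L2_def)
  from tendsto_add[OF tendsto_mult_left[OF this[OF u], of c] tendsto_mult_left[OF this[OF v], of d]]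
  have lim: "((\<lambda>r. c * L2_norm (lebesgue_on \<Omega>) (\<lambda>x. u r x - u t x) + d * L2_norm (lebesgue_on \<Omega>) (\<lambda>x. v r x - v t x)) \<longlongrightarrow> 0) (at t within {0..T})"
    by simp
  show "((\<lambda>r. L2_norm (lebesgue_on \<Omega>) (\<lambda>x. z r x - z t x)) \<longlongrightarrow> 0) (at t within {0..T})"
    by (rule tendsto_sandwich[OF _ _ tendsto_const lim]) (auto simp: eventually_at_filter intro!: always_eventually le t)
qed

lemma C_L2_lin:
  assumes u: "u \<in> C_L2 T \<Omega>" and v: "v \<in> C_L2 T \<Omega>"
  shows "(\<lambda>t x. c * u t x + d * v t x) \<in> C_L2 T \<Omega>"
proof (rule C_L2_I[OF u v])
  fix r t assume rt: "r \<in> {0..T}" "t \<in> {0..T}"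
  have "(\<lambda>x. (c * u r x + d * v r x) - (c * u t x + d * v t x)) = (\<lambda>x. c * (u r x - u t x) + d * (v r x - v t x))"
    by (simp add: fun_eq_iff algebra_simps)
  then show "L2_norm (lebesgue_on \<Omega>) (\<lambda>x. (c * u r x + d * v r x) - (c * u t x + d * v t x))
      \<le> \<bar>c\<bar> * L2_norm (lebesgue_on \<Omega>) (\<lambda>x. u r x - u t x) + \<bar>d\<bar> * L2_norm (lebesgue_on \<Omega>) (\<lambda>x. v r x - v t x)"
    using L2_norm_lin_le[OF L2_diff[OF C_L2_D[OF u rt(1)] C_L2_D[OF u rt(2)]] L2_diff[OF C_L2_D[OF v rt(1)] C_L2_D[OF v rt(2)]], of c d]
    by simp
qed (intro L2_lin C_L2_D[OF u] C_L2_D[OF v])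

lemma C_L2_pos_part:
  assumes u: "u \<in> C_L2 T \<Omega>"
  shows "(\<lambda>t x. max 0 (u t x)) \<in> C_L2 T \<Omega>"
proof (rule C_L2_I[OF u u])
  fix r t assume rt: "r \<in> {0..T}" "t \<in> {0..T}"
  note L = C_L2_D[OF u rt(1)] C_L2_D[OF u rt(2)]
  have "L2_norm (lebesgue_on \<Omega>) (\<lambda>x. max 0 (u r x) - max 0 (u t x)) \<le> L2_norm (lebesgue_on \<Omega>) (\<lambda>x. u r x - u t x)"
    by (rule L2_norm_mono[OF L2_measurable[OF L2_diff[OF L2_pos_part[OF L(1)] L2_pos_part[OF L(2)]]] L2_diff[OF L]]) auto
  then show "L2_norm (lebesgue_on \<Omega>) (\<lambda>x. max 0 (u r x) - max 0 (u t x))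
      \<le> 1 * L2_norm (lebesgue_on \<Omega>) (\<lambda>x. u r x - u t x) + 0 * L2_norm (lebesgue_on \<Omega>) (\<lambda>x. u r x - u t x)" by simp
qed (intro L2_pos_part C_L2_D[OF u])

lemma C_L2_inner_continuous:
  assumes u: "u \<in> C_L2 T \<Omega>" and v: "v \<in> L2 (lebesgue_on \<Omega>)"
  shows "continuous_on {0..T} (\<lambda>t. L2_inner (lebesgue_on \<Omega>) (u t) v)"
  unfolding continuous_on_def
proof
  fix t assume t: "t \<in> {0..T}"
  have "((\<lambda>r. L2_norm (lebesgue_on \<Omega>) (\<lambda>x. u r x - u t x) * L2_norm (lebesgue_on \<Omega>) v) \<longlongrightarrow> 0 * L2_norm (lebesgue_on \<Omega>) v) (at t within {0..T})"
    using u t by (intro tendsto_mult_right) (simp add: C_L2_def)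
  then have lim: "((\<lambda>r. L2_norm (lebesgue_on \<Omega>) (\<lambda>x. u r x - u t x) * L2_norm (lebesgue_on \<Omega>) v) \<longlongrightarrow> 0) (at t within {0..T})" by simp
  have le: "\<bar>L2_inner (lebesgue_on \<Omega>) (u r) v - L2_inner (lebesgue_on \<Omega>) (u t) v\<bar>
      \<le> L2_norm (lebesgue_on \<Omega>) (\<lambda>x. u r x - u t x) * L2_norm (lebesgue_on \<Omega>) v" if r: "r \<in> {0..T}" for r
    using L2_Cauchy_Schwarz[OF L2_diff[OF C_L2_D[OF u r] C_L2_D[OF u t]] v]
      L2_inner_add_left[OF C_L2_D[OF u r] C_L2_D[OF u t] v, of 1 "-1"] by simp
  show "((\<lambda>t. L2_inner (lebesgue_on \<Omega>) (u t) v) \<longlongrightarrow> L2_inner (lebesgue_on \<Omega>) (u t) v) (at t within {0..T})"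
    by (rule LIM_zero_cancel, rule tendsto_rabs_zero_cancel, rule tendsto_sandwich[OF _ _ tendsto_const lim])
      (auto simp: eventually_at_filter intro!: always_eventually le)
qed

lemma C_L2_norm_continuous:
  assumes u: "u \<in> C_L2 T \<Omega>"
  shows "continuous_on {0..T} (\<lambda>t. (L2_norm (lebesgue_on \<Omega>) (u t))\<^sup>2)"
proof (intro continuous_on_power, unfold continuous_on_def, rule)
  fix t assume t: "t \<in> {0..T}"
  have lim: "((\<lambda>r. L2_norm (lebesgue_on \<Omega>) (\<lambda>x. u r x - u t x)) \<longlongrightarrow> 0) (at t within {0..T})"
    using u t by (simp add: C_L2_def)
  show "((\<lambda>t. L2_norm (lebesgue_on \<Omega>) (u t)) \<longlongrightarrow> L2_norm (lebesgue_on \<Omega>) (u t)) (at t within {0..T})"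
    by (rule LIM_zero_cancel, rule tendsto_rabs_zero_cancel, rule tendsto_sandwich[OF _ _ tendsto_const lim])
      (auto simp: eventually_at_filter intro!: always_eventually L2_norm_reverse_triangle C_L2_D[OF u] t)
qed

context bounded_open
begin

definition evolution :: "real \<Rightarrow> (real \<Rightarrow> 'a \<Rightarrow> real) \<Rightarrow> (real \<Rightarrow> ('a \<Rightarrow> real) \<Rightarrow> real) \<Rightarrow> bool" where
  "evolution T w l \<longleftrightarrow> w \<in> C_L2 T \<Omega> \<and> dual_path T l \<and>
     (\<forall>s t. \<forall>v\<in>H1 \<Omega>. 0 < s \<longrightarrow> s < t \<longrightarrow> t < T \<longrightarrow>
       L2_inner (lebesgue_on \<Omega>) (w t) v - L2_inner (lebesgue_on \<Omega>) (w s) v = integral {s..t} (\<lambda>\<tau>. l \<tau> v)) \<and>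
     (\<exists>n\<in>L2 (time T). (\<forall>t. 0 \<le> n t) \<and> (AE t in time T. w t \<in> H1 \<Omega> \<and> H1_norm \<Omega> (w t) \<le> n t))"

lemma evolution_lin:
  assumes w: "evolution T w l" and w': "evolution T w' l'"
  shows "evolution T (\<lambda>t x. c * w t x + d * w' t x) (\<lambda>t v. c * l t v + d * l' t v)"
  unfolding evolution_def
proof (intro conjI allI ballI impI)
  show "(\<lambda>t x. c * w t x + d * w' t x) \<in> C_L2 T \<Omega>" using w w' by (auto simp: evolution_def intro: C_L2_lin)
  show "dual_path T (\<lambda>t v. c * l t v + d * l' t v)" using w w' by (auto simp: evolution_def intro: dual_path_lin)
next
  fix s t v assume v: "v \<in> H1 \<Omega>" and st: "0 < s" "s < t" "t < T"
  have L: "w r \<in> L2 (lebesgue_on \<Omega>)" "w' r \<in> L2 (lebesgue_on \<Omega>)" if "r \<in> {0..T}" for r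
    using w w' that by (auto simp: evolution_def intro: C_L2_D)
  have "(\<lambda>\<tau>. l \<tau> v) integrable_on {0..T}" "(\<lambda>\<tau>. l' \<tau> v) integrable_on {0..T}"
    using w w' v by (auto simp: evolution_def dual_path_def intro!: time_integrable_on)
  then have i: "(\<lambda>\<tau>. l \<tau> v) integrable_on {s..t}" "(\<lambda>\<tau>. l' \<tau> v) integrable_on {s..t}"
    using st by (auto intro: integrable_subinterval_real)
  have "L2_inner (lebesgue_on \<Omega>) (w t) v - L2_inner (lebesgue_on \<Omega>) (w s) v = integral {s..t} (\<lambda>\<tau>. l \<tau> v)"
    "L2_inner (lebesgue_on \<Omega>) (w' t) v - L2_inner (lebesgue_on \<Omega>) (w' s) v = integral {s..t} (\<lambda>\<tau>. l' \<tau> v)"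
    using w w' v st unfolding evolution_def by blast+
  moreover have "integral {s..t} (\<lambda>\<tau>. c * l \<tau> v + d * l' \<tau> v) = c * integral {s..t} (\<lambda>\<tau>. l \<tau> v) + d * integral {s..t} (\<lambda>\<tau>. l' \<tau> v)"
    using i by (simp add: Henstock_Kurzweil_Integration.integral_add integrable_on_mult_right)
  ultimately show "L2_inner (lebesgue_on \<Omega>) (\<lambda>x. c * w t x + d * w' t x) v - L2_inner (lebesgue_on \<Omega>) (\<lambda>x. c * w s x + d * w' s x) v
      = integral {s..t} (\<lambda>\<tau>. c * l \<tau> v + d * l' \<tau> v)"
    using st by (simp add: L2_inner_add_left L H1_L2[OF v] right_diff_distrib[symmetric])
      (simp add: algebra_simps)
next
  obtain n where n: "n \<in> L2 (time T)" "\<And>t. 0 \<le> n t" "AE t in time T. w t \<in> H1 \<Omega> \<and> H1_norm \<Omega> (w t) \<le> n t"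
    using w unfolding evolution_def by blast
  obtain n' where n': "n' \<in> L2 (time T)" "\<And>t. 0 \<le> n' t" "AE t in time T. w' t \<in> H1 \<Omega> \<and> H1_norm \<Omega> (w' t) \<le> n' t"
    using w' unfolding evolution_def by blast
  let ?n = "\<lambda>t. 2 * \<bar>c\<bar> * n t + 2 * \<bar>d\<bar> * n' t"
  have "AE t in time T. (\<lambda>x. c * w t x + d * w' t x) \<in> H1 \<Omega> \<and> H1_norm \<Omega> (\<lambda>x. c * w t x + d * w' t x) \<le> ?n t"
    using n(3) n'(3)
  proof eventually_elim
    case (elim t)
    have "(H1_norm \<Omega> (\<lambda>x. c * w t x + d * w' t x))\<^sup>2 \<le> 2 * c\<^sup>2 * (H1_norm \<Omega> (w t))\<^sup>2 + 2 * d\<^sup>2 * (H1_norm \<Omega> (w' t))\<^sup>2"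
      using elim by (intro H1_norm_lin_le_power2) auto
    also have "\<dots> \<le> 2 * c\<^sup>2 * (n t)\<^sup>2 + 2 * d\<^sup>2 * (n' t)\<^sup>2"
      using elim by (intro add_mono mult_left_mono power_mono) (auto simp: H1_norm_nonneg)
    also have "\<dots> \<le> (?n t)\<^sup>2"
    proof -
      have "0 \<le> (\<bar>c\<bar> * n t) * (\<bar>d\<bar> * n' t)" using n(2) n'(2) by simp
      moreover have "(?n t)\<^sup>2 = 4 * (c\<^sup>2 * (n t)\<^sup>2) + 8 * ((\<bar>c\<bar> * n t) * (\<bar>d\<bar> * n' t)) + 4 * (d\<^sup>2 * (n' t)\<^sup>2)"
        by (simp add: power2_sum power_mult_distrib)
      moreover have "0 \<le> c\<^sup>2 * (n t)\<^sup>2" "0 \<le> d\<^sup>2 * (n' t)\<^sup>2" by simp_all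
      ultimately show ?thesis by linarith
    qed
    finally have "H1_norm \<Omega> (\<lambda>x. c * w t x + d * w' t x) \<le> ?n t"
      by (rule power2_le_imp_le) (use n(2) n'(2) in simp)
    then show ?case using elim H1_lin by blast
  qed
  moreover have "?n \<in> L2 (time T)" by (rule L2_lin[OF n(1) n'(1)])
  moreover have "\<forall>t. 0 \<le> ?n t" using n(2) n'(2) by simp
  ultimately show "\<exists>n\<in>L2 (time T). (\<forall>t. 0 \<le> n t) \<and>
      (AE t in time T. (\<lambda>x. c * w t x + d * w' t x) \<in> H1 \<Omega> \<and> H1_norm \<Omega> (\<lambda>x. c * w t x + d * w' t x) \<le> n t)"
    by (intro bexI[of _ ?n] conjI)
qed

lemma evolution_energy:
  assumes T: "T > 0" and w: "evolution T w l" and R: "integrable (time T) R"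
    and l: "AE t in time T. w t \<in> H1 \<Omega> \<longrightarrow> l t (w t) \<le> R t" and t: "t \<in> {0..T}"
  shows "(L2_norm (lebesgue_on \<Omega>) (w t))\<^sup>2 / 2 - (L2_norm (lebesgue_on \<Omega>) (w 0))\<^sup>2 / 2 \<le> integral {0..t} R"
proof -
  obtain n where n: "n \<in> L2 (time T)" "\<And>t. 0 \<le> n t" "AE t in time T. w t \<in> H1 \<Omega> \<and> H1_norm \<Omega> (w t) \<le> n t"
    using w unfolding evolution_def by blast
  have wC: "w \<in> C_L2 T \<Omega>" using w by (simp add: evolution_def)
  show ?thesis
  proof (rule energy_bound[OF T _ _ _ n(1,2) R])
    show "dual_path T l" using w by (simp add: evolution_def)
    show "L2_inner (lebesgue_on \<Omega>) (w t) v - L2_inner (lebesgue_on \<Omega>) (w s) v = integral {s..t} (\<lambda>\<tau>. l \<tau> v)"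
      if "0 < s" "s < t" "t < T" "v \<in> H1 \<Omega>" for s t v using w that unfolding evolution_def by blast
    show "continuous_on {0..T} (\<lambda>t. (L2_norm (lebesgue_on \<Omega>) (w t))\<^sup>2 / 2)"
      by (intro continuous_intros C_L2_norm_continuous[OF wC]) simp
    show "AE t in time T. w t \<in> H1 \<Omega> \<and> H1_norm \<Omega> (w t) \<le> n t \<and> l t (w t) \<le> R t"
      using n(3) l by eventually_elim simp
    show "AE t in time T. \<forall>s. 0 < s \<longrightarrow> s < t \<longrightarrow> (L2_norm (lebesgue_on \<Omega>) (w t))\<^sup>2 / 2 - (L2_norm (lebesgue_on \<Omega>) (w s))\<^sup>2 / 2
        \<le> L2_inner (lebesgue_on \<Omega>) (w t) (w t) - L2_inner (lebesgue_on \<Omega>) (w s) (w t)"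
      using AE_space
    proof eventually_elim
      case (elim t)
      show ?case
      proof (intro allI impI)
        fix s assume s: "0 < s" "s < t"
        then have "s \<in> {0..T}" "t \<in> {0..T}" using elim by auto
        then have L: "w t \<in> L2 (lebesgue_on \<Omega>)" "w s \<in> L2 (lebesgue_on \<Omega>)" using C_L2_D[OF wC] by auto
        have "L2_inner (lebesgue_on \<Omega>) (w t) (w t) = (L2_norm (lebesgue_on \<Omega>) (w t))\<^sup>2"
          unfolding L2_norm_power2 L2_inner_def by (simp add: power2_eq_square)
        then show "(L2_norm (lebesgue_on \<Omega>) (w t))\<^sup>2 / 2 - (L2_norm (lebesgue_on \<Omega>) (w s))\<^sup>2 / 2
            \<le> L2_inner (lebesgue_on \<Omega>) (w t) (w t) - L2_inner (lebesgue_on \<Omega>) (w s) (w t)"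
          using L2_norm_lin_power2[OF L, of 1 "-1"] zero_le_power2[of "L2_norm (lebesgue_on \<Omega>) (\<lambda>x. 1 * w t x + - 1 * w s x)"]
          by (simp add: L2_inner_commute[of _ "w s"])
      qed
    qed
  qed (use t in auto)
qed

end

context trace_domain
begin

lemma evolution_nonpos:
  assumes T: "T > 0" and w: "evolution T w l"
    and l: "AE t in time T. w t \<in> H1 \<Omega> \<longrightarrow> l t (\<lambda>x. max 0 (w t x)) \<le> 0"
    and w0: "AE x in lebesgue_on \<Omega>. w 0 x \<le> 0" and t: "t \<in> {0..T}"
  shows "AE x in lebesgue_on \<Omega>. w t x \<le> 0"
proof -
  let ?M = "lebesgue_on \<Omega>"
  let ?p = "\<lambda>t x. max 0 (w t x)"
  obtain n where n: "n \<in> L2 (time T)" "\<And>t. 0 \<le> n t" "AE t in time T. w t \<in> H1 \<Omega> \<and> H1_norm \<Omega> (w t) \<le> n t"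
    using w unfolding evolution_def by blast
  have wC: "w \<in> C_L2 T \<Omega>" using w by (simp add: evolution_def)
  note pC = C_L2_pos_part[OF wC]
  have "(L2_norm ?M (?p t))\<^sup>2 / 2 - (L2_norm ?M (?p 0))\<^sup>2 / 2 \<le> integral {0..t} (\<lambda>_. 0)"
  proof (rule energy_bound[OF T _ _ _ n(1,2)])
    show "dual_path T l" using w by (simp add: evolution_def)
    show "L2_inner ?M (w t) v - L2_inner ?M (w s) v = integral {s..t} (\<lambda>\<tau>. l \<tau> v)"
      if "0 < s" "s < t" "t < T" "v \<in> H1 \<Omega>" for s t v using w that unfolding evolution_def by blast
    show "continuous_on {0..T} (\<lambda>t. (L2_norm ?M (?p t))\<^sup>2 / 2)"
      by (intro continuous_intros C_L2_norm_continuous[OF pC]) simp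
    show "AE t in time T. ?p t \<in> H1 \<Omega> \<and> H1_norm \<Omega> (?p t) \<le> n t \<and> l t (?p t) \<le> 0"
      using n(3) l
    proof eventually_elim
      case (elim t)
      then have "w t \<in> H1 \<Omega>" by simp
      then show ?case
        using elim pos_part_H1(2)[OF H1_L2 H1_wgrad] H1_norm_pos_part[of "w t"] by auto
    qed
    show "AE t in time T. \<forall>s. 0 < s \<longrightarrow> s < t \<longrightarrow> (L2_norm ?M (?p t))\<^sup>2 / 2 - (L2_norm ?M (?p s))\<^sup>2 / 2
        \<le> L2_inner ?M (w t) (?p t) - L2_inner ?M (w s) (?p t)"
      using AE_space
    proof eventually_elim
      case (elim t)
      show ?case
      proof (intro allI impI)
        fix s assume s: "0 < s" "s < t"
        then have "s \<in> {0..T}" "t \<in> {0..T}" using elim by auto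
        then have L: "w t \<in> L2 ?M" "w s \<in> L2 ?M" "?p t \<in> L2 ?M" "?p s \<in> L2 ?M"
          using C_L2_D[OF wC] C_L2_D[OF pC] by auto
        have "(L2_norm ?M (?p t))\<^sup>2 / 2 - (L2_norm ?M (?p s))\<^sup>2 / 2 = (\<integral>x. (?p t x)\<^sup>2 / 2 - (?p s x)\<^sup>2 / 2 \<partial>?M)"
          unfolding L2_norm_power2 using L2_square_integrable[OF L(3)] L2_square_integrable[OF L(4)] by simp
        also have "\<dots> \<le> (\<integral>x. w t x * ?p t x - w s x * ?p t x \<partial>?M)"
        proof (rule Bochner_Integration.integral_mono)
          show "integrable ?M (\<lambda>x. (?p t x)\<^sup>2 / 2 - (?p s x)\<^sup>2 / 2)"
            using L2_square_integrable[OF L(3)] L2_square_integrable[OF L(4)] by simp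
          show "integrable ?M (\<lambda>x. w t x * ?p t x - w s x * ?p t x)"
            by (intro Bochner_Integration.integrable_diff L2_mult_integrable L)
          fix x
          have "w t x * ?p t x = (?p t x)\<^sup>2" by (auto simp: max_def power2_eq_square)
          moreover have "w s x * ?p t x \<le> ?p s x * ?p t x" by (intro mult_right_mono) auto
          moreover have "2 * (?p s x * ?p t x) \<le> (?p s x)\<^sup>2 + (?p t x)\<^sup>2"
            using two_mult_le_squares[of "?p s x" "?p t x"] by (simp add: abs_mult)
          ultimately show "(?p t x)\<^sup>2 / 2 - (?p s x)\<^sup>2 / 2 \<le> w t x * ?p t x - w s x * ?p t x" by linarith
        qed
        also have "\<dots> = L2_inner ?M (w t) (?p t) - L2_inner ?M (w s) (?p t)"
          unfolding L2_inner_def by (intro Bochner_Integration.integral_diff L2_mult_integrable L)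
        finally show "(L2_norm ?M (?p t))\<^sup>2 / 2 - (L2_norm ?M (?p s))\<^sup>2 / 2 \<le> L2_inner ?M (w t) (?p t) - L2_inner ?M (w s) (?p t)" .
      qed
    qed
  qed (use t in auto)
  moreover have "L2_norm ?M (?p 0) = 0"
    using L2_norm_zero_iff[OF C_L2_D[OF pC, of 0]] w0 T by (auto elim!: eventually_mono)
  ultimately have "L2_norm ?M (?p t) = 0" by simp
  then have "AE x in ?M. ?p t x = 0" using L2_norm_zero_iff[OF C_L2_D[OF pC t]] by simp
  then show ?thesis by eventually_elim (simp add: max_def split: if_splits)
qed

end

section \<open>The variational inequality at a fixed time\<close>

lemma L2_restrict_space:
  assumes f: "f \<in> L2 N" and A: "A \<in> sets N"
  shows "f \<in> L2 (restrict_space N A)" "L2_norm (restrict_space N A) f \<le> L2_norm N f"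
proof -
  have [measurable]: "f \<in> borel_measurable N" by (rule L2_measurable[OF f])
  have A': "A \<inter> space N \<in> sets N" using A by simp
  have i: "integrable N (\<lambda>x. indicator A x *\<^sub>R (f x)\<^sup>2)"
    by (rule integrable_mult_indicator[OF A L2_square_integrable[OF f]])
  show L: "f \<in> L2 (restrict_space N A)"
    using i A' by (auto simp: L2_def integrable_restrict_space intro: measurable_restrict_space1)
  show "L2_norm (restrict_space N A) f \<le> L2_norm N f"
  proof (rule power2_le_imp_le)
    show "(L2_norm (restrict_space N A) f)\<^sup>2 \<le> (L2_norm N f)\<^sup>2"
      unfolding L2_norm_power2 integral_restrict_space[OF A']
      by (rule Bochner_Integration.integral_mono[OF i L2_square_integrable[OF f]]) (simp add: indicator_def)
  qed simp
qed

locale robin_domain = trace_domain \<Omega> \<gamma> for \<Omega> :: "'a::euclidean_space set" and \<gamma> +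
  fixes \<Gamma>\<^sub>1 \<Gamma>\<^sub>2 \<Gamma>\<^sub>3 :: "'a set" and h :: real
  assumes \<Gamma>: "\<Gamma>\<^sub>1 \<in> sets borel" "\<Gamma>\<^sub>1 \<subseteq> frontier \<Omega>" "\<Gamma>\<^sub>2 \<in> sets borel" "\<Gamma>\<^sub>2 \<subseteq> frontier \<Omega>"
    "\<Gamma>\<^sub>3 \<in> sets borel" "\<Gamma>\<^sub>3 \<subseteq> frontier \<Omega>"
    and h: "h > 0"
begin

lemma surface_restrict:
  assumes "\<Gamma> \<in> sets borel" "\<Gamma> \<subseteq> frontier \<Omega>"
  shows "surface \<Gamma> = restrict_space (surface (frontier \<Omega>)) \<Gamma>" "\<Gamma> \<in> sets (surface (frontier \<Omega>))"
proof -
  have "frontier \<Omega> \<inter> \<Gamma> = \<Gamma>" using assms by auto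
  then show "surface \<Gamma> = restrict_space (surface (frontier \<Omega>)) \<Gamma>"
    by (subst restrict_restrict_space) (use assms in \<open>auto simp: frontier_closed\<close>)
  show "\<Gamma> \<in> sets (surface (frontier \<Omega>))"
    using assms by (subst sets_restrict_space_iff) (auto simp: frontier_closed)
qed

lemma AE_surface:
  assumes "\<Gamma> \<in> sets borel" "\<Gamma> \<subseteq> frontier \<Omega>" "AE x in surface (frontier \<Omega>). P x"
  shows "AE x in surface \<Gamma>. P x"
  unfolding surface_restrict(1)[OF assms(1,2)]
  using assms(3) by (subst AE_restrict_space_iff[OF sets.Int[OF surface_restrict(2)[OF assms(1,2)] sets.top]]) auto

lemma trace_L2_surface:
  assumes "\<Gamma> \<in> sets borel" "\<Gamma> \<subseteq> frontier \<Omega>" "u \<in> H1 \<Omega>"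
  shows "\<gamma> u \<in> L2 (surface \<Gamma>)" "L2_norm (surface \<Gamma>) (\<gamma> u) \<le> L2_norm (surface (frontier \<Omega>)) (\<gamma> u)"
  unfolding surface_restrict(1)[OF assms(1,2)]
  by (intro L2_restrict_space trace_L2 assms surface_restrict(2))+

lemma finite_measure_surface:
  assumes "\<Gamma> \<in> sets borel" "\<Gamma> \<subseteq> frontier \<Omega>"
  shows "finite_measure (surface \<Gamma>)"
  unfolding surface_restrict(1)[OF assms]
  by (rule finite_measure_restrict_space[OF finite_measure_frontier surface_restrict(2)[OF assms]])

lemma trace_inner_lin:
  assumes \<Gamma>: "\<Gamma> \<in> sets borel" "\<Gamma> \<subseteq> frontier \<Omega>" and f: "f \<in> L2 (surface \<Gamma>)" and uv: "u \<in> H1 \<Omega>" "v \<in> H1 \<Omega>"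
  shows "L2_inner (surface \<Gamma>) f (\<gamma> (\<lambda>x. c * u x + d * v x)) = c * L2_inner (surface \<Gamma>) f (\<gamma> u) + d * L2_inner (surface \<Gamma>) f (\<gamma> v)"
proof -
  note t = trace_L2_surface(1)[OF \<Gamma>]
  have "L2_inner (surface \<Gamma>) f (\<gamma> (\<lambda>x. c * u x + d * v x)) = L2_inner (surface \<Gamma>) f (\<lambda>x. c * \<gamma> u x + d * \<gamma> v x)"
    using AE_surface[OF \<Gamma> trace_lin[OF uv, of c d]] L2_measurable[OF f] L2_measurable[OF t[OF H1_lin[OF uv]]]
      L2_measurable[OF L2_lin[OF t[OF uv(1)] t[OF uv(2)]]]
    by (intro L2_inner_cong_AE) auto
  then show ?thesis using L2_inner_add_right[OF t[OF uv(1)] t[OF uv(2)] f, of c d] by simp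
qed

lemma robin_form_lin_right:
  assumes "u \<in> H1 \<Omega>" "v \<in> H1 \<Omega>" "w \<in> H1 \<Omega>"
  shows "robin_form \<Omega> \<gamma> \<Gamma>\<^sub>1 h w (\<lambda>x. c * u x + d * v x) = c * robin_form \<Omega> \<gamma> \<Gamma>\<^sub>1 h w u + d * robin_form \<Omega> \<gamma> \<Gamma>\<^sub>1 h w v"
  using trace_inner_lin[OF \<Gamma>(1,2) trace_L2_surface(1)[OF \<Gamma>(1,2) assms(3)] assms(1,2), of c d]
  by (simp add: robin_form_def dirichlet_form_lin_right[OF assms] L2_inner_def algebra_simps)

lemma robin_form_commute: "robin_form \<Omega> \<gamma> \<Gamma>\<^sub>1 h u v = robin_form \<Omega> \<gamma> \<Gamma>\<^sub>1 h v u"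
  by (simp add: robin_form_def dirichlet_form_commute mult.commute)

lemma robin_form_lin_left:
  assumes "u \<in> H1 \<Omega>" "v \<in> H1 \<Omega>" "w \<in> H1 \<Omega>"
  shows "robin_form \<Omega> \<gamma> \<Gamma>\<^sub>1 h (\<lambda>x. c * u x + d * v x) w = c * robin_form \<Omega> \<gamma> \<Gamma>\<^sub>1 h u w + d * robin_form \<Omega> \<gamma> \<Gamma>\<^sub>1 h v w"
  using robin_form_lin_right[OF assms, of c d] by (simp add: robin_form_commute)

lemma trace_pos_part:
  assumes u: "u \<in> H1 \<Omega>" and \<Gamma>: "\<Gamma> \<in> sets borel" "\<Gamma> \<subseteq> frontier \<Omega>"
  shows "AE x in surface \<Gamma>. \<gamma> (\<lambda>y. max 0 (u y)) x = max 0 (\<gamma> u x)"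
  by (rule AE_surface[OF \<Gamma> pos_part_H1(3)[OF H1_L2[OF u] H1_wgrad[OF u]]])

lemma robin_form_pos_part:
  assumes u: "u \<in> H1 \<Omega>"
  shows "0 \<le> robin_form \<Omega> \<gamma> \<Gamma>\<^sub>1 h u (\<lambda>x. max 0 (u x))"
proof -
  have "0 \<le> (\<integral>x. \<gamma> u x * \<gamma> (\<lambda>x. max 0 (u x)) x \<partial>surface \<Gamma>\<^sub>1)"
    by (rule integral_nonneg_AE) (use trace_pos_part[OF u \<Gamma>(1,2)] in \<open>eventually_elim, auto simp: max_def\<close>)
  then show ?thesis
    using dirichlet_form_nonneg h by (simp add: robin_form_def dirichlet_form_pos_part[OF u])
qed

lemma trace_nonneg:
  assumes u: "u \<in> H1 \<Omega>" "AE x in lebesgue_on \<Omega>. 0 \<le> u x" and \<Gamma>: "\<Gamma> \<in> sets borel" "\<Gamma> \<subseteq> frontier \<Omega>"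
  shows "AE x in surface \<Gamma>. 0 \<le> \<gamma> u x"
proof -
  let ?v = "\<lambda>x. - 1 * u x + 0 * u x" and ?p = "\<lambda>x. max 0 (- 1 * u x + 0 * u x)"
  have v: "?v \<in> H1 \<Omega>" by (rule H1_lin[OF u(1,1)])
  note vL = H1_L2[OF v] H1_wgrad[OF v]
  note p = pos_part_H1[OF vL]
  have "AE x in lebesgue_on \<Omega>. ?p x = 0" using u(2) by eventually_elim simp
  then have n0: "L2_norm (lebesgue_on \<Omega>) ?p = 0" using L2_norm_zero_iff[OF H1_L2[OF p(2)]] by simp
  have "dirichlet_form \<Omega> ?p ?p = (\<integral>x. 0 \<partial>lebesgue_on \<Omega>)"
    unfolding dirichlet_form_eq[OF H1_L2[OF p(2)] p(1) H1_L2[OF p(2)] p(1)]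
  proof (rule integral_cong_AE)
    show "AE x in lebesgue_on \<Omega>. (if 0 < ?v x then 1 else 0) *\<^sub>R wgrad \<Omega> ?v x \<bullet> (if 0 < ?v x then 1 else 0) *\<^sub>R wgrad \<Omega> ?v x = 0"
      using u(2) by eventually_elim simp
  qed (use H1_gradient_inner_integrable(2)[OF p(1,1)] in auto)
  then have "H1_norm \<Omega> ?p = 0" unfolding H1_norm_def n0 by simp
  moreover obtain C where "C \<ge> 0" "\<And>u. u \<in> H1 \<Omega> \<Longrightarrow> L2_norm (surface (frontier \<Omega>)) (\<gamma> u) \<le> C * H1_norm \<Omega> u"
    using trace_bound by blast
  ultimately have "L2_norm (surface (frontier \<Omega>)) (\<gamma> ?p) \<le> 0" using p(2) by fastforce
  then have "L2_norm (surface (frontier \<Omega>)) (\<gamma> ?p) = 0" by (simp add: antisym)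
  then have "AE x in surface (frontier \<Omega>). \<gamma> ?p x = 0" using L2_norm_zero_iff[OF trace_L2[OF p(2)]] by simp
  then have "AE x in surface (frontier \<Omega>). 0 \<le> \<gamma> u x"
    using p(3) trace_lin[OF u(1,1), of "-1" 0] by eventually_elim simp
  then show ?thesis by (rule AE_surface[OF \<Gamma>])
qed

text \<open>The variational inequality says \<open>residual (v - u) + \<Phi> v - \<Phi> u \<ge> 0\<close>.\<close>

definition residual ::
    "('a \<Rightarrow> real) \<Rightarrow> ('a \<Rightarrow> real) \<Rightarrow> ('a \<Rightarrow> real) \<Rightarrow> ('a \<Rightarrow> real) \<Rightarrow> (('a \<Rightarrow> real) \<Rightarrow> real) \<Rightarrow> ('a \<Rightarrow> real) \<Rightarrow> real" where
  "residual g b f u l v = l v + robin_form \<Omega> \<gamma> \<Gamma>\<^sub>1 h u v - L2_inner (lebesgue_on \<Omega>) g v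
     + L2_inner (surface \<Gamma>\<^sub>3) f (\<gamma> v) - h * L2_inner (surface \<Gamma>\<^sub>1) b (\<gamma> v)"

definition linear_on_H1 :: "(('a \<Rightarrow> real) \<Rightarrow> real) \<Rightarrow> bool" where
  "linear_on_H1 l \<longleftrightarrow> (\<forall>u\<in>H1 \<Omega>. \<forall>v\<in>H1 \<Omega>. \<forall>c d. l (\<lambda>x. c * u x + d * v x) = c * l u + d * l v)"

definition data :: "('a \<Rightarrow> real) \<Rightarrow> ('a \<Rightarrow> real) \<Rightarrow> ('a \<Rightarrow> real) \<Rightarrow> bool" where
  "data g b q \<longleftrightarrow> g \<in> L2 (lebesgue_on \<Omega>) \<and> b \<in> L2 (surface \<Gamma>\<^sub>1) \<and> q \<in> L2 (surface \<Gamma>\<^sub>2) \<and>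
     (AE x in lebesgue_on \<Omega>. 0 \<le> g x) \<and> (AE x in surface \<Gamma>\<^sub>1. 0 \<le> b x) \<and> (AE x in surface \<Gamma>\<^sub>2. 0 \<le> q x)"

lemma robin_inequalityD:
  assumes "robin_inequality \<Omega> \<gamma> \<Gamma>\<^sub>1 \<Gamma>\<^sub>2 \<Gamma>\<^sub>3 g b q h f u l" "v \<in> H1 \<Omega>"
  shows "0 \<le> residual g b f u l (\<lambda>x. v x - u x) + friction \<gamma> \<Gamma>\<^sub>2 q v - friction \<gamma> \<Gamma>\<^sub>2 q u"
  using assms(1)[unfolded robin_inequality_def, rule_format, OF assms(2)]
  by (simp add: residual_def L2_inner_def)

lemma residual_uminus:
  assumes d: "data g b q" and f: "f \<in> L2 (surface \<Gamma>\<^sub>3)" and u: "u \<in> H1 \<Omega>" and l: "linear_on_H1 l" and v: "v \<in> H1 \<Omega>"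
  shows "residual g b f u l (\<lambda>x. - v x) = - residual g b f u l v"
proof -
  have L: "g \<in> L2 (lebesgue_on \<Omega>)" "b \<in> L2 (surface \<Gamma>\<^sub>1)" using d by (auto simp: data_def)
  have "l (\<lambda>x. - 1 * v x + 0 * v x) = - 1 * l v + 0 * l v" using l v unfolding linear_on_H1_def by blast
  then show ?thesis
    using robin_form_lin_right[OF v v u, of "-1" 0] L2_inner_add_right[OF H1_L2[OF v] H1_L2[OF v] L(1), of "-1" 0]
      trace_inner_lin[OF \<Gamma>(5,6) f v v, of "-1" 0] trace_inner_lin[OF \<Gamma>(1,2) L(2) v v, of "-1" 0]
    by (simp add: residual_def)
qed

lemma friction_integrable:
  assumes d: "data g b q" and v: "v \<in> H1 \<Omega>"
  shows "integrable (surface \<Gamma>\<^sub>2) (\<lambda>x. q x * \<bar>\<gamma> v x\<bar>)"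
  using d by (intro L2_mult_integrable L2_abs trace_L2_surface(1)[OF \<Gamma>(3,4) v]) (simp add: data_def)

lemma solution_nonneg_test:
  assumes d: "data g b q" and f: "AE x in surface \<Gamma>\<^sub>3. f x \<le> 0" and u: "u \<in> H1 \<Omega>"
    and sol: "robin_inequality \<Omega> \<gamma> \<Gamma>\<^sub>1 \<Gamma>\<^sub>2 \<Gamma>\<^sub>3 g b q h f u l"
  shows "0 \<le> l (\<lambda>x. max 0 (- u x))"
proof -
  let ?p = "\<lambda>x. max 0 (- u x)"
  have mu: "(\<lambda>x. - u x) \<in> H1 \<Omega>" by (rule H1_uminus[OF u])
  have p: "?p \<in> H1 \<Omega>" by (rule pos_part_H1(2)[OF H1_L2[OF mu] H1_wgrad[OF mu]])
  have trp: "AE x in surface \<Gamma>. \<gamma> ?p x = max 0 (- \<gamma> u x)" if "\<Gamma> \<in> sets borel" "\<Gamma> \<subseteq> frontier \<Omega>" for \<Gamma>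
    using trace_pos_part[OF mu that] AE_surface[OF that trace_lin[OF u u, of "-1" 0]] by eventually_elim simp
  have v: "(\<lambda>x. u x + ?p x) \<in> H1 \<Omega>" by (rule H1_add[OF u p])
  have "AE x in surface \<Gamma>\<^sub>2. \<gamma> (\<lambda>x. u x + ?p x) x = max 0 (\<gamma> u x)"
    using trp[OF \<Gamma>(3,4)] AE_surface[OF \<Gamma>(3,4) trace_lin[OF u p, of 1 1]] by eventually_elim auto
  moreover have "AE x in surface \<Gamma>\<^sub>2. 0 \<le> q x" using d by (simp add: data_def)
  ultimately have "AE x in surface \<Gamma>\<^sub>2. q x * \<bar>\<gamma> (\<lambda>x. u x + ?p x) x\<bar> \<le> q x * \<bar>\<gamma> u x\<bar>"
    by eventually_elim (auto intro!: mult_left_mono)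
  then have fr: "friction \<gamma> \<Gamma>\<^sub>2 q (\<lambda>x. u x + ?p x) \<le> friction \<gamma> \<Gamma>\<^sub>2 q u"
    unfolding friction_def by (intro integral_mono_AE friction_integrable[OF d] u v)
  have "robin_form \<Omega> \<gamma> \<Gamma>\<^sub>1 h u ?p \<le> 0"
    using robin_form_pos_part[OF mu] robin_form_lin_left[OF u u p, of "-1" 0] by simp
  moreover have "0 \<le> L2_inner (lebesgue_on \<Omega>) g ?p"
    unfolding L2_inner_def
    by (rule integral_nonneg_AE) (use d in \<open>auto simp: data_def elim!: eventually_mono\<close>)
  moreover have "0 \<le> L2_inner (surface \<Gamma>\<^sub>1) b (\<gamma> ?p)"
  proof -
    have "AE x in surface \<Gamma>\<^sub>1. 0 \<le> b x" using d by (simp add: data_def)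
    then have "AE x in surface \<Gamma>\<^sub>1. 0 \<le> b x * \<gamma> ?p x"
      using trp[OF \<Gamma>(1,2)] by eventually_elim simp
    then show ?thesis unfolding L2_inner_def by (rule integral_nonneg_AE)
  qed
  moreover have "L2_inner (surface \<Gamma>\<^sub>3) f (\<gamma> ?p) \<le> 0"
  proof -
    have "AE x in surface \<Gamma>\<^sub>3. 0 \<le> - (f x * \<gamma> ?p x)"
      using f trp[OF \<Gamma>(5,6)] by eventually_elim (simp add: mult_nonpos_nonneg)
    then have "0 \<le> (\<integral>x. - (f x * \<gamma> ?p x) \<partial>surface \<Gamma>\<^sub>3)" by (rule integral_nonneg_AE)
    then show ?thesis by (simp add: L2_inner_def)
  qed
  moreover have "0 \<le> residual g b f u l ?p" using robin_inequalityD[OF sol v] fr by simp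
  ultimately show ?thesis using h by (simp add: residual_def) (smt (verit) mult_nonneg_nonneg)
qed

text \<open>
  For nonnegative solutions \<open>u\<^sub>1\<close> and \<open>u\<^sub>2\<close>, the friction terms of the test functions \<open>u\<^sub>1 + w\<^sup>+\<close>,
  \<open>u\<^sub>2 + w\<^sup>+\<close> and \<open>u - w\<^sup>+\<close> cancel, where \<open>w\<close> is the difference between \<open>u\<close> and the convex combination.
\<close>

lemma convex_combination_test:
  assumes d: "data g b q" and f: "f\<^sub>1 \<in> L2 (surface \<Gamma>\<^sub>3)" "f\<^sub>2 \<in> L2 (surface \<Gamma>\<^sub>3)" and \<mu>: "0 \<le> \<mu>" "\<mu> \<le> 1"
    and u: "u\<^sub>1 \<in> H1 \<Omega>" "u\<^sub>2 \<in> H1 \<Omega>" "u \<in> H1 \<Omega>"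
    and pos: "AE x in lebesgue_on \<Omega>. 0 \<le> u\<^sub>1 x" "AE x in lebesgue_on \<Omega>. 0 \<le> u\<^sub>2 x"
    and l: "linear_on_H1 l"
    and sol1: "robin_inequality \<Omega> \<gamma> \<Gamma>\<^sub>1 \<Gamma>\<^sub>2 \<Gamma>\<^sub>3 g b q h f\<^sub>1 u\<^sub>1 l\<^sub>1"
    and sol2: "robin_inequality \<Omega> \<gamma> \<Gamma>\<^sub>1 \<Gamma>\<^sub>2 \<Gamma>\<^sub>3 g b q h f\<^sub>2 u\<^sub>2 l\<^sub>2"
    and sol: "robin_inequality \<Omega> \<gamma> \<Gamma>\<^sub>1 \<Gamma>\<^sub>2 \<Gamma>\<^sub>3 g b q h (\<lambda>x. \<mu> * f\<^sub>1 x + (1 - \<mu>) * f\<^sub>2 x) u l"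
  defines "p \<equiv> \<lambda>x. max 0 (1 * u x + - 1 * (\<mu> * u\<^sub>1 x + (1 - \<mu>) * u\<^sub>2 x))"
  shows "1 * l p + - 1 * (\<mu> * l\<^sub>1 p + (1 - \<mu>) * l\<^sub>2 p) \<le> 0"
proof -
  let ?w = "\<lambda>x. 1 * u x + - 1 * (\<mu> * u\<^sub>1 x + (1 - \<mu>) * u\<^sub>2 x)"
  have u3: "(\<lambda>x. \<mu> * u\<^sub>1 x + (1 - \<mu>) * u\<^sub>2 x) \<in> H1 \<Omega>" by (rule H1_lin[OF u(1,2)])
  have w: "?w \<in> H1 \<Omega>" by (rule H1_lin[OF u(3) u3])
  have p: "p \<in> H1 \<Omega>" unfolding p_def by (rule pos_part_H1(2)[OF H1_L2[OF w] H1_wgrad[OF w]])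
  have fL: "(\<lambda>x. \<mu> * f\<^sub>1 x + (1 - \<mu>) * f\<^sub>2 x) \<in> L2 (surface \<Gamma>\<^sub>3)" by (rule L2_lin[OF f])
  have v: "(\<lambda>x. u\<^sub>1 x + p x) \<in> H1 \<Omega>" "(\<lambda>x. u\<^sub>2 x + p x) \<in> H1 \<Omega>" "(\<lambda>x. u x - p x) \<in> H1 \<Omega>"
    by (intro H1_add H1_diff u p)+
  have r1: "0 \<le> residual g b f\<^sub>1 u\<^sub>1 l\<^sub>1 p + friction \<gamma> \<Gamma>\<^sub>2 q (\<lambda>x. u\<^sub>1 x + p x) - friction \<gamma> \<Gamma>\<^sub>2 q u\<^sub>1"
    using robin_inequalityD[OF sol1 v(1)] by simp
  have r2: "0 \<le> residual g b f\<^sub>2 u\<^sub>2 l\<^sub>2 p + friction \<gamma> \<Gamma>\<^sub>2 q (\<lambda>x. u\<^sub>2 x + p x) - friction \<gamma> \<Gamma>\<^sub>2 q u\<^sub>2"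
    using robin_inequalityD[OF sol2 v(2)] by simp
  have r: "0 \<le> - residual g b (\<lambda>x. \<mu> * f\<^sub>1 x + (1 - \<mu>) * f\<^sub>2 x) u l p + friction \<gamma> \<Gamma>\<^sub>2 q (\<lambda>x. u x - p x) - friction \<gamma> \<Gamma>\<^sub>2 q u"
    using robin_inequalityD[OF sol v(3)] residual_uminus[OF d fL u(3) l p] by simp
  have pt: "AE x in surface \<Gamma>\<^sub>2. \<gamma> p x = max 0 (\<gamma> u x - (\<mu> * \<gamma> u\<^sub>1 x + (1 - \<mu>) * \<gamma> u\<^sub>2 x))"
    using trace_pos_part[OF w \<Gamma>(3,4)] AE_surface[OF \<Gamma>(3,4) trace_lin[OF u(3) u3, of 1 "-1"]]
      AE_surface[OF \<Gamma>(3,4) trace_lin[OF u(1,2), of \<mu> "1 - \<mu>"]]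
    unfolding p_def by eventually_elim simp
  note pos1 = trace_nonneg[OF u(1) pos(1) \<Gamma>(3,4)] and pos2 = trace_nonneg[OF u(2) pos(2) \<Gamma>(3,4)]
  define Q where "Q = L2_inner (surface \<Gamma>\<^sub>2) q (\<gamma> p)"
  have qL: "q \<in> L2 (surface \<Gamma>\<^sub>2)" using d by (simp add: data_def)
  have iQ: "integrable (surface \<Gamma>\<^sub>2) (\<lambda>x. q x * \<gamma> p x)"
    by (rule L2_mult_integrable[OF qL trace_L2_surface(1)[OF \<Gamma>(3,4) p]])
  have frQ: "friction \<gamma> \<Gamma>\<^sub>2 q y - friction \<gamma> \<Gamma>\<^sub>2 q z = c * Q"
    if yz: "y \<in> H1 \<Omega>" "z \<in> H1 \<Omega>" and ae: "AE x in surface \<Gamma>\<^sub>2. \<bar>\<gamma> y x\<bar> - \<bar>\<gamma> z x\<bar> = c * \<gamma> p x" for y z c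
  proof -
    have "friction \<gamma> \<Gamma>\<^sub>2 q y - friction \<gamma> \<Gamma>\<^sub>2 q z = (\<integral>x. q x * \<bar>\<gamma> y x\<bar> - q x * \<bar>\<gamma> z x\<bar> \<partial>surface \<Gamma>\<^sub>2)"
      unfolding friction_def by (rule Bochner_Integration.integral_diff[symmetric]) (intro friction_integrable[OF d] yz)+
    also have "\<dots> = (\<integral>x. c * (q x * \<gamma> p x) \<partial>surface \<Gamma>\<^sub>2)"
    proof (rule integral_cong_AE)
      show "AE x in surface \<Gamma>\<^sub>2. q x * \<bar>\<gamma> y x\<bar> - q x * \<bar>\<gamma> z x\<bar> = c * (q x * \<gamma> p x)"
        using ae
      proof eventually_elim
        case (elim x)
        then have "q x * (\<bar>\<gamma> y x\<bar> - \<bar>\<gamma> z x\<bar>) = q x * (c * \<gamma> p x)" by simp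
        then show ?case by (simp add: algebra_simps)
      qed
      show "(\<lambda>x. q x * \<bar>\<gamma> y x\<bar> - q x * \<bar>\<gamma> z x\<bar>) \<in> borel_measurable (surface \<Gamma>\<^sub>2)"
        by (intro borel_measurable_integrable Bochner_Integration.integrable_diff friction_integrable[OF d] yz)
      show "(\<lambda>x. c * (q x * \<gamma> p x)) \<in> borel_measurable (surface \<Gamma>\<^sub>2)"
        by (intro borel_measurable_integrable integrable_mult_right iQ)
    qed
    also have "\<dots> = c * Q" by (simp add: Q_def L2_inner_def)
    finally show ?thesis .
  qed
  have fr1: "friction \<gamma> \<Gamma>\<^sub>2 q (\<lambda>x. u\<^sub>1 x + p x) - friction \<gamma> \<Gamma>\<^sub>2 q u\<^sub>1 = 1 * Q"
    using pt pos1 AE_surface[OF \<Gamma>(3,4) trace_lin[OF u(1) p, of 1 1]]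
    by (intro frQ v u, eventually_elim) auto
  have fr2: "friction \<gamma> \<Gamma>\<^sub>2 q (\<lambda>x. u\<^sub>2 x + p x) - friction \<gamma> \<Gamma>\<^sub>2 q u\<^sub>2 = 1 * Q"
    using pt pos2 AE_surface[OF \<Gamma>(3,4) trace_lin[OF u(2) p, of 1 1]]
    by (intro frQ v u, eventually_elim) auto
  have fr: "friction \<gamma> \<Gamma>\<^sub>2 q (\<lambda>x. u x - p x) - friction \<gamma> \<Gamma>\<^sub>2 q u = - 1 * Q"
  proof (rule frQ[OF v(3) u(3)])
    show "AE x in surface \<Gamma>\<^sub>2. \<bar>\<gamma> (\<lambda>x. u x - p x) x\<bar> - \<bar>\<gamma> u x\<bar> = - 1 * \<gamma> p x"
      using pt pos1 pos2 AE_surface[OF \<Gamma>(3,4) trace_lin[OF u(3) p, of 1 "-1"]]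
    proof eventually_elim
      case (elim x)
      have "0 \<le> \<mu> * \<gamma> u\<^sub>1 x + (1 - \<mu>) * \<gamma> u\<^sub>2 x" using elim \<mu> by simp
      then show ?case using elim by auto
    qed
  qed
  have R: "residual g b (\<lambda>x. \<mu> * f\<^sub>1 x + (1 - \<mu>) * f\<^sub>2 x) u l p - (\<mu> * residual g b f\<^sub>1 u\<^sub>1 l\<^sub>1 p + (1 - \<mu>) * residual g b f\<^sub>2 u\<^sub>2 l\<^sub>2 p)
      = l p - (\<mu> * l\<^sub>1 p + (1 - \<mu>) * l\<^sub>2 p) + robin_form \<Omega> \<gamma> \<Gamma>\<^sub>1 h ?w p"
    unfolding residual_def robin_form_lin_left[OF u(3) u3 p] robin_form_lin_left[OF u(1,2) p]
      L2_inner_add_left[OF f trace_L2_surface(1)[OF \<Gamma>(5,6) p]]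
    by (simp add: algebra_simps)
  have a: "0 \<le> robin_form \<Omega> \<gamma> \<Gamma>\<^sub>1 h ?w p" unfolding p_def by (rule robin_form_pos_part[OF w])
  have "0 \<le> \<mu> * (residual g b f\<^sub>1 u\<^sub>1 l\<^sub>1 p + Q)" using r1 fr1 \<mu> by (intro mult_nonneg_nonneg) auto
  moreover have "0 \<le> (1 - \<mu>) * (residual g b f\<^sub>2 u\<^sub>2 l\<^sub>2 p + Q)" using r2 fr2 \<mu> by (intro mult_nonneg_nonneg) auto
  moreover have "\<mu> * Q + (1 - \<mu>) * Q = Q" by (simp add: algebra_simps)
  ultimately have "0 \<le> \<mu> * residual g b f\<^sub>1 u\<^sub>1 l\<^sub>1 p + (1 - \<mu>) * residual g b f\<^sub>2 u\<^sub>2 l\<^sub>2 p + Q"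
    unfolding distrib_left by linarith
  then have "l p - (\<mu> * l\<^sub>1 p + (1 - \<mu>) * l\<^sub>2 p) \<le> 0" using r fr R a by linarith
  then show ?thesis by simp
qed

lemma difference_test:
  assumes d: "data g b q" and f: "f\<^sub>1 \<in> L2 (surface \<Gamma>\<^sub>3)" "f\<^sub>2 \<in> L2 (surface \<Gamma>\<^sub>3)"
    and u: "u\<^sub>1 \<in> H1 \<Omega>" "u\<^sub>2 \<in> H1 \<Omega>" and l: "linear_on_H1 l\<^sub>1"
    and sol1: "robin_inequality \<Omega> \<gamma> \<Gamma>\<^sub>1 \<Gamma>\<^sub>2 \<Gamma>\<^sub>3 g b q h f\<^sub>1 u\<^sub>1 l\<^sub>1"
    and sol2: "robin_inequality \<Omega> \<gamma> \<Gamma>\<^sub>1 \<Gamma>\<^sub>2 \<Gamma>\<^sub>3 g b q h f\<^sub>2 u\<^sub>2 l\<^sub>2"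
    and C: "C \<ge> 0" "\<And>u. u \<in> H1 \<Omega> \<Longrightarrow> L2_norm (surface (frontier \<Omega>)) (\<gamma> u) \<le> C * H1_norm \<Omega> u"
  defines "w \<equiv> \<lambda>x. 1 * u\<^sub>1 x + - 1 * u\<^sub>2 x"
  shows "1 * l\<^sub>1 w + - 1 * l\<^sub>2 w \<le> C\<^sup>2 / 2 * (L2_norm (surface \<Gamma>\<^sub>3) (\<lambda>x. f\<^sub>1 x - f\<^sub>2 x))\<^sup>2 + (L2_norm (lebesgue_on \<Omega>) w)\<^sup>2 / 2"
proof -
  have w: "w \<in> H1 \<Omega>" unfolding w_def by (rule H1_lin[OF u])
  have "(\<lambda>x. u\<^sub>2 x - u\<^sub>1 x) = (\<lambda>x. - w x)" "(\<lambda>x. u\<^sub>1 x - u\<^sub>2 x) = w" by (simp_all add: w_def)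
  then have "0 \<le> - residual g b f\<^sub>1 u\<^sub>1 l\<^sub>1 w + friction \<gamma> \<Gamma>\<^sub>2 q u\<^sub>2 - friction \<gamma> \<Gamma>\<^sub>2 q u\<^sub>1"
    "0 \<le> residual g b f\<^sub>2 u\<^sub>2 l\<^sub>2 w + friction \<gamma> \<Gamma>\<^sub>2 q u\<^sub>1 - friction \<gamma> \<Gamma>\<^sub>2 q u\<^sub>2"
    using robin_inequalityD[OF sol1 u(2)] robin_inequalityD[OF sol2 u(1)] residual_uminus[OF d f(1) u(1) l w] by simp_all
  then have "residual g b f\<^sub>1 u\<^sub>1 l\<^sub>1 w - residual g b f\<^sub>2 u\<^sub>2 l\<^sub>2 w \<le> 0" by linarith
  moreover have "residual g b f\<^sub>1 u\<^sub>1 l\<^sub>1 w - residual g b f\<^sub>2 u\<^sub>2 l\<^sub>2 w =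
      (l\<^sub>1 w - l\<^sub>2 w) + robin_form \<Omega> \<gamma> \<Gamma>\<^sub>1 h w w + L2_inner (surface \<Gamma>\<^sub>3) (\<lambda>x. f\<^sub>1 x - f\<^sub>2 x) (\<gamma> w)"
    using robin_form_lin_left[OF u w, of 1 "-1"] L2_inner_add_left[OF f trace_L2_surface(1)[OF \<Gamma>(5,6) w], of 1 "-1"]
    by (simp add: residual_def w_def)
  moreover have "dirichlet_form \<Omega> w w \<le> robin_form \<Omega> \<gamma> \<Gamma>\<^sub>1 h w w"
    using h by (simp add: robin_form_def Bochner_Integration.integral_nonneg)
  moreover have "\<bar>L2_inner (surface \<Gamma>\<^sub>3) (\<lambda>x. f\<^sub>1 x - f\<^sub>2 x) (\<gamma> w)\<bar>
      \<le> C\<^sup>2 / 2 * (L2_norm (surface \<Gamma>\<^sub>3) (\<lambda>x. f\<^sub>1 x - f\<^sub>2 x))\<^sup>2 + (H1_norm \<Omega> w)\<^sup>2 / 2"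
  proof -
    let ?n = "L2_norm (surface \<Gamma>\<^sub>3) (\<lambda>x. f\<^sub>1 x - f\<^sub>2 x)"
    have "\<bar>L2_inner (surface \<Gamma>\<^sub>3) (\<lambda>x. f\<^sub>1 x - f\<^sub>2 x) (\<gamma> w)\<bar> \<le> ?n * L2_norm (surface \<Gamma>\<^sub>3) (\<gamma> w)"
      by (rule L2_Cauchy_Schwarz[OF L2_diff[OF f] trace_L2_surface(1)[OF \<Gamma>(5,6) w]])
    also have "\<dots> \<le> ?n * (C * H1_norm \<Omega> w)"
      using trace_L2_surface(2)[OF \<Gamma>(5,6) w] C(2)[OF w] by (intro mult_left_mono) auto
    also have "\<dots> \<le> ((C * ?n)\<^sup>2 + (H1_norm \<Omega> w)\<^sup>2) / 2"
    proof -
      have "?n * (C * H1_norm \<Omega> w) = (C * ?n) * H1_norm \<Omega> w" by simp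
      also have "x * y \<le> (x\<^sup>2 + y\<^sup>2) / 2" for x y :: real
        using two_mult_le_squares[of x y] by simp
      finally show ?thesis .
    qed
    also have "\<dots> = C\<^sup>2 / 2 * ?n\<^sup>2 + (H1_norm \<Omega> w)\<^sup>2 / 2" by (simp add: power_mult_distrib add_divide_distrib)
    finally show ?thesis .
  qed
  ultimately show ?thesis
    using H1_norm_power2[of w] dirichlet_form_nonneg[of w] by (simp add: add_divide_distrib)
qed

end

section \<open>The control problem\<close>

lemma gronwall_integral:
  fixes y :: "real \<Rightarrow> real" and A T :: real
  assumes y: "continuous_on {0..T} y" and A: "A \<ge> 0"
    and le: "\<And>t. t \<in> {0..T} \<Longrightarrow> y t \<le> A + integral {0..t} y" and t: "t \<in> {0..T}"
  shows "y t \<le> 2 * A * exp (2 * T)"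
proof -
  have "continuous_on {0..T} (\<lambda>s. exp (- 2 * s) * y s)" by (intro continuous_intros y)
  then obtain t\<^sub>0 where t0: "t\<^sub>0 \<in> {0..T}" "\<And>s. s \<in> {0..T} \<Longrightarrow> exp (- 2 * s) * y s \<le> exp (- 2 * t\<^sub>0) * y t\<^sub>0"
    using continuous_attains_sup[of "{0..T}" "\<lambda>s. exp (- 2 * s) * y s"] t by auto
  define m where "m = exp (- 2 * t\<^sub>0) * y t\<^sub>0"
  have ym: "y s \<le> m * exp (2 * s)" if "s \<in> {0..T}" for s
  proof -
    have "exp (- 2 * s) * y s * exp (2 * s) \<le> m * exp (2 * s)"
      using t0(2)[OF that] unfolding m_def by (intro mult_right_mono) auto
    moreover have "exp (- 2 * s) * exp (2 * s) = 1" by (simp flip: exp_add)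
    then have "exp (- 2 * s) * y s * exp (2 * s) = y s" by (metis mult.assoc mult.commute mult_1)
    ultimately show ?thesis by linarith
  qed
  have yt0: "y t\<^sub>0 = m * exp (2 * t\<^sub>0)" by (simp add: m_def exp_minus field_simps)
  have "m \<le> 2 * A"
  proof (cases "m \<le> 0")
    case False
    have "((\<lambda>s. m * exp (2 * s)) has_integral (m / 2 * exp (2 * t\<^sub>0) - m / 2 * exp (2 * 0))) {0..t\<^sub>0}"
      using t0(1) by (intro fundamental_theorem_of_calculus)
        (auto intro!: derivative_eq_intros simp flip: has_real_derivative_iff_has_vector_derivative)
    from integral_unique[OF this] have "integral {0..t\<^sub>0} (\<lambda>s. m * exp (2 * s)) = m / 2 * exp (2 * t\<^sub>0) - m / 2"
      by (rule trans) simp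
    moreover have "integral {0..t\<^sub>0} y \<le> integral {0..t\<^sub>0} (\<lambda>s. m * exp (2 * s))"
      using t0(1) by (intro integral_le integrable_continuous_interval continuous_on_subset[OF y] continuous_intros ym) auto
    ultimately have "y t\<^sub>0 \<le> A + (m / 2 * exp (2 * t\<^sub>0) - m / 2)" using le[OF t0(1)] by linarith
    then have "m * exp (2 * t\<^sub>0) + m \<le> 2 * A" using yt0 by simp
    then show ?thesis using False by (smt (verit) exp_gt_zero mult_pos_pos)
  qed (use A in auto)
  have "y t \<le> m * exp (2 * t)" by (rule ym[OF t])
  also have "\<dots> \<le> 2 * A * exp (2 * T)"
  proof (cases "m \<le> 0")
    case True
    then have "m * exp (2 * t) \<le> 0" by (simp add: mult_nonpos_nonneg)
    also have "\<dots> \<le> 2 * A * exp (2 * T)" using A by simp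
    finally show ?thesis .
  next
    case False
    then show ?thesis using \<open>m \<le> 2 * A\<close> t by (intro mult_mono) auto
  qed
  finally show ?thesis .
qed

lemma uniformly_convex_minimizer:
  assumes P: "finite_measure P" and K: "K \<subseteq> L2 P" "K \<noteq> {}" and c: "c > 0"
    and J0: "\<And>f. f \<in> K \<Longrightarrow> 0 \<le> J f"
    and mid: "\<And>f g. f \<in> K \<Longrightarrow> g \<in> K \<Longrightarrow> (\<lambda>z. 1/2 * f z + (1 - 1/2) * g z) \<in> K"
    and convex: "\<And>f g. f \<in> K \<Longrightarrow> g \<in> K \<Longrightarrow>
      J (\<lambda>z. 1/2 * f z + (1 - 1/2) * g z) \<le> 1/2 * J f + (1 - 1/2) * J g - c * (L2_norm P (\<lambda>z. f z - g z))\<^sup>2"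
    and closed: "\<And>F f. (\<And>n::nat. F n \<in> K) \<Longrightarrow> f \<in> L2 P \<Longrightarrow> (\<lambda>n. L2_norm P (\<lambda>z. F n z - f z)) \<longlonglongrightarrow> 0 \<Longrightarrow> f \<in> K"
    and cont: "\<And>F f. (\<And>n::nat. F n \<in> K) \<Longrightarrow> f \<in> K \<Longrightarrow> (\<lambda>n. L2_norm P (\<lambda>z. F n z - f z)) \<longlonglongrightarrow> 0 \<Longrightarrow> (\<lambda>n. J (F n)) \<longlonglongrightarrow> J f"
  shows "\<exists>f. minimizer_on K J f"
proof -
  have bdd: "bdd_below (J ` K)" using J0 by (intro bdd_belowI2)
  define m where "m = Inf (J ` K)"
  have m: "m \<le> J f" if "f \<in> K" for f unfolding m_def using that bdd by (intro cInf_lower) auto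
  have "\<exists>f\<in>K. J f < m + 1 / real (Suc n)" for n
    using cInf_lessD[of "J ` K" "m + 1 / real (Suc n)"] K(2) by (auto simp: m_def)
  then obtain F where F: "\<And>n. F n \<in> K" "\<And>n. J (F n) < m + 1 / real (Suc n)" by metis
  have FL: "F n \<in> L2 P" for n using F(1) K(1) by blast
  have small: "c * (L2_norm P (\<lambda>z. F i z - F j z))\<^sup>2 < 1 / real (Suc N)" if "i \<ge> N" "j \<ge> N" for i j N
  proof -
    define a where "a n = 1 / real (Suc n)" for n
    have "a i \<le> a N" "a j \<le> a N" unfolding a_def using that by (auto intro!: divide_left_mono)
    moreover have "J (F i) < m + a i" "J (F j) < m + a j" using F(2) by (auto simp: a_def)
    moreover have "m \<le> J (\<lambda>z. 1/2 * F i z + (1 - 1/2) * F j z)" by (rule m[OF mid[OF F(1) F(1)]])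
    moreover have "J (\<lambda>z. 1/2 * F i z + (1 - 1/2) * F j z)
        \<le> 1/2 * J (F i) + (1 - 1/2) * J (F j) - c * (L2_norm P (\<lambda>z. F i z - F j z))\<^sup>2"
      by (rule convex[OF F(1) F(1)])
    ultimately have "c * (L2_norm P (\<lambda>z. F i z - F j z))\<^sup>2 < a N"
      using less_le_trans by (auto simp: field_simps)
    then show ?thesis by (simp add: a_def)
  qed
  have cauchy: "\<exists>N. \<forall>i\<ge>N. \<forall>j\<ge>N. L2_norm P (\<lambda>z. F i z - F j z) < e" if e: "e > 0" for e
  proof -
    obtain N where N: "1 / real (Suc N) < c * e\<^sup>2"
      using reals_Archimedean[of "c * e\<^sup>2"] c e by (auto simp: inverse_eq_divide)
    have "L2_norm P (\<lambda>z. F i z - F j z) < e" if "i \<ge> N" "j \<ge> N" for i j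
    proof -
      have "c * (L2_norm P (\<lambda>z. F i z - F j z))\<^sup>2 < c * e\<^sup>2" using small[OF that] N by linarith
      then have "(L2_norm P (\<lambda>z. F i z - F j z))\<^sup>2 < e\<^sup>2" using c by simp
      then show ?thesis using e by (simp add: power2_less_imp_less)
    qed
    then show ?thesis by blast
  qed
  obtain f where f: "f \<in> L2 P" "(\<lambda>n. L2_norm P (\<lambda>x. F n x - f x)) \<longlonglongrightarrow> 0"
    using L2_complete[of P F, OF P FL cauchy] by blast
  have fK: "f \<in> K" by (rule closed[OF F(1) f])
  have lim: "(\<lambda>n. m + 1 / real (Suc n)) \<longlonglongrightarrow> m + 0"
    using LIMSEQ_inverse_real_of_nat by (intro tendsto_add tendsto_const) (simp add: inverse_eq_divide)
  have "J f \<le> m + 0"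
    by (rule LIMSEQ_le[OF cont[OF F(1) fK f(2)] lim]) (use F(2) less_imp_le in blast)
  then show ?thesis using fK m by (intro exI[of _ f]) (auto simp: minimizer_on_def intro: order_trans)
qed

lemma lateral_slices:
  assumes "finite_measure (surface \<Gamma>)" and f: "f \<in> L2 (lateral T \<Gamma>)"
  shows "AE t in time T. (\<lambda>x. f (t, x)) \<in> L2 (surface \<Gamma>)"
    "integrable (time T) (\<lambda>t. (L2_norm (surface \<Gamma>) (\<lambda>x. f (t, x)))\<^sup>2)"
    "(\<integral>t. (L2_norm (surface \<Gamma>) (\<lambda>x. f (t, x)))\<^sup>2 \<partial>time T) = (L2_norm (lateral T \<Gamma>) f)\<^sup>2"
proof -
  interpret S: finite_measure "surface \<Gamma>" by fact
  interpret time: finite_measure "time T" by (rule finite_measure_time)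
  interpret pair_sigma_finite "time T" "surface \<Gamma>" ..
  have fm: "f \<in> borel_measurable (lateral T \<Gamma>)" by (rule L2_measurable[OF f])
  have i: "integrable (lateral T \<Gamma>) (\<lambda>z. (f z)\<^sup>2)" by (rule L2_square_integrable[OF f])
  show "AE t in time T. (\<lambda>x. f (t, x)) \<in> L2 (surface \<Gamma>)"
    using AE_integrable_fst'[OF i] AE_space
    by eventually_elim (use measurable_Pair2[OF fm] in \<open>auto simp: L2_def\<close>)
  show "integrable (time T) (\<lambda>t. (L2_norm (surface \<Gamma>) (\<lambda>x. f (t, x)))\<^sup>2)"
    unfolding L2_norm_power2 by (rule integrable_fst'[OF i])
  show "(\<integral>t. (L2_norm (surface \<Gamma>) (\<lambda>x. f (t, x)))\<^sup>2 \<partial>time T) = (L2_norm (lateral T \<Gamma>) f)\<^sup>2"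
    unfolding L2_norm_power2 by (rule integral_fst'[OF i])
qed

lemma lateral_AE_slices:
  assumes "finite_measure (surface \<Gamma>)" and "AE z in lateral T \<Gamma>. Q z"
  shows "AE t in time T. AE x in surface \<Gamma>. Q (t, x)"
proof -
  interpret S: finite_measure "surface \<Gamma>" by fact
  interpret time: finite_measure "time T" by (rule finite_measure_time)
  interpret pair_sigma_finite "time T" "surface \<Gamma>" ..
  show ?thesis using AE_pair[OF assms(2)] .
qed

lemma finite_measure_lateral:
  assumes "finite_measure (surface \<Gamma>)"
  shows "finite_measure (lateral T \<Gamma>)"
  by (intro finite_measure_pair_measure assms finite_measure_time)

locale robin_problem = robin_domain \<Omega> \<gamma> \<Gamma>\<^sub>1 \<Gamma>\<^sub>2 \<Gamma>\<^sub>3 h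
  for \<Omega> :: "'a::euclidean_space set" and \<gamma> \<Gamma>\<^sub>1 \<Gamma>\<^sub>2 \<Gamma>\<^sub>3 h +
  fixes T M :: real and g b :: "real \<Rightarrow> 'a \<Rightarrow> real" and q :: "real \<times> 'a \<Rightarrow> real" and u\<^sub>b :: "'a \<Rightarrow> real"
    and D :: "(real \<Rightarrow> ('a \<Rightarrow> real) \<Rightarrow> real) set"
  assumes T: "T > 0" and M: "M > 0"
    and data_AE: "AE t in time T. data (g t) (b t) (\<lambda>x. q (t, x))"
    and ub_nonneg: "AE x in lebesgue_on \<Omega>. u\<^sub>b x \<ge> 0"
    and D: "D = L2_derivatives T \<Omega> \<or> D = dual_derivatives T \<Omega>"
    and solvable: "\<And>f. f \<in> L2 (lateral T \<Gamma>\<^sub>3) \<Longrightarrow> \<exists>u. robin_solution D \<Omega> \<gamma> \<Gamma>\<^sub>1 \<Gamma>\<^sub>2 \<Gamma>\<^sub>3 T g b q u\<^sub>b h f u"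
begin

abbreviation solution :: "(real \<times> 'a \<Rightarrow> real) \<Rightarrow> (real \<Rightarrow> 'a \<Rightarrow> real) \<Rightarrow> bool" where
  "solution f u \<equiv> robin_solution D \<Omega> \<gamma> \<Gamma>\<^sub>1 \<Gamma>\<^sub>2 \<Gamma>\<^sub>3 T g b q u\<^sub>b h f u"

abbreviation inequality_at :: "(real \<times> 'a \<Rightarrow> real) \<Rightarrow> real \<Rightarrow> ('a \<Rightarrow> real) \<Rightarrow> (('a \<Rightarrow> real) \<Rightarrow> real) \<Rightarrow> bool" where
  "inequality_at f t \<equiv> robin_inequality \<Omega> \<gamma> \<Gamma>\<^sub>1 \<Gamma>\<^sub>2 \<Gamma>\<^sub>3 (g t) (b t) (\<lambda>x. q (t, x)) h (\<lambda>x. f (t, x))"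

lemma finite_measure_controls: "finite_measure (surface \<Gamma>\<^sub>3)" "finite_measure (lateral T \<Gamma>\<^sub>3)"
  by (intro finite_measure_lateral finite_measure_surface \<Gamma>)+

lemma solution_C_L2: "solution f u \<Longrightarrow> u \<in> C_L2 T \<Omega>"
  by (simp add: robin_solution_def)

lemma solution_initial: "solution f u \<Longrightarrow> AE x in lebesgue_on \<Omega>. u 0 x = u\<^sub>b x"
  by (simp add: robin_solution_def)

lemma solution_evolution:
  assumes u: "solution f u"
  obtains l where "evolution T u l" "AE t in time T. u t \<in> H1 \<Omega> \<and> linear_on_H1 (l t) \<and> inequality_at f t (u t) (l t)"
proof -
  obtain l where l: "l \<in> D" "has_time_derivative T \<Omega> u l" "AE t in time T. inequality_at f t (u t) (l t)"
    using u unfolding robin_solution_def by blast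
  have uC: "u \<in> C_L2 T \<Omega>" by (rule solution_C_L2[OF u])
  have dp: "dual_path T l" using D l(1) L2_derivatives_dual_path dual_derivatives_dual_path by blast
  have uH: "u \<in> L2_H1 T \<Omega>" using u by (simp add: robin_solution_def)
  have H: "AE t in time T. u t \<in> H1 \<Omega>" using uH by (simp add: bochner_L2_def)
  have i: "integrable (time T) (\<lambda>t. (H1_norm \<Omega> (u t))\<^sup>2)" using uH by (simp add: bochner_L2_def)
  have "(\<lambda>t. sqrt ((H1_norm \<Omega> (u t))\<^sup>2)) \<in> borel_measurable (time T)"
    by (rule measurable_compose[OF borel_measurable_integrable[OF i] borel_measurable_sqrt])
  then have "(\<lambda>t. H1_norm \<Omega> (u t)) \<in> borel_measurable (time T)" by (simp add: H1_norm_nonneg)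
  then have nL: "(\<lambda>t. H1_norm \<Omega> (u t)) \<in> L2 (time T)" using i by (simp add: L2_def)
  have id: "L2_inner (lebesgue_on \<Omega>) (u t) v - L2_inner (lebesgue_on \<Omega>) (u s) v = integral {s..t} (\<lambda>\<tau>. l \<tau> v)"
    if v: "v \<in> H1 \<Omega>" and st: "0 < s" "s < t" "t < T" for s t v
  proof (rule weak_derivative_integral[OF C_L2_inner_continuous[OF uC H1_L2[OF v]] _ _ st])
    show "integrable (time T) (\<lambda>\<tau>. l \<tau> v)" using dp v by (simp add: dual_path_def)
    show "(\<integral>t. deriv \<theta> t * L2_inner (lebesgue_on \<Omega>) (u t) v \<partial>time T) = - (\<integral>t. \<theta> t * l t v \<partial>time T)"
      if "\<theta> \<in> C1_compact {0<..<T}" for \<theta> using l(2) that v unfolding has_time_derivative_def by blast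
  qed
  have nn: "\<exists>n\<in>L2 (time T). (\<forall>t. 0 \<le> n t) \<and> (AE t in time T. u t \<in> H1 \<Omega> \<and> H1_norm \<Omega> (u t) \<le> n t)"
    by (rule bexI[OF _ nL]) (use H in \<open>simp add: H1_norm_nonneg\<close>)
  have "evolution T u l" unfolding evolution_def by (intro conjI uC dp nn allI ballI impI id)
  moreover have "AE t in time T. linear_on_H1 (l t)" using dp unfolding dual_path_def linear_on_H1_def by blast
  then have "AE t in time T. u t \<in> H1 \<Omega> \<and> linear_on_H1 (l t) \<and> inequality_at f t (u t) (l t)"
    using H l(3) by eventually_elim simp
  ultimately show ?thesis by (rule that)
qed

lemma controls_L2: "f \<in> nonpos_controls T \<Gamma>\<^sub>3 \<Longrightarrow> f \<in> L2 (lateral T \<Gamma>\<^sub>3)"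
  by (simp add: nonpos_controls_def)

lemma controls_slices:
  "f \<in> L2 (lateral T \<Gamma>\<^sub>3) \<Longrightarrow> AE t in time T. (\<lambda>x. f (t, x)) \<in> L2 (surface \<Gamma>\<^sub>3)"
  by (rule lateral_slices(1)[OF finite_measure_controls(1)])

lemma solution_nonneg:
  assumes f: "f \<in> nonpos_controls T \<Gamma>\<^sub>3" and u: "solution f u" and t: "t \<in> {0..T}"
  shows "AE x in lebesgue_on \<Omega>. 0 \<le> u t x"
proof -
  obtain l where l: "evolution T u l" "AE t in time T. u t \<in> H1 \<Omega> \<and> linear_on_H1 (l t) \<and> inequality_at f t (u t) (l t)"
    using solution_evolution[OF u] by blast
  have "AE z in lateral T \<Gamma>\<^sub>3. f z \<le> 0" using f by (simp add: nonpos_controls_def)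
  then have fs: "AE t in time T. AE x in surface \<Gamma>\<^sub>3. f (t, x) \<le> 0"
    by (rule lateral_AE_slices[OF finite_measure_controls(1)])
  have "AE x in lebesgue_on \<Omega>. - 1 * u t x + 0 * u t x \<le> 0"
  proof (rule evolution_nonpos[OF T evolution_lin[OF l(1,1), of "-1" 0] _ _ t])
    show "AE t in time T. (\<lambda>x. - 1 * u t x + 0 * u t x) \<in> H1 \<Omega> \<longrightarrow>
        - 1 * l t (\<lambda>x. max 0 (- 1 * u t x + 0 * u t x)) + 0 * l t (\<lambda>x. max 0 (- 1 * u t x + 0 * u t x)) \<le> 0"
      using l(2) fs data_AE
    proof eventually_elim
      case (elim t)
      then have "0 \<le> l t (\<lambda>x. max 0 (- u t x))" 
        by (intro solution_nonneg_test[where g="g t" and b="b t" and q="\<lambda>x. q (t, x)" and f="\<lambda>x. f (t, x)"]) auto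
      then show ?case by simp
    qed
    show "AE x in lebesgue_on \<Omega>. - 1 * u 0 x + 0 * u 0 x \<le> 0"
      using solution_initial[OF u] ub_nonneg by eventually_elim simp
  qed
  then show ?thesis by eventually_elim simp
qed

lemma solution_convex:
  assumes f: "f\<^sub>1 \<in> nonpos_controls T \<Gamma>\<^sub>3" "f\<^sub>2 \<in> nonpos_controls T \<Gamma>\<^sub>3" and \<mu>: "0 \<le> \<mu>" "\<mu> \<le> 1"
    and u: "solution f\<^sub>1 u\<^sub>1" "solution f\<^sub>2 u\<^sub>2" "solution (\<lambda>z. \<mu> * f\<^sub>1 z + (1 - \<mu>) * f\<^sub>2 z) u"
    and t: "t \<in> {0..T}"
  shows "AE x in lebesgue_on \<Omega>. u t x \<le> \<mu> * u\<^sub>1 t x + (1 - \<mu>) * u\<^sub>2 t x"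
proof -
  obtain l\<^sub>1 where l1: "evolution T u\<^sub>1 l\<^sub>1" "AE t in time T. u\<^sub>1 t \<in> H1 \<Omega> \<and> linear_on_H1 (l\<^sub>1 t) \<and> inequality_at f\<^sub>1 t (u\<^sub>1 t) (l\<^sub>1 t)"
    using solution_evolution[OF u(1)] by blast
  obtain l\<^sub>2 where l2: "evolution T u\<^sub>2 l\<^sub>2" "AE t in time T. u\<^sub>2 t \<in> H1 \<Omega> \<and> linear_on_H1 (l\<^sub>2 t) \<and> inequality_at f\<^sub>2 t (u\<^sub>2 t) (l\<^sub>2 t)"
    using solution_evolution[OF u(2)] by blast
  obtain l where l: "evolution T u l" "AE t in time T. u t \<in> H1 \<Omega> \<and> linear_on_H1 (l t) \<and>
      inequality_at (\<lambda>z. \<mu> * f\<^sub>1 z + (1 - \<mu>) * f\<^sub>2 z) t (u t) (l t)"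
    using solution_evolution[OF u(3)] by blast
  have fs: "AE t in time T. (\<lambda>x. f\<^sub>1 (t, x)) \<in> L2 (surface \<Gamma>\<^sub>3)" "AE t in time T. (\<lambda>x. f\<^sub>2 (t, x)) \<in> L2 (surface \<Gamma>\<^sub>3)"
    by (rule controls_slices[OF controls_L2[OF f(1)]], rule controls_slices[OF controls_L2[OF f(2)]])
  have ev: "evolution T (\<lambda>t x. 1 * u t x + - 1 * (\<mu> * u\<^sub>1 t x + (1 - \<mu>) * u\<^sub>2 t x))
      (\<lambda>t v. 1 * l t v + - 1 * (\<mu> * l\<^sub>1 t v + (1 - \<mu>) * l\<^sub>2 t v))"
    by (rule evolution_lin[OF l(1) evolution_lin[OF l1(1) l2(1)]])
  have "AE x in lebesgue_on \<Omega>. 1 * u t x + - 1 * (\<mu> * u\<^sub>1 t x + (1 - \<mu>) * u\<^sub>2 t x) \<le> 0"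
  proof (rule evolution_nonpos[OF T ev _ _ t])
    show "AE t in time T. (\<lambda>x. 1 * u t x + - 1 * (\<mu> * u\<^sub>1 t x + (1 - \<mu>) * u\<^sub>2 t x)) \<in> H1 \<Omega> \<longrightarrow>
        1 * l t (\<lambda>x. max 0 (1 * u t x + - 1 * (\<mu> * u\<^sub>1 t x + (1 - \<mu>) * u\<^sub>2 t x))) +
        - 1 * (\<mu> * l\<^sub>1 t (\<lambda>x. max 0 (1 * u t x + - 1 * (\<mu> * u\<^sub>1 t x + (1 - \<mu>) * u\<^sub>2 t x))) +
          (1 - \<mu>) * l\<^sub>2 t (\<lambda>x. max 0 (1 * u t x + - 1 * (\<mu> * u\<^sub>1 t x + (1 - \<mu>) * u\<^sub>2 t x)))) \<le> 0"
      using AE_space l1(2) l2(2) l(2) fs data_AE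
    proof eventually_elim
      case (elim t)
      then have "t \<in> {0..T}" by auto
      then have "AE x in lebesgue_on \<Omega>. 0 \<le> u\<^sub>1 t x" "AE x in lebesgue_on \<Omega>. 0 \<le> u\<^sub>2 t x"
        using solution_nonneg[OF f(1) u(1)] solution_nonneg[OF f(2) u(2)] by auto
      then show ?case using elim \<mu> by (intro impI convex_combination_test[of "g t" "b t" "\<lambda>x. q (t, x)" "\<lambda>x. f\<^sub>1 (t, x)" "\<lambda>x. f\<^sub>2 (t, x)"]) auto
    qed
    show "AE x in lebesgue_on \<Omega>. 1 * u 0 x + - 1 * (\<mu> * u\<^sub>1 0 x + (1 - \<mu>) * u\<^sub>2 0 x) \<le> 0"
      using solution_initial[OF u(1)] solution_initial[OF u(2)] solution_initial[OF u(3)]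
      by eventually_elim (simp add: algebra_simps)
  qed
  then show ?thesis by eventually_elim simp
qed

lemma solution_Lipschitz:
  obtains C where "C \<ge> 0" "\<And>f\<^sub>1 f\<^sub>2 u\<^sub>1 u\<^sub>2 t. f\<^sub>1 \<in> L2 (lateral T \<Gamma>\<^sub>3) \<Longrightarrow> f\<^sub>2 \<in> L2 (lateral T \<Gamma>\<^sub>3) \<Longrightarrow>
    solution f\<^sub>1 u\<^sub>1 \<Longrightarrow> solution f\<^sub>2 u\<^sub>2 \<Longrightarrow> t \<in> {0..T} \<Longrightarrow>
    L2_norm (lebesgue_on \<Omega>) (\<lambda>x. u\<^sub>1 t x - u\<^sub>2 t x) \<le> C * L2_norm (lateral T \<Gamma>\<^sub>3) (\<lambda>z. f\<^sub>1 z - f\<^sub>2 z)"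
proof -
  let ?M = "lebesgue_on \<Omega>"
  obtain C where C: "C \<ge> 0" "\<And>u. u \<in> H1 \<Omega> \<Longrightarrow> L2_norm (surface (frontier \<Omega>)) (\<gamma> u) \<le> C * H1_norm \<Omega> u"
    using trace_bound by blast
  have main: "(L2_norm ?M (\<lambda>x. 1 * u\<^sub>1 t x + - 1 * u\<^sub>2 t x))\<^sup>2
      \<le> 2 * (C\<^sup>2 * (L2_norm (lateral T \<Gamma>\<^sub>3) (\<lambda>z. f\<^sub>1 z - f\<^sub>2 z))\<^sup>2) * exp (2 * T)"
    if f: "f\<^sub>1 \<in> L2 (lateral T \<Gamma>\<^sub>3)" "f\<^sub>2 \<in> L2 (lateral T \<Gamma>\<^sub>3)" and u: "solution f\<^sub>1 u\<^sub>1" "solution f\<^sub>2 u\<^sub>2" and t: "t \<in> {0..T}"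
    for f\<^sub>1 f\<^sub>2 u\<^sub>1 u\<^sub>2 t
  proof -
    obtain l\<^sub>1 where l1: "evolution T u\<^sub>1 l\<^sub>1" "AE t in time T. u\<^sub>1 t \<in> H1 \<Omega> \<and> linear_on_H1 (l\<^sub>1 t) \<and> inequality_at f\<^sub>1 t (u\<^sub>1 t) (l\<^sub>1 t)"
      using solution_evolution[OF u(1)] by blast
    obtain l\<^sub>2 where l2: "evolution T u\<^sub>2 l\<^sub>2" "AE t in time T. u\<^sub>2 t \<in> H1 \<Omega> \<and> linear_on_H1 (l\<^sub>2 t) \<and> inequality_at f\<^sub>2 t (u\<^sub>2 t) (l\<^sub>2 t)"
      using solution_evolution[OF u(2)] by blast
    let ?w = "\<lambda>t x. 1 * u\<^sub>1 t x + - 1 * u\<^sub>2 t x"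
    let ?\<phi> = "\<lambda>t. (L2_norm (surface \<Gamma>\<^sub>3) (\<lambda>x. f\<^sub>1 (t, x) - f\<^sub>2 (t, x)))\<^sup>2"
    let ?N = "(L2_norm (lateral T \<Gamma>\<^sub>3) (\<lambda>z. f\<^sub>1 z - f\<^sub>2 z))\<^sup>2"
    note \<phi> = lateral_slices[OF finite_measure_controls(1) L2_diff[OF f]]
    have ev: "evolution T ?w (\<lambda>t v. 1 * l\<^sub>1 t v + - 1 * l\<^sub>2 t v)" by (rule evolution_lin[OF l1(1) l2(1)])
    have wC: "?w \<in> C_L2 T \<Omega>" by (rule C_L2_lin[OF solution_C_L2[OF u(1)] solution_C_L2[OF u(2)]])
    define y where "y t = (L2_norm ?M (?w t))\<^sup>2" for t
    have yc: "continuous_on {0..T} y" unfolding y_def by (rule C_L2_norm_continuous[OF wC])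
    have yi: "integrable (time T) y" by (rule L2_integrable[OF finite_measure_time continuous_time_L2[OF yc]])
    define R where "R t = C\<^sup>2 / 2 * ?\<phi> t + y t / 2" for t
    have Ri: "integrable (time T) R" unfolding R_def using \<phi>(2) yi by simp
    have y0: "y 0 = 0"
    proof -
      have "AE x in ?M. ?w 0 x = 0"
        using solution_initial[OF u(1)] solution_initial[OF u(2)] by eventually_elim simp
      then show ?thesis unfolding y_def using L2_norm_zero_iff[OF C_L2_D[OF wC, of 0]] T by simp
    qed
    have "y t \<le> C\<^sup>2 * ?N + integral {0..t} y" if t: "t \<in> {0..T}" for t
    proof -
      have "y t / 2 - y 0 / 2 \<le> integral {0..t} R"
        unfolding y_def
      proof (rule evolution_energy[OF T ev Ri _ t])
        show "AE t in time T. ?w t \<in> H1 \<Omega> \<longrightarrow> 1 * l\<^sub>1 t (?w t) + - 1 * l\<^sub>2 t (?w t) \<le> R t"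
          using l1(2) l2(2) controls_slices[OF f(1)] controls_slices[OF f(2)] data_AE
        proof eventually_elim
          case (elim t)
          then show ?case unfolding R_def y_def
            by (intro impI difference_test[of "g t" "b t" "\<lambda>x. q (t, x)"] C) auto
        qed
      qed
      also have "integral {0..t} R = C\<^sup>2 / 2 * integral {0..t} ?\<phi> + integral {0..t} y / 2"
      proof -
        have "?\<phi> integrable_on {0..t}"
          by (rule integrable_subinterval_real[OF time_integrable_on[OF \<phi>(2)]]) (use t in auto)
        moreover have "y integrable_on {0..t}"
          by (rule integrable_subinterval_real[OF time_integrable_on[OF yi]]) (use t in auto)
        ultimately show ?thesis unfolding R_def
          by (subst Henstock_Kurzweil_Integration.integral_add) (auto intro: integrable_on_divide integrable_on_mult_right)
      qed
      also have "integral {0..t} ?\<phi> \<le> ?N"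
      proof -
        have t': "(0::real) \<le> 0" "t \<le> T" using t by auto
        have "integral {0..t} ?\<phi> = (\<integral>x. indicator {0<..<t} x * ?\<phi> x \<partial>time T)"
          by (rule time_integral_slice(1)[OF \<phi>(2) t', symmetric])
        also have "\<dots> \<le> (\<integral>x. ?\<phi> x \<partial>time T)"
          by (rule Bochner_Integration.integral_mono[OF time_integral_slice(2)[OF \<phi>(2) t'] \<phi>(2)])
            (simp add: indicator_def)
        finally show ?thesis by (simp only: \<phi>(3))
      qed
      finally show ?thesis using y0 by (simp add: mult_left_mono)
    qed
    then have "y t \<le> 2 * (C\<^sup>2 * ?N) * exp (2 * T)"
      by (intro gronwall_integral[OF yc _ _ t]) auto
    then show ?thesis by (simp add: y_def)
  qed
  show ?thesis
  proof (rule that[of "sqrt (2 * C\<^sup>2 * exp (2 * T))"])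
    fix f\<^sub>1 f\<^sub>2 u\<^sub>1 u\<^sub>2 t
    assume a: "f\<^sub>1 \<in> L2 (lateral T \<Gamma>\<^sub>3)" "f\<^sub>2 \<in> L2 (lateral T \<Gamma>\<^sub>3)" "solution f\<^sub>1 u\<^sub>1" "solution f\<^sub>2 u\<^sub>2" "t \<in> {0..T}"
    show "L2_norm ?M (\<lambda>x. u\<^sub>1 t x - u\<^sub>2 t x) \<le> sqrt (2 * C\<^sup>2 * exp (2 * T)) * L2_norm (lateral T \<Gamma>\<^sub>3) (\<lambda>z. f\<^sub>1 z - f\<^sub>2 z)"
    proof (rule power2_le_imp_le)
      show "(L2_norm ?M (\<lambda>x. u\<^sub>1 t x - u\<^sub>2 t x))\<^sup>2 \<le> (sqrt (2 * C\<^sup>2 * exp (2 * T)) * L2_norm (lateral T \<Gamma>\<^sub>3) (\<lambda>z. f\<^sub>1 z - f\<^sub>2 z))\<^sup>2"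
        using main[OF a] by (simp add: power_mult_distrib mult_ac)
    qed simp
  qed simp
qed

abbreviation state :: "(real \<times> 'a \<Rightarrow> real) \<Rightarrow> real \<Rightarrow> 'a \<Rightarrow> real" where
  "state \<equiv> robin_state D \<Omega> \<gamma> \<Gamma>\<^sub>1 \<Gamma>\<^sub>2 \<Gamma>\<^sub>3 T g b q u\<^sub>b h"

abbreviation cost :: "(real \<times> 'a \<Rightarrow> real) \<Rightarrow> real" where
  "cost \<equiv> robin_cost D \<Omega> \<gamma> \<Gamma>\<^sub>1 \<Gamma>\<^sub>2 \<Gamma>\<^sub>3 T g b q u\<^sub>b M h"

definition state_energy :: "(real \<times> 'a \<Rightarrow> real) \<Rightarrow> real" where
  "state_energy f = (\<integral>t. (L2_norm (lebesgue_on \<Omega>) (state f t))\<^sup>2 \<partial>time T)"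

lemma state_solution: "f \<in> L2 (lateral T \<Gamma>\<^sub>3) \<Longrightarrow> solution f (state f)"
  unfolding robin_state_def by (rule someI_ex[OF solvable])

lemma state_norm_integrable:
  "f \<in> L2 (lateral T \<Gamma>\<^sub>3) \<Longrightarrow> integrable (time T) (\<lambda>t. (L2_norm (lebesgue_on \<Omega>) (state f t))\<^sup>2)"
  by (intro L2_integrable[OF finite_measure_time] continuous_time_L2 C_L2_norm_continuous solution_C_L2[OF state_solution])

lemma cost_eq: "cost f = 1/2 * state_energy f + M/2 * (L2_norm (lateral T \<Gamma>\<^sub>3) f)\<^sup>2"
  by (simp add: robin_cost_def bochner_L2_norm_def state_energy_def Bochner_Integration.integral_nonneg)

lemma controls_convex:
  assumes "f \<in> nonpos_controls T \<Gamma>\<^sub>3" "f' \<in> nonpos_controls T \<Gamma>\<^sub>3" "0 \<le> \<mu>" "\<mu> \<le> 1"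
  shows "(\<lambda>z. \<mu> * f z + (1 - \<mu>) * f' z) \<in> nonpos_controls T \<Gamma>\<^sub>3"
  unfolding nonpos_controls_def
proof (intro CollectI conjI)
  show "(\<lambda>z. \<mu> * f z + (1 - \<mu>) * f' z) \<in> L2 (lateral T \<Gamma>\<^sub>3)" by (rule L2_lin[OF controls_L2 controls_L2]; fact)
  have "AE z in lateral T \<Gamma>\<^sub>3. f z \<le> 0" "AE z in lateral T \<Gamma>\<^sub>3. f' z \<le> 0"
    using assms by (auto simp: nonpos_controls_def)
  then show "AE z in lateral T \<Gamma>\<^sub>3. \<mu> * f z + (1 - \<mu>) * f' z \<le> 0"
    by eventually_elim (use assms in \<open>simp add: add_nonpos_nonpos mult_nonneg_nonpos\<close>)
qed

lemma convex_norm_identity: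
  assumes "f \<in> L2 P" "f' \<in> L2 P"
  shows "(L2_norm P (\<lambda>z. \<mu> * f z + (1 - \<mu>) * f' z))\<^sup>2 =
    \<mu> * (L2_norm P f)\<^sup>2 + (1 - \<mu>) * (L2_norm P f')\<^sup>2 - \<mu> * (1 - \<mu>) * (L2_norm P (\<lambda>z. f z - f' z))\<^sup>2"
proof -
  have "(L2_norm P (\<lambda>z. f z - f' z))\<^sup>2 = (L2_norm P f)\<^sup>2 - 2 * L2_inner P f f' + (L2_norm P f')\<^sup>2"
    using L2_norm_lin_power2[OF assms, of 1 "-1"] by simp
  then show ?thesis unfolding L2_norm_lin_power2[OF assms] by algebra
qed

lemma cost_uniformly_convex:
  assumes f: "f \<in> nonpos_controls T \<Gamma>\<^sub>3" "f' \<in> nonpos_controls T \<Gamma>\<^sub>3" and \<mu>: "0 \<le> \<mu>" "\<mu> \<le> 1"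
  shows "cost (\<lambda>z. \<mu> * f z + (1 - \<mu>) * f' z)
    \<le> \<mu> * cost f + (1 - \<mu>) * cost f' - M/2 * (\<mu> * (1 - \<mu>) * (L2_norm (lateral T \<Gamma>\<^sub>3) (\<lambda>z. f z - f' z))\<^sup>2)"
proof -
  let ?f = "\<lambda>z. \<mu> * f z + (1 - \<mu>) * f' z" and ?M = "lebesgue_on \<Omega>"
  note fK = controls_convex[OF f \<mu>]
  note L = controls_L2[OF f(1)] controls_L2[OF f(2)] controls_L2[OF fK]
  note sol = state_solution[OF L(1)] state_solution[OF L(2)] state_solution[OF L(3)]
  have "(L2_norm ?M (state ?f t))\<^sup>2 \<le> \<mu> * (L2_norm ?M (state f t))\<^sup>2 + (1 - \<mu>) * (L2_norm ?M (state f' t))\<^sup>2"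
    if t: "t \<in> {0..T}" for t
  proof -
    note S = C_L2_D[OF solution_C_L2[OF sol(1)] t] C_L2_D[OF solution_C_L2[OF sol(2)] t] C_L2_D[OF solution_C_L2[OF sol(3)] t]
    have "L2_norm ?M (state ?f t) \<le> L2_norm ?M (\<lambda>x. \<mu> * state f t x + (1 - \<mu>) * state f' t x)"
    proof (rule L2_norm_mono[OF L2_measurable[OF S(3)] L2_lin[OF S(1,2)]])
      show "AE x in ?M. \<bar>state ?f t x\<bar> \<le> \<bar>\<mu> * state f t x + (1 - \<mu>) * state f' t x\<bar>"
        using solution_nonneg[OF fK sol(3) t] solution_convex[OF f \<mu> sol t] by eventually_elim simp
    qed
    then have "(L2_norm ?M (state ?f t))\<^sup>2 \<le> (L2_norm ?M (\<lambda>x. \<mu> * state f t x + (1 - \<mu>) * state f' t x))\<^sup>2"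
      by (rule power_mono) simp
    also have "\<dots> \<le> \<mu> * (L2_norm ?M (state f t))\<^sup>2 + (1 - \<mu>) * (L2_norm ?M (state f' t))\<^sup>2"
      unfolding convex_norm_identity[OF S(1,2)] using \<mu> by simp
    finally show ?thesis .
  qed
  then have "state_energy ?f \<le> (\<integral>t. \<mu> * (L2_norm ?M (state f t))\<^sup>2 + (1 - \<mu>) * (L2_norm ?M (state f' t))\<^sup>2 \<partial>time T)"
    unfolding state_energy_def
    by (intro Bochner_Integration.integral_mono state_norm_integrable L Bochner_Integration.integrable_add integrable_mult_right) auto
  also have "\<dots> = \<mu> * state_energy f + (1 - \<mu>) * state_energy f'"
    by (simp add: state_energy_def state_norm_integrable[OF L(1)] state_norm_integrable[OF L(2)])
  finally have E: "state_energy ?f \<le> \<mu> * state_energy f + (1 - \<mu>) * state_energy f'" .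
  have "1/2 * S + M/2 * (\<mu> * X + (1 - \<mu>) * Y - \<mu> * (1 - \<mu>) * Z)
      \<le> \<mu> * (1/2 * A + M/2 * X) + (1 - \<mu>) * (1/2 * B + M/2 * Y) - M/2 * (\<mu> * (1 - \<mu>) * Z)"
    if "S \<le> \<mu> * A + (1 - \<mu>) * B" for S A B X Y Z
    using that by (simp add: field_simps)
  from this[OF E] show ?thesis unfolding cost_eq convex_norm_identity[OF L(1,2)] .
qed

lemma cost_strictly_convex: "strictly_convex_on_AE (lateral T \<Gamma>\<^sub>3) (nonpos_controls T \<Gamma>\<^sub>3) cost"
  unfolding strictly_convex_on_AE_def
proof (intro ballI allI impI)
  fix f f' and \<mu> :: real
  assume f: "f \<in> nonpos_controls T \<Gamma>\<^sub>3" "f' \<in> nonpos_controls T \<Gamma>\<^sub>3" and \<mu>: "0 < \<mu>" "\<mu> < 1"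
    and ne: "\<not> (AE z in lateral T \<Gamma>\<^sub>3. f z = f' z)"
  have "L2_norm (lateral T \<Gamma>\<^sub>3) (\<lambda>z. f z - f' z) \<noteq> 0"
    using L2_norm_zero_iff[OF L2_diff[OF controls_L2[OF f(1)] controls_L2[OF f(2)]]] ne by simp
  then have "0 < M/2 * (\<mu> * (1 - \<mu>) * (L2_norm (lateral T \<Gamma>\<^sub>3) (\<lambda>z. f z - f' z))\<^sup>2)" using M \<mu> by simp
  then show "cost (\<lambda>z. \<mu> * f z + (1 - \<mu>) * f' z) < \<mu> * cost f + (1 - \<mu>) * cost f'"
    using cost_uniformly_convex[OF f, of \<mu>] \<mu> by simp
qed

lemma cost_continuous:
  assumes F: "\<And>n::nat. F n \<in> L2 (lateral T \<Gamma>\<^sub>3)" and f: "f \<in> L2 (lateral T \<Gamma>\<^sub>3)"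
    and lim: "(\<lambda>n. L2_norm (lateral T \<Gamma>\<^sub>3) (\<lambda>z. F n z - f z)) \<longlonglongrightarrow> 0"
  shows "(\<lambda>n. cost (F n)) \<longlonglongrightarrow> cost f"
proof -
  let ?M = "lebesgue_on \<Omega>"
  obtain C where C: "C \<ge> 0" "\<And>f\<^sub>1 f\<^sub>2 u\<^sub>1 u\<^sub>2 t. f\<^sub>1 \<in> L2 (lateral T \<Gamma>\<^sub>3) \<Longrightarrow> f\<^sub>2 \<in> L2 (lateral T \<Gamma>\<^sub>3) \<Longrightarrow>
    solution f\<^sub>1 u\<^sub>1 \<Longrightarrow> solution f\<^sub>2 u\<^sub>2 \<Longrightarrow> t \<in> {0..T} \<Longrightarrow>
    L2_norm ?M (\<lambda>x. u\<^sub>1 t x - u\<^sub>2 t x) \<le> C * L2_norm (lateral T \<Gamma>\<^sub>3) (\<lambda>z. f\<^sub>1 z - f\<^sub>2 z)"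
    using solution_Lipschitz by blast
  interpret finite_measure "time T" by (rule finite_measure_time)
  define d where "d n = C * L2_norm (lateral T \<Gamma>\<^sub>3) (\<lambda>z. F n z - f z)" for n
  have d0: "0 \<le> d n" for n using C(1) by (simp add: d_def)
  have dlim: "d \<longlonglongrightarrow> 0" unfolding d_def using tendsto_mult_left[OF lim, of C] by simp
  define V where "V = (\<integral>t. (1::real) \<partial>time T)"
  have "\<bar>state_energy (F n) - state_energy f\<bar> \<le> (d n)\<^sup>2 * V + d n * (V + state_energy f)" for n
  proof -
    note I = state_norm_integrable[OF F[of n]] state_norm_integrable[OF f]
    have "\<bar>state_energy (F n) - state_energy f\<bar>
        = \<bar>\<integral>t. (L2_norm ?M (state (F n) t))\<^sup>2 - (L2_norm ?M (state f t))\<^sup>2 \<partial>time T\<bar>"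
      unfolding state_energy_def using I by simp
    also have "\<dots> \<le> (\<integral>t. (d n)\<^sup>2 * 1 + d n * (1 + (L2_norm ?M (state f t))\<^sup>2) \<partial>time T)"
    proof (rule integral_abs_bound_integral)
      show "integrable (time T) (\<lambda>t. (L2_norm ?M (state (F n) t))\<^sup>2 - (L2_norm ?M (state f t))\<^sup>2)" using I by simp
      show "integrable (time T) (\<lambda>t. (d n)\<^sup>2 * 1 + d n * (1 + (L2_norm ?M (state f t))\<^sup>2))" using I by simp
      fix t assume "t \<in> space (time T)"
      then have t: "t \<in> {0..T}" by auto
      let ?a = "L2_norm ?M (state (F n) t)" and ?b = "L2_norm ?M (state f t)"
      note sol = state_solution[OF F[of n]] state_solution[OF f]
      have "\<bar>?a - ?b\<bar> \<le> d n"
        using L2_norm_reverse_triangle[OF C_L2_D[OF solution_C_L2[OF sol(1)] t] C_L2_D[OF solution_C_L2[OF sol(2)] t]]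
          C(2)[OF F[of n] f sol t] unfolding d_def by linarith
      moreover have "\<bar>?a + ?b\<bar> \<le> \<bar>?a - ?b\<bar> + 2 * ?b" using L2_norm_nonneg[of ?M "state f t"] by linarith
      ultimately have "\<bar>?a - ?b\<bar> * \<bar>?a + ?b\<bar> \<le> d n * (d n + 2 * ?b)"
        using d0[of n] by (intro mult_mono) auto
      moreover have "2 * ?b \<le> 1 + ?b\<^sup>2" using two_mult_le_squares[of ?b 1] by simp
      then have "d n * (2 * ?b) \<le> d n * (1 + ?b\<^sup>2)" using d0 by (rule mult_left_mono)
      moreover have "\<bar>?a\<^sup>2 - ?b\<^sup>2\<bar> = \<bar>?a - ?b\<bar> * \<bar>?a + ?b\<bar>"
        unfolding abs_mult[symmetric] by (simp add: power2_eq_square algebra_simps)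
      moreover have "d n * (d n + 2 * ?b) = (d n)\<^sup>2 * 1 + d n * (2 * ?b)" by (simp add: power2_eq_square distrib_left)
      ultimately show "\<bar>?a\<^sup>2 - ?b\<^sup>2\<bar> \<le> (d n)\<^sup>2 * 1 + d n * (1 + ?b\<^sup>2)" by linarith
    qed
    also have "\<dots> = (d n)\<^sup>2 * V + d n * (V + state_energy f)"
      unfolding V_def state_energy_def using I by simp
    finally show ?thesis .
  qed
  moreover have "(\<lambda>n. (d n)\<^sup>2 * V + d n * (V + state_energy f)) \<longlonglongrightarrow> 0"
    by (rule tendsto_eq_intros dlim | simp)+
  ultimately have "(\<lambda>n. \<bar>state_energy (F n) - state_energy f\<bar>) \<longlonglongrightarrow> 0"
    by (rule real_null_squeeze[OF abs_ge_zero])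
  then have E: "(\<lambda>n. state_energy (F n)) \<longlonglongrightarrow> state_energy f"
    by (rule LIM_zero_cancel[OF tendsto_rabs_zero_cancel])
  have "(\<lambda>n. \<bar>L2_norm (lateral T \<Gamma>\<^sub>3) (F n) - L2_norm (lateral T \<Gamma>\<^sub>3) f\<bar>) \<longlonglongrightarrow> 0"
    by (rule real_null_squeeze[OF abs_ge_zero L2_norm_reverse_triangle[OF F f] lim])
  then have N: "(\<lambda>n. L2_norm (lateral T \<Gamma>\<^sub>3) (F n)) \<longlonglongrightarrow> L2_norm (lateral T \<Gamma>\<^sub>3) f"
    by (rule LIM_zero_cancel[OF tendsto_rabs_zero_cancel])
  show ?thesis unfolding cost_eq by (intro tendsto_intros E N)
qed

lemma controls_closed:
  assumes F: "\<And>n::nat. F n \<in> nonpos_controls T \<Gamma>\<^sub>3" and f: "f \<in> L2 (lateral T \<Gamma>\<^sub>3)"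
    and lim: "(\<lambda>n. L2_norm (lateral T \<Gamma>\<^sub>3) (\<lambda>z. F n z - f z)) \<longlonglongrightarrow> 0"
  shows "f \<in> nonpos_controls T \<Gamma>\<^sub>3"
proof -
  obtain r :: "nat \<Rightarrow> nat" where r: "AE z in lateral T \<Gamma>\<^sub>3. (\<lambda>n. F (r n) z) \<longlonglongrightarrow> f z"
    using L2_tendsto_AE_subseq[OF controls_L2[OF F] f lim] by blast
  have "AE z in lateral T \<Gamma>\<^sub>3. \<forall>n. F n z \<le> 0"
    using F by (simp add: nonpos_controls_def AE_all_countable)
  with r have "AE z in lateral T \<Gamma>\<^sub>3. f z \<le> 0"
    by eventually_elim (auto intro: LIMSEQ_le_const2)
  then show ?thesis using f by (simp add: nonpos_controls_def)
qed

lemma optimal_control: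
  "\<exists>f\<^sub>o\<^sub>p. minimizer_on (nonpos_controls T \<Gamma>\<^sub>3) cost f\<^sub>o\<^sub>p \<and>
    (\<forall>f. minimizer_on (nonpos_controls T \<Gamma>\<^sub>3) cost f \<longrightarrow> (AE z in lateral T \<Gamma>\<^sub>3. f z = f\<^sub>o\<^sub>p z))"
proof -
  let ?K = "nonpos_controls T \<Gamma>\<^sub>3"
  have "\<exists>f. minimizer_on ?K cost f"
  proof (rule uniformly_convex_minimizer[OF finite_measure_controls(2), where c="M/8"])
    show "?K \<subseteq> L2 (lateral T \<Gamma>\<^sub>3)" using controls_L2 by blast
    have "(\<lambda>_. 0) \<in> ?K" by (simp add: nonpos_controls_def L2_zero)
    then show "?K \<noteq> {}" by blast
    show "0 \<le> cost f" for f
      using M by (simp add: cost_eq state_energy_def Bochner_Integration.integral_nonneg)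
    show "cost (\<lambda>z. 1/2 * f z + (1 - 1/2) * f' z) \<le> 1/2 * cost f + (1 - 1/2) * cost f'
        - M/8 * (L2_norm (lateral T \<Gamma>\<^sub>3) (\<lambda>z. f z - f' z))\<^sup>2" if "f \<in> ?K" "f' \<in> ?K" for f f'
      using cost_uniformly_convex[OF that, of "1/2"] by simp
    show "M / 8 > 0" using M by simp
    show "(\<lambda>z. 1/2 * f z + (1 - 1/2) * f' z) \<in> ?K" if "f \<in> ?K" "f' \<in> ?K" for f f'
      by (rule controls_convex[OF that]) auto
    show "f \<in> ?K" if "\<And>n::nat. F n \<in> ?K" "f \<in> L2 (lateral T \<Gamma>\<^sub>3)"
      "(\<lambda>n. L2_norm (lateral T \<Gamma>\<^sub>3) (\<lambda>z. F n z - f z)) \<longlonglongrightarrow> 0" for F f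
      by (rule controls_closed[OF that])
    show "(\<lambda>n. cost (F n)) \<longlonglongrightarrow> cost f" if "\<And>n::nat. F n \<in> ?K" "f \<in> ?K"
      "(\<lambda>n. L2_norm (lateral T \<Gamma>\<^sub>3) (\<lambda>z. F n z - f z)) \<longlonglongrightarrow> 0" for F f
      by (rule cost_continuous[OF controls_L2[OF that(1)] controls_L2[OF that(2)] that(3)])
  qed
  then obtain f\<^sub>o\<^sub>p where op: "minimizer_on ?K cost f\<^sub>o\<^sub>p" by blast
  have "AE z in lateral T \<Gamma>\<^sub>3. f z = f\<^sub>o\<^sub>p z" if f: "minimizer_on ?K cost f" for f
  proof (rule ccontr)
    assume ne: "\<not> (AE z in lateral T \<Gamma>\<^sub>3. f z = f\<^sub>o\<^sub>p z)"
    have K: "f \<in> ?K" "f\<^sub>o\<^sub>p \<in> ?K" using f op by (auto simp: minimizer_on_def)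
    have "cost (\<lambda>z. 1/2 * f z + (1 - 1/2) * f\<^sub>o\<^sub>p z) < 1/2 * cost f + (1 - 1/2) * cost f\<^sub>o\<^sub>p"
      using cost_strictly_convex[unfolded strictly_convex_on_AE_def, rule_format, OF K, of "1/2"] ne by auto
    moreover have "(\<lambda>z. 1/2 * f z + (1 - 1/2) * f\<^sub>o\<^sub>p z) \<in> ?K" by (rule controls_convex[OF K]) auto
    then have "cost f \<le> cost (\<lambda>z. 1/2 * f z + (1 - 1/2) * f\<^sub>o\<^sub>p z)" "cost f\<^sub>o\<^sub>p \<le> cost (\<lambda>z. 1/2 * f z + (1 - 1/2) * f\<^sub>o\<^sub>p z)"
      using f op by (auto simp: minimizer_on_def)
    moreover have "a \<ge> 1/2 * x + (1 - 1/2) * y" if "x \<le> a" "y \<le> a" for a x y :: real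
      using that by simp
    ultimately show False by (meson not_less)
  qed
  with op show ?thesis by blast
qed

end

theorem theorem2p2:
  fixes \<Omega> \<Gamma>\<^sub>1 \<Gamma>\<^sub>2 \<Gamma>\<^sub>3 :: "'a::euclidean_space set"
    and \<gamma> :: "('a \<Rightarrow> real) \<Rightarrow> 'a \<Rightarrow> real"
    and T M :: real
    and g b :: "real \<Rightarrow> 'a \<Rightarrow> real"
    and q :: "real \<times> 'a \<Rightarrow> real"
    and u\<^sub>b :: "'a \<Rightarrow> real"
    and D :: "(real \<Rightarrow> ('a \<Rightarrow> real) \<Rightarrow> real) set"
  assumes domain: "regular_domain \<Omega>"
    and trace: "trace_operator \<Omega> \<gamma>"
    and parts: "frontier \<Omega> = \<Gamma>\<^sub>1 \<union> \<Gamma>\<^sub>2 \<union> \<Gamma>\<^sub>3"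
      "\<Gamma>\<^sub>1 \<in> sets borel" "\<Gamma>\<^sub>2 \<in> sets borel" "\<Gamma>\<^sub>3 \<in> sets borel"
    and meas_pos: "emeasure (hausdorff_measure (DIM('a) - 1)) \<Gamma>\<^sub>1 > 0"
      "emeasure (hausdorff_measure (DIM('a) - 1)) \<Gamma>\<^sub>3 > 0"
    and T: "T > 0"
    and g: "g \<in> L2_L2 T \<Omega>"
    and b: "b \<in> bochner_L2 T (Hhalf \<Omega> \<gamma> \<Gamma>\<^sub>1) (Hhalf_norm \<Omega> \<gamma> \<Gamma>\<^sub>1)"
    and q: "q \<in> L2 (lateral T \<Gamma>\<^sub>2)" "AE z in lateral T \<Gamma>\<^sub>2. q z > 0"
    and ub: "AE t in time T. u\<^sub>b \<in> dirichlet_class \<Omega> \<gamma> \<Gamma>\<^sub>1 (b t)"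
    and D: "D = L2_derivatives T \<Omega> \<or> D = dual_derivatives T \<Omega>"
    and well_posed: "robin_well_posed D \<Omega> \<gamma> \<Gamma>\<^sub>1 \<Gamma>\<^sub>2 \<Gamma>\<^sub>3 T g b q u\<^sub>b"
    and M: "M > 0"
    and g_nonneg: "AE t in time T. AE x in lebesgue_on \<Omega>. g t x \<ge> 0"
    and b_nonneg: "AE t in time T. AE x in surface \<Gamma>\<^sub>1. b t x \<ge> 0"
    and ub_nonneg: "AE x in lebesgue_on \<Omega>. u\<^sub>b x \<ge> 0"
  shows "(\<forall>h>0. strictly_convex_on_AE (lateral T \<Gamma>\<^sub>3) (nonpos_controls T \<Gamma>\<^sub>3)
            (robin_cost D \<Omega> \<gamma> \<Gamma>\<^sub>1 \<Gamma>\<^sub>2 \<Gamma>\<^sub>3 T g b q u\<^sub>b M h)) \<and>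
         (\<forall>h>0. \<exists>f\<^sub>o\<^sub>p. minimizer_on (nonpos_controls T \<Gamma>\<^sub>3)
              (robin_cost D \<Omega> \<gamma> \<Gamma>\<^sub>1 \<Gamma>\<^sub>2 \<Gamma>\<^sub>3 T g b q u\<^sub>b M h) f\<^sub>o\<^sub>p \<and>
            (\<forall>f. minimizer_on (nonpos_controls T \<Gamma>\<^sub>3)
                (robin_cost D \<Omega> \<gamma> \<Gamma>\<^sub>1 \<Gamma>\<^sub>2 \<Gamma>\<^sub>3 T g b q u\<^sub>b M h) f \<longrightarrow>
              (AE z in lateral T \<Gamma>\<^sub>3. f z = f\<^sub>o\<^sub>p z)))"
proof -
  have \<Gamma>: "\<Gamma>\<^sub>1 \<subseteq> frontier \<Omega>" "\<Gamma>\<^sub>2 \<subseteq> frontier \<Omega>" "\<Gamma>\<^sub>3 \<subseteq> frontier \<Omega>" using parts(1) by auto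
  have robin: "robin_problem \<Omega> \<gamma> \<Gamma>\<^sub>1 \<Gamma>\<^sub>2 \<Gamma>\<^sub>3 h T M g b q u\<^sub>b D" if h: "h > 0" for h
  proof -
    interpret robin_domain \<Omega> \<gamma> \<Gamma>\<^sub>1 \<Gamma>\<^sub>2 \<Gamma>\<^sub>3 h
      by unfold_locales (use domain trace parts \<Gamma> h in auto)
    have fin: "finite_measure (surface \<Gamma>\<^sub>2)" by (rule finite_measure_surface) (use parts \<Gamma> in auto)
    have "AE t in time T. (\<lambda>x. q (t, x)) \<in> L2 (surface \<Gamma>\<^sub>2)"
      by (rule lateral_slices(1)[OF fin q(1)])
    moreover have "AE t in time T. AE x in surface \<Gamma>\<^sub>2. 0 < q (t, x)"
      by (rule lateral_AE_slices[OF fin q(2)])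
    moreover have "AE t in time T. g t \<in> L2 (lebesgue_on \<Omega>)" using g by (simp add: bochner_L2_def)
    moreover have "AE t in time T. b t \<in> Hhalf \<Omega> \<gamma> \<Gamma>\<^sub>1" using b by (simp add: bochner_L2_def)
    ultimately have "AE t in time T. data (g t) (b t) (\<lambda>x. q (t, x))"
      using g_nonneg b_nonneg
      by eventually_elim (auto simp: data_def Hhalf_def elim: eventually_mono)
    then show ?thesis
      using T M ub_nonneg D well_posed h
      by unfold_locales (auto simp: robin_well_posed_def)
  qed
  show ?thesis
    by (intro conjI allI impI robin_problem.cost_strictly_convex[OF robin] robin_problem.optimal_control[OF robin])
qed

end
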